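(* Let $N\geq 3$ and consider the equation $|x|^{-2}\partial_t u=\Delta u$ in $\mathbb{R}^N\times(0,\infty)$. (a) There is no fundamental solution of the equation, that is, for $M>0$ there is no solution with initial data $u_0=M\delta_0$, where $\delta_0$ is the Dirac mass at the origin. (b) Let $u$ be a solution with initial data $u_0\in L^1_2(\mathbb{R}^N)$, $u_0\geq 0$, $u_0\not\equiv 0$. If $u_0(x)=0$ for any $x\in B(0,r_0)$, for some $r_0>0$, then $u(x,t)>0$ for all $(x,t)\in(\mathbb{R}^N\setminus\{0\})\times(0,\infty)$ and $u(0,t)=0$ for any $t>0$.
   Context: $L^1_2(\mathbb{R}^N)$ is the space of measurable $h:\mathbb{R}^N\to\mathbb{R}$ with $\int_{\mathbb{R}^N}|x|^{-2}|h(x)|\,dx<\infty$. A weak solution of $|x|^{-2}u_t=\Delta u$ in $\mathbb{R}^N\times(0,\infty)$ with initial data $u_0$ is a function $u\geq 0$ such that $u\in C([0,\infty);L^1_2(\mathbb{R}^N))\cap L^\infty(\mathbb{R}^N\times(\tau,\infty))$ for every $\tau>0$, $u(0)=u_0$, and $\iint u(\Delta\varphi+|x|^{-2}\varphi_t)\,dx\,dt=0$ for all $\varphi\in C_0^\infty(\mathbb{R}^N\times(0,\infty))$. A strong solution is a weak solution with $|x|^{-2}u_t,\ \Delta u\in L^1_{\rm loc}(Q_* )$ and $|x|^{-2}u_t=\Delta u$ a.e. in $Q_*$, where $Q_*=(\mathbb{R}^N\times(0,\infty))\setminus\{(0,t):t>0\}$. "Solution" means strong solution. In (a), where the initial datum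 is a measure, a solution with initial data $M\delta_0$ is a function $u\geq 0$ such that $u\in C((0,\infty);L^1_2(\mathbb{R}^N))\cap L^\infty(\mathbb{R}^N\times(\tau,\infty))$ for every $\tau>0$, $\iint u(\Delta\varphi+|x|^{-2}\varphi_t)\,dx\,dt=0$ for all $\varphi\in C_0^\infty(\mathbb{R}^N\times(0,\infty))$, $|x|^{-2}u_t,\ \Delta u\in L^1_{\rm loc}(Q_* )$, $|x|^{-2}u_t=\Delta u$ a.e. in $Q_*$, and such that $u(\cdot,t)\to M\delta_0$ in the sense of distributions as $t\to 0^+$. In (b), $u$ is identified with its continuous representative on $(\mathbb{R}^N\setminus\{0\})\times(0,\infty)$, and $u(0,t)$ is understood as $\lim_{x\to 0}u(x,t)$. $B(0,r_0)$ is the ball of radius $r_0$ centered at the origin. *)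

theory Defs
  imports "HOL-Analysis.Analysis"
begin

definition dir_deriv :: "'a::euclidean_space \<Rightarrow> ('a \<Rightarrow> real) \<Rightarrow> 'a \<Rightarrow> real" where
  "dir_deriv v f x = frechet_derivative f (at x) v"

primrec C_k :: "nat \<Rightarrow> ('a::euclidean_space \<Rightarrow> real) \<Rightarrow> bool" where
  "C_k 0 f \<longleftrightarrow> continuous_on UNIV f"
| "C_k (Suc k) f \<longleftrightarrow>
     (\<forall>x. f differentiable (at x)) \<and> (\<forall>b\<in>Basis. C_k k (dir_deriv b f))"

text \<open>The elements of \<open>C_0^\<infinity>(\<Omega>)\<close>, extended by zero to the whole space.\<close>

definition test_functions :: "'a::euclidean_space set \<Rightarrow> ('a \<Rightarrow> real) set" where
  "test_functions \<Omega> = {\<phi>. (\<forall>k. C_k k \<phi>) \<and>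
     compact (closure {x. \<phi> x \<noteq> 0}) \<and> closure {x. \<phi> x \<noteq> 0} \<subseteq> \<Omega>}"

text \<open>Points of space-time are pairs \<open>(x, t)\<close>; the Laplacian acts on \<open>x\<close> only.
  Both operators are only ever applied to test functions.\<close>

definition time_deriv :: "('a::euclidean_space \<times> real \<Rightarrow> real) \<Rightarrow> 'a \<times> real \<Rightarrow> real" where
  "time_deriv \<phi> = dir_deriv (0, 1) \<phi>"

definition laplacian :: "('a::euclidean_space \<times> real \<Rightarrow> real) \<Rightarrow> 'a \<times> real \<Rightarrow> real" where
  "laplacian \<phi> z = (\<Sum>b\<in>Basis. dir_deriv (b, 0) (dir_deriv (b, 0) \<phi>) z)"

definition L1_loc :: "'a::euclidean_space set \<Rightarrow> ('a \<Rightarrow> real) set" where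
  "L1_loc \<Omega> = {f. \<forall>K. compact K \<and> K \<subseteq> \<Omega> \<longrightarrow> set_integrable lebesgue K f}"

definition weak_time_deriv ::
  "('a::euclidean_space \<times> real) set \<Rightarrow> ('a \<times> real \<Rightarrow> real) \<Rightarrow> ('a \<times> real \<Rightarrow> real) \<Rightarrow> bool" where
  "weak_time_deriv \<Omega> u w \<longleftrightarrow> w \<in> L1_loc \<Omega> \<and>
     (\<forall>\<phi>\<in>test_functions \<Omega>.
        (LINT z:\<Omega>|lebesgue. u z * time_deriv \<phi> z) = - (LINT z:\<Omega>|lebesgue. w z * \<phi> z))"

definition weak_laplacian ::
  "('a::euclidean_space \<times> real) set \<Rightarrow> ('a \<times> real \<Rightarrow> real) \<Rightarrow> ('a \<times> real \<Rightarrow> real) \<Rightarrow> bool" where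
  "weak_laplacian \<Omega> u l \<longleftrightarrow> l \<in> L1_loc \<Omega> \<and>
     (\<forall>\<phi>\<in>test_functions \<Omega>.
        (LINT z:\<Omega>|lebesgue. u z * laplacian \<phi> z) = (LINT z:\<Omega>|lebesgue. l z * \<phi> z))"

text \<open>Elements are functions rather than classes modulo null sets, so equalities and
  inequalities between them are stated almost everywhere. The value of the weight at the origin,
  \<open>1 / 0 = 0\<close> in HOL, is immaterial.\<close>

definition L12 :: "('a::euclidean_space \<Rightarrow> real) set" where
  "L12 = {h. h \<in> borel_measurable lebesgue \<and> integrable lebesgue (\<lambda>x. \<bar>h x\<bar> / (norm x)\<^sup>2)}"

definition L12_dist :: "('a::euclidean_space \<Rightarrow> real) \<Rightarrow> ('a \<Rightarrow> real) \<Rightarrow> real" where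
  "L12_dist f g = (LINT x|lebesgue. \<bar>f x - g x\<bar> / (norm x)\<^sup>2)"

definition continuous_into_L12 :: "real set \<Rightarrow> ('a::euclidean_space \<times> real \<Rightarrow> real) \<Rightarrow> bool" where
  "continuous_into_L12 I u \<longleftrightarrow>
     (\<forall>t\<in>I. (\<lambda>x. u (x, t)) \<in> L12) \<and>
     (\<forall>t\<in>I. ((\<lambda>s. L12_dist (\<lambda>x. u (x, s)) (\<lambda>x. u (x, t))) \<longlongrightarrow> 0) (at t within I))"

definition Q :: "('a::euclidean_space \<times> real) set" where
  "Q = UNIV \<times> {0<..}"

definition Q_star :: "('a::euclidean_space \<times> real) set" where
  "Q_star = Q - {0} \<times> {0<..}"

text \<open>The time interval \<open>I\<close> is \<open>[0, \<infinity>)\<close> for initial data in \<open>L^1_2\<close> and \<open>(0, \<infinity>)\<close> for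
  measure data. The integrand in the last condition is integrable by the other conditions.\<close>

definition weak_solution_on :: "real set \<Rightarrow> ('a::euclidean_space \<times> real \<Rightarrow> real) \<Rightarrow> bool" where
  "weak_solution_on I u \<longleftrightarrow>
     u \<in> borel_measurable (lebesgue_on Q) \<and>
     (AE z in lebesgue_on Q. 0 \<le> u z) \<and>
     continuous_into_L12 I u \<and>
     (\<forall>\<tau>>0. \<exists>C. AE z in lebesgue_on (UNIV \<times> {\<tau><..}). \<bar>u z\<bar> \<le> C) \<and>
     (\<forall>\<phi>\<in>test_functions Q.
        (LINT z:Q|lebesgue. u z * (laplacian \<phi> z + time_deriv \<phi> z / (norm (fst z))\<^sup>2)) = 0)"

definition strong_on_Q_star :: "('a::euclidean_space \<times> real \<Rightarrow> real) \<Rightarrow> bool" where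
  "strong_on_Q_star u \<longleftrightarrow>
     (\<exists>w l. weak_time_deriv Q_star u w \<and> weak_laplacian Q_star u l \<and>
        (\<lambda>z. w z / (norm (fst z))\<^sup>2) \<in> L1_loc Q_star \<and>
        (AE z in lebesgue_on Q_star. w z / (norm (fst z))\<^sup>2 = l z))"

definition is_solution ::
  "('a::euclidean_space \<Rightarrow> real) \<Rightarrow> ('a \<times> real \<Rightarrow> real) \<Rightarrow> bool" where
  "is_solution u\<^sub>0 u \<longleftrightarrow>
     weak_solution_on {0..} u \<and> strong_on_Q_star u \<and> (AE x in lebesgue. u (x, 0) = u\<^sub>0 x)"

text \<open>The initial datum is \<open>M\<close> times the Dirac mass at the origin, taken in the sense of
  distributions on the whole space.\<close>

definition is_dirac_solution :: "real \<Rightarrow> ('a::euclidean_space \<times> real \<Rightarrow> real) \<Rightarrow> bool" where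
  "is_dirac_solution M u \<longleftrightarrow>
     weak_solution_on {0<..} u \<and> strong_on_Q_star u \<and>
     (\<forall>\<psi>\<in>test_functions UNIV.
        ((\<lambda>t. LINT x|lebesgue. u (x, t) * \<psi> x) \<longlongrightarrow> M * \<psi> 0) (at_right 0))"

definition continuous_representative ::
  "('a::euclidean_space \<times> real \<Rightarrow> real) \<Rightarrow> ('a \<times> real \<Rightarrow> real) \<Rightarrow> bool" where
  "continuous_representative u v \<longleftrightarrow>
     continuous_on Q_star v \<and> (AE z in lebesgue_on Q_star. v z = u z)"

end

theory Submission
  imports Defs
begin

text \<open>Write \<open>\<mu>\<^sub>t = u(\<cdot>, t) |x|\<^sup>-\<^sup>2 dx\<close>. Testing the equation with radial functions
  shows that the mass of \<open>\<mu>\<^sub>t\<close> is constant. A bump of radius \<open>r\<close> at the origin therefore has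
  \<open>u\<close>-integral at most \<open>r\<^sup>2\<close> times that mass, uniformly in \<open>t\<close>, so no Dirac mass can be
  the initial datum. Testing with powers of \<open>(1 + |x|\<^sup>2/\<rho>\<^sup>2)\<^sup>-\<^sup>1\<close> shows that, if the datum
  vanishes near the origin, the mass in the ball of radius \<open>\<rho>\<close> is smaller than any power of
  \<open>\<rho>\<close>; this gives the limit \<open>0\<close> at the origin.

  The operator \<open>|x|\<^sup>2 \<Delta>\<close> commutes with dilations and rotations, hence with averaging
  against a kernel that is bi-invariant up to its homogeneity in \<open>(x, y)\<close>. The averages \<open>avg e\<close>
  are smooth solutions, bounded independently of the scale \<open>e\<close>. Hamilton's gradient estimate,
  applied to derivatives along dilations and rotations, bounds their logarithmic gradient
  independently of \<open>e\<close>. Consequently they converge to a continuous representative, and the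
  gradient estimate, integrated along segments avoiding the origin, propagates positivity from one
  point to all others.\<close>


subsection \<open>Smooth functions\<close>

text \<open>The coefficient |x|^2 rules out mollification by translations. In terms of the measures
  \<mu>_t the equation reads d/dt \<mu>_t(f) = \<mu>_t(|y|^2 \<Delta> f), so a kernel with |x|^2
  \<Delta>_x K = |y|^2 \<Delta>_y K turns it into a classical equation for x \<mapsto> \<mu>_t(K x).
  Put D_x = x . grad_x. As |x|^2 \<Delta>_x equals D_x (D_x + N - 2) plus the sum of the squares of
  the rotation generators, this identity follows from invariance under joint rotations and from D_x
  + D_y = 2 - N on K. The degree 2 - N is also the one for which the integral of K x y |y|^-2 dy
  does not depend on x, so that one constant normalises all averages.

  Hamilton's estimate asks for some finite bound on the derivative, which may blow up as the scale
  of the kernel shrinks; its conclusion contains only the bound of the solution itself. This is why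
  no regularity of u is needed beforehand. Averages may vanish, so the estimate is applied to
  average plus \<delta>, and \<delta> tends to 0 at the end.\<close>

definition smooth :: "('a::euclidean_space \<Rightarrow> real) \<Rightarrow> bool" where
  "smooth f \<longleftrightarrow> (\<forall>k. C_k k f)"

lemma dir_deriv_eq:
  assumes "(f has_derivative f') (at x)"
  shows "dir_deriv v f x = f' v"
  using frechet_derivative_at[OF assms] by (simp add: dir_deriv_def)

lemma C_k_SucI:
  assumes "\<And>x. (f has_derivative f' x) (at x)" "\<And>b. b \<in> Basis \<Longrightarrow> C_k k (\<lambda>x. f' x b)"
  shows "C_k (Suc k) f"
proof -
  have "dir_deriv b f = (\<lambda>x. f' x b)" for b
    using dir_deriv_eq[OF assms(1)] by blast
  then show ?thesis using assms by (auto simp: differentiable_def)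
qed

lemma C_k_Suc_imp: "C_k (Suc k) f \<Longrightarrow> C_k k f"
proof (induction k arbitrary: f)
  case 0
  then show ?case
    by (simp add: continuous_at_imp_continuous_on differentiable_imp_continuous_within)
next
  case (Suc k)
  then show ?case by auto
qed

lemma C_k_has_derivative:
  assumes "C_k (Suc k) f"
  shows "(f has_derivative (\<lambda>v. dir_deriv v f x)) (at x)"
proof -
  have "(f has_derivative frechet_derivative f (at x)) (at x)"
    using assms frechet_derivative_works by auto
  moreover have "frechet_derivative f (at x) = (\<lambda>v. dir_deriv v f x)"
    by (simp add: dir_deriv_def fun_eq_iff)
  ultimately show ?thesis by simp
qed

lemma C_k_const: "C_k k (\<lambda>x. c)"
proof (induction k arbitrary: c)
  case (Suc k)
  show ?case
    by (rule C_k_SucI[where f'="\<lambda>_ _. 0"]) (auto intro: Suc has_derivative_const)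
qed simp

lemma C_k_add: "C_k k f \<Longrightarrow> C_k k g \<Longrightarrow> C_k k (\<lambda>x. f x + g x)"
proof (induction k arbitrary: f g)
  case 0 then show ?case by (auto intro: continuous_intros)
next
  case (Suc k)
  show ?case
    by (rule C_k_SucI[where f'="\<lambda>x v. dir_deriv v f x + dir_deriv v g x"])
      (use Suc in \<open>auto intro!: has_derivative_add C_k_has_derivative simp del: C_k.simps(2)\<close>, auto)
qed

lemma C_k_mult: "C_k k f \<Longrightarrow> C_k k g \<Longrightarrow> C_k k (\<lambda>x. f x * g x)"
proof (induction k arbitrary: f g)
  case 0 then show ?case by (auto intro: continuous_intros)
next
  case (Suc k)
  have 1: "C_k k (\<lambda>x. f x * dir_deriv b g x + dir_deriv b f x * g x)" if "b \<in> Basis" for b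
    using Suc.prems that C_k_Suc_imp[OF Suc.prems(1)] C_k_Suc_imp[OF Suc.prems(2)]
    by (intro C_k_add Suc.IH) auto
  show ?case
    by (rule C_k_SucI[where f'="\<lambda>x v. f x * dir_deriv v g x + dir_deriv v f x * g x"])
      (use Suc.prems 1 in \<open>auto intro!: has_derivative_mult C_k_has_derivative simp del: C_k.simps(2)\<close>)
qed

lemma C_k_linear: "bounded_linear f \<Longrightarrow> C_k k f"
proof (cases k)
  case 0
  assume "bounded_linear f" then show ?thesis using 0
    by (simp add: linear_continuous_on)
next
  case (Suc j)
  assume "bounded_linear f" then show ?thesis unfolding Suc
    by (intro C_k_SucI[where f'="\<lambda>_. f"]) (auto intro: bounded_linear_imp_has_derivative C_k_const)
qed

text \<open>The whole chain of derivatives \<open>h n\<close> is carried along because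
  differentiating \<open>h n (f x)\<close> produces \<open>h (Suc n)\<close>. The set
  \<open>S\<close> admits outer functions that are smooth only on part of the line, such as the
  reciprocal on the positive axis.\<close>

lemma C_k_compose:
  fixes h :: "nat \<Rightarrow> real \<Rightarrow> real"
  assumes h: "\<And>n t. t \<in> S \<Longrightarrow> (h n has_real_derivative h (Suc n) t) (at t)"
    and f: "\<And>x. f x \<in> S"
  shows "C_k k f \<Longrightarrow> C_k k (\<lambda>x. h n (f x))"
  using f
proof (induction k arbitrary: n)
  case 0
  have "continuous_on S (h n)"
    using h DERIV_isCont by (blast intro: continuous_at_imp_continuous_on)
  then show ?case
    using 0 by (auto intro: continuous_on_compose2[of S "h n"])
next
  case (Suc k)
  have "((\<lambda>x. h n (f x)) has_derivative (\<lambda>v. dir_deriv v f x * h (Suc n) (f x))) (at x)" for x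
    using has_derivative_compose[OF C_k_has_derivative[OF Suc.prems(1)]
        h[OF Suc.prems(2), unfolded has_field_derivative_def]]
    by (simp add: mult.commute)
  then show ?case
    by (rule C_k_SucI[where f'="\<lambda>x v. dir_deriv v f x * h (Suc n) (f x)"])
      (use Suc.prems in \<open>auto intro!: C_k_mult Suc.IH intro: C_k_Suc_imp simp del: C_k.simps(2)\<close>, auto)
qed

lemma smooth_const: "smooth (\<lambda>x. c)"
  and smooth_add: "smooth f \<Longrightarrow> smooth g \<Longrightarrow> smooth (\<lambda>x. f x + g x)"
  and smooth_mult: "smooth f \<Longrightarrow> smooth g \<Longrightarrow> smooth (\<lambda>x. f x * g x)"
  and smooth_linear: "bounded_linear f \<Longrightarrow> smooth f"
  by (auto simp: smooth_def C_k_const C_k_add C_k_mult C_k_linear)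

lemma smooth_compose:
  fixes h :: "nat \<Rightarrow> real \<Rightarrow> real"
  assumes "\<And>n t. t \<in> S \<Longrightarrow> (h n has_real_derivative h (Suc n) t) (at t)" "\<And>x. f x \<in> S" "smooth f"
  shows "smooth (\<lambda>x. h n (f x))"
  using C_k_compose[of S h f] assms by (auto simp: smooth_def)

lemma smooth_has_derivative:
  "smooth f \<Longrightarrow> (f has_derivative (\<lambda>v. dir_deriv v f x)) (at x)"
  unfolding smooth_def using C_k_has_derivative by blast

lemma smooth_dir_deriv:
  assumes "smooth f" "b \<in> Basis" shows "smooth (dir_deriv b f)"
  using assms unfolding smooth_def by (metis C_k.simps(2))

lemma smooth_continuous: "smooth f \<Longrightarrow> continuous_on UNIV f"
  unfolding smooth_def by (metis C_k.simps(1))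

lemma smooth_norm2: "smooth (\<lambda>x. (norm x)\<^sup>2)"
proof -
  have "C_k k (\<lambda>x::'a. (norm x)\<^sup>2)" for k
  proof (cases k)
    case 0 then show ?thesis by (auto intro: continuous_intros)
  next
    case (Suc j)
    show ?thesis unfolding Suc power2_norm_eq_inner
      by (rule C_k_SucI[where f'="\<lambda>x v. 2 * (x \<bullet> v)"])
        (auto intro!: derivative_eq_intros C_k_linear bounded_linear_const_mult bounded_linear_inner_left bounded_linear_inner_right simp: fun_eq_iff inner_commute)
  qed
  then show ?thesis by (simp add: smooth_def)
qed

lemma C_k_fst: "C_k k f \<Longrightarrow> C_k k (\<lambda>z::'a::euclidean_space \<times> 'b::euclidean_space. f (fst z))"
proof (induction k arbitrary: f)
  case 0 then show ?case
    by (simp add: continuous_on_compose2[of UNIV f] continuous_on_fst continuous_on_snd)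
next
  case (Suc k)
  have 1: "C_k k (\<lambda>z::'a\<times>'b. dir_deriv (fst b) f (fst z))" if "b \<in> Basis" for b :: "'a \<times> 'b"
  \<comment> \<open>A basis vector of the product has one vanishing component. If it is the first,
    the derivative is 0 by linearity, and the induction hypothesis, which speaks of basis vectors of
    the factor, does not apply.\<close>
  proof (cases "fst b = 0")
    case True
    have "dir_deriv 0 f = (\<lambda>x. 0)"
      using linear_0[OF has_derivative_linear[OF C_k_has_derivative[OF Suc.prems]]] by auto
    then show ?thesis using True by (simp add: C_k_const)
  next
    case False
    then show ?thesis using that Suc.prems by (intro Suc.IH) (auto simp: Basis_prod_def)
  qed
  show ?case
    by (rule C_k_SucI[where f'="\<lambda>x v. dir_deriv (fst v) f (fst x)"])
      (use 1 in \<open>auto intro: has_derivative_compose[OF has_derivative_fst[OF has_derivative_ident] C_k_has_derivative[OF Suc.prems]]\<close>)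
qed

lemma C_k_snd: "C_k k f \<Longrightarrow> C_k k (\<lambda>z::'a::euclidean_space \<times> 'b::euclidean_space. f (snd z))"
proof (induction k arbitrary: f)
  case 0 then show ?case
    by (simp add: continuous_on_compose2[of UNIV f] continuous_on_fst continuous_on_snd)
next
  case (Suc k)
  have 1: "C_k k (\<lambda>z::'a\<times>'b. dir_deriv (snd b) f (snd z))" if "b \<in> Basis" for b :: "'a \<times> 'b"
  proof (cases "snd b = 0")
    case True
    have "dir_deriv 0 f = (\<lambda>x. 0)"
      using linear_0[OF has_derivative_linear[OF C_k_has_derivative[OF Suc.prems]]] by auto
    then show ?thesis using True by (simp add: C_k_const)
  next
    case False
    then show ?thesis using that Suc.prems by (intro Suc.IH) (auto simp: Basis_prod_def)
  qed
  show ?case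
    by (rule C_k_SucI[where f'="\<lambda>x v. dir_deriv (snd v) f (snd x)"])
      (use 1 in \<open>auto intro: has_derivative_compose[OF has_derivative_snd[OF has_derivative_ident] C_k_has_derivative[OF Suc.prems]]\<close>)
qed

text \<open>The standard flat function \<open>exp (-1/t)\<close> and its derivatives, the \<open>n\<close>-th being a
  polynomial in \<open>1/t\<close> times \<open>exp (-1/t)\<close>.\<close>

primrec flat_poly :: "nat \<Rightarrow> real poly" where
  "flat_poly 0 = 1"
| "flat_poly (Suc n) = [:0, 0, 1:] * (flat_poly n - pderiv (flat_poly n))"

definition flat :: "nat \<Rightarrow> real \<Rightarrow> real" where
  "flat n t = (if t > 0 then poly (flat_poly n) (1/t) * exp (- (1/t)) else 0)"

lemma poly_exp_tendsto_0:
  "((\<lambda>s. poly p s * exp (- s)) \<longlongrightarrow> (0::real)) at_top"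
proof (induction p)
  case 0 then show ?case by simp
next
  case (pCons a p)
  have "((\<lambda>s. s ^ i / exp s) \<longlongrightarrow> (0::real)) at_top" for i
    by (rule tendsto_power_div_exp_0)
  then have *: "((\<lambda>s. \<Sum>i\<le>degree (pCons a p). coeff (pCons a p) i * (s ^ i / exp s)) \<longlongrightarrow> 0) at_top"
    by (intro tendsto_null_sum) (metis tendsto_mult_right_zero)
  have "(\<lambda>s. \<Sum>i\<le>degree (pCons a p). coeff (pCons a p) i * (s ^ i / exp s))
      = (\<lambda>s. poly (pCons a p) s * exp (- s))"
    by (subst poly_altdef) (auto simp: fun_eq_iff sum_distrib_right exp_minus divide_inverse mult.assoc simp del: coeff_pCons_Suc)
  with * show ?case by simp
qed

lemma flat_tendsto_0: "((\<lambda>t. poly p (1/t) * exp (- (1/t))) \<longlongrightarrow> (0::real)) (at_right 0)"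
  using filterlim_compose[OF poly_exp_tendsto_0 filterlim_inverse_at_top_right]
  by (simp add: inverse_eq_divide)

lemma flat_deriv: "(flat n has_real_derivative flat (Suc n) t) (at t)"
proof -
  consider "t > 0" | "t < 0" | "t = 0" by linarith
  then show ?thesis
  proof cases
    case 1
    have "((\<lambda>t. poly (flat_poly n) (1/t) * exp (- (1/t))) has_real_derivative flat (Suc n) t) (at t)"
      using 1 unfolding flat_def
      by (auto intro!: derivative_eq_intros poly_DERIV[THEN DERIV_chain2] simp: field_simps power2_eq_square)
    moreover have "eventually (\<lambda>s. s > 0) (nhds t)"
      using 1 by (simp add: eventually_nhds_in_open[of "{0<..}", simplified])
    then have "\<forall>\<^sub>F s in nhds t. flat n s = poly (flat_poly n) (1/s) * exp (- (1/s))"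
      by eventually_elim (simp add: flat_def)
    ultimately show ?thesis by (subst DERIV_cong_ev) auto
  next
    case 2
    have "eventually (\<lambda>s. s < 0) (nhds t)"
      using 2 by (simp add: eventually_nhds_in_open[of "{..<0}", simplified])
    then have "\<forall>\<^sub>F s in nhds t. flat n s = 0"
      by eventually_elim (simp add: flat_def)
    then show ?thesis using 2 by (subst DERIV_cong_ev[OF refl _ refl]) (auto simp: flat_def)
  next
    case 3
    \<comment> \<open>Division by the increment adds one factor \<open>1/t\<close> to the
      polynomial, so the difference quotient at 0 is again a polynomial in \<open>1/t\<close> times
      exp (-1/t).\<close>
    have "((\<lambda>h. flat n h / h) \<longlongrightarrow> 0) (at_right 0)"
    proof (rule Lim_transform_eventually)
      show "((\<lambda>t. poly ([:0,1:] * flat_poly n) (1/t) * exp (- (1/t))) \<longlongrightarrow> (0::real)) (at_right 0)"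
        by (rule flat_tendsto_0)
      show "\<forall>\<^sub>F x in at_right 0. poly ([:0, 1:] * flat_poly n) (1 / x) * exp (- (1 / x)) = flat n x / x"
        by (auto simp: eventually_at_filter flat_def)
    qed
    moreover have "((\<lambda>h. flat n h / h) \<longlongrightarrow> 0) (at_left 0)"
      by (rule tendsto_eventually) (auto simp: eventually_at_filter flat_def)
    ultimately have "((\<lambda>h. flat n h / h) \<longlongrightarrow> 0) (at 0)"
      by (simp add: filterlim_at_split)
    then show ?thesis using 3 by (simp add: DERIV_def flat_def)
  qed
qed

lemma flat_nonpos [simp]: "t \<le> 0 \<Longrightarrow> flat n t = 0"
  by (simp add: flat_def)

lemma flat_0_pos: "t > 0 \<Longrightarrow> flat 0 t > 0"
  by (simp add: flat_def)

lemma flat_0_nonneg: "flat 0 t \<ge> 0"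
  by (simp add: flat_def)

lemma flat_0_le_1: "flat 0 t \<le> 1"
  by (simp add: flat_def)

lemma flat_0_mono: "s \<le> t \<Longrightarrow> flat 0 s \<le> flat 0 t"
  by (simp add: flat_def frac_le)

lemma flat_continuous: "continuous_on S (flat n)"
  by (meson DERIV_isCont continuous_at_imp_continuous_on flat_deriv)

lemma flat_bounded: "\<exists>C>0. \<forall>t\<le>b. \<bar>flat n t\<bar> \<le> C"
proof -
  have "compact (flat n ` {0..b})"
    by (intro compact_continuous_image flat_continuous) auto
  then obtain C where C: "\<And>x. x \<in> flat n ` {0..b} \<Longrightarrow> \<bar>x\<bar> \<le> C"
    by (metis compact_imp_bounded bounded_iff real_norm_def)
  have "\<bar>flat n t\<bar> \<le> max C 1" if "t \<le> b" for t
    using C[of "flat n t"] that by (cases "t \<ge> 0") (auto intro: le_max_iff_disj[THEN iffD2])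
  then show ?thesis by (intro exI[of _ "max C 1"]) auto
qed

lemma smooth_flat: "smooth f \<Longrightarrow> smooth (\<lambda>x. flat n (f x))"
  by (rule smooth_compose[where S=UNIV and h=flat]) (auto intro: flat_deriv)

subsection \<open>The measures \<open>u(\<cdot>, t) |x|\<^sup>-\<^sup>2 dx\<close>\<close>

lemma AE_lebesgue_slices:
  fixes R :: "'a::euclidean_space \<times> 'b::euclidean_space \<Rightarrow> bool"
  assumes "AE z in lebesgue. R z"
  shows "AE r in lebesgue. AE y in lebesgue. R (y, r)"
proof -
  have "AE z in lborel \<Otimes>\<^sub>M lborel. R z"
    unfolding lborel_prod using assms by (simp add: AE_completion_iff)
  then have "AE z in lborel \<Otimes>\<^sub>M lborel. R (case z of (x, y) \<Rightarrow> (y, x))"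
    by (subst (asm) lborel_pair.distr_pair_swap) (auto dest!: AE_distrD[rotated])
  then have "AE r in lborel. AE y in lborel. R (y, r)"
    using lborel_pair.AE_pair by fastforce
  then show ?thesis by (simp add: AE_completion_iff)
qed

text \<open>\<open>F\<close> is replaced by a Borel version \<open>G\<close>; for almost every
  \<open>r\<close> the two agree on almost all of the slice, since almost every slice of a null set
  is null. The dominating function \<open>B\<close> bounds the slice integrals and yields
  integrability of \<open>G\<close>.\<close>

lemma lebesgue_Fubini_snd:
  fixes F :: "'a::euclidean_space \<times> 'b::euclidean_space \<Rightarrow> real"
  assumes F: "F \<in> borel_measurable lebesgue"
    and ae: "AE r in lebesgue. integrable lebesgue (\<lambda>y. F (y, r)) \<and> (LINT y|lebesgue. \<bar>F (y, r)\<bar>) \<le> B r"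
    and B: "integrable lebesgue B"
  shows "integrable lebesgue F"
    and "(LINT z|lebesgue. F z) = (LINT r|lebesgue. LINT y|lebesgue. F (y, r))"
proof -
  obtain G where G [measurable]: "G \<in> borel_measurable lborel" and FG: "AE z in lborel. F z = G z"
    using completion_ex_borel_measurable_real[OF F] by auto
  have G' [measurable]: "G \<in> borel_measurable (lborel \<Otimes>\<^sub>M lborel)"
    using G by (simp add: lborel_prod)
  have sl: "AE r in lebesgue. AE y in lebesgue. F (y, r) = G (y, r)"
    using FG by (intro AE_lebesgue_slices) (simp add: AE_completion_iff)
  have Gm [measurable]: "(\<lambda>y. G (y, r)) \<in> borel_measurable lborel" for r
    by simp
  have Gml: "(\<lambda>y. G (y, r)) \<in> borel_measurable lebesgue" for r
    using Gm by (rule measurable_completion)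
  have key: "AE r in lebesgue. (\<integral>\<^sup>+y. ennreal (norm (G (y, r))) \<partial>lborel) \<le> ennreal (B r)"
    using ae sl
  proof eventually_elim
    case (elim r)
    have i: "integrable lebesgue (\<lambda>y. norm (F (y, r)))"
      using elim by auto
    have "(\<integral>\<^sup>+y. ennreal (norm (G (y, r))) \<partial>lborel) = (\<integral>\<^sup>+y. ennreal (norm (G (y, r))) \<partial>lebesgue)"
      by (simp add: nn_integral_completion)
    also have "\<dots> = (\<integral>\<^sup>+y. ennreal (norm (F (y, r))) \<partial>lebesgue)"
      using elim(2) by (intro nn_integral_cong_AE) auto
    also have "\<dots> = ennreal (LINT y|lebesgue. norm (F (y, r)))"
      using i by (intro nn_integral_eq_integral) auto
    finally show ?case using elim by (simp add: ennreal_leI)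
  qed
  have "(\<integral>\<^sup>+z. ennreal (norm (G z)) \<partial>(lborel \<Otimes>\<^sub>M lborel)) =
      (\<integral>\<^sup>+r. (\<integral>\<^sup>+y. ennreal (norm (G (y, r))) \<partial>lborel) \<partial>lborel)"
    by (subst lborel_pair.nn_integral_snd) (auto simp: case_prod_beta)
  also have "\<dots> \<le> (\<integral>\<^sup>+r. ennreal (B r) \<partial>lebesgue)"
    using nn_integral_mono_AE[OF key] by (simp add: nn_integral_completion)
  also have "\<dots> < \<infinity>"
    using integrableD(2)[OF B] by (auto simp: top.not_eq_extremum)
  finally have "integrable (lborel \<Otimes>\<^sub>M lborel) G"
    by (intro integrableI_bounded) auto
  then have Gi: "integrable lborel G" and
    Gi': "(LINT r|lborel. LINT y|lborel. G (y, r)) = integral\<^sup>L lborel G"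
    using lborel_pair.integral_snd[of "\<lambda>y r. G (y, r)"] by (simp_all add: lborel_prod)
  have Gl: "integrable lebesgue G"
    using Gi by (simp add: integrable_completion)
  show "integrable lebesgue F"
    by (subst integrable_cong_AE[of F lebesgue G]) (use F Gl FG in \<open>auto simp: AE_completion_iff\<close>)
  have "(LINT z|lebesgue. F z) = (LINT z|lebesgue. G z)"
    using F Gl FG by (intro integral_cong_AE) (auto simp: AE_completion_iff)
  also have "\<dots> = (LINT r|lborel. LINT y|lborel. G (y, r))"
    using Gi' by (simp add: integral_completion)
  also have "\<dots> = (LINT r|lebesgue. LINT y|lebesgue. G (y, r))"
    by (simp add: integral_completion)
  also have "\<dots> = (LINT r|lebesgue. LINT y|lebesgue. F (y, r))"
  proof (rule integral_cong_AE)
    show Gm2: "(\<lambda>r. LINT y|lebesgue. G (y, r)) \<in> borel_measurable lebesgue"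
    proof -
      have "(\<lambda>(r, y). G (y, r)) \<in> borel_measurable (lborel \<Otimes>\<^sub>M lborel)"
        by measurable
      then have "(\<lambda>r. LBINT y. G (y, r)) \<in> borel_measurable lborel"
        using lborel.borel_measurable_lebesgue_integral[of "\<lambda>r y. G (y, r)" lborel] by simp
      then show ?thesis
        by (simp add: integral_completion measurable_completion)
    qed
    show eq: "AE r in lebesgue. (LINT y|lebesgue. G (y, r)) = (LINT y|lebesgue. F (y, r))"
      using ae sl
    proof eventually_elim
      case (elim r)
      show ?case using elim Gml[of r] by (intro integral_cong_AE) auto
    qed
    show "(\<lambda>r. LINT y|lebesgue. F (y, r)) \<in> borel_measurable lebesgue"
      by (rule borel_measurable_AE) (use eq Gm2 in auto)
  qed
  finally show "(LINT z|lebesgue. F z) = (LINT r|lebesgue. LINT y|lebesgue. F (y, r))" .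
qed

text \<open>Sign and size of a solution are given almost everywhere in space-time, hence only for
  almost every time. Through this lemma the continuity in time upgrades them to every
  \<open>t\<close> in \<open>I\<close>, including the left end point.\<close>

lemma AE_ge_0_imp_continuous_ge_0:
  fixes g :: "real \<Rightarrow> real"
  assumes cont: "continuous_on I g" and I: "\<And>t. a < t \<Longrightarrow> t \<in> I" and t: "t \<in> I" "a \<le> t"
    and ae: "AE s in lebesgue. a < s \<longrightarrow> 0 \<le> g s"
  shows "0 \<le> g t"
proof (rule ccontr)
  assume "\<not> 0 \<le> g t"
  then have "\<forall>\<^sub>F s in at t within I. g s < 0"
    using cont t by (intro order_tendstoD(2)) (auto simp: continuous_on_def)
  then obtain d where d: "d > 0" "\<And>s. s \<in> I \<Longrightarrow> s \<noteq> t \<Longrightarrow> dist s t < d \<Longrightarrow> g s < 0"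
    by (auto simp: eventually_at)
  have "AE s in lebesgue. s \<notin> {t<..<t+d}"
    using ae by eventually_elim (use d I t in \<open>force simp: dist_real_def not_less[symmetric]\<close>)
  then have "{t<..<t+d} \<in> null_sets lebesgue"
    by (subst AE_iff_null_sets) auto
  then have "emeasure lebesgue {t<..<t+d} = 0" by (simp add: null_sets_def)
  then show False using d by simp
qed

section \<open>Densities and pairings at a fixed time\<close>

text \<open>The density of \<mu>_t. At \<open>y = 0\<close> the division returns 0; this affects no
  integral and lets identities between such quotients hold at the origin too.\<close>

definition dens :: "('a::euclidean_space \<times> real \<Rightarrow> real) \<Rightarrow> real \<Rightarrow> 'a \<Rightarrow> real" where
  "dens u t y = u (y, t) / (norm y)\<^sup>2"

definition pairing :: "('a::euclidean_space \<times> real \<Rightarrow> real) \<Rightarrow> ('a \<Rightarrow> real) \<Rightarrow> real \<Rightarrow> real" where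
  "pairing u f t = (LINT y|lebesgue. f y * dens u t y)"

definition lap :: "('a::euclidean_space \<Rightarrow> real) \<Rightarrow> 'a \<Rightarrow> real" where
  "lap f x = (\<Sum>b\<in>Basis. dir_deriv b (dir_deriv b f) x)"

lemma borel_measurable_lebesgueI: "f \<in> borel_measurable borel \<Longrightarrow> f \<in> borel_measurable lebesgue"
  by (rule measurable_completion) simp

lemma open_lebesgue: "open S \<Longrightarrow> S \<in> sets lebesgue"
  by (simp add: borel_open sets_completionI_sets)

text \<open>The two choices of \<open>I\<close> serve initial data in \<open>L12\<close> and the
  Dirac datum, so that everything common to both parts is proved once.\<close>

locale global_solution =
  fixes I :: "real set" and u :: "'a::euclidean_space \<times> real \<Rightarrow> real"
  assumes I: "I = {0..} \<or> I = {0<..}"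
    and weak: "weak_solution_on I u"
begin

abbreviation P :: "('a \<Rightarrow> real) \<Rightarrow> real \<Rightarrow> real" where "P \<equiv> pairing u"

lemma pos_I: "t > 0 \<Longrightarrow> t \<in> I" and I_nonneg: "t \<in> I \<Longrightarrow> t \<ge> 0"
  using I by auto

lemma slice_L12: "t \<in> I \<Longrightarrow> (\<lambda>x. u (x, t)) \<in> L12"
  and slice_cont: "t \<in> I \<Longrightarrow> ((\<lambda>s. L12_dist (\<lambda>x. u (x, s)) (\<lambda>x. u (x, t))) \<longlongrightarrow> 0) (at t within I)"
  using weak by (auto simp: weak_solution_on_def continuous_into_L12_def)

lemma slice_measurable: "t \<in> I \<Longrightarrow> (\<lambda>x. u (x, t)) \<in> borel_measurable lebesgue"
  using slice_L12 by (auto simp: L12_def)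

lemma borel_norm_lebesgue [measurable]: "(\<lambda>y::'a. (norm y)\<^sup>2) \<in> borel_measurable lebesgue"
  by (rule measurable_completion) auto

lemma dens_measurable: "t \<in> I \<Longrightarrow> dens u t \<in> borel_measurable lebesgue"
  unfolding dens_def[abs_def] using slice_measurable[of t] by (intro borel_measurable_divide) auto

lemma slice_integrable: "t \<in> I \<Longrightarrow> integrable lebesgue (dens u t)"
  using slice_L12[of t] dens_measurable[of t]
  by (intro Bochner_Integration.integrable_bound[of lebesgue "\<lambda>x. \<bar>u (x, t)\<bar> / (norm x)\<^sup>2" "dens u t"])
    (auto simp: L12_def dens_def)

lemma L12_dist_dens: "L12_dist (\<lambda>x. u (x, s)) (\<lambda>x. u (x, t)) = (LINT y|lebesgue. \<bar>dens u s y - dens u t y\<bar>)"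
  by (simp add: L12_dist_def dens_def diff_divide_distrib[symmetric])

lemma pairing_integrable:
  assumes "t \<in> I" "f \<in> borel_measurable borel" "\<And>y. \<bar>f y\<bar> \<le> C"
  shows "integrable lebesgue (\<lambda>y. f y * dens u t y)"
proof (rule Bochner_Integration.integrable_bound)
  show "integrable lebesgue (\<lambda>y. C * dens u t y)"
    using slice_integrable[OF assms(1)] by simp
  note [measurable] = borel_measurable_lebesgueI[OF assms(2)]
  show "(\<lambda>y. f y * dens u t y) \<in> borel_measurable lebesgue"
    using dens_measurable[OF assms(1)] by measurable
  have "\<bar>f y\<bar> \<le> \<bar>C\<bar>" for y using assms(3)[of y] by linarith
  then show "AE y in lebesgue. norm (f y * dens u t y) \<le> norm (C * dens u t y)"
    by (auto simp: abs_mult divide_right_mono mult_right_mono)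
qed

text \<open>The absolute value is taken because nonnegativity of the density at every time, rather
  than almost every time, is obtained only in \<open>slice_nonneg\<close>.\<close>

definition mass :: "real \<Rightarrow> real" where
  "mass t = (LINT y|lebesgue. \<bar>dens u t y\<bar>)"

lemma pairing_bound:
  assumes "t \<in> I" "f \<in> borel_measurable borel" "\<And>y. \<bar>f y\<bar> \<le> C"
  shows "(LINT y|lebesgue. \<bar>f y * dens u t y\<bar>) \<le> C * mass t"
proof -
  have "(LINT y|lebesgue. \<bar>f y * dens u t y\<bar>) \<le> (LINT y|lebesgue. C * \<bar>dens u t y\<bar>)"
    using pairing_integrable[OF assms] slice_integrable[OF assms(1)]
    by (intro integral_mono integrable_abs integrable_mult_right) (auto simp: abs_mult intro!: mult_right_mono assms)
  then show ?thesis by (simp add: mass_def)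
qed

text \<open>The modulus of continuity in time depends on the test function only through its bound.
  This uniformity is what makes the averages jointly continuous in space and time.\<close>

lemma pairing_diff_bound:
  assumes "s \<in> I" "t \<in> I" "f \<in> borel_measurable borel" "\<And>y. \<bar>f y\<bar> \<le> C"
  shows "\<bar>P f s - P f t\<bar> \<le> C * L12_dist (\<lambda>x. u (x, s)) (\<lambda>x. u (x, t))"
proof -
  have C: "C \<ge> 0" using assms(4)[of 0] by linarith
  have i: "integrable lebesgue (\<lambda>y. dens u s y - dens u t y)"
    using slice_integrable assms by auto
  have p: "integrable lebesgue (\<lambda>y. f y * dens u s y)" "integrable lebesgue (\<lambda>y. f y * dens u t y)"
    using pairing_integrable assms by blast+
  have "P f s - P f t = (LINT y|lebesgue. f y * (dens u s y - dens u t y))"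
    unfolding pairing_def using p
    by (subst Bochner_Integration.integral_diff[symmetric]) (auto simp: right_diff_distrib)
  also have "\<bar>\<dots>\<bar> \<le> (LINT y|lebesgue. C * \<bar>dens u s y - dens u t y\<bar>)"
    using p i assms(4) by (intro integral_abs_bound_integral)
       (auto simp: abs_mult intro!: mult_right_mono, simp add: right_diff_distrib)
  finally show ?thesis by (simp add: L12_dist_dens)
qed

lemma pairing_continuous:
  assumes "f \<in> borel_measurable borel" "\<And>y. \<bar>f y\<bar> \<le> C"
  shows "continuous_on I (P f)"
  unfolding continuous_on_def
proof
  fix t assume t: "t \<in> I"
  show "(P f \<longlongrightarrow> P f t) (at t within I)"
  proof (rule Lim_null_comparison[THEN LIM_zero_cancel])
    show "((\<lambda>s. C * L12_dist (\<lambda>x. u (x, s)) (\<lambda>x. u (x, t))) \<longlongrightarrow> 0) (at t within I)"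
      using slice_cont[OF t] by (rule tendsto_mult_right_zero)
    show "\<forall>\<^sub>F s in at t within I. norm (P f s - P f t) \<le> C * L12_dist (\<lambda>x. u (x, s)) (\<lambda>x. u (x, t))"
      using pairing_diff_bound[OF _ t assms] by (auto simp: eventually_at_filter)
  qed
qed

lemma mass_continuous: "continuous_on I mass"
  unfolding continuous_on_def
proof
  fix t assume t: "t \<in> I"
  have "\<bar>mass s - mass t\<bar> \<le> L12_dist (\<lambda>x. u (x, s)) (\<lambda>x. u (x, t))" if s: "s \<in> I" for s
  proof -
    have "mass s - mass t = (LINT y|lebesgue. \<bar>dens u s y\<bar> - \<bar>dens u t y\<bar>)"
      unfolding mass_def using slice_integrable s t by (subst Bochner_Integration.integral_diff) auto
    also have "\<bar>\<dots>\<bar> \<le> (LINT y|lebesgue. \<bar>dens u s y - dens u t y\<bar>)"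
      using slice_integrable s t by (intro integral_abs_bound_integral) auto
    also have "\<dots> = L12_dist (\<lambda>x. u (x, s)) (\<lambda>x. u (x, t))"
      by (simp add: L12_dist_dens)
    finally show ?thesis .
  qed
  then show "(mass \<longlongrightarrow> mass t) (at t within I)"
    by (intro Lim_null_comparison[OF _ slice_cont[OF t], THEN LIM_zero_cancel]) (auto simp: eventually_at_filter)
qed

lemma u_measurable: "(\<lambda>z. indicator Q z * u z) \<in> borel_measurable lebesgue"
proof -
  have "Q \<in> sets (lebesgue :: ('a \<times> real) measure)"
    unfolding Q_def by (intro open_lebesgue open_Times) auto
  then show ?thesis
    using weak unfolding weak_solution_on_def
    by (subst (asm) borel_measurable_restrict_space_iff) (auto simp: mult.commute)
qed

lemma AE_slices_Q:
  fixes R :: "'a \<times> real \<Rightarrow> bool"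
  assumes "AE z in lebesgue_on (UNIV \<times> {\<tau><..}). R z"
  shows "AE r in lebesgue. \<tau> < r \<longrightarrow> (AE y::'a in lebesgue. R (y, r))"
proof -
  have "UNIV \<times> {\<tau><..} \<in> sets (lebesgue :: ('a \<times> real) measure)"
    by (intro open_lebesgue open_Times) auto
  then have "AE z in lebesgue. z \<in> (UNIV :: 'a set) \<times> {\<tau><..} \<longrightarrow> R z"
    using assms by (subst (asm) AE_restrict_space_iff) auto
  then show ?thesis
    by (drule_tac AE_lebesgue_slices) auto
qed

lemma AE_dens_nonneg: "AE s in lebesgue. 0 < s \<longrightarrow> (AE y in lebesgue. 0 \<le> dens u s y)"
proof -
  have "AE z in lebesgue_on (UNIV \<times> {0<..}). 0 \<le> u z"
    using weak unfolding weak_solution_on_def Q_def by blast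
  from AE_slices_Q[OF this] show ?thesis
    by eventually_elim (auto simp: dens_def elim!: eventually_mono)
qed

lemma pairing_nonneg:
  assumes "t \<in> I" and f: "f \<in> borel_measurable borel" "\<And>y. \<bar>f y\<bar> \<le> C" "\<And>y. 0 \<le> f y"
  shows "0 \<le> P f t"
proof (rule AE_ge_0_imp_continuous_ge_0[OF pairing_continuous[OF f(1,2)]])
  show "AE s in lebesgue. 0 < s \<longrightarrow> 0 \<le> P f s"
    using AE_dens_nonneg
    by eventually_elim (auto elim!: eventually_mono simp: pairing_def intro!: integral_nonneg_AE mult_nonneg_nonneg f(3))
qed (use assms pos_I I_nonneg in auto)

text \<open>The difference between the integral of the density and the integral of its absolute
  value is continuous in time and vanishes at almost every time, hence at every time. The
  nonnegative function |dens| - dens then has integral 0.\<close>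

lemma slice_nonneg:
  assumes t: "t \<in> I"
  shows "AE y in lebesgue. 0 \<le> dens u t y"
proof -
  have "AE s in lebesgue. 0 < s \<longrightarrow> (LINT y|lebesgue. \<bar>dens u s y\<bar>) = P (\<lambda>_. 1) s"
    using AE_dens_nonneg
  proof eventually_elim
    case (elim s)
    then show ?case
      unfolding pairing_def using dens_measurable[OF pos_I[of s]]
      by (auto intro!: integral_cong_AE)
  qed
  then have ae: "AE s in lebesgue. 0 < s \<longrightarrow> 0 \<le> P (\<lambda>_. 1) s - mass s"
    by (auto simp: mass_def)
  have "0 \<le> P (\<lambda>_. 1) t - mass t"
    by (rule AE_ge_0_imp_continuous_ge_0[OF _ _ _ _ ae, of I])
      (use pos_I I_nonneg t in \<open>auto intro!: continuous_intros mass_continuous pairing_continuous[where C=1]\<close>)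
  then have "(LINT y|lebesgue. \<bar>dens u t y\<bar> - dens u t y) \<le> 0"
    using slice_integrable[OF t] by (simp add: mass_def pairing_def)
  moreover have "(LINT y|lebesgue. \<bar>dens u t y\<bar> - dens u t y) \<ge> 0"
    by (intro integral_nonneg_AE) auto
  ultimately have "AE y in lebesgue. \<bar>dens u t y\<bar> - dens u t y = 0"
    using slice_integrable[OF t] by (subst integral_nonneg_eq_0_iff_AE[symmetric]) auto
  then show ?thesis by eventually_elim auto
qed

text \<open>One constant serves all test functions and all times from \<tau> on. Tested with a
  normalised kernel it bounds the averages independently of the scale.\<close>

lemma pairing_upper:
  assumes "\<tau> > 0"
  obtains C where "C > 0" "\<And>f t B. f \<in> borel_measurable borel \<Longrightarrow> (\<And>y. \<bar>f y\<bar> \<le> B) \<Longrightarrow> (\<And>y. 0 \<le> f y)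
     \<Longrightarrow> integrable lebesgue (\<lambda>y. f y / (norm y)\<^sup>2) \<Longrightarrow> t \<ge> \<tau>
     \<Longrightarrow> P f t \<le> C * (LINT y|lebesgue. f y / (norm y)\<^sup>2)"
proof -
  obtain C where C: "AE z in lebesgue_on (UNIV \<times> {\<tau><..}). \<bar>u z\<bar> \<le> C"
    using weak assms unfolding weak_solution_on_def by blast
  have *: "P f t \<le> max C 1 * (LINT y|lebesgue. f y / (norm y)\<^sup>2)"
    if f: "f \<in> borel_measurable borel" "\<And>y. \<bar>f y\<bar> \<le> B" "\<And>y. 0 \<le> f y"
      "integrable lebesgue (\<lambda>y. f y / (norm y)\<^sup>2)" and t: "t \<ge> \<tau>" for f B t
  proof -
    have "0 \<le> max C 1 * (LINT y|lebesgue. f y / (norm y)\<^sup>2) - P f t"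
    proof (rule AE_ge_0_imp_continuous_ge_0[where I=I and a=\<tau> and t=t
        and g="\<lambda>t. max C 1 * (LINT y|lebesgue. f y / (norm y)\<^sup>2) - P f t"])
      show "continuous_on I (\<lambda>t. max C 1 * (LINT y|lebesgue. f y / (norm y)\<^sup>2) - P f t)"
        by (intro continuous_intros pairing_continuous[OF f(1,2)])
      show "t \<in> I" "\<tau> \<le> t" "\<And>t. \<tau> < t \<Longrightarrow> t \<in> I" using pos_I assms t by auto
      show "AE s in lebesgue. \<tau> < s \<longrightarrow> 0 \<le> max C 1 * (LINT y|lebesgue. f y / (norm y)\<^sup>2) - P f s"
        using AE_slices_Q[OF C]
      proof (eventually_elim, intro impI)
        fix s assume "\<tau> < s \<longrightarrow> (AE y in lebesgue. \<bar>u (y, s)\<bar> \<le> C)" "\<tau> < s"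
        then have s: "AE y in lebesgue. \<bar>u (y, s)\<bar> \<le> C" "\<tau> < s" by auto
        have "P f s \<le> (LINT y|lebesgue. max C 1 * (f y / (norm y)\<^sup>2))"
          unfolding pairing_def
        proof (rule integral_mono_AE)
          show "integrable lebesgue (\<lambda>y. f y * dens u s y)"
            using pairing_integrable[OF _ f(1,2)] pos_I assms s by auto
          show "AE y in lebesgue. f y * dens u s y \<le> max C 1 * (f y / (norm y)\<^sup>2)"
            using s(1) unfolding dens_def
          proof eventually_elim
            case (elim y)
            have "f y * u (y, s) \<le> f y * max C 1" using elim f(3)[of y] by (intro mult_left_mono) auto
            then show ?case by (auto simp: divide_right_mono mult.commute)
          qed
          show "integrable lebesgue (\<lambda>y. max C 1 * (f y / (norm y)\<^sup>2))"
            using f(4) by (rule integrable_mult_right)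
        qed
        then show "0 \<le> max C 1 * (LINT y|lebesgue. f y / (norm y)\<^sup>2) - P f s"
          by (simp only: integral_mult_right_zero diff_ge_0_iff_ge)
      qed
    qed
    then show ?thesis by simp
  qed
  show thesis
  proof (rule that[of "max C 1"])
    show "0 < max C 1" by simp
  qed (rule *)
qed

end

subsection \<open>The equation for the pairings\<close>

text \<open>The parameter sits in the bounded factor \<open>J\<close> only, and the integrable
  density \<open>k\<close> is fixed. By the mean value theorem the difference quotients of
  \<open>J\<close> are bounded by \<open>C\<close>, so \<open>C * \<bar>k y\<bar>\<close>
  dominates.\<close>

lemma has_real_derivative_integral:
  fixes J J' :: "real \<Rightarrow> 'b \<Rightarrow> real"
  assumes k: "integrable M k" and e: "e > 0"
    and meas: "\<And>s. \<bar>s - t\<bar> < e \<Longrightarrow> J s \<in> borel_measurable M"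
    and deriv: "\<And>s y. \<bar>s - t\<bar> < e \<Longrightarrow> ((\<lambda>s. J s y) has_real_derivative J' s y) (at s)"
    and bound: "\<And>s y. \<bar>s - t\<bar> < e \<Longrightarrow> \<bar>J' s y\<bar> \<le> C"
    and bound0: "\<And>s y. \<bar>s - t\<bar> < e \<Longrightarrow> \<bar>J s y\<bar> \<le> C0"
  shows "((\<lambda>s. LINT y|M. J s y * k y) has_real_derivative (LINT y|M. J' t y * k y)) (at t)"
  unfolding has_field_derivative_iff tendsto_at_iff_sequentially
proof (intro allI impI)
  fix X :: "nat \<Rightarrow> real"
  assume X: "\<forall>i. X i \<in> UNIV - {t}" "X \<longlonglongrightarrow> t"
  have int: "integrable M (\<lambda>y. J s y * k y)" if "\<bar>s - t\<bar> < e" for s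
  proof (rule Bochner_Integration.integrable_bound[of _ "\<lambda>y. C0 * k y"])
    have "\<bar>J s y\<bar> \<le> \<bar>C0\<bar>" for y using bound0[OF that, of y] by linarith
    then show "AE y in M. norm (J s y * k y) \<le> norm (C0 * k y)"
      by (auto simp: abs_mult intro!: mult_right_mono)
  qed (use k meas[OF that] in auto)
  have ev: "\<forall>\<^sub>F i in sequentially. \<bar>X i - t\<bar> < e"
    using X(2) e by (simp add: tendsto_iff dist_real_def)
  obtain N where N: "\<And>i. \<bar>X (i + N) - t\<bar> < e"
    using ev unfolding eventually_sequentially by (metis le_add2)
  define q where "q i y = (J (X (i + N)) y - J t y) / (X (i + N) - t)" for i y
  have qi: "(LINT y|M. J (X (i+N)) y * k y) - (LINT y|M. J t y * k y) = (X (i+N) - t) * (LINT y|M. q i y * k y)" for i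
  proof -
    have "X (i+N) - t \<noteq> 0" using X(1) by auto
    then have "(X (i+N) - t) * q i y = J (X (i+N)) y - J t y" for y
      by (simp add: q_def)
    then have "(X (i+N) - t) * (q i y * k y) = J (X (i+N)) y * k y - J t y * k y" for y
      by (metis left_diff_distrib mult.assoc)
    then have "(X (i+N) - t) * (LINT y|M. q i y * k y) = (LINT y|M. J (X (i+N)) y * k y - J t y * k y)"
      by (simp only: integral_mult_right_zero[symmetric])
    also have "\<dots> = (LINT y|M. J (X (i+N)) y * k y) - (LINT y|M. J t y * k y)"
      using int[OF N] int[of t] e by (intro Bochner_Integration.integral_diff) auto
    finally show ?thesis by simp
  qed
  have qlim: "(\<lambda>i. q i y) \<longlonglongrightarrow> J' t y" for y
  proof -
    have "((\<lambda>s. (J s y - J t y) / (s - t)) \<longlongrightarrow> J' t y) (at t)"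
      using deriv[of t y] e by (simp add: has_field_derivative_iff)
    then have "((\<lambda>s. (J s y - J t y) / (s - t)) \<circ> X) \<longlonglongrightarrow> J' t y"
      using X unfolding tendsto_at_iff_sequentially by blast
    from LIMSEQ_ignore_initial_segment[OF this, of N] show ?thesis
      by (simp add: q_def o_def)
  qed
  have qb: "\<bar>q i y\<bar> \<le> C" for i y
  proof -
    define s where "s = X (i+N)"
    have s: "s \<noteq> t" "\<bar>s - t\<bar> < e" using X(1) N by (auto simp: s_def)
    have "norm (J s y - J t y) \<le> C * norm (s - t)"
      by (rule field_differentiable_bound[of "{t-e<..<t+e}" "\<lambda>s. J s y" "\<lambda>s. J' s y"])
        (use s e bound in \<open>auto intro!: has_field_derivative_at_within deriv\<close>)
    moreover have "q i y = (J s y - J t y) / (s - t)" by (simp add: q_def s_def)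
    ultimately show ?thesis using s by (simp add: abs_divide divide_le_eq)
  qed
  have "(\<lambda>i. LINT y|M. q i y * k y) \<longlonglongrightarrow> (LINT y|M. J' t y * k y)"
  proof (rule integral_dominated_convergence[where w="\<lambda>y. C * \<bar>k y\<bar>"])
    have qm: "q i \<in> borel_measurable M" for i
      unfolding q_def using meas[OF N[of i]] meas[of t] e by auto
    then show "\<And>i. (\<lambda>y. q i y * k y) \<in> borel_measurable M" using k by auto
    have "J' t \<in> borel_measurable M"
      by (rule borel_measurable_LIMSEQ_real[OF qlim qm])
    then show "(\<lambda>y. J' t y * k y) \<in> borel_measurable M" using k by auto
    show "integrable M (\<lambda>y. C * \<bar>k y\<bar>)" using k by auto
    show "AE y in M. (\<lambda>i. q i y * k y) \<longlonglongrightarrow> J' t y * k y"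
      using qlim by (auto intro!: tendsto_intros)
    show "\<And>i. AE y in M. norm (q i y * k y) \<le> C * \<bar>k y\<bar>"
      using qb by (auto simp: abs_mult intro!: mult_right_mono)
  qed
  moreover have "(\<lambda>i. LINT y|M. q i y * k y) = (\<lambda>i. ((LINT y|M. J (X (i+N)) y * k y) - (LINT y|M. J t y * k y)) / (X (i+N) - t))"
    using X(1) by (auto simp: qi)
  ultimately have "(\<lambda>i. ((LINT y|M. J (X (i+N)) y * k y) - (LINT y|M. J t y * k y)) / (X (i+N) - t)) \<longlonglongrightarrow> (LINT y|M. J' t y * k y)"
    by simp
  then show "((\<lambda>s. ((LINT y|M. J s y * k y) - (LINT y|M. J t y * k y)) / (s - t)) \<circ> X) \<longlonglongrightarrow> (LINT y|M. J' t y * k y)"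
    by - (rule LIMSEQ_offset[where k=N], simp add: o_def)
qed

text \<open>Mollify \<open>g\<close> by a narrow bump. The weak equation, tested with translates of
  the bump, says that the derivative of the mollified \<open>g\<close> is the mollified
  \<open>h\<close>, which near \<open>t\<close> is close to \<open>h t\<close>. The mean value
  inequality then compares increments, and shrinking the bump returns to \<open>g\<close>.\<close>

lemma weak_derivative_imp_derivative:
  fixes g h :: "real \<Rightarrow> real"
  assumes g: "continuous_on {0<..} g" and h: "continuous_on {0<..} h"
    and weak: "\<And>\<theta> a b. smooth \<theta> \<Longrightarrow> 0 < a \<Longrightarrow> (\<And>r. r \<notin> {a..b} \<Longrightarrow> \<theta> r = 0) \<Longrightarrow>
      (LINT r|lebesgue. \<theta> r * h r + dir_deriv 1 \<theta> r * g r) = 0"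
    and t: "t > 0"
  shows "(g has_real_derivative h t) (at t)"
proof -
  define \<beta> where "\<beta> r = flat 0 (1 - r\<^sup>2)" for r :: real
  define \<beta>' where "\<beta>' r = - 2 * r * flat 1 (1 - r\<^sup>2)" for r :: real
  have \<beta>d: "(\<beta> has_real_derivative \<beta>' r) (at r)" for r
    unfolding \<beta>_def \<beta>'_def
    by (rule DERIV_chain2[OF flat_deriv, THEN DERIV_cong]) (auto intro!: derivative_eq_intros)
  have \<beta>0: "\<beta> r = 0" if "\<bar>r\<bar> \<ge> 1" for r
    using that by (simp add: \<beta>_def abs_le_square_iff[of 1, simplified])
  have \<beta>'0: "\<beta>' r = 0" if "\<bar>r\<bar> \<ge> 1" for r
    using that by (simp add: \<beta>'_def abs_le_square_iff[of 1, simplified])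
  have \<beta>nn: "0 \<le> \<beta> r" and \<beta>1: "\<beta> r \<le> 1" for r
    by (auto simp: \<beta>_def flat_0_nonneg flat_0_le_1)
  have \<beta>c: "continuous_on S \<beta>" for S
    by (meson DERIV_isCont \<beta>d continuous_at_imp_continuous_on)
  have \<beta>'c: "continuous_on S \<beta>'" for S
    unfolding \<beta>'_def by (intro continuous_intros continuous_on_compose2[OF flat_continuous[of UNIV 1]]) auto
  have "compact (\<beta>' ` {-1..1})"
    by (intro compact_continuous_image \<beta>'c) auto
  then obtain C where C: "\<And>x. x \<in> \<beta>' ` {-1..1} \<Longrightarrow> \<bar>x\<bar> \<le> C"
    by (metis compact_imp_bounded bounded_iff real_norm_def)
  have Cb: "\<bar>\<beta>' r\<bar> \<le> \<bar>C\<bar>" for r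
    using C[of "\<beta>' r"] \<beta>'0[of r] by (cases "\<bar>r\<bar> \<le> 1") force+
  have bm: "\<beta> \<in> borel_measurable borel" "\<beta>' \<in> borel_measurable borel"
    using \<beta>c \<beta>'c by (auto intro: borel_measurable_continuous_onI)
  have sm: "smooth (\<lambda>r. \<beta> ((r - s) / \<delta>))" for s \<delta> :: real
  proof -
    have "smooth (\<lambda>r. (r - s) / \<delta>)"
      using smooth_add[OF smooth_linear[of "\<lambda>r. r / \<delta>"] smooth_const[of "- s / \<delta>"]]
      by (simp add: bounded_linear_divide diff_divide_distrib)
    then have "smooth (\<lambda>r. 1 + (-1) * ((r - s) / \<delta> * ((r - s) / \<delta>)))"
      by (intro smooth_add smooth_mult smooth_const)
    from smooth_flat[OF this, of 0] show ?thesis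
      by (simp add: \<beta>_def power2_eq_square)
  qed
  have main: "\<bar>g s - g t - h t * (s - t)\<bar> \<le> \<epsilon> * \<bar>s - t\<bar>"
    if \<epsilon>: "\<epsilon> > 0" and \<rho>: "\<rho> > 0" "t - 2 * \<rho> > 0" and hb: "\<And>r. \<bar>r - t\<bar> \<le> 2 * \<rho> \<Longrightarrow> \<bar>h r - h t\<bar> \<le> \<epsilon>"
      and st: "\<bar>s - t\<bar> < \<rho>" for \<epsilon> \<rho> s
  proof (rule field_le_epsilon)
    fix \<eta> :: real assume \<eta>: "\<eta> > 0"
    have gcont: "isCont g r" if "r > 0" for r
      using g that by (simp add: continuous_on_eq_continuous_at)
    have s0: "s > 0" using st \<rho> by linarith
    obtain d1 where d1: "d1 > 0" "\<And>r. \<bar>r - s\<bar> < d1 \<Longrightarrow> \<bar>g r - g s\<bar> < \<eta>/2"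
      using gcont[of s, unfolded continuous_at_eps_delta, rule_format, OF s0, of "\<eta>/2"] \<eta>
      by (auto simp: dist_real_def)
    obtain d2 where d2: "d2 > 0" "\<And>r. \<bar>r - t\<bar> < d2 \<Longrightarrow> \<bar>g r - g t\<bar> < \<eta>/2"
      using gcont[of t, unfolded continuous_at_eps_delta, rule_format, OF t, of "\<eta>/2"] \<eta>
      by (auto simp: dist_real_def)
    define \<delta> where "\<delta> = min \<rho> (min d1 d2)"
    have \<delta>: "\<delta> > 0" "\<delta> \<le> \<rho>" "\<delta> \<le> d1" "\<delta> \<le> d2"
      using d1 d2 \<rho> by (auto simp: \<delta>_def)
    \<comment> \<open>Every bump used is centred within \<rho> of \<open>t\<close> and has radius
      \<delta> \<le> \<rho>, so its support lies in the interval from \<open>a\<close> to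
      \<open>b\<close>, inside the positive times. Cutting \<open>g\<close> and \<open>h\<close> off
      there makes them integrable without changing the integrals.\<close>
    define a b where "a = t - 2 * \<rho>" and "b = t + 2 * \<rho>"
    have ab: "0 < a" "a \<le> b" using \<rho> by (auto simp: a_def b_def)
    define B where "B r x = \<beta> ((x - r) / \<delta>)" for r x
    have Bm: "B r \<in> borel_measurable lebesgue" for r
      unfolding B_def by (intro borel_measurable_lebesgueI measurable_compose[OF _ bm(1)]) auto
    have Bz: "B r x = 0" if "\<bar>x - r\<bar> \<ge> \<delta>" for r x
      unfolding B_def using that \<delta> by (intro \<beta>0) (auto simp: field_simps)
    have Babs: "\<bar>B r x\<bar> \<le> 1" for r x
      using \<beta>1 \<beta>nn by (simp add: B_def)
    have int: "integrable lebesgue (\<lambda>x. indicator {a..b} x * f x)" if "continuous_on {0<..} f" for f :: "real \<Rightarrow> real"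
    proof -
      have "set_integrable lborel {a..b} f"
        using that ab by (intro borel_integrable_atLeastAtMost') (auto elim: continuous_on_subset)
      then show ?thesis unfolding set_integrable_def
        by (simp add: integrable_completion)
    qed
    \<comment> \<open>The bump is left unnormalised; \<kappa> is its integral, the same for every
      centre, and it is divided out only in the last line of this argument.\<close>
    define \<kappa> where "\<kappa> = (LINT x|lebesgue. B 0 x)"
    have Bi: "integrable lebesgue (B r)" for r
    proof (rule Bochner_Integration.integrable_bound[OF _ Bm])
      show "integrable lebesgue (\<lambda>x. indicator {r-\<delta>..r+\<delta>} x :: real)" 
        by (intro integrable_real_indicator) (auto simp: emeasure_lborel_Icc_eq)
      show "AE x in lebesgue. norm (B r x) \<le> norm (indicator {r - \<delta>..r + \<delta>} x :: real)"
      proof (rule AE_I2)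
        fix x show "norm (B r x) \<le> norm (indicator {r - \<delta>..r + \<delta>} x :: real)"
        proof (cases "\<bar>x - r\<bar> \<ge> \<delta>")
          case False
          then have "x \<in> {r - \<delta>..r + \<delta>}" by auto
          then show ?thesis using \<beta>1 \<beta>nn by (simp add: B_def)
        qed (simp add: Bz)
      qed
    qed
    have \<kappa>: "(LINT x|lebesgue. B r x) = \<kappa>" for r
    proof -
      have m: "B r' \<in> borel_measurable lborel" for r'
        unfolding B_def by (auto intro!: measurable_compose[OF _ bm(1)])
      have "(LINT x|lebesgue. B r x) = (LINT x|lborel. B r (r + 1 * x))"
        using m by (simp add: integral_completion lborel_integral_real_affine[of 1 "B r" r])
      also have "(\<lambda>x. B r (r + 1 * x)) = B 0" by (simp add: B_def fun_eq_iff)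
      also have "(LINT x|lborel. B 0 x) = \<kappa>"
        unfolding \<kappa>_def using m[of 0] by (intro integral_completion[symmetric])
      finally show ?thesis .
    qed
    have \<kappa>pos: "\<kappa> > 0"
    proof -
      have "\<kappa> \<ge> 0" unfolding \<kappa>_def by (intro integral_nonneg_AE) (auto simp: B_def \<beta>nn)
      moreover have "\<kappa> \<noteq> 0"
      proof
        assume "\<kappa> = 0"
        then have "AE x in lebesgue. B 0 x = 0"
          using Bi[of 0] unfolding \<kappa>_def by (subst (asm) integral_nonneg_eq_0_iff_AE) (auto simp: B_def \<beta>nn)
        then have "AE x in lebesgue. x \<notin> {-\<delta><..<\<delta>}"
        proof eventually_elim
          case (elim x)
          show ?case
          proof
            assume "x \<in> {-\<delta><..<\<delta>}"
            then have "\<bar>x / \<delta>\<bar> < 1" using \<delta> by (auto simp: abs_if field_simps)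
            then have "(x/\<delta>)\<^sup>2 < 1" by (simp add: abs_square_less_1)
            then show False using elim flat_0_pos[of "1 - (x/\<delta>)\<^sup>2"] by (simp add: B_def \<beta>_def)
          qed
        qed
        then have "{-\<delta><..<\<delta>} \<in> null_sets lebesgue" by (subst AE_iff_null_sets) auto
        then have "emeasure lebesgue {-\<delta><..<\<delta>} = 0" by (simp add: null_sets_def)
        then show False using \<delta> by simp
      qed
      ultimately show ?thesis by simp
    qed
    define m where "m r = (LINT x|lebesgue. B r x * (indicator {a..b} x * g x))" for r
    have near: "B r x * (indicator {a..b} x * f x) = B r x * f x" if "\<bar>r - t\<bar> \<le> \<rho>" for r x and f :: "real \<Rightarrow> real"
      using Bz[of x r] \<delta> that by (cases "x \<in> {a..b}") (auto simp: a_def b_def)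
    have md: "(m has_real_derivative (LINT x|lebesgue. B r x * (indicator {a..b} x * h x))) (at r)"
      if r: "\<bar>r - t\<bar> \<le> \<rho>" for r
    proof -
      have d: "(m has_real_derivative (LINT x|lebesgue. (- \<beta>' ((x - r)/\<delta>) / \<delta>) * (indicator {a..b} x * g x))) (at r)"
        unfolding m_def
      proof (rule has_real_derivative_integral[where e=1 and C="\<bar>C\<bar> / \<delta>" and C0=1])
        show "((\<lambda>s. B s y) has_real_derivative - \<beta>' ((y - s) / \<delta>) / \<delta>) (at s)" for s y
          unfolding B_def using \<delta>
          by (intro DERIV_chain2[OF \<beta>d, THEN DERIV_cong]) (auto intro!: derivative_eq_intros)
        show "\<bar>- \<beta>' ((y - s) / \<delta>) / \<delta>\<bar> \<le> \<bar>C\<bar> / \<delta>" for s y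
          using Cb[of "(y - s) / \<delta>"] \<delta> by (simp add: divide_right_mono)
      qed (use int[OF g] Bm Babs in auto)
      have dd: "dir_deriv 1 (B r) x = \<beta>' ((x - r)/\<delta>) / \<delta>" for x
      proof -
        have "(B r has_real_derivative \<beta>' ((x - r)/\<delta>) / \<delta>) (at x)"
          unfolding B_def using \<delta>
          by (intro DERIV_chain2[OF \<beta>d, THEN DERIV_cong]) (auto intro!: derivative_eq_intros)
        then show ?thesis
          unfolding has_field_derivative_def by (simp add: dir_deriv_eq)
      qed
      have ddz: "\<beta>' ((x - r)/\<delta>) = 0" if "\<bar>x - r\<bar> \<ge> \<delta>" for x
        using that \<delta> by (intro \<beta>'0) (auto simp: field_simps)
      have z: "(LINT x|lebesgue. B r x * h x + dir_deriv 1 (B r) x * g x) = 0"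
      proof (rule weak)
        show "smooth (B r)" unfolding B_def by (rule sm)
        show "0 < a" by (rule ab)
        show "B r x = 0" if "x \<notin> {a..b}" for x
          using that r \<delta> by (intro Bz) (auto simp: a_def b_def)
      qed
      have eq: "B r x * h x + dir_deriv 1 (B r) x * g x =
          B r x * (indicator {a..b} x * h x) - (- \<beta>' ((x - r)/\<delta>) / \<delta>) * (indicator {a..b} x * g x)" for x
        using near[OF r, of x h] ddz[of x] \<delta> r by (cases "x \<in> {a..b}") (auto simp: dd a_def b_def)
      have i1: "integrable lebesgue (\<lambda>x. B r x * (indicator {a..b} x * h x))"
        by (rule Bochner_Integration.integrable_bound[OF int[OF h]])
          (use Bm[of r] int[OF h] Babs in \<open>auto simp: abs_mult mult_left_le_one_le\<close>)
      have i2: "integrable lebesgue (\<lambda>x. (- \<beta>' ((x - r)/\<delta>) / \<delta>) * (indicator {a..b} x * g x))"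
      proof (rule Bochner_Integration.integrable_bound)
        show "integrable lebesgue (\<lambda>x. (\<bar>C\<bar> / \<delta>) * (indicator {a..b} x * g x))"
          using int[OF g] by (rule integrable_mult_right)
        have "(\<lambda>x. \<beta>' ((x - r)/\<delta>)) \<in> borel_measurable lebesgue"
          by (intro borel_measurable_lebesgueI measurable_compose[OF _ bm(2)]) auto
        then have "(\<lambda>x. - \<beta>' ((x - r)/\<delta>) / \<delta>) \<in> borel_measurable lebesgue" by simp
        then show "(\<lambda>x. (- \<beta>' ((x - r)/\<delta>) / \<delta>) * (indicator {a..b} x * g x)) \<in> borel_measurable lebesgue"
          using int[OF g] by (rule borel_measurable_times[OF _ borel_measurable_integrable])
        show "AE x in lebesgue. norm ((- \<beta>' ((x - r)/\<delta>) / \<delta>) * (indicator {a..b} x * g x)) \<le> norm ((\<bar>C\<bar> / \<delta>) * (indicator {a..b} x * g x))"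
          using Cb \<delta> by (auto simp: abs_mult intro!: mult_right_mono divide_right_mono)
      qed
      have "(LINT x|lebesgue. B r x * (indicator {a..b} x * h x)) = (LINT x|lebesgue. (- \<beta>' ((x - r)/\<delta>) / \<delta>) * (indicator {a..b} x * g x))"
        using z unfolding eq using i1 i2 by (subst (asm) Bochner_Integration.integral_diff) auto
      with d show ?thesis by simp
    qed
    have avg: "\<bar>(LINT x|lebesgue. B r x * (indicator {a..b} x * f x)) - \<kappa> * c\<bar> \<le> \<kappa> * e"
      if r: "\<bar>r - t\<bar> \<le> \<rho>" and f: "continuous_on {0<..} f" and fe: "\<And>x. \<bar>x - r\<bar> < \<delta> \<Longrightarrow> \<bar>f x - c\<bar> \<le> e"
      for r c e and f :: "real \<Rightarrow> real"
    proof -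
      have i1: "integrable lebesgue (\<lambda>x. B r x * (indicator {a..b} x * f x))"
        by (rule Bochner_Integration.integrable_bound[OF int[OF f]])
          (use Bm[of r] int[OF f] Babs in \<open>auto simp: abs_mult mult_left_le_one_le\<close>)
      have i2: "integrable lebesgue (\<lambda>x. B r x * c)" "integrable lebesgue (\<lambda>x. B r x * e)"
        using Bi[of r] by auto
      have "(LINT x|lebesgue. B r x * (indicator {a..b} x * f x)) - \<kappa> * c =
         (LINT x|lebesgue. B r x * (indicator {a..b} x * f x) - B r x * c)"
        using i1 i2 \<kappa>[of r] by simp
      also have "\<bar>\<dots>\<bar> \<le> (LINT x|lebesgue. B r x * e)"
      proof (rule integral_abs_bound_integral)
        show "\<bar>B r x * (indicator {a..b} x * f x) - B r x * c\<bar> \<le> B r x * e" for x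
        proof (cases "\<bar>x - r\<bar> < \<delta>")
          case True
          then show ?thesis unfolding near[OF r] using fe[OF True] \<beta>nn
            by (simp add: B_def right_diff_distrib[symmetric] abs_mult mult_left_mono)
        qed (simp add: Bz)
      qed (use i1 i2 in auto)
      also have "\<dots> = \<kappa> * e" using \<kappa>[of r] by simp
      finally show ?thesis .
    qed
    \<comment> \<open>After subtraction of the linear function with slope \<kappa> *
      \<open>h t\<close>, the derivative of \<open>m\<close> is at most \<kappa> * \<epsilon>,
      because a bump average of \<open>h\<close> near \<open>t\<close> differs from \<kappa> *
      \<open>h t\<close> by no more.\<close>
    have "norm ((m s - \<kappa> * h t * s) - (m t - \<kappa> * h t * t)) \<le> (\<kappa> * \<epsilon>) * norm (s - t)"
    proof (rule field_differentiable_bound[of "{t-\<rho>..t+\<rho>}" _ "\<lambda>r. (LINT x|lebesgue. B r x * (indicator {a..b} x * h x)) - \<kappa> * h t"])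
      fix r assume "r \<in> {t-\<rho>..t+\<rho>}"
      then have r: "\<bar>r - t\<bar> \<le> \<rho>" by auto
      show "((\<lambda>s. m s - \<kappa> * h t * s) has_real_derivative (LINT x|lebesgue. B r x * (indicator {a..b} x * h x)) - \<kappa> * h t) (at r within {t - \<rho>..t + \<rho>})"
        by (rule has_field_derivative_at_within[OF DERIV_diff[OF md[OF r] DERIV_cmult_Id]])
      show "norm ((LINT x|lebesgue. B r x * (indicator {a..b} x * h x)) - \<kappa> * h t) \<le> \<kappa> * \<epsilon>"
        unfolding real_norm_def using r \<delta> by (intro avg h hb) auto
    qed (use \<rho> st in auto)
    moreover have "\<bar>m s - \<kappa> * g s\<bar> \<le> \<kappa> * (\<eta>/2)"
      unfolding m_def using st \<delta> d1 by (intro avg g less_imp_le[OF d1(2)]) auto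
    moreover have "\<bar>m t - \<kappa> * g t\<bar> \<le> \<kappa> * (\<eta>/2)"
      unfolding m_def using \<rho> \<delta> d2 by (intro avg g less_imp_le[OF d2(2)]) auto
    ultimately have "\<bar>\<kappa> * g s - \<kappa> * g t - \<kappa> * h t * (s - t)\<bar> \<le> \<kappa> * \<epsilon> * \<bar>s - t\<bar> + \<kappa> * \<eta>"
      unfolding real_norm_def right_diff_distrib by linarith
    also have "\<kappa> * g s - \<kappa> * g t - \<kappa> * h t * (s - t) = \<kappa> * (g s - g t - h t * (s - t))"
      by (simp add: algebra_simps)
    also have "\<kappa> * \<epsilon> * \<bar>s - t\<bar> + \<kappa> * \<eta> = \<kappa> * (\<epsilon> * \<bar>s - t\<bar> + \<eta>)"
      by (simp add: algebra_simps)
    finally show "\<bar>g s - g t - h t * (s - t)\<bar> \<le> \<epsilon> * \<bar>s - t\<bar> + \<eta>"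
      using \<kappa>pos by (simp add: abs_mult)
  qed
  show ?thesis
    unfolding has_field_derivative_iff
  proof (rule LIM_I)
    fix \<epsilon> :: real assume \<epsilon>: "\<epsilon> > 0"
    have "isCont h t" using h t by (simp add: continuous_on_eq_continuous_at)
    from this[unfolded continuous_at_eps_delta, rule_format, of "\<epsilon>/2"]
    obtain d where d: "d > 0" "\<And>r. \<bar>r - t\<bar> < d \<Longrightarrow> \<bar>h r - h t\<bar> < \<epsilon>/2"
      using \<epsilon> by (auto simp: dist_real_def)
    define \<rho> where "\<rho> = min d t / 4"
    have \<rho>: "\<rho> > 0" "t - 2 * \<rho> > 0" "2 * \<rho> < d" using d t by (auto simp: \<rho>_def min_def)
    show "\<exists>e>0. \<forall>s. s \<noteq> t \<and> norm (s - t) < e \<longrightarrow> norm ((g s - g t) / (s - t) - h t) < \<epsilon>"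
    proof (intro exI[of _ \<rho>] conjI allI impI \<rho>(1))
      fix s assume s: "s \<noteq> t \<and> norm (s - t) < \<rho>"
      have "\<bar>g s - g t - h t * (s - t)\<bar> \<le> \<epsilon>/2 * \<bar>s - t\<bar>"
      proof (rule main[of "\<epsilon>/2" \<rho>])
        show "\<bar>h r - h t\<bar> \<le> \<epsilon>/2" if "\<bar>r - t\<bar> \<le> 2 * \<rho>" for r
          using d(2)[of r] that \<rho> by linarith
      qed (use \<rho> s \<epsilon> in auto)
      moreover have "(g s - g t) / (s - t) - h t = (g s - g t - h t * (s - t)) / (s - t)"
        using s by (simp add: field_simps)
      ultimately have "\<bar>(g s - g t) / (s - t) - h t\<bar> \<le> \<epsilon>/2"
        using s by (simp add: abs_divide divide_le_eq)
      then show "norm ((g s - g t) / (s - t) - h t) < \<epsilon>" using \<epsilon> by simp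
    qed
  qed
qed

section \<open>Test functions of product form\<close>

lemma bounded_of_compact_support:
  fixes f :: "'a::euclidean_space \<Rightarrow> real"
  assumes "continuous_on UNIV f" "\<And>y. norm y > R \<Longrightarrow> f y = 0"
  obtains C where "C > 0" "\<And>y. \<bar>f y\<bar> \<le> C"
proof -
  have "compact (f ` cball 0 R)"
    using assms by (intro compact_continuous_image) (auto elim: continuous_on_subset)
  then obtain C where C: "\<And>x. x \<in> f ` cball 0 R \<Longrightarrow> \<bar>x\<bar> \<le> C"
    by (metis compact_imp_bounded bounded_iff real_norm_def)
  have "\<bar>f y\<bar> \<le> max C 1" for y
  proof (cases "norm y > R")
    case False
    then show ?thesis using C[of "f y"] by (auto simp: le_max_iff_disj)
  qed (simp add: assms)
  then show ?thesis by (intro that[of "max C 1"]) auto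
qed

lemma dir_deriv_zero_on_open:
  assumes "open S" "\<And>y. y \<in> S \<Longrightarrow> J y = 0" "y \<in> S"
  shows "dir_deriv v J y = 0"
proof (rule dir_deriv_eq[of _ "\<lambda>_. 0"])
  show "(J has_derivative (\<lambda>_. 0)) (at y)"
    by (rule has_derivative_transform_within_open[OF has_derivative_const[of 0]]) (use assms in auto)
qed

lemma lap_zero_on_open:
  assumes "open S" "\<And>y. y \<in> S \<Longrightarrow> J y = 0" "y \<in> S"
  shows "lap J y = 0"
proof -
  have "dir_deriv b (dir_deriv b J) y = 0" for b
    by (rule dir_deriv_zero_on_open[OF assms(1) _ assms(3)]) (rule dir_deriv_zero_on_open[OF assms(1,2)])
  then show ?thesis by (simp add: lap_def)
qed

lemma open_norm_greater: "open {y::'a::real_normed_vector. R < norm y}"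
  by (intro open_Collect_less continuous_intros)

lemma smooth_sum: "(\<And>i. i \<in> A \<Longrightarrow> smooth (f i)) \<Longrightarrow> smooth (\<lambda>x. \<Sum>i\<in>A. f i x)"
  by (induction A rule: infinite_finite_induct) (auto intro: smooth_const smooth_add)

lemma smooth_lap: "smooth J \<Longrightarrow> smooth (lap J)"
  unfolding lap_def[abs_def] by (intro smooth_sum smooth_dir_deriv)

lemma dir_deriv_product:
  fixes J :: "'a::euclidean_space \<Rightarrow> real" and \<theta> :: "real \<Rightarrow> real"
  assumes "smooth J" "smooth \<theta>"
  shows "dir_deriv (v, w) (\<lambda>z. J (fst z) * \<theta> (snd z)) z =
    J (fst z) * dir_deriv w \<theta> (snd z) + dir_deriv v J (fst z) * \<theta> (snd z)"
proof -
  have "((\<lambda>z. J (fst z) * \<theta> (snd z)) has_derivative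
     (\<lambda>h. J (fst z) * dir_deriv (snd h) \<theta> (snd z) + dir_deriv (fst h) J (fst z) * \<theta> (snd z))) (at z)"
    using assms by (intro has_derivative_mult
      has_derivative_compose[OF has_derivative_snd[OF has_derivative_ident] smooth_has_derivative]
      has_derivative_compose[OF has_derivative_fst[OF has_derivative_ident] smooth_has_derivative])
  from dir_deriv_eq[OF this, of "(v, w)"] show ?thesis by simp
qed

lemma dir_deriv_0: "smooth f \<Longrightarrow> dir_deriv 0 f x = 0"
  using linear_0[OF has_derivative_linear[OF smooth_has_derivative]] by auto

lemma product_test_function:
  fixes J :: "'a::euclidean_space \<Rightarrow> real" and \<theta> :: "real \<Rightarrow> real"
  assumes "smooth J" "smooth \<theta>" "0 < a" and J: "\<And>y. norm y > R \<Longrightarrow> J y = 0"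
    and \<theta>: "\<And>r. r \<notin> {a..b} \<Longrightarrow> \<theta> r = 0"
  shows "(\<lambda>z. J (fst z) * \<theta> (snd z)) \<in> test_functions Q"
proof -
  have "smooth (\<lambda>z::'a \<times> real. J (fst z))" "smooth (\<lambda>z::'a \<times> real. \<theta> (snd z))"
    using assms by (auto simp: smooth_def intro: C_k_fst C_k_snd)
  then have 1: "C_k k (\<lambda>z::'a \<times> real. J (fst z) * \<theta> (snd z))" for k
    using smooth_mult unfolding smooth_def by blast
  have sub: "closure {z. J (fst z) * \<theta> (snd z) \<noteq> 0} \<subseteq> cball 0 R \<times> {a..b}"
  proof (rule closure_minimal)
    show "{z. J (fst z) * \<theta> (snd z) \<noteq> 0} \<subseteq> cball 0 R \<times> {a..b}"
      using J \<theta> by (force simp: not_less)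
  qed (auto intro: closed_Times)
  moreover have "compact (cball (0::'a) R \<times> {a..b})"
    by (intro compact_Times) auto
  ultimately have 2: "compact (closure {z. J (fst z) * \<theta> (snd z) \<noteq> 0})"
    unfolding compact_closure by (meson bounded_subset closure_subset compact_imp_bounded order_trans)
  have "cball (0::'a) R \<times> {a..b} \<subseteq> Q" using assms(3) by (auto simp: Q_def)
  with 1 2 sub show ?thesis by (auto simp: test_functions_def)
qed

lemma laplacian_product:
  assumes "smooth J" "smooth \<theta>"
  shows "laplacian (\<lambda>z. J (fst z) * \<theta> (snd z)) z = lap J (fst z) * \<theta> (snd z)"
proof -
  have "dir_deriv (b, 0) (\<lambda>z. J (fst z) * \<theta> (snd z)) = (\<lambda>z. dir_deriv b J (fst z) * \<theta> (snd z))"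
    if "smooth J" for J and b :: 'a
    by (rule ext) (simp add: dir_deriv_product[OF that assms(2)] dir_deriv_0[OF assms(2)])
  then show ?thesis using assms
    by (simp add: laplacian_def lap_def smooth_dir_deriv sum_distrib_right)
qed

lemma time_deriv_product:
  assumes "smooth J" "smooth \<theta>"
  shows "time_deriv (\<lambda>z. J (fst z) * \<theta> (snd z)) z = J (fst z) * dir_deriv 1 \<theta> (snd z)"
  by (simp add: time_deriv_def dir_deriv_product[OF assms] dir_deriv_0[OF assms(1)])

context global_solution
begin

lemma pairing_linear:
  assumes "t \<in> I" "f \<in> borel_measurable borel" "\<And>y. \<bar>f y\<bar> \<le> C"
    "g \<in> borel_measurable borel" "\<And>y. \<bar>g y\<bar> \<le> D"
  shows "P (\<lambda>y. c * f y + d * g y) t = c * P f t + d * P g t"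
proof -
  have "P (\<lambda>y. c * f y + d * g y) t = (LINT y|lebesgue. c * (f y * dens u t y) + d * (g y * dens u t y))"
    by (simp add: pairing_def algebra_simps)
  also have "\<dots> = c * P f t + d * P g t"
    unfolding pairing_def using pairing_integrable[OF assms(1-3)] pairing_integrable[OF assms(1,4,5)]
    by (subst Bochner_Integration.integral_add) auto
  finally show ?thesis .
qed

text \<open>The weak formulation tested with \<open>J\<close> (x) \<theta> (t) and integrated over
  space first. What remains is the statement that |y|^2 \<Delta> J, paired with the solution, is the
  weak time derivative of the pairing with \<open>J\<close>.\<close>

lemma weak_pairing:
  assumes J: "smooth J" "\<And>y. norm y > R \<Longrightarrow> J y = 0" and \<theta>: "smooth \<theta>" "0 < a" "\<And>r. r \<notin> {a..b} \<Longrightarrow> \<theta> r = 0"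
  shows "(LINT r|lebesgue. \<theta> r * P (\<lambda>y. (norm y)\<^sup>2 * lap J y) r + dir_deriv 1 \<theta> r * P J r) = 0"
proof -
  define \<phi> where "\<phi> z = J (fst z) * \<theta> (snd z)" for z :: "'a \<times> real"
  define F where "F z = indicator Q z *\<^sub>R (u z * (laplacian \<phi> z + time_deriv \<phi> z / (norm (fst z))\<^sup>2))" for z
  define q where "q y = (norm y)\<^sup>2 * lap J y" for y
  define \<theta>' where "\<theta>' = dir_deriv 1 \<theta>"
  have "\<phi> \<in> test_functions Q"
    unfolding \<phi>_def by (rule product_test_function[OF J(1) \<theta>(1,2) J(2) \<theta>(3)])
  then have 0: "(LINT z|lebesgue. F z) = 0"
    using weak unfolding weak_solution_on_def set_lebesgue_integral_def F_def by blast
  have \<phi>eq: "laplacian \<phi> z + time_deriv \<phi> z / (norm (fst z))\<^sup>2 =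
      lap J (fst z) * \<theta> (snd z) + J (fst z) * \<theta>' (snd z) / (norm (fst z))\<^sup>2" for z
    unfolding \<phi>_def[abs_def] \<theta>'_def by (simp add: laplacian_product time_deriv_product J \<theta>)
  have \<theta>'0: "\<theta>' r = 0" if "r \<notin> {a..b}" for r
    unfolding \<theta>'_def by (rule dir_deriv_zero_on_open[of "- {a..b}"]) (use \<theta> that in auto)
  have sm: "smooth q" "smooth \<theta>'"
    unfolding q_def \<theta>'_def by (auto intro!: smooth_mult smooth_norm2 smooth_lap J smooth_dir_deriv \<theta>)
  have q0: "q y = 0" if "norm y > R" for y
  proof -
    have "lap J y = 0"
      using lap_zero_on_open[OF open_norm_greater, of R J y] J that by auto
    then show ?thesis by (simp add: q_def)
  qed
  obtain CJ where CJ: "CJ > 0" "\<And>y. \<bar>J y\<bar> \<le> CJ"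
    using bounded_of_compact_support[OF smooth_continuous[OF J(1)] J(2)] by blast
  obtain Cq where Cq: "Cq > 0" "\<And>y. \<bar>q y\<bar> \<le> Cq"
    using bounded_of_compact_support[OF smooth_continuous[OF sm(1)] q0] by blast
  have R': "\<theta> r = 0 \<and> \<theta>' r = 0" if "norm r > max \<bar>a\<bar> \<bar>b\<bar>" for r
  proof -
    have "r \<notin> {a..b}" using that \<theta>(2) by auto
    then show ?thesis using \<theta>(3) \<theta>'0 by blast
  qed
  obtain Ct where Ct: "Ct > 0" "\<And>r. \<bar>\<theta> r\<bar> \<le> Ct"
    using bounded_of_compact_support[OF smooth_continuous[OF \<theta>(1)]] R' by blast
  obtain Ct' where Ct': "Ct' > 0" "\<And>r. \<bar>\<theta>' r\<bar> \<le> Ct'"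
    using bounded_of_compact_support[OF smooth_continuous[OF sm(2)]] R' by blast
  have bm: "J \<in> borel_measurable borel" "q \<in> borel_measurable borel"
    using smooth_continuous J(1) sm by (auto intro: borel_measurable_continuous_onI)
  define C where "C = Ct * Cq + Ct' * CJ"
  \<comment> \<open>Off the origin the factor |y|^-2 can be extracted from both terms, which turns
    the Laplacian into |y|^2 \<Delta> and leaves the density of \<mu>_r.\<close>
  have slice: "AE y in lebesgue. F (y, r) = indicator {a..b} r * ((\<theta> r * q y + \<theta>' r * J y) * dens u r y)" for r
  proof -
    have "AE y::'a in lebesgue. y \<noteq> 0"
      using AE_lborel_singleton[of "0::'a"] by (simp add: AE_completion_iff)
    then show ?thesis
    proof eventually_elim
      case (elim y)
      show ?case
      proof (cases "r \<in> {a..b}")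
        case True
        then show ?thesis using elim \<theta>(2) unfolding F_def \<phi>eq
          by (simp add: Q_def q_def dens_def field_simps)
      next
        case False
        then show ?thesis using \<theta>(3)[OF False] \<theta>'0[OF False] unfolding F_def \<phi>eq by simp
      qed
    qed
  qed
  have Fm: "F \<in> borel_measurable lebesgue"
  proof -
    have "(\<lambda>z. lap J (fst z) * \<theta> (snd z) + J (fst z) * \<theta>' (snd z) / (norm (fst z))\<^sup>2) \<in> borel_measurable (borel :: ('a \<times> real) measure)"
    proof -
      have [measurable]: "lap J \<in> borel_measurable borel" "\<theta> \<in> borel_measurable borel"
         "\<theta>' \<in> borel_measurable borel" "J \<in> borel_measurable borel"
        using smooth_continuous smooth_lap[OF J(1)] J(1) \<theta>(1) sm by (auto intro: borel_measurable_continuous_onI)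
      have [measurable]: "fst \<in> borel_measurable (borel :: ('a \<times> real) measure)" "snd \<in> borel_measurable (borel :: ('a \<times> real) measure)"
        by (auto intro!: borel_measurable_continuous_onI continuous_intros)
      show ?thesis by measurable
    qed
    from borel_measurable_times[OF u_measurable borel_measurable_lebesgueI[OF this]]
    show ?thesis unfolding F_def[abs_def] \<phi>eq by (simp add: mult.assoc)
  qed
  have sb: "\<bar>\<theta> r * q y + \<theta>' r * J y\<bar> \<le> C" for r y
    unfolding C_def using Ct(2)[of r] Ct'(2)[of r] CJ Cq Ct(1) Ct'(1)
    by (intro order.trans[OF abs_triangle_ineq] add_mono) (auto simp: abs_mult intro!: mult_mono)
  have bmr: "(\<lambda>y. \<theta> r * q y + \<theta>' r * J y) \<in> borel_measurable borel" for r
    using bm by auto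
  obtain M where M: "\<And>r. r \<in> {a..b} \<Longrightarrow> mass r \<le> M"
  proof -
    have "compact (mass ` {a..b})"
      using pos_I \<theta>(2) by (intro compact_continuous_image continuous_on_subset[OF mass_continuous]) auto
    then show ?thesis using that
      by (metis compact_imp_bounded bounded_iff real_norm_def abs_le_D1 imageI)
  qed
  have rI: "r \<in> I" if "r \<in> {a..b}" for r using pos_I that \<theta>(2) by auto
  have slice_int: "integrable lebesgue (\<lambda>y. F (y, r))" "(LINT y|lebesgue. F (y, r)) = \<theta> r * P q r + \<theta>' r * P J r"
    "(LINT y|lebesgue. \<bar>F (y, r)\<bar>) \<le> C * M * indicator {a..b} r" for r
  proof -
    have Cpos: "C \<ge> 0" using Ct Cq Ct' CJ by (simp add: C_def)
    let ?G = "\<lambda>y. indicator {a..b} r * ((\<theta> r * q y + \<theta>' r * J y) * dens u r y)"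
    have G: "integrable lebesgue ?G"
      using pairing_integrable[OF rI bmr sb] by (cases "r \<in> {a..b}") auto
    have m: "(\<lambda>y. F (y, r)) \<in> borel_measurable lebesgue"
      using borel_measurable_AE[OF borel_measurable_integrable[OF G]] slice[of r] by (auto simp: eq_commute)
    show "integrable lebesgue (\<lambda>y. F (y, r))"
      by (rule integrable_cong_AE_imp[OF G m]) (use slice[of r] in auto)
    have "(LINT y|lebesgue. F (y, r)) = (LINT y|lebesgue. ?G y)"
      by (rule integral_cong_AE[OF m borel_measurable_integrable[OF G] slice])
    also have "\<dots> = \<theta> r * P q r + \<theta>' r * P J r"
    proof (cases "r \<in> {a..b}")
      case True
      then show ?thesis using pairing_linear[OF rI[OF True] bm(2) Cq(2) bm(1) CJ(2)]
        by (simp add: pairing_def)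
    qed (use \<theta>(3) \<theta>'0 in auto)
    finally show "(LINT y|lebesgue. F (y, r)) = \<theta> r * P q r + \<theta>' r * P J r" .
    have "(LINT y|lebesgue. \<bar>F (y, r)\<bar>) = (LINT y|lebesgue. \<bar>?G y\<bar>)"
    proof (rule integral_cong_AE)
      show "AE y in lebesgue. \<bar>F (y, r)\<bar> = \<bar>?G y\<bar>" using slice[of r] by eventually_elim simp
    qed (use m G in auto)
    also have "\<dots> \<le> C * M * indicator {a..b} r"
    proof (cases "r \<in> {a..b}")
      case True
      then show ?thesis
        using order.trans[OF pairing_bound[OF rI[OF True] bmr sb] mult_left_mono[OF M[OF True] Cpos]] by simp
    qed auto
    finally show "(LINT y|lebesgue. \<bar>F (y, r)\<bar>) \<le> C * M * indicator {a..b} r" .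
  qed
  have "(LINT z|lebesgue. F z) = (LINT r|lebesgue. LINT y|lebesgue. F (y, r))"
    by (rule lebesgue_Fubini_snd(2)[OF Fm, of "\<lambda>r. C * M * indicator {a..b} r"])
      (use slice_int in \<open>auto intro!: integrable_mult_right integrable_real_indicator simp: emeasure_lborel_Icc_eq\<close>)
  then show ?thesis using 0 by (simp add: slice_int(2) q_def[abs_def] \<theta>'_def)
qed

text \<open>Both \<open>J\<close> and |y|^2 \<Delta> J are bounded, so their pairings are continuous
  in time and the weak derivative is a classical one.\<close>

lemma pairing_deriv:
  assumes J: "smooth J" "\<And>y. norm y > R \<Longrightarrow> J y = 0" and t: "t > 0"
  shows "(P J has_real_derivative P (\<lambda>y. (norm y)\<^sup>2 * lap J y) t) (at t)"
proof (rule weak_derivative_imp_derivative[OF _ _ _ t])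
  have cont: "continuous_on {0<..} (P f)" if f: "smooth f" "\<And>y. norm y > R \<Longrightarrow> f y = 0" for f
  proof -
    obtain C where "\<And>y. \<bar>f y\<bar> \<le> C"
      using bounded_of_compact_support[OF smooth_continuous[OF f(1)] f(2)] by blast
    then have "continuous_on I (P f)"
      using smooth_continuous[OF f(1)] by (intro pairing_continuous) (auto intro: borel_measurable_continuous_onI)
    then show ?thesis by (rule continuous_on_subset) (use pos_I in auto)
  qed
  show "continuous_on {0<..} (P J)" by (rule cont[OF J])
  show "continuous_on {0<..} (P (\<lambda>y. (norm y)\<^sup>2 * lap J y))"
  proof (rule cont)
    show "smooth (\<lambda>y. (norm y)\<^sup>2 * lap J y)"
      by (intro smooth_mult smooth_norm2 smooth_lap J)
    show "(norm y)\<^sup>2 * lap J y = 0" if "norm y > R" for y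
      using lap_zero_on_open[OF open_norm_greater, of R J y] J that by auto
  qed
qed (rule weak_pairing[OF J])

end

subsection \<open>Conservation of mass\<close>

lemma norm2_has_derivative: "((\<lambda>y::'a::euclidean_space. (norm y)\<^sup>2) has_derivative (\<lambda>v. 2 * (y \<bullet> v))) (at y)"
  unfolding power2_norm_eq_inner
  by (auto intro!: derivative_eq_intros simp: fun_eq_iff inner_commute)

lemma radial_dir_deriv:
  assumes "\<And>y::'a::euclidean_space. (h has_real_derivative h1 ((norm y)\<^sup>2)) (at ((norm y)\<^sup>2))"
  shows "dir_deriv b (\<lambda>y::'a. h ((norm y)\<^sup>2)) = (\<lambda>y. 2 * (y \<bullet> b) * h1 ((norm y)\<^sup>2))"
proof
  fix y :: 'a
  have "((\<lambda>y. h ((norm y)\<^sup>2)) has_derivative (\<lambda>v. h1 ((norm y)\<^sup>2) * (2 * (y \<bullet> v)))) (at y)"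
    using has_derivative_compose[OF norm2_has_derivative assms[of y, unfolded has_field_derivative_def]]
    by simp
  from dir_deriv_eq[OF this, of b] show "dir_deriv b (\<lambda>y::'a. h ((norm y)\<^sup>2)) y = 2 * (y \<bullet> b) * h1 ((norm y)\<^sup>2)"
    by simp
qed

text \<open>The derivatives of \<open>h\<close> are required only at values of |y|^2, that is on the
  half-line of nonnegative numbers, so profiles such as 1 / (1 + p) qualify.\<close>

lemma radial_lap:
  assumes h: "\<And>y::'a::euclidean_space. (h has_real_derivative h1 ((norm y)\<^sup>2)) (at ((norm y)\<^sup>2))"
    and h1: "\<And>y::'a. (h1 has_real_derivative h2 ((norm y)\<^sup>2)) (at ((norm y)\<^sup>2))"
  shows "lap (\<lambda>y::'a. h ((norm y)\<^sup>2)) y = 2 * real DIM('a) * h1 ((norm y)\<^sup>2) + 4 * (norm y)\<^sup>2 * h2 ((norm y)\<^sup>2)"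
proof -
  have "dir_deriv b (dir_deriv b (\<lambda>y::'a. h ((norm y)\<^sup>2))) y = 2 * h1 ((norm y)\<^sup>2) + 4 * (y \<bullet> b)\<^sup>2 * h2 ((norm y)\<^sup>2)"
    if "b \<in> Basis" for b :: 'a
  proof -
    have "((\<lambda>y. h1 ((norm y)\<^sup>2)) has_derivative (\<lambda>v. h2 ((norm y)\<^sup>2) * (2 * (y \<bullet> v)))) (at y)"
      using has_derivative_compose[OF norm2_has_derivative h1[of y, unfolded has_field_derivative_def]]
      by simp
    then have "((\<lambda>y. 2 * (y \<bullet> b) * h1 ((norm y)\<^sup>2)) has_derivative
        (\<lambda>v. 2 * (y \<bullet> b) * (h2 ((norm y)\<^sup>2) * (2 * (y \<bullet> v))) + 2 * (v \<bullet> b) * h1 ((norm y)\<^sup>2))) (at y)"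
      by (intro has_derivative_mult) (auto intro!: derivative_eq_intros)
    from dir_deriv_eq[OF this, of b] show ?thesis
      using that unfolding radial_dir_deriv[OF h] by (simp add: power2_eq_square)
  qed
  then have "lap (\<lambda>y::'a. h ((norm y)\<^sup>2)) y = (\<Sum>b\<in>(Basis::'a set). 2 * h1 ((norm y)\<^sup>2) + 4 * (y \<bullet> b)\<^sup>2 * h2 ((norm y)\<^sup>2))"
    by (simp add: lap_def)
  also have "\<dots> = 2 * real DIM('a) * h1 ((norm y)\<^sup>2) + 4 * (\<Sum>b\<in>(Basis::'a set). (y \<bullet> b)\<^sup>2) * h2 ((norm y)\<^sup>2)"
    by (simp add: sum.distrib sum_distrib_left sum_distrib_right)
  also have "(\<Sum>b\<in>(Basis::'a set). (y \<bullet> b)\<^sup>2) = (norm y)\<^sup>2"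
    unfolding power2_norm_eq_inner by (subst euclidean_inner[of y y]) (simp add: power2_eq_square)
  finally show ?thesis .
qed

text \<open>A cut-off in the variable p = |y|^2, supported in the ball of radius sqrt (n + 1). The
  quotient normalises its value at the origin to 1, so that it tends to 1 at every point as
  \<open>n\<close> grows. \<open>cutoff1\<close> and \<open>cutoff2\<close> are its first two
  derivatives in \<open>p\<close>.\<close>

definition cutoff :: "nat \<Rightarrow> real \<Rightarrow> real" where
  "cutoff n p = flat 0 (1 - p / Suc n) / flat 0 1"

definition cutoff1 :: "nat \<Rightarrow> real \<Rightarrow> real" where
  "cutoff1 n p = - flat 1 (1 - p / Suc n) / (Suc n * flat 0 1)"

definition cutoff2 :: "nat \<Rightarrow> real \<Rightarrow> real" where
  "cutoff2 n p = flat 2 (1 - p / Suc n) / ((real (Suc n))\<^sup>2 * flat 0 1)"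

lemma cutoff_deriv: "(cutoff n has_real_derivative cutoff1 n p) (at p)"
  and cutoff1_deriv: "(cutoff1 n has_real_derivative cutoff2 n p) (at p)"
proof -
  have *: "((\<lambda>p. flat k (1 - p / Suc n)) has_real_derivative flat (Suc k) (1 - p / Suc n) * (- 1 / Suc n)) (at p)" for k
    by (rule DERIV_chain2[OF flat_deriv]) (auto intro!: derivative_eq_intros)
  have c: "flat 0 1 \<noteq> 0" using flat_0_pos[of 1] by simp
  show "(cutoff n has_real_derivative cutoff1 n p) (at p)"
    unfolding cutoff_def cutoff1_def by (rule DERIV_cdivide[OF *, THEN DERIV_cong]) simp
  show "(cutoff1 n has_real_derivative cutoff2 n p) (at p)"
    unfolding cutoff1_def cutoff2_def
    by (rule DERIV_cdivide[OF DERIV_minus[OF *], THEN DERIV_cong]) (simp add: power2_eq_square numeral_2_eq_2 mult.assoc del: of_nat_Suc)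
qed

lemma cutoff_nonneg: "0 \<le> cutoff n p"
  and cutoff_le_1: "0 \<le> p \<Longrightarrow> cutoff n p \<le> 1"
  and cutoff_0: "p \<ge> Suc n \<Longrightarrow> cutoff n p = 0"
proof -
  show "0 \<le> cutoff n p" by (simp add: cutoff_def flat_0_nonneg)
  show "cutoff n p \<le> 1" if "0 \<le> p"
    using flat_0_mono[of "1 - p / Suc n" 1] that flat_0_pos[of 1] by (simp add: cutoff_def divide_le_eq)
  show "cutoff n p = 0" if "p \<ge> Suc n"
    using that by (simp add: cutoff_def divide_le_eq le_divide_eq)
qed

lemma smooth_cutoff: "smooth (\<lambda>y::'a::euclidean_space. cutoff n ((norm y)\<^sup>2))"
proof -
  have "smooth (\<lambda>y::'a. 1 + (-1 / Suc n) * (norm y)\<^sup>2)"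
    by (intro smooth_add smooth_mult smooth_const smooth_norm2)
  from smooth_mult[OF smooth_flat[OF this, of 0] smooth_const[of "1 / flat 0 1"]]
  show ?thesis by (simp add: cutoff_def)
qed

text \<open>The quantities \<open>p * cutoff1 n p\<close> and \<open>p\<^sup>2 * cutoff2 n p\<close>
  depend on p / (n + 1) alone. The bounds by \<open>C\<close> give domination uniformly in
  \<open>n\<close>; the bounds by \<open>C * (p / Suc n)\<close> give convergence to 0 at each
  point.\<close>

lemma cutoff_bound:
  obtains C where "C > 0" "\<And>n p. 0 \<le> p \<Longrightarrow> \<bar>p * cutoff1 n p\<bar> \<le> C" "\<And>n p. 0 \<le> p \<Longrightarrow> \<bar>p\<^sup>2 * cutoff2 n p\<bar> \<le> C"
    "\<And>n p. 0 \<le> p \<Longrightarrow> \<bar>p * cutoff1 n p\<bar> \<le> C * (p / Suc n)" "\<And>n p. 0 \<le> p \<Longrightarrow> \<bar>p\<^sup>2 * cutoff2 n p\<bar> \<le> C * (p / Suc n)"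
proof -
  obtain A where A: "A > 0" "\<And>t. t \<le> 1 \<Longrightarrow> \<bar>flat 1 t\<bar> \<le> A" using flat_bounded[of 1 1] by blast
  obtain B where B: "B > 0" "\<And>t. t \<le> 1 \<Longrightarrow> \<bar>flat 2 t\<bar> \<le> B" using flat_bounded[of 1 2] by blast
  define c where "c = flat 0 1"
  have c: "c > 0" using flat_0_pos[of 1] by (simp add: c_def)
  define C where "C = (A + B) / c"
  have C: "C > 0" "A / c \<le> C" "B / c \<le> C" using A B c by (auto simp: C_def divide_right_mono)
  have 1: "\<bar>p * cutoff1 n p\<bar> \<le> C * (p / Suc n) \<and> (p / Suc n > 1 \<longrightarrow> p * cutoff1 n p = 0)" if p: "0 \<le> p" for n p
  proof -
    define x where "x = p / Suc n"
    have x: "x \<ge> 0" using p by (simp add: x_def)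
    have eq: "p * cutoff1 n p = - (x * (flat 1 (1 - x) / c))"
      by (simp add: cutoff1_def x_def c_def)
    have "\<bar>flat 1 (1 - x) / c\<bar> \<le> A / c" using A(2)[of "1 - x"] x c by (simp add: abs_divide divide_right_mono)
    then have "\<bar>flat 1 (1 - x) / c\<bar> \<le> C" using C by linarith
    then have "x * \<bar>flat 1 (1 - x) / c\<bar> \<le> x * C" using x by (intro mult_left_mono)
    then show ?thesis using x unfolding eq x_def[symmetric] by (simp add: abs_mult mult.commute)
  qed
  have 2: "\<bar>p\<^sup>2 * cutoff2 n p\<bar> \<le> C * (p / Suc n) \<and> (p / Suc n > 1 \<longrightarrow> p\<^sup>2 * cutoff2 n p = 0)" if p: "0 \<le> p" for n p
  proof -
    define x where "x = p / Suc n"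
    have x: "x \<ge> 0" using p by (simp add: x_def)
    have eq: "p\<^sup>2 * cutoff2 n p = x * (x * (flat 2 (1 - x) / c))"
      by (simp add: cutoff2_def x_def c_def power2_eq_square mult_ac)
    have "\<bar>flat 2 (1 - x) / c\<bar> \<le> B / c" using B(2)[of "1 - x"] x c by (simp add: abs_divide divide_right_mono)
    then have f: "\<bar>flat 2 (1 - x) / c\<bar> \<le> C" using C by linarith
    have "x * \<bar>flat 2 (1 - x) / c\<bar> \<le> C"
    proof (cases "x \<le> 1")
      case True
      then show ?thesis using f x mult_mono[of x 1 "\<bar>flat 2 (1 - x) / c\<bar>" C] by simp
    qed (use C in simp)
    then have "x * (x * \<bar>flat 2 (1 - x) / c\<bar>) \<le> x * C" using x by (intro mult_left_mono)
    then show ?thesis using x unfolding eq x_def[symmetric] by (simp add: abs_mult mult.commute)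
  qed
  have 3: "C * (p / Suc n) \<le> C" if "p / Suc n \<le> 1" for p n
    using mult_left_mono[OF that, of C] C by simp
  show thesis
  proof (rule that[OF C(1)])
    show "\<bar>p * cutoff1 n p\<bar> \<le> C" if "0 \<le> p" for n p
      using 1[OF that, of n] 3[of p n] C by (cases "p / Suc n \<le> 1") auto
    show "\<bar>p\<^sup>2 * cutoff2 n p\<bar> \<le> C" if "0 \<le> p" for n p
      using 2[OF that, of n] 3[of p n] C by (cases "p / Suc n \<le> 1") auto
  qed (use 1 2 in auto)
qed

context global_solution
begin

lemma pairing_tendsto:
  assumes t: "t \<in> I" and f: "\<And>n. f n \<in> borel_measurable borel" "\<And>n y. \<bar>f n y\<bar> \<le> C"
    and lim: "\<And>y. y \<noteq> 0 \<Longrightarrow> (\<lambda>n. f n y) \<longlonglongrightarrow> g y" and g: "g \<in> borel_measurable borel"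
  shows "(\<lambda>n::nat. P (f n) t) \<longlonglongrightarrow> P g t"
  unfolding pairing_def
proof (rule integral_dominated_convergence[where w="\<lambda>y. C * \<bar>dens u t y\<bar>"])
  show "(\<lambda>y. g y * dens u t y) \<in> borel_measurable lebesgue"
    by (intro borel_measurable_times borel_measurable_lebesgueI g dens_measurable t)
  show "\<And>n. (\<lambda>y. f n y * dens u t y) \<in> borel_measurable lebesgue"
    by (intro borel_measurable_times borel_measurable_lebesgueI f dens_measurable t)
  show "integrable lebesgue (\<lambda>y. C * \<bar>dens u t y\<bar>)"
    using slice_integrable[OF t] by auto
  have "AE y::'a in lebesgue. y \<noteq> 0"
    using AE_lborel_singleton[of "0::'a"] by (simp add: AE_completion_iff)
  then show "AE y in lebesgue. (\<lambda>n. f n y * dens u t y) \<longlonglongrightarrow> g y * dens u t y"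
    by eventually_elim (auto intro!: tendsto_intros lim)
  show "AE y in lebesgue. norm (f n y * dens u t y) \<le> C * \<bar>dens u t y\<bar>" for n
    using f(2) by (auto simp: abs_mult intro!: mult_right_mono)
qed

lemma mass_bounded:
  assumes "0 < a"
  obtains M where "M > 0" "\<And>r. r \<in> {a..b} \<Longrightarrow> mass r \<le> M"
proof -
  have "compact (mass ` {a..b})"
    using pos_I assms by (intro compact_continuous_image continuous_on_subset[OF mass_continuous]) auto
  then obtain M where "\<And>r. r \<in> {a..b} \<Longrightarrow> \<bar>mass r\<bar> \<le> M"
    by (metis compact_imp_bounded bounded_iff real_norm_def imageI)
  then show thesis by (intro that[of "max M 1"]) (auto simp: le_max_iff_disj dest: abs_le_D1)
qed

lemma pairing_abs_le:
  assumes "t \<in> I" "f \<in> borel_measurable borel" "\<And>y. \<bar>f y\<bar> \<le> C"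
  shows "\<bar>P f t\<bar> \<le> C * mass t"
proof -
  have "\<bar>P f t\<bar> \<le> (LINT y|lebesgue. \<bar>f y * dens u t y\<bar>)"
    unfolding pairing_def by (rule integral_abs_bound)
  also have "\<dots> \<le> C * mass t" by (rule pairing_bound[OF assms])
  finally show ?thesis .
qed

text \<open>The bounds on \<open>h\<close> are exactly what makes the cut-off errors at infinity vanish by
  dominated convergence, so that the equation may be tested with \<open>h (|y|\<^sup>2)\<close>.\<close>

lemma pairing_deriv_radial:
  assumes h: "\<And>p. p \<ge> 0 \<Longrightarrow> (h has_real_derivative h1 p) (at p)"
    and h1: "\<And>p. p \<ge> 0 \<Longrightarrow> (h1 has_real_derivative h2 p) (at p)"
    and sm: "smooth (\<lambda>y::'a. h ((norm y)\<^sup>2))"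
    and b: "\<And>p. p \<ge> 0 \<Longrightarrow> \<bar>h p\<bar> \<le> C" "\<And>p. p \<ge> 0 \<Longrightarrow> \<bar>p * h1 p\<bar> \<le> C" "\<And>p. p \<ge> 0 \<Longrightarrow> \<bar>p\<^sup>2 * h2 p\<bar> \<le> C"
    and t: "t > 0"
  shows "(P (\<lambda>y. h ((norm y)\<^sup>2)) has_real_derivative P (\<lambda>y. (norm y)\<^sup>2 * lap (\<lambda>y. h ((norm y)\<^sup>2)) y) t) (at t)"
proof -
  define f where "f y = h ((norm y)\<^sup>2)" for y :: 'a
  define q where "q y = (norm y)\<^sup>2 * lap f y" for y
  define fn where "fn n y = f y * cutoff n ((norm y)\<^sup>2)" for n y
  define qn where "qn n y = (norm y)\<^sup>2 * lap (fn n) y" for n y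
  obtain B where B: "B > 0" "\<And>n p. 0 \<le> p \<Longrightarrow> \<bar>p * cutoff1 n p\<bar> \<le> B" "\<And>n p. 0 \<le> p \<Longrightarrow> \<bar>p\<^sup>2 * cutoff2 n p\<bar> \<le> B"
    "\<And>n p. 0 \<le> p \<Longrightarrow> \<bar>p * cutoff1 n p\<bar> \<le> B * (p / Suc n)" "\<And>n p. 0 \<le> p \<Longrightarrow> \<bar>p\<^sup>2 * cutoff2 n p\<bar> \<le> B * (p / Suc n)"
    using cutoff_bound by metis
  have C: "C \<ge> 0" using b(1)[of 0] by linarith
  have qeq: "q y = 2 * real DIM('a) * (p * h1 p) + 4 * (p\<^sup>2 * h2 p)" if "p = (norm y)\<^sup>2" for y p
    unfolding q_def f_def[abs_def] using h h1
    by (subst radial_lap[of h h1 h2]) (auto simp: that power2_eq_square algebra_simps)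
  have qneq: "qn n y = 2 * real DIM('a) * (p * h1 p * cutoff n p + h p * (p * cutoff1 n p)) +
      4 * (p\<^sup>2 * h2 p * cutoff n p + 2 * ((p * h1 p) * (p * cutoff1 n p)) + h p * (p\<^sup>2 * cutoff2 n p))"
    if "p = (norm y)\<^sup>2" for n y p
  proof -
    have d: "((\<lambda>p. h p * cutoff n p) has_real_derivative h1 p * cutoff n p + cutoff1 n p * h p) (at p)"
      "((\<lambda>p. h1 p * cutoff n p + cutoff1 n p * h p) has_real_derivative
        h2 p * cutoff n p + cutoff1 n p * h1 p + (cutoff2 n p * h p + h1 p * cutoff1 n p)) (at p)" if "p \<ge> 0" for p
      using DERIV_mult[OF h[OF that] cutoff_deriv]
        DERIV_add[OF DERIV_mult[OF h1[OF that] cutoff_deriv] DERIV_mult[OF cutoff1_deriv h[OF that]]] by blast+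
    have "qn n y = p * (2 * real DIM('a) * (h1 p * cutoff n p + cutoff1 n p * h p) +
        4 * p * (h2 p * cutoff n p + cutoff1 n p * h1 p + (cutoff2 n p * h p + h1 p * cutoff1 n p)))"
      unfolding qn_def fn_def[abs_def] f_def that
      by (subst radial_lap[OF d]) (rule zero_le_power2 refl)+
    then show ?thesis
      by (simp add: power2_eq_square algebra_simps)
  qed
  have smn: "smooth (fn n)" for n
    unfolding fn_def f_def by (intro smooth_mult sm smooth_cutoff)
  have fm: "f \<in> borel_measurable borel" "fn n \<in> borel_measurable borel"
      "q \<in> borel_measurable borel" "qn n \<in> borel_measurable borel" for n
    using sm[folded f_def] smn unfolding q_def qn_def
    by (auto intro!: borel_measurable_continuous_onI smooth_continuous smooth_mult smooth_norm2 smooth_lap)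
  have c01: "\<bar>cutoff n ((norm y)\<^sup>2)\<bar> \<le> 1" for n and y :: 'a
    using cutoff_nonneg cutoff_le_1[of "(norm y)\<^sup>2" n] by simp
  have fb: "\<bar>f y\<bar> \<le> C" "\<bar>fn n y\<bar> \<le> C" for n y
    using b(1)[of "(norm y)\<^sup>2"] c01[of n y] mult_mono[of "\<bar>f y\<bar>" C "\<bar>cutoff n ((norm y)\<^sup>2)\<bar>" 1] C
    by (auto simp: f_def fn_def abs_mult)
  \<comment> \<open>This is \<open>qneq\<close> with each product of a derivative of
    \<open>h\<close> and a derivative of the cut-off replaced by its bound.\<close>
  define D where "D = 2 * real DIM('a) * (C + C * B) + 4 * (C + 2 * (C * B) + C * B)"
  have D: "D \<ge> 0" using C B(1) by (simp add: D_def)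
  have qnb: "\<bar>qn n y\<bar> \<le> D" for n y
  proof -
    define p where "p = (norm y)\<^sup>2"
    have p: "p \<ge> 0" by (simp add: p_def)
    have m: "\<bar>x * z\<bar> \<le> X * Z" if "\<bar>x\<bar> \<le> X" "\<bar>z\<bar> \<le> Z" for x z X Z :: real
      using that by (auto simp: abs_mult intro!: mult_mono)
    have 1: "\<bar>p * h1 p * cutoff n p\<bar> \<le> C * 1" "\<bar>p\<^sup>2 * h2 p * cutoff n p\<bar> \<le> C * 1"
      using m[OF b(2)[OF p] c01[of n y]] m[OF b(3)[OF p] c01[of n y]] by (auto simp: p_def)
    have 2: "\<bar>h p * (p * cutoff1 n p)\<bar> \<le> C * B" "\<bar>(p * h1 p) * (p * cutoff1 n p)\<bar> \<le> C * B"
        "\<bar>h p * (p\<^sup>2 * cutoff2 n p)\<bar> \<le> C * B"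
      by (intro m b B p)+
    have "\<bar>2 * real DIM('a) * (p * h1 p * cutoff n p + h p * (p * cutoff1 n p))\<bar> \<le> 2 * real DIM('a) * (C + C * B)"
      unfolding abs_mult using 1 2 by (intro mult_mono) auto
    moreover have gen: "\<bar>X + 4 * (x + 2 * z + w)\<bar> \<le> Y + 4 * (c + 2 * e + e)"
      if "\<bar>X\<bar> \<le> Y" "\<bar>x\<bar> \<le> c" "\<bar>z\<bar> \<le> e" "\<bar>w\<bar> \<le> e" for X Y x z w c e :: real
    proof -
      have "X \<le> Y" "- X \<le> Y" "x \<le> c" "- x \<le> c" "z \<le> e" "- z \<le> e" "w \<le> e" "- w \<le> e"
        using that by (auto simp: abs_le_iff)
      then show ?thesis by (intro abs_leI; simp only: distrib_left; linarith)
    qed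
    moreover have "\<bar>p\<^sup>2 * h2 p * cutoff n p\<bar> \<le> C" using 1(2) by simp
    ultimately show ?thesis unfolding qneq[OF p_def] D_def by (intro gen[OF _ _ 2(2,3)])
  qed
  have cl: "(\<lambda>n. cutoff n p) \<longlonglongrightarrow> 1" for p
  proof -
    have "(\<lambda>n. 1 - p / Suc n) \<longlonglongrightarrow> 1 - 0"
      by (intro tendsto_intros LIMSEQ_Suc[OF lim_const_over_n, of p])
    then have "(\<lambda>n. flat 0 (1 - p / Suc n)) \<longlonglongrightarrow> flat 0 1"
      using isCont_tendsto_compose[OF DERIV_isCont[OF flat_deriv]] by fastforce
    from tendsto_divide[OF this tendsto_const[of "flat 0 1"]] show ?thesis
      using flat_0_pos[of 1] by (simp add: cutoff_def)
  qed
  have z: "(\<lambda>n. B * (p / Suc n)) \<longlonglongrightarrow> 0" for p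
    by (intro tendsto_mult_right_zero LIMSEQ_Suc[OF lim_const_over_n, of p])
  have c1: "(\<lambda>n. p * cutoff1 n p) \<longlonglongrightarrow> 0" "(\<lambda>n. p\<^sup>2 * cutoff2 n p) \<longlonglongrightarrow> 0" if "p \<ge> 0" for p
    using B(4,5)[OF that] by (auto intro!: Lim_null_comparison[OF _ z[of p]])
  have qlim: "(\<lambda>n. qn n y) \<longlonglongrightarrow> q y" for y
  proof -
    define p where "p = (norm y)\<^sup>2"
    have p: "p \<ge> 0" by (simp add: p_def)
    have "(\<lambda>n. qn n y) \<longlonglongrightarrow> 2 * real DIM('a) * (p * h1 p * 1 + h p * 0) + 4 * (p\<^sup>2 * h2 p * 1 + 2 * ((p * h1 p) * 0) + h p * 0)"
      unfolding qneq[OF p_def] by (intro tendsto_intros cl c1 p)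
    then show ?thesis by (simp add: qeq[OF p_def])
  qed
  have flim: "(\<lambda>n. fn n y) \<longlonglongrightarrow> f y" for y
    using tendsto_mult[OF tendsto_const[of "f y"] cl[of "(norm y)\<^sup>2"]] by (simp add: fn_def)
  have deriv_n: "(P (fn n) has_real_derivative P (qn n) s) (at s)" if "s > 0" for n s
    unfolding qn_def
  proof (rule pairing_deriv[OF smn _ that])
    \<comment> \<open>The cut-off needs |y|^2 \<ge> n + 1, which follows from |y| > n + 1 because
      this number is at least 1.\<close>
    show "fn n y = 0" if "norm y > Suc n" for y
    proof -
      have "1 * norm y \<le> norm y * norm y" using that by (intro mult_right_mono) auto
      then show ?thesis using that unfolding fn_def by (subst cutoff_0) (auto simp: power2_eq_square)
    qed
  qed
  have cq: "continuous_on {0<..} (P q)"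
  proof -
    have "\<bar>q y\<bar> \<le> D" for y
      by (rule LIMSEQ_le_const2[OF tendsto_rabs[OF qlim[of y]]]) (use qnb in auto)
    then show ?thesis
      by (intro continuous_on_subset[OF pairing_continuous[OF fm(3)]]) (use pos_I in auto)
  qed
  \<comment> \<open>The truncated equations converge at each time, with no uniformity shown for the
    derivatives. The limit is therefore taken in integrated form, by dominated convergence in time.
    Starting at t/2 keeps away from time 0, which need not belong to \<open>I\<close>.\<close>
  have FTC: "(P q has_integral (P f s - P f (t/2))) {t/2..s}" if s: "s \<ge> t/2" for s
  proof -
    obtain M where M: "M > 0" "\<And>r. r \<in> {t/2..s} \<Longrightarrow> mass r \<le> M"
      using mass_bounded[of "t/2" s] t by auto
    have i: "(P (qn n) has_integral (P (fn n) s - P (fn n) (t/2))) {t/2..s}" for n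
      using s t by (intro fundamental_theorem_of_calculus)
        (auto intro!: has_field_derivative_at_within deriv_n simp: has_real_derivative_iff_has_vector_derivative[symmetric])
    have "(\<lambda>n. integral {t/2..s} (P (qn n))) \<longlonglongrightarrow> integral {t/2..s} (P q)"
    proof (rule dominated_convergence(2)[where h="\<lambda>_. D * M"])
      show "norm (P (qn n) r) \<le> D * M" if "r \<in> {t/2..s}" for n r
      proof -
        have "r \<in> I" using pos_I that t by auto
        then have "\<bar>P (qn n) r\<bar> \<le> D * mass r" by (intro pairing_abs_le fm qnb)
        also have "\<dots> \<le> D * M" using M(2)[OF that] D by (intro mult_left_mono)
        finally show ?thesis by simp
      qed
      show "(\<lambda>n. P (qn n) r) \<longlonglongrightarrow> P q r" if "r \<in> {t/2..s}" for r
        using that t pos_I by (intro pairing_tendsto[where C=D] fm qnb qlim) auto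
    qed (use i in auto)
    moreover have "integral {t/2..s} (P (qn n)) = P (fn n) s - P (fn n) (t/2)" for n
      using i by (rule integral_unique)
    moreover have "(\<lambda>n. P (fn n) s - P (fn n) (t/2)) \<longlonglongrightarrow> P f s - P f (t/2)"
      using s t pos_I by (intro tendsto_diff pairing_tendsto[where C=C] fm fb flim) auto
    ultimately have "integral {t/2..s} (P q) = P f s - P f (t/2)"
      using LIMSEQ_unique by simp
    moreover have "P q integrable_on {t/2..s}"
      using t by (intro integrable_continuous_real continuous_on_subset[OF cq]) auto
    ultimately show ?thesis by (metis integrable_integral)
  qed
  have "((\<lambda>s. integral {t/2..s} (P q)) has_real_derivative P q t) (at t within {t/2..2*t})"
    using t by (intro integral_has_real_derivative continuous_on_subset[OF cq]) auto
  then have d: "((\<lambda>s. integral {t/2..s} (P q)) has_real_derivative P q t) (at t)"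
    using t by (subst (asm) at_within_interior) auto
  have "((\<lambda>s. P f (t/2) + integral {t/2..s} (P q)) has_real_derivative P q t) (at t)"
    using DERIV_add[OF DERIV_const d] by simp
  then have "(P f has_real_derivative P q t) (at t)"
  proof (rule has_field_derivative_transform_within_open[of _ _ _ "{t/2<..}"])
    show "P f (t/2) + integral {t/2..s} (P q) = P f s" if "s \<in> {t/2<..}" for s
      using integral_unique[OF FTC[of s]] that by simp
  qed (use t in auto)
  then show ?thesis by (simp add: f_def[abs_def] q_def[abs_def])
qed

lemma mass_eq: "t \<in> I \<Longrightarrow> mass t = P (\<lambda>_. 1) t"
  unfolding mass_def pairing_def
  using slice_nonneg[of t] dens_measurable[of t] by (intro integral_cong_AE) auto

lemma mass_nonneg: "0 \<le> mass t"
  unfolding mass_def by (intro integral_nonneg_AE) auto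

text \<open>The constant 1 meets the bounds of \<open>pairing_deriv_radial\<close> and has zero
  Laplacian. Time 0, when it belongs to \<open>I\<close>, is reached by continuity in the weighted
  norm.\<close>

lemma mass_constant:
  assumes "s \<in> I" "t \<in> I"
  shows "mass s = mass t"
proof -
  have d: "(P (\<lambda>_. 1) has_real_derivative 0) (at t)" if "t > 0" for t
  proof -
    have l0: "lap (\<lambda>y::'a. 1) y = 0" for y :: 'a
      using radial_lap[of "\<lambda>_. 1" "\<lambda>_. 0" "\<lambda>_. 0" y] by simp
    show ?thesis
      using pairing_deriv_radial[of "\<lambda>_. 1" "\<lambda>_. 0" "\<lambda>_. 0" 1 t] that
      by (simp add: l0 smooth_const pairing_def)
  qed
  have pc: "P (\<lambda>_. 1) s = P (\<lambda>_. 1) t" if "0 < s" "s < t" for s t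
    using that by (intro DERIV_isconst_end[symmetric] DERIV_atLeastAtMost_imp_continuous_on) (auto intro!: d exI[of _ 0])
  have pos: "mass s = mass t" if "s > 0" "t > 0" for s t
  proof -
    have "P (\<lambda>_. 1) s = P (\<lambda>_. 1) t"
    proof (cases s t rule: linorder_cases)
      case less then show ?thesis using that by (intro pc)
    next
      case greater then show ?thesis using that by (intro pc[symmetric])
    qed simp
    then show ?thesis using that by (simp only: mass_eq pos_I)
  qed
  have "mass s = mass 1" if "s \<in> I" for s
  proof (cases "s > 0")
    case False
    then have s: "s = 0" "0 \<in> I" using I_nonneg[of s] that by auto
    then have "I = {0..}" using I by auto
    then have "(mass \<longlongrightarrow> mass 0) (at_right 0)"
      using mass_continuous s(2) unfolding continuous_on_def
      by (metis at_within_Ici_at_right)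
    moreover have "(mass \<longlongrightarrow> mass 1) (at_right 0)"
      by (intro tendsto_eventually eventually_at_rightI[of 0 1]) (rule pos, auto)
    ultimately show ?thesis using s tendsto_unique trivial_limit_at_right_real by blast
  qed (rule pos, auto)
  then show ?thesis using assms by metis
qed


section \<open>Decay of the mass near the origin\<close>

lemma indicator_ball_measurable: "(indicator {y. norm y < r} :: 'a \<Rightarrow> real) \<in> borel_measurable borel"
  by (intro borel_measurable_indicator borel_open open_Collect_less continuous_intros)

lemma pairing_mono:
  assumes "t \<in> I" "f \<in> borel_measurable borel" "\<And>y. \<bar>f y\<bar> \<le> C"
    "g \<in> borel_measurable borel" "\<And>y. \<bar>g y\<bar> \<le> D" "\<And>y. f y \<le> g y"
  shows "P f t \<le> P g t"
  unfolding pairing_def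
proof (rule integral_mono_AE)
  show "AE y in lebesgue. f y * dens u t y \<le> g y * dens u t y"
    using slice_nonneg[OF assms(1)] by eventually_elim (intro mult_right_mono assms)
qed (rule pairing_integrable[OF assms(1-3)], rule pairing_integrable[OF assms(1,4,5)])

text \<open>If the initial datum vanishes near the origin, the weights \<open>(1 + |y|\<^sup>2/\<rho>\<^sup>2)\<^sup>-\<^sup>k\<close>
  are supersolutions up to an exponential factor that does not depend on \<open>\<rho>\<close>.\<close>

lemma mass_near_origin:
  assumes I0: "0 \<in> I" and r0: "r0 > 0" and vanish: "AE x in lebesgue. x \<in> ball 0 r0 \<longrightarrow> u (x, 0) = 0" and t: "t > 0"
  obtains C where "C > 0" "\<And>\<rho>. \<rho> > 0 \<Longrightarrow> P (indicator {y. norm y < \<rho>}) t \<le> C * \<rho> ^ (2 * k)"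
proof -
  \<comment> \<open>With h (p) = (1 + p/\<rho>^2)^-k the first-order part of |y|^2 \<Delta> is
    nonpositive, and the second-order part is 4 p^2 h'' = 4 k (k + 1) z^2 h, where z = (p/\<rho>^2)
    / (1 + p/\<rho>^2) lies between 0 and 1.\<close>
  define K where "K = 4 * real k * (real k + 1)"
  \<comment> \<open>The factor 2^k appears because the weight is at least 2^-k on the ball of radius
    \<rho>; the exponential is the growth up to time \<open>t\<close>; and outside the ball of
    radius \<open>r0\<close> the weight is at most (\<rho>/r0)^(2k). Adding 1 makes \<open>C\<close>
    positive even if the mass vanishes.\<close>
  define C where "C = 2 ^ k * (exp (K * t) * (mass 0 / r0 ^ (2 * k))) + 1"
  have Cpos: "C > 0" using mass_nonneg[of 0] r0 by (simp add: C_def add_nonneg_pos)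
  have "P (indicator {y. norm y < \<rho>}) t \<le> C * \<rho> ^ (2 * k)" if \<rho>: "\<rho> > 0" for \<rho>
  proof -
    define g where "g p = inverse (1 + p / \<rho>\<^sup>2)" for p :: real
    define h where "h p = g p ^ k" for p
    define h1 where "h1 p = - (k / \<rho>\<^sup>2) * g p ^ (k + 1)" for p
    define h2 where "h2 p = (k * (k + 1) / (\<rho>\<^sup>2 * \<rho>\<^sup>2)) * g p ^ (k + 2)" for p
    have g1: "0 < g p" "g p \<le> 1" "p / \<rho>\<^sup>2 * g p \<le> 1" "0 \<le> p / \<rho>\<^sup>2 * g p" if "p \<ge> 0" for p
    proof -
      define x where "x = p / \<rho>\<^sup>2"
      have x: "x \<ge> 0" using that by (simp add: x_def)
      then show "0 < g p" "g p \<le> 1" "p / \<rho>\<^sup>2 * g p \<le> 1" "0 \<le> p / \<rho>\<^sup>2 * g p"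
        unfolding g_def x_def[symmetric]
        by (auto simp: inverse_le_1_iff divide_inverse[symmetric] divide_le_eq add_pos_nonneg)
    qed
    have gd: "(g has_real_derivative - (1 / \<rho>\<^sup>2) * (g p)\<^sup>2) (at p)" if "p \<ge> 0" for p
    proof -
      have "1 + p / \<rho>\<^sup>2 > 0" using that by (simp add: add_pos_nonneg)
      then show ?thesis unfolding g_def using \<rho>
        by (auto intro!: derivative_eq_intros simp: power2_eq_square)
    qed
    have gpow: "((\<lambda>p. g p ^ n) has_real_derivative - (n / \<rho>\<^sup>2) * g p ^ (n + 1)) (at p)" if "p \<ge> 0" for p n
      using DERIV_power[OF gd[OF that], of n]
      by (cases n) (auto simp: power2_eq_square algebra_simps)
    have hd: "(h has_real_derivative h1 p) (at p)" if "p \<ge> 0" for p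
      unfolding h_def h1_def by (rule gpow[OF that])
    have h1d: "(h1 has_real_derivative h2 p) (at p)" if "p \<ge> 0" for p
      unfolding h1_def[abs_def] h2_def
      by (rule DERIV_cong[OF DERIV_cmult[OF gpow[OF that]]]) (simp add: field_simps power4_eq_xxxx power2_eq_square)
    have smh: "smooth (\<lambda>y::'a. h ((norm y)\<^sup>2))"
    proof -
      have sg: "smooth (\<lambda>y::'a. g ((norm y)\<^sup>2))"
      proof -
        have s: "smooth (\<lambda>y::'a. 1 + (1 / \<rho>\<^sup>2) * (norm y)\<^sup>2)"
          by (intro smooth_add smooth_mult smooth_const smooth_norm2)
        \<comment> \<open>The \<open>n\<close>-th derivative of the reciprocal, as
          \<open>smooth_compose\<close> requires.\<close>
        define J where "J n t = (-1) ^ n * fact n * inverse t ^ (n + 1)" for n and t :: real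
        have "smooth (\<lambda>y::'a. J 0 (1 + (1 / \<rho>\<^sup>2) * (norm y)\<^sup>2))"
        proof (rule smooth_compose[of "{0<..}" J, OF _ _ s])
          show "(J n has_real_derivative J (Suc n) t) (at t)" if "t \<in> {0<..}" for n t
          proof -
            have "((\<lambda>t. inverse t ^ (n + 1)) has_real_derivative - (real (n + 1)) * inverse t ^ (n + 2)) (at t)"
              using DERIV_power[OF DERIV_inverse[of t UNIV], of "n + 1"] that
              by (simp add: power2_eq_square algebra_simps numeral_2_eq_2)
            from DERIV_cmult[OF this, of "(-1) ^ n * fact n"] show ?thesis
              unfolding J_def by (simp add: algebra_simps)
          qed
          show "1 + (1 / \<rho>\<^sup>2) * (norm y)\<^sup>2 \<in> {0<..}" for y :: 'a
            by (simp add: add_pos_nonneg)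
        qed
        then show ?thesis by (simp add: J_def g_def)
      qed
      have "smooth (\<lambda>y::'a. g ((norm y)\<^sup>2) ^ n)" for n
        by (induction n) (auto intro: smooth_const smooth_mult sg)
      then show ?thesis by (simp add: h_def)
    qed
    define f where "f y = h ((norm y)\<^sup>2)" for y :: 'a
    define q where "q y = (norm y)\<^sup>2 * lap f y" for y
    define D where "D = 1 + real k + real k * (real k + 1)"
    have hn: "0 \<le> h p" "h p \<le> 1" "p * h1 p = - k * (p / \<rho>\<^sup>2 * g p) * h p"
      "p\<^sup>2 * h2 p = k * (k + 1) * (p / \<rho>\<^sup>2 * g p)\<^sup>2 * h p" if "p \<ge> 0" for p
      using g1[OF that] by (auto simp: h_def h1_def h2_def power2_eq_square power_le_one)
    have le1: "0 \<le> (p / \<rho>\<^sup>2 * g p) * h p" "(p / \<rho>\<^sup>2 * g p) * h p \<le> 1"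
      "0 \<le> (p / \<rho>\<^sup>2 * g p)\<^sup>2 * h p" "(p / \<rho>\<^sup>2 * g p)\<^sup>2 * h p \<le> h p" if "p \<ge> 0" for p
    proof -
      define z where "z = p / \<rho>\<^sup>2 * g p"
      have a: "0 \<le> z" "z \<le> 1" "0 \<le> h p" "h p \<le> 1" using g1[OF that] hn[OF that] by (auto simp: z_def)
      then have b: "z\<^sup>2 \<le> 1" by (simp add: power_le_one)
      show "0 \<le> (p / \<rho>\<^sup>2 * g p) * h p" "(p / \<rho>\<^sup>2 * g p) * h p \<le> 1"
       "0 \<le> (p / \<rho>\<^sup>2 * g p)\<^sup>2 * h p" "(p / \<rho>\<^sup>2 * g p)\<^sup>2 * h p \<le> h p"
        unfolding z_def[symmetric] using a b mult_mono[of z 1 "h p" 1] mult_right_mono[OF b, of "h p"] by auto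
    qed
    have D: "\<bar>h p\<bar> \<le> D" "\<bar>p * h1 p\<bar> \<le> D" "\<bar>p\<^sup>2 * h2 p\<bar> \<le> D" if "p \<ge> 0" for p
    proof -
      have "1 \<le> D" by (simp add: D_def)
      then show "\<bar>h p\<bar> \<le> D" using hn(1,2)[OF that] by simp
      have "real k * ((p / \<rho>\<^sup>2 * g p) * h p) \<le> real k * 1" using le1[OF that] by (intro mult_left_mono) auto
      moreover have "real k * 1 \<le> D" by (simp add: D_def)
      ultimately have "real k * ((p / \<rho>\<^sup>2 * g p) * h p) \<le> D" by (rule order_trans)
      moreover have "\<bar>p * h1 p\<bar> = real k * ((p / \<rho>\<^sup>2 * g p) * h p)"
      proof -
        have "p * h1 p = - (real k * ((p / \<rho>\<^sup>2 * g p) * h p))"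
          unfolding hn(3)[OF that] by simp
        moreover have "0 \<le> real k * ((p / \<rho>\<^sup>2 * g p) * h p)"
          by (rule mult_nonneg_nonneg[OF _ le1(1)[OF that]]) simp
        ultimately show ?thesis by (simp only: abs_minus_cancel abs_of_nonneg)
      qed
      ultimately show "\<bar>p * h1 p\<bar> \<le> D" by simp
      have "real (k * (k + 1)) * ((p / \<rho>\<^sup>2 * g p)\<^sup>2 * h p) \<le> real (k * (k + 1)) * 1"
        using le1[OF that] hn(2)[OF that] by (intro mult_left_mono) auto
      moreover have "real (k * (k + 1)) * 1 \<le> D" by (simp add: D_def distrib_left)
      ultimately have "real (k * (k + 1)) * ((p / \<rho>\<^sup>2 * g p)\<^sup>2 * h p) \<le> D" by (rule order_trans)
      moreover have "\<bar>p\<^sup>2 * h2 p\<bar> = real (k * (k + 1)) * ((p / \<rho>\<^sup>2 * g p)\<^sup>2 * h p)"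
      proof -
        have "p\<^sup>2 * h2 p = real (k * (k + 1)) * ((p / \<rho>\<^sup>2 * g p)\<^sup>2 * h p)"
          unfolding hn(4)[OF that] by simp
        moreover have "0 \<le> real (k * (k + 1)) * ((p / \<rho>\<^sup>2 * g p)\<^sup>2 * h p)"
          by (rule mult_nonneg_nonneg[OF _ le1(3)[OF that]]) simp
        ultimately show ?thesis by (simp only: abs_of_nonneg)
      qed
      ultimately show "\<bar>p\<^sup>2 * h2 p\<bar> \<le> D" by simp
    qed
    have qeq: "q y = 2 * real DIM('a) * (p * h1 p) + 4 * (p\<^sup>2 * h2 p)" if "p = (norm y)\<^sup>2" for y p
      unfolding q_def f_def[abs_def] using hd h1d
      by (subst radial_lap[of h h1 h2]) (auto simp: that power2_eq_square algebra_simps)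
    have qle: "q y \<le> K * f y" for y
    proof -
      define p where "p = (norm y)\<^sup>2"
      have p: "p \<ge> 0" by (simp add: p_def)
      have "0 \<le> real k * ((p / \<rho>\<^sup>2 * g p) * h p)"
        by (rule mult_nonneg_nonneg[OF _ le1(1)[OF p]]) simp
      moreover have "p * h1 p = - (real k * ((p / \<rho>\<^sup>2 * g p) * h p))"
        unfolding hn(3)[OF p] by simp
      ultimately have "p * h1 p \<le> 0" by (simp only: neg_le_0_iff_le)
      then have "2 * real DIM('a) * (p * h1 p) \<le> 0" by (simp add: mult_nonneg_nonpos)
      moreover have "4 * (p\<^sup>2 * h2 p) \<le> K * h p"
      proof -
        have "K * ((p / \<rho>\<^sup>2 * g p)\<^sup>2 * h p) \<le> K * h p"
          by (rule mult_left_mono[OF le1(4)[OF p]]) (simp add: K_def)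
        moreover have "4 * (p\<^sup>2 * h2 p) = K * ((p / \<rho>\<^sup>2 * g p)\<^sup>2 * h p)"
          unfolding hn(4)[OF p] K_def by (simp add: distrib_left)
        ultimately show ?thesis by simp
      qed
      ultimately show ?thesis unfolding qeq[OF p_def] by (simp add: f_def p_def)
    qed
    have qb: "\<bar>q y\<bar> \<le> 2 * real DIM('a) * D + 4 * D" for y
    proof -
      define p where "p = (norm y)\<^sup>2"
      have p: "p \<ge> 0" by (simp add: p_def)
      have "\<bar>2 * real DIM('a) * (p * h1 p)\<bar> \<le> 2 * real DIM('a) * D"
        using D(2)[OF p] unfolding abs_mult[of "2 * _"] by (intro mult_mono) auto
      then show ?thesis unfolding qeq[OF p_def] using D(3)[OF p] by linarith
    qed
    have fb: "\<bar>f y\<bar> \<le> 1" "0 \<le> f y" for y using hn[of "(norm y)\<^sup>2"] by (auto simp: f_def)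
    have sm: "smooth f" "smooth q"
      using smh unfolding f_def q_def by (auto intro!: smooth_mult smooth_norm2 smooth_lap)
    have meas: "f \<in> borel_measurable borel" "q \<in> borel_measurable borel"
      using sm by (auto intro!: borel_measurable_continuous_onI smooth_continuous)
    have d: "(P f has_real_derivative P q s) (at s)" if "s > 0" for s
      using pairing_deriv_radial[OF hd h1d smh D that] by (simp add: f_def[abs_def] q_def[abs_def])
    have gron: "P f t \<le> exp (K * t) * P f 0"
    proof -
      have "exp (- K * t) * P f t \<le> exp (- K * 0) * P f 0"
      proof (rule DERIV_nonpos_imp_decreasing_open[of 0 t])
        fix s assume s: "0 < s" "s < t"
        have "((\<lambda>s. exp (- K * s) * P f s) has_real_derivative exp (- K * s) * (P q s - K * P f s)) (at s)"
          by (rule DERIV_cong[OF DERIV_mult[OF _ d[OF s(1)], of _ "exp (- K * s) * (- K)"]])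
            (auto intro!: derivative_eq_intros simp: algebra_simps)
        \<comment> \<open>The summand \<open>0 * f y\<close> gives the bound the two-term shape of
          \<open>pairing_linear\<close>.\<close>
        moreover have "P q s \<le> P (\<lambda>y. K * f y + 0 * f y) s"
        proof (rule pairing_mono[OF _ meas(2) qb _ _])
          show "\<bar>K * f y + 0 * f y\<bar> \<le> K" for y
            using fb[of y] mult_left_mono[of "f y" 1 K] by (simp add: abs_mult K_def)
        qed (use s pos_I meas qle in auto)
        moreover have "P (\<lambda>y. K * f y + 0 * f y) s = K * P f s"
          using pairing_linear[OF pos_I[OF s(1)] meas(1) fb(1) meas(1) fb(1), of K 0] by simp
        ultimately show "\<exists>z. ((\<lambda>s. exp (- K * s) * P f s) has_real_derivative z) (at s) \<and> z \<le> 0"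
          by (intro exI[of _ "exp (- K * s) * (P q s - K * P f s)"]) (auto simp: mult_nonneg_nonpos)
      next
        show "continuous_on {0..t} (\<lambda>s. exp (- K * s) * P f s)"
          using I0 pos_I by (intro continuous_intros continuous_on_subset[OF pairing_continuous[OF meas(1) fb(1)]])
            (metis atLeastAtMost_iff less_eq_real_def subsetI)
      qed (use t in auto)
      then have "exp (K * t) * (exp (- K * t) * P f t) \<le> exp (K * t) * P f 0" by simp
      then show ?thesis by (simp add: exp_minus field_simps)
    qed
    have init: "P f 0 \<le> (\<rho> / r0) ^ (2 * k) * mass 0"
    proof -
      have "P f 0 \<le> (LINT y|lebesgue. (\<rho> / r0) ^ (2 * k) * \<bar>dens u 0 y\<bar>)"
        unfolding pairing_def
      proof (rule integral_mono_AE)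
        show "integrable lebesgue (\<lambda>y. f y * dens u 0 y)" by (rule pairing_integrable[OF I0 meas(1) fb(1)])
        show "integrable lebesgue (\<lambda>y. (\<rho> / r0) ^ (2 * k) * \<bar>dens u 0 y\<bar>)"
          using slice_integrable[OF I0] by auto
        show "AE y in lebesgue. f y * dens u 0 y \<le> (\<rho> / r0) ^ (2 * k) * \<bar>dens u 0 y\<bar>"
          using vanish
        proof eventually_elim
          case (elim y)
          show ?case
          proof (cases "norm y < r0")
            case True
            then show ?thesis using elim by (simp add: dens_def)
          next
            case False
            then have "(r0 / \<rho>)\<^sup>2 \<le> (norm y)\<^sup>2 / \<rho>\<^sup>2"
              using r0 \<rho> by (simp add: power_divide divide_right_mono)
            then have "inverse (1 + (norm y)\<^sup>2 / \<rho>\<^sup>2) \<le> inverse ((r0 / \<rho>)\<^sup>2)"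
              using r0 \<rho> by (intro le_imp_inverse_le) auto
            then have "g ((norm y)\<^sup>2) \<le> (\<rho> / r0)\<^sup>2"
              by (simp add: g_def power_divide)
            then have "f y \<le> (\<rho> / r0) ^ (2 * k)"
              unfolding f_def h_def power_mult using g1(1)[of "(norm y)\<^sup>2"] by (intro power_mono) auto
            then have "f y * \<bar>dens u 0 y\<bar> \<le> (\<rho> / r0) ^ (2 * k) * \<bar>dens u 0 y\<bar>"
              by (rule mult_right_mono) simp
            then show ?thesis using mult_left_mono[OF abs_ge_self fb(2)[of y], of "dens u 0 y"] by linarith
          qed
        qed
      qed
      then show ?thesis by (simp add: mass_def)
    qed
    have "P (indicator {y. norm y < \<rho>}) t \<le> P (\<lambda>y. 2 ^ k * f y + 0 * f y) t"
    proof (rule pairing_mono[OF pos_I[OF t] indicator_ball_measurable, where C=1 and D="2 ^ k"])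
      show "\<bar>2 ^ k * f y + 0 * f y\<bar> \<le> 2 ^ k" for y using fb[of y] by (simp add: abs_mult)
      show "indicator {y. norm y < \<rho>} y \<le> 2 ^ k * f y + 0 * f y" for y
      proof (cases "norm y < \<rho>")
        case True
        then have "(norm y)\<^sup>2 / \<rho>\<^sup>2 \<le> 1" using \<rho> by (simp add: divide_le_eq power_mono)
        then have "inverse 2 \<le> g ((norm y)\<^sup>2)"
          unfolding g_def by (intro le_imp_inverse_le) (auto intro: add_pos_nonneg)
        then have "inverse 2 ^ k \<le> f y" unfolding f_def h_def by (intro power_mono) auto
        then have "2 ^ k * inverse 2 ^ k \<le> 2 ^ k * f y" by (intro mult_left_mono) auto
        then show ?thesis using True by (simp add: power_mult_distrib[symmetric])
      qed (use fb in auto)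
    qed (use meas in auto)
    also have "\<dots> = 2 ^ k * P f t"
      using pairing_linear[OF pos_I[OF t] meas(1) fb(1) meas(1) fb(1), of "2 ^ k" 0] by simp
    also have "\<dots> \<le> 2 ^ k * (exp (K * t) * ((\<rho> / r0) ^ (2 * k) * mass 0))"
      using gron init by (intro mult_left_mono) (auto intro: order_trans mult_left_mono)
    also have "\<dots> = (2 ^ k * (exp (K * t) * (mass 0 / r0 ^ (2 * k)))) * \<rho> ^ (2 * k)"
      by (simp add: power_divide)
    also have "\<dots> \<le> C * \<rho> ^ (2 * k)"
      unfolding C_def using \<rho> by (intro mult_right_mono) auto
    finally show ?thesis .
  qed
  with Cpos show thesis by (rule that)
qed

end

subsection \<open>The averaging kernel\<close>

text \<open>The kernel is \<open>K x y = \<Phi> (|x|\<^sup>2 + |y|\<^sup>2) (x \<bullet> y)\<close> with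
  \<open>\<Phi> p c = p\<^sup>-\<^sup>m exp (-1/(e - 1 + 2c/p))\<close>, homogeneous of degree \<open>-m\<close> where \<open>2m = N - 2\<close>;
  \<open>kphi i j\<close> is \<open>\<partial>\<^sub>p\<^sup>i \<partial>\<^sub>c\<^sup>j \<Phi>\<close>, computed by Euler's relation for
  homogeneous functions.\<close>

primrec kphi :: "nat \<Rightarrow> real \<Rightarrow> real \<Rightarrow> nat \<Rightarrow> real \<Rightarrow> real \<Rightarrow> real" where
  "kphi 0 m e j p c = 2 ^ j * p powr (- (m + j)) * flat j (e - 1 + 2 * c / p)"
| "kphi (Suc i) m e j p c = - ((m + i + j) * kphi i m e j p c + c * kphi i m e (Suc j) p c) / p"

lemma kphi_euler: "p \<noteq> 0 \<Longrightarrow> p * kphi (Suc i) m e j p c + c * kphi i m e (Suc j) p c = - (m + i + j) * kphi i m e j p c"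
proof -
  assume "p \<noteq> 0"
  then have "p * kphi (Suc i) m e j p c = - ((m + i + j) * kphi i m e j p c + c * kphi i m e (Suc j) p c)"
    by (simp only: kphi.simps(2) times_divide_eq_right) simp
  then show ?thesis by (simp only: minus_add_distrib) (simp add: algebra_simps)
qed

text \<open>This justifies reading the indices of \<open>kphi\<close> as orders of differentiation.
  The recursion over \<open>i\<close> is Euler's relation solved for the next derivative in
  \<open>p\<close>, and differentiating that relation gives the induction step.\<close>

lemma kphi_has_derivative:
  assumes "(P has_derivative P') (at y)" "(C has_derivative C') (at y)" "P y > 0"
  shows "((\<lambda>y. kphi i m e j (P y) (C y)) has_derivative
    (\<lambda>v. P' v * kphi (Suc i) m e j (P y) (C y) + C' v * kphi i m e (Suc j) (P y) (C y))) (at y)"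
proof (induction i arbitrary: j)
  case 0
  have p: "P y \<noteq> 0" using assms(3) by simp
  have q: "((\<lambda>y. e - 1 + 2 * C y / P y) has_derivative (\<lambda>v. 2 * (C' v * P y - C y * P' v) / (P y * P y))) (at y)"
    using assms p by (auto intro!: derivative_eq_intros simp: fun_eq_iff field_simps)
  have f: "((\<lambda>y. flat j (e - 1 + 2 * C y / P y)) has_derivative
      (\<lambda>v. flat (Suc j) (e - 1 + 2 * C y / P y) * (2 * (C' v * P y - C y * P' v) / (P y * P y)))) (at y)"
    by (rule has_derivative_compose[OF q flat_deriv[unfolded has_field_derivative_def]])
  have "((\<lambda>p. p powr (- (m + j))) has_real_derivative (- (m + j)) * P y powr (- (m + j) - 1)) (at (P y))"
    by (rule has_real_derivative_powr[OF assms(3)])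
  from has_derivative_compose[OF assms(1) this[unfolded has_field_derivative_def]]
  have g: "((\<lambda>y. P y powr (- (m + j))) has_derivative (\<lambda>v. (- (m + j)) * P y powr (- (m + j) - 1) * P' v)) (at y)" .
  have e1: "P y powr (- (m + j) - 1) = P y powr (- (m + j)) / P y"
    using assms(3) by (simp add: powr_diff)
  have e2: "P y powr (- (m + Suc j)) = P y powr (- (m + j)) / P y"
  proof -
    have "- (m + real (Suc j)) = - (m + j) - 1" by simp
    then show ?thesis using e1 by (simp only:)
  qed
  have "((\<lambda>y. 2 ^ j * (P y powr (- (m + j)) * flat j (e - 1 + 2 * C y / P y))) has_derivative
     (\<lambda>v. 2 ^ j * (P y powr (- (m + j)) * (flat (Suc j) (e - 1 + 2 * C y / P y) * (2 * (C' v * P y - C y * P' v) / (P y * P y)))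
        + (- (m + j)) * P y powr (- (m + j) - 1) * P' v * flat j (e - 1 + 2 * C y / P y)))) (at y)"
    by (intro has_derivative_mult_right has_derivative_mult f g)
  moreover have "(\<lambda>y. kphi 0 m e j (P y) (C y)) = (\<lambda>y. 2 ^ j * (P y powr (- (m + j)) * flat j (e - 1 + 2 * C y / P y)))"
    by (simp add: mult.assoc)
  ultimately show ?case
    by (elim ssubst, elim has_derivative_eq_rhs, intro ext)
      (simp only: kphi.simps e1 e2, simp add: p field_simps)
next
  case (Suc i)
  have p: "P y \<noteq> 0" using assms(3) by simp
  have "((\<lambda>y. - ((m + i + j) * kphi i m e j (P y) (C y) + C y * kphi i m e (Suc j) (P y) (C y)) / P y) has_derivative
    (\<lambda>v. (- ((m + i + j) * (P' v * kphi (Suc i) m e j (P y) (C y) + C' v * kphi i m e (Suc j) (P y) (C y)) +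
       (C y * (P' v * kphi (Suc i) m e (Suc j) (P y) (C y) + C' v * kphi i m e (Suc (Suc j)) (P y) (C y))
         + C' v * kphi i m e (Suc j) (P y) (C y))) * P y -
       - ((m + i + j) * kphi i m e j (P y) (C y) + C y * kphi i m e (Suc j) (P y) (C y)) * P' v) / (P y * P y))) (at y)"
    by (intro has_derivative_divide' has_derivative_minus has_derivative_add has_derivative_mult_right has_derivative_mult Suc assms p)
  moreover have "(\<lambda>y. kphi (Suc i) m e j (P y) (C y)) =
      (\<lambda>y. - ((m + i + j) * kphi i m e j (P y) (C y) + C y * kphi i m e (Suc j) (P y) (C y)) / P y)"
    by simp
  ultimately show ?case
    by (elim ssubst, elim has_derivative_eq_rhs, intro ext)
      (simp only: kphi.simps(2), use p in \<open>simp add: field_simps\<close>)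
qed

declare kphi.simps [simp del]

lemma kphi_outside: "2 * c / p \<le> 1 - e \<Longrightarrow> kphi i m e j p c = 0"
  by (induction i arbitrary: j) (auto simp: kphi.simps)

text \<open>For |c| \<le> p and e \<le> 1 the argument of \<open>flat\<close> is at most 2, where
  every derivative of \<open>flat\<close> is bounded. The power of \<open>p\<close> is dictated by
  homogeneity.\<close>

lemma kphi_bound:
  assumes e: "e \<le> 1"
  obtains C where "C > 0" "\<And>p c. p > 0 \<Longrightarrow> \<bar>c\<bar> \<le> p \<Longrightarrow> \<bar>kphi i m e j p c\<bar> \<le> C * p powr (- (m + i + j))"
proof -
  have "\<exists>C>0. \<forall>p>0. \<forall>c. \<bar>c\<bar> \<le> p \<longrightarrow> \<bar>kphi i m e j p c\<bar> \<le> C * p powr (- (m + i + j))"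
  proof (induction i arbitrary: j)
    case 0
    obtain C where C: "C > 0" "\<And>t. t \<le> 2 \<Longrightarrow> \<bar>flat j t\<bar> \<le> C" using flat_bounded[of 2 j] by blast
    have "\<bar>kphi 0 m e j p c\<bar> \<le> (2 ^ j * C) * p powr (- (m + 0 + j))" if p: "p > 0" "\<bar>c\<bar> \<le> p" for p c
    proof -
      have "2 * c / p \<le> 2" using p by (simp add: divide_le_eq)
      then have "\<bar>flat j (e - 1 + 2 * c / p)\<bar> \<le> C" using e by (intro C(2)) linarith
      then have "2 ^ j * p powr (- (m + j)) * \<bar>flat j (e - 1 + 2 * c / p)\<bar> \<le> 2 ^ j * p powr (- (m + j)) * C"
        by (rule mult_left_mono) simp
      then show ?thesis by (simp add: kphi.simps abs_mult mult_ac)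
    qed
    then show ?case using C(1) by (intro exI[of _ "2 ^ j * C"]) auto
  next
    case (Suc i)
    obtain A where A: "A > 0" "\<And>p c. p > 0 \<Longrightarrow> \<bar>c\<bar> \<le> p \<Longrightarrow> \<bar>kphi i m e j p c\<bar> \<le> A * p powr (- (m + i + j))"
      using Suc[of j] by blast
    obtain B where B: "B > 0" "\<And>p c. p > 0 \<Longrightarrow> \<bar>c\<bar> \<le> p \<Longrightarrow> \<bar>kphi i m e (Suc j) p c\<bar> \<le> B * p powr (- (m + i + Suc j))"
      using Suc[of "Suc j"] by blast
    have "\<bar>kphi (Suc i) m e j p c\<bar> \<le> (\<bar>m + i + j\<bar> * A + B) * p powr (- (m + Suc i + j))"
      if p: "p > 0" "\<bar>c\<bar> \<le> p" for p c
    proof -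
      have e1: "p powr (- (m + i + j)) = p * p powr (- (m + Suc i + j))"
        using p powr_add[of p 1 "- (m + Suc i + j)"] by (simp add: algebra_simps)
      have e2: "p powr (- (m + i + Suc j)) = p powr (- (m + Suc i + j))"
        by (simp add: algebra_simps)
      have "\<bar>(m + i + j) * kphi i m e j p c + c * kphi i m e (Suc j) p c\<bar> \<le>
         \<bar>m + i + j\<bar> * (A * (p * p powr (- (m + Suc i + j)))) + p * (B * p powr (- (m + Suc i + j)))"
        using A(2)[OF p] B(2)[OF p] p(2) unfolding e1 e2
        by (intro order.trans[OF abs_triangle_ineq] add_mono) (auto simp: abs_mult intro!: mult_mono)
      also have "\<dots> = ((\<bar>m + i + j\<bar> * A + B) * p powr (- (m + Suc i + j))) * p"
        by (simp add: algebra_simps)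
      finally show ?thesis using p(1) by (simp add: kphi.simps(2) abs_divide divide_le_eq)
    qed
    moreover have "\<bar>m + i + j\<bar> * A + B > 0" using A B by (simp add: add_nonneg_pos)
    ultimately show ?case by blast
  qed
  then show thesis using that by blast
qed

text \<open>Since 1 - 2 (x . y) / (|x|^2 + |y|^2) = |x - y|^2 / (|x|^2 + |y|^2), the kernel lives
  where |x - y|^2 < e (|x|^2 + |y|^2): \<open>e\<close> is a squared relative distance. The exponent
  (N - 2) / 2 makes \<open>ker 0 0\<close> homogeneous of degree 2 - N in (x, y).\<close>

definition ker :: "nat \<Rightarrow> nat \<Rightarrow> real \<Rightarrow> 'a::euclidean_space \<Rightarrow> 'a \<Rightarrow> real" where
  "ker i j e x y = kphi i ((real DIM('a) - 2) / 2) e j ((norm x)\<^sup>2 + (norm y)\<^sup>2) (x \<bullet> y)"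

lemma sum_norm2_pos: "x \<noteq> 0 \<or> y \<noteq> 0 \<Longrightarrow> (norm x)\<^sup>2 + (norm y)\<^sup>2 > 0"
  by (auto simp: add_pos_nonneg add_nonneg_pos)

lemma abs_inner_le_sum: "\<bar>x \<bullet> y\<bar> \<le> (norm x)\<^sup>2 + (norm y)\<^sup>2"
proof -
  have "\<bar>x \<bullet> y\<bar> \<le> norm x * norm y" by (rule Cauchy_Schwarz_ineq2)
  also have "2 * (norm x * norm y) \<le> (norm x)\<^sup>2 + (norm y)\<^sup>2"
    using sum_squares_bound[of "norm x" "norm y"] by simp
  finally show ?thesis using mult_nonneg_nonneg[of "norm x" "norm y"] by linarith
qed

lemma ker_sym: "ker i j e x y = ker i j e y x"
  by (simp add: ker_def add.commute inner_commute)

lemma nat_nums: "Suc 0 = 1" "Suc 1 = 2" "Suc 2 = 3"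
  by auto

text \<open>If one norm is at least four times the other, then 2 (x . y) is at most half of |x|^2 +
  |y|^2. Hence for fixed x \<noteq> 0 the kernel is supported in the annulus |x|/4 \<le> |y| \<le> 4
  |x|, which keeps it off both the origin and infinity.\<close>

lemma ker_outside:
  assumes "e \<le> 1/2" "4 * norm x \<le> norm y \<or> 4 * norm y \<le> norm x" "x \<noteq> 0 \<or> y \<noteq> 0"
  shows "ker i j e x y = 0"
  unfolding ker_def
proof (rule kphi_outside)
  have *: "4 * (a * b) \<le> a\<^sup>2 + b\<^sup>2" if "4 * a \<le> b" "0 \<le> a" for a b :: real
  proof -
    have "4 * a * b \<le> b * b" using that by (intro mult_right_mono) auto
    moreover have "b * b \<le> a\<^sup>2 + b\<^sup>2" by (simp add: power2_eq_square)
    ultimately show ?thesis by simp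
  qed
  have "4 * (norm x * norm y) \<le> (norm x)\<^sup>2 + (norm y)\<^sup>2"
    using assms(2) *[of "norm x" "norm y"] *[of "norm y" "norm x"] by (auto simp: mult.commute add.commute)
  moreover have "x \<bullet> y \<le> norm x * norm y" by (rule norm_cauchy_schwarz)
  ultimately have "4 * (x \<bullet> y) \<le> (norm x)\<^sup>2 + (norm y)\<^sup>2" by linarith
  then have "2 * (x \<bullet> y) \<le> ((norm x)\<^sup>2 + (norm y)\<^sup>2) / 2" by simp
  also have "\<dots> \<le> (1 - e) * ((norm x)\<^sup>2 + (norm y)\<^sup>2)"
    using mult_right_mono[of "1/2" "1 - e" "(norm x)\<^sup>2 + (norm y)\<^sup>2"] assms(1) by simp
  finally show "2 * (x \<bullet> y) / ((norm x)\<^sup>2 + (norm y)\<^sup>2) \<le> 1 - e"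
    using sum_norm2_pos[OF assms(3)] by (simp add: divide_le_eq)
qed

lemma ker_has_derivative:
  fixes x y :: "'a::euclidean_space"
  assumes "x \<noteq> 0 \<or> y \<noteq> 0"
  shows "((\<lambda>x. ker i j e x y) has_derivative
    (\<lambda>v. 2 * (x \<bullet> v) * ker (Suc i) j e x y + (v \<bullet> y) * ker i (Suc j) e x y)) (at x)"
  unfolding ker_def
proof (rule kphi_has_derivative)
  show "((\<lambda>x. (norm x)\<^sup>2 + (norm y)\<^sup>2) has_derivative (\<lambda>v. 2 * (x \<bullet> v))) (at x)"
    using has_derivative_add[OF norm2_has_derivative has_derivative_const] by simp
  show "((\<lambda>x. x \<bullet> y) has_derivative (\<lambda>v. v \<bullet> y)) (at x)"
    by (auto intro!: derivative_eq_intros)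
qed (use sum_norm2_pos[OF assms] in simp)

lemma ker_has_derivative2:
  fixes x y :: "'a::euclidean_space"
  assumes "x \<noteq> 0 \<or> y \<noteq> 0"
  shows "((\<lambda>y. ker i j e x y) has_derivative
    (\<lambda>v. 2 * (y \<bullet> v) * ker (Suc i) j e x y + (x \<bullet> v) * ker i (Suc j) e x y)) (at y)"
proof -
  have "y \<noteq> 0 \<or> x \<noteq> 0" using assms by auto
  from ker_has_derivative[OF this, where i=i and j=j and e=e] show ?thesis
    by (simp add: ker_sym[where x=x] inner_commute[of x])
qed

lemma ker_euler:
  fixes x y :: "'a::euclidean_space"
  assumes "x \<noteq> 0 \<or> y \<noteq> 0"
  shows "((norm x)\<^sup>2 + (norm y)\<^sup>2) * ker (Suc i) j e x y + (x \<bullet> y) * ker i (Suc j) e x y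
    = - ((real DIM('a) - 2) / 2 + i + j) * ker i j e x y"
  unfolding ker_def using sum_norm2_pos[OF assms] by (intro kphi_euler) linarith

text \<open>Smoothness holds on the whole space, the origin included, because |x|^2 + |y|^2 stays
  above |x|^2 > 0. So the kernel is a legitimate test function in \<open>y\<close>.\<close>

lemma smooth_ker: 
  fixes x :: "'a::euclidean_space"
  assumes "x \<noteq> 0" shows "smooth (ker i j e x)"
proof -
  have "C_k k (ker i j e x)" for k
  proof (induction k arbitrary: i j)
    case 0
    show ?case
      using has_derivative_continuous[OF ker_has_derivative2[OF disjI1[OF assms]]]
      by (simp add: continuous_at_imp_continuous_on)
  next
    case (Suc k)
    have "C_k k (\<lambda>y. 2 * (y \<bullet> b) * ker (Suc i) j e x y + (x \<bullet> b) * ker i (Suc j) e x y)" for b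
      by (rule C_k_add[OF C_k_mult[OF C_k_linear Suc] C_k_mult[OF C_k_const Suc]])
        (intro bounded_linear_const_mult bounded_linear_inner_left)
    then show ?case
      using assms by (intro C_k_SucI[OF ker_has_derivative2]) auto
  qed
  then show ?thesis by (simp add: smooth_def)
qed

section \<open>Spatial derivatives of the kernel\<close>

text \<open>\<open>dker\<close> and \<open>ddker\<close> are the first and second derivatives of
  \<open>ker i j\<close> in its first argument along \<open>v\<close>; \<open>lapker\<close> is the
  Laplacian in the first argument.\<close>

definition dker :: "nat \<Rightarrow> nat \<Rightarrow> real \<Rightarrow> 'a::euclidean_space \<Rightarrow> 'a \<Rightarrow> 'a \<Rightarrow> real" where
  "dker i j e v x y = 2 * (x \<bullet> v) * ker (Suc i) j e x y + (v \<bullet> y) * ker i (Suc j) e x y"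

definition ddker :: "nat \<Rightarrow> nat \<Rightarrow> real \<Rightarrow> 'a::euclidean_space \<Rightarrow> 'a \<Rightarrow> 'a \<Rightarrow> real" where
  "ddker i j e v x y = 2 * (v \<bullet> v) * ker (Suc i) j e x y + 2 * (x \<bullet> v) * dker (Suc i) j e v x y
     + (v \<bullet> y) * dker i (Suc j) e v x y"

definition lapker :: "nat \<Rightarrow> nat \<Rightarrow> real \<Rightarrow> 'a::euclidean_space \<Rightarrow> 'a \<Rightarrow> real" where
  "lapker i j e x y = 2 * real DIM('a) * ker (Suc i) j e x y + 4 * (norm x)\<^sup>2 * ker (Suc (Suc i)) j e x y
     + 4 * (x \<bullet> y) * ker (Suc i) (Suc j) e x y + (norm y)\<^sup>2 * ker i (Suc (Suc j)) e x y"

text \<open>Spatial derivatives of the averages are taken along lines. This reduces them to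
  differentiating an integral in one real parameter and matches the form of the maximum
  principle.\<close>

lemma line_deriv:
  assumes "(f has_derivative f') (at (x + s *\<^sub>R v))"
  shows "((\<lambda>s. f (x + s *\<^sub>R v)) has_real_derivative f' v) (at s)"
proof -
  have "((\<lambda>s. x + s *\<^sub>R v) has_derivative (\<lambda>r. r *\<^sub>R v)) (at s)"
    by (auto intro!: derivative_eq_intros)
  from has_derivative_compose[OF this assms]
  have "((\<lambda>s. f (x + s *\<^sub>R v)) has_derivative (\<lambda>r. f' (r *\<^sub>R v))) (at s)" .
  moreover have "f' (r *\<^sub>R v) = f' v * r" for r
    using linear_scale[OF has_derivative_linear[OF assms], of r v] by simp
  ultimately show ?thesis by (simp add: has_field_derivative_def)
qed

lemma ker_line:
  fixes y :: "'a::euclidean_space"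
  assumes "x + s *\<^sub>R v \<noteq> 0 \<or> y \<noteq> 0"
  shows "((\<lambda>s. ker i j e (x + s *\<^sub>R v) y) has_real_derivative dker i j e v (x + s *\<^sub>R v) y) (at s)"
  unfolding dker_def by (rule line_deriv[OF ker_has_derivative[OF assms]])

lemma inner_line: "((\<lambda>s. (x + s *\<^sub>R v) \<bullet> w) has_real_derivative (v \<bullet> w)) (at s)"
  by (auto intro!: derivative_eq_intros simp: inner_add_left)

lemma dker_line:
  fixes y :: "'a::euclidean_space"
  assumes "x + s *\<^sub>R v \<noteq> 0 \<or> y \<noteq> 0"
  shows "((\<lambda>s. dker i j e v (x + s *\<^sub>R v) y) has_real_derivative ddker i j e v (x + s *\<^sub>R v) y) (at s)"
  unfolding dker_def ddker_def
  by (rule DERIV_cong[OF DERIV_add[OF DERIV_mult[OF DERIV_cmult[OF inner_line] ker_line[OF assms]] DERIV_cmult[OF ker_line[OF assms]]]])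
    (simp add: dker_def algebra_simps)

lemma ddker_sum:
  fixes x y :: "'a::euclidean_space"
  shows "(\<Sum>b\<in>Basis. ddker i j e b x y) = lapker i j e x y"
proof -
  have "ddker i j e b x y = 2 * (b \<bullet> b) * ker (Suc i) j e x y + 4 * ((x \<bullet> b) * (x \<bullet> b)) * ker (Suc (Suc i)) j e x y
     + 4 * ((x \<bullet> b) * (y \<bullet> b)) * ker (Suc i) (Suc j) e x y + ((y \<bullet> b) * (y \<bullet> b)) * ker i (Suc (Suc j)) e x y" for b
    unfolding ddker_def dker_def inner_commute[of b y] by algebra
  moreover have "(\<Sum>b\<in>Basis. 2 * (b \<bullet> b) * ker (Suc i) j e x y + 4 * ((x \<bullet> b) * (x \<bullet> b)) * ker (Suc (Suc i)) j e x y
     + 4 * ((x \<bullet> b) * (y \<bullet> b)) * ker (Suc i) (Suc j) e x y + ((y \<bullet> b) * (y \<bullet> b)) * ker i (Suc (Suc j)) e x y)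
    = 2 * (\<Sum>b\<in>(Basis::'a set). b \<bullet> b) * ker (Suc i) j e x y + 4 * (\<Sum>b\<in>Basis. (x \<bullet> b) * (x \<bullet> b)) * ker (Suc (Suc i)) j e x y
     + 4 * (\<Sum>b\<in>Basis. (x \<bullet> b) * (y \<bullet> b)) * ker (Suc i) (Suc j) e x y + (\<Sum>b\<in>Basis. (y \<bullet> b) * (y \<bullet> b)) * ker i (Suc (Suc j)) e x y"
    by (simp only: sum.distrib sum_distrib_left sum_distrib_right)
  moreover have "(\<Sum>b\<in>(Basis::'a set). b \<bullet> b) = real DIM('a)" by (simp add: inner_Basis)
  ultimately show ?thesis
    by (simp only: lapker_def euclidean_inner[symmetric] power2_norm_eq_inner)
qed

lemma dir_deriv_ker:
  fixes x :: "'a::euclidean_space"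
  assumes "x \<noteq> 0"
  shows "dir_deriv b (ker i j e x) = (\<lambda>y. dker i j e b y x)"
proof
  fix y
  show "dir_deriv b (ker i j e x) y = dker i j e b y x"
    unfolding dker_def ker_sym[where x=y and y=x] inner_commute[of b x]
    by (rule dir_deriv_eq[OF ker_has_derivative2[OF disjI1[OF assms]]])
qed

text \<open>The bridge from the line derivatives computed for the kernels to the derivatives
  occurring in \<open>lap\<close>.\<close>

lemma dir_deriv_line:
  assumes "smooth f" "((\<lambda>s. f (y + s *\<^sub>R v)) has_real_derivative D) (at 0)"
  shows "dir_deriv v f y = D"
proof -
  have "((\<lambda>s. f (y + s *\<^sub>R v)) has_real_derivative dir_deriv v f y) (at 0)"
    using line_deriv[of f "\<lambda>v. dir_deriv v f y" y 0 v] smooth_has_derivative[OF assms(1), of y] by simp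
  then show ?thesis using assms(2) by (rule DERIV_unique)
qed

lemma lap_ker:
  fixes x :: "'a::euclidean_space"
  assumes "x \<noteq> 0"
  shows "lap (ker i j e x) y = lapker i j e y x"
proof -
  have "dir_deriv b (dir_deriv b (ker i j e x)) y = ddker i j e b y x" if "b \<in> Basis" for b
  proof (rule dir_deriv_line[OF smooth_dir_deriv[OF smooth_ker[OF assms] that]])
    show "((\<lambda>s. dir_deriv b (ker i j e x) (y + s *\<^sub>R b)) has_real_derivative ddker i j e b y x) (at 0)"
      using dker_line[of y 0 b x i j e] assms by (simp add: dir_deriv_ker[OF assms])
  qed
  then show ?thesis by (simp add: lap_def ddker_sum)
qed

text \<open>With p = |x|^2 + |y|^2 and c = x . y the two sides differ by (|x|^2 - |y|^2) times 2 N
  K_p + 4 (p K_pp + c K_pc). This factor vanishes by Euler's relation for K_p, which is homogeneous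
  of degree -N/2 in (p, c); here the exponent (N - 2) / 2 is decisive.\<close>

lemma ker_laplace_identity:
  fixes x y :: "'a::euclidean_space"
  assumes "x \<noteq> 0"
  shows "(norm x)\<^sup>2 * lapker 0 0 e x y = (norm y)\<^sup>2 * lapker 0 0 e y x"
proof -
  have e1: "4 * (((norm x)\<^sup>2 + (norm y)\<^sup>2) * ker 2 0 e x y + (x \<bullet> y) * ker 1 1 e x y) = - 2 * real DIM('a) * ker 1 0 e x y"
    using ker_euler[OF disjI1[OF assms], where i=1 and j=0 and e=e and y=y]
    unfolding nat_nums by (simp only:) (simp add: field_simps)
  have "(norm x)\<^sup>2 * lapker 0 0 e x y - (norm y)\<^sup>2 * lapker 0 0 e y x =
     ((norm x)\<^sup>2 - (norm y)\<^sup>2) * (2 * real DIM('a) * ker 1 0 e x y + 4 * (((norm x)\<^sup>2 + (norm y)\<^sup>2) * ker 2 0 e x y + (x \<bullet> y) * ker 1 1 e x y))"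
    unfolding lapker_def ker_sym[where x=y and y=x] inner_commute[of y x] nat_nums by algebra
  then show ?thesis unfolding e1 by simp
qed

text \<open>Infinitesimal similarities \<open>B\<close>, generating dilations and rotations. The vector field
  \<open>x \<mapsto> B x\<close> commutes with \<open>|x|\<^sup>2 \<Delta>\<close>.\<close>

definition simil :: "('a::euclidean_space \<Rightarrow> 'a) \<Rightarrow> real \<Rightarrow> bool" where
  "simil B l \<longleftrightarrow> linear B \<and> (\<forall>y. B y \<bullet> y = l * (norm y)\<^sup>2) \<and> (\<forall>y. norm (B y) \<le> norm y)"

text \<open>The derivative of \<open>ker 0 0 e\<close> in its first argument along the field x
  \<mapsto> B x, with x . B x replaced by l |x|^2, so that \<open>B\<close> itself enters one term
  only and linearly. \<open>dkerB\<close> and \<open>ddkerB\<close> are its derivatives along a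
  line.\<close>

definition kerB :: "('a::euclidean_space \<Rightarrow> 'a) \<Rightarrow> real \<Rightarrow> real \<Rightarrow> 'a \<Rightarrow> 'a \<Rightarrow> real" where
  "kerB B l e x y = 2 * l * ((x \<bullet> x) * ker 1 0 e x y) + (B x \<bullet> y) * ker 0 1 e x y"

definition dkerB :: "('a::euclidean_space \<Rightarrow> 'a) \<Rightarrow> real \<Rightarrow> real \<Rightarrow> 'a \<Rightarrow> 'a \<Rightarrow> 'a \<Rightarrow> real" where
  "dkerB B l e v x y = 2 * l * (2 * (x \<bullet> v) * ker 1 0 e x y + (x \<bullet> x) * dker 1 0 e v x y)
     + ((B v \<bullet> y) * ker 0 1 e x y + (B x \<bullet> y) * dker 0 1 e v x y)"

definition ddkerB :: "('a::euclidean_space \<Rightarrow> 'a) \<Rightarrow> real \<Rightarrow> real \<Rightarrow> 'a \<Rightarrow> 'a \<Rightarrow> 'a \<Rightarrow> real" where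
  "ddkerB B l e v x y = 2 * l * (2 * (v \<bullet> v) * ker 1 0 e x y + 4 * (x \<bullet> v) * dker 1 0 e v x y + (x \<bullet> x) * ddker 1 0 e v x y)
     + (2 * (B v \<bullet> y) * dker 0 1 e v x y + (B x \<bullet> y) * ddker 0 1 e v x y)"

lemma simil_linear: "simil B l \<Longrightarrow> linear B"
  and simil_inner: "simil B l \<Longrightarrow> B y \<bullet> y = l * (norm y)\<^sup>2"
  and simil_norm: "simil B l \<Longrightarrow> norm (B y) \<le> norm y"
  by (auto simp: simil_def)

lemma kerB_eq_dker: "simil B l \<Longrightarrow> kerB B l e x y = dker 0 0 e (B x) x y"
  by (simp add: kerB_def dker_def inner_commute[of x "B x"] simil_inner power2_norm_eq_inner)

lemma Binner_line: "linear B \<Longrightarrow> ((\<lambda>s. B (x + s *\<^sub>R v) \<bullet> w) has_real_derivative (B v \<bullet> w)) (at s)"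
  using inner_line[of "B x" "B v" w s] by (simp only: linear_add[of B] linear_scale[of B])

lemma norm2_line: "((\<lambda>s. (x + s *\<^sub>R v) \<bullet> (x + s *\<^sub>R v)) has_real_derivative (2 * ((x + s *\<^sub>R v) \<bullet> v))) (at s)"
proof -
  have "((\<lambda>s. x + s *\<^sub>R v) has_derivative (\<lambda>r. r *\<^sub>R v)) (at s)"
    by (auto intro!: derivative_eq_intros)
  from has_derivative_inner[OF this this]
  have "((\<lambda>s. (x + s *\<^sub>R v) \<bullet> (x + s *\<^sub>R v)) has_derivative
      (\<lambda>r. (x + s *\<^sub>R v) \<bullet> (r *\<^sub>R v) + (r *\<^sub>R v) \<bullet> (x + s *\<^sub>R v))) (at s)" .
  moreover have "z \<bullet> (r *\<^sub>R v) + (r *\<^sub>R v) \<bullet> z = 2 * (z \<bullet> v) * r" for z r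
    by (simp only: inner_scaleR_left inner_scaleR_right inner_commute[of v z]) simp
  ultimately show ?thesis by (simp only: has_field_derivative_def)
qed

lemma kerB_line:
  fixes y :: "'a::euclidean_space"
  assumes "x + s *\<^sub>R v \<noteq> 0 \<or> y \<noteq> 0" "simil B l"
  shows "((\<lambda>s. kerB B l e (x + s *\<^sub>R v) y) has_real_derivative dkerB B l e v (x + s *\<^sub>R v) y) (at s)"
  unfolding kerB_def
  by (rule DERIV_cong[OF DERIV_add[OF DERIV_cmult[OF DERIV_mult[OF norm2_line ker_line[OF assms(1)]]]
     DERIV_mult[OF Binner_line[OF simil_linear[OF assms(2)]] ker_line[OF assms(1)]]]])
    (simp add: dkerB_def mult.commute)

lemma dkerB_line:
  fixes y :: "'a::euclidean_space"
  assumes "x + s *\<^sub>R v \<noteq> 0 \<or> y \<noteq> 0" "simil B l"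
  shows "((\<lambda>s. dkerB B l e v (x + s *\<^sub>R v) y) has_real_derivative ddkerB B l e v (x + s *\<^sub>R v) y) (at s)"
  unfolding dkerB_def
  by (rule DERIV_cong[OF DERIV_add[OF
      DERIV_cmult[OF DERIV_add[OF DERIV_mult[OF DERIV_cmult[OF inner_line] ker_line[OF assms(1)]] DERIV_mult[OF norm2_line dker_line[OF assms(1)]]]]
      DERIV_add[OF DERIV_cmult[OF ker_line[OF assms(1)]] DERIV_mult[OF Binner_line[OF simil_linear[OF assms(2)]] dker_line[OF assms(1)]]]]])
    (simp add: ddkerB_def algebra_simps)

lemma simil_adjoint_sum:
  fixes x :: "'a::euclidean_space"
  assumes "linear B"
  shows "(\<Sum>b\<in>Basis. (x \<bullet> b) * (B b \<bullet> y)) = B x \<bullet> y"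
proof -
  have "B x = (\<Sum>b\<in>Basis. (x \<bullet> b) *\<^sub>R B b)"
    by (subst euclidean_representation[of x, symmetric]) (simp only: linear_sum[OF assms] linear_scale[OF assms])
  then show ?thesis by (simp add: inner_sum_left)
qed

lemma ddkerB_sum:
  fixes x y :: "'a::euclidean_space"
  assumes B: "simil B l"
  shows "(\<Sum>b\<in>Basis. ddkerB B l e b x y) =
    2 * l * (2 * real DIM('a) * ker 1 0 e x y + 4 * (2 * (norm x)\<^sup>2 * ker 2 0 e x y + (x \<bullet> y) * ker 1 1 e x y) + (norm x)\<^sup>2 * lapker 1 0 e x y)
     + (2 * (2 * (B x \<bullet> y) * ker 1 1 e x y + l * (norm y)\<^sup>2 * ker 0 2 e x y) + (B x \<bullet> y) * lapker 0 1 e x y)"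
proof -
  have "ddkerB B l e b x y = 2 * l * (2 * (b \<bullet> b) * ker 1 0 e x y + 4 * (2 * ((x \<bullet> b) * (x \<bullet> b)) * ker 2 0 e x y + ((x \<bullet> b) * (y \<bullet> b)) * ker 1 1 e x y)
       + (x \<bullet> x) * ddker 1 0 e b x y)
     + (2 * (2 * ((x \<bullet> b) * (B b \<bullet> y)) * ker 1 1 e x y + ((y \<bullet> b) * (B b \<bullet> y)) * ker 0 2 e x y) + (B x \<bullet> y) * ddker 0 1 e b x y)" for b
    unfolding ddkerB_def dker_def inner_commute[of b y] nat_nums by algebra
  then have "(\<Sum>b\<in>Basis. ddkerB B l e b x y) = 2 * l * (2 * (\<Sum>b\<in>(Basis::'a set). b \<bullet> b) * ker 1 0 e x y + 4 * (2 * (\<Sum>b\<in>Basis. (x \<bullet> b) * (x \<bullet> b)) * ker 2 0 e x y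
         + (\<Sum>b\<in>Basis. (x \<bullet> b) * (y \<bullet> b)) * ker 1 1 e x y)
       + (x \<bullet> x) * (\<Sum>b\<in>Basis. ddker 1 0 e b x y))
     + (2 * (2 * (\<Sum>b\<in>Basis. (x \<bullet> b) * (B b \<bullet> y)) * ker 1 1 e x y + (\<Sum>b\<in>Basis. (y \<bullet> b) * (B b \<bullet> y)) * ker 0 2 e x y)
         + (B x \<bullet> y) * (\<Sum>b\<in>Basis. ddker 0 1 e b x y))"
    by (simp only: sum.distrib sum_distrib_left[symmetric] sum_distrib_right[symmetric])
  moreover have "(\<Sum>b\<in>(Basis::'a set). b \<bullet> b) = real DIM('a)" by (simp add: inner_Basis)
  ultimately show ?thesis
    by (simp only: simil_adjoint_sum[OF simil_linear[OF B]] simil_inner[OF B] ddker_sum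
        euclidean_inner[symmetric] power2_norm_eq_inner)
qed

lemma smooth_kerB:
  fixes x :: "'a::euclidean_space"
  assumes "x \<noteq> 0" shows "smooth (kerB B l e x)"
  unfolding kerB_def[abs_def]
  by (intro smooth_add smooth_mult smooth_const smooth_ker[OF assms] smooth_linear bounded_linear_inner_right)

lemma lap_kerB:
  fixes x :: "'a::euclidean_space"
  assumes x: "x \<noteq> 0"
  shows "lap (kerB B l e x) y = 2 * l * (norm x)\<^sup>2 * lapker 1 0 e y x +
    (2 * (2 * (B x \<bullet> y) * ker 1 1 e x y + (B x \<bullet> x) * ker 0 2 e x y) + (B x \<bullet> y) * lapker 0 1 e y x)"
proof -
  define f1 where "f1 v y = 2 * l * ((x \<bullet> x) * dker 1 0 e v y x) + ((B x \<bullet> v) * ker 0 1 e y x + (B x \<bullet> y) * dker 0 1 e v y x)" for v y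
  have il: "((\<lambda>s. B x \<bullet> (y + s *\<^sub>R v)) has_real_derivative (B x \<bullet> v)) (at s)" for y v s
    using inner_line[of y v "B x" s] by (simp add: inner_commute)
  have d1: "dir_deriv v (kerB B l e x) y = f1 v y" for v y
  proof (rule dir_deriv_line[OF smooth_kerB[OF x]])
    have "((\<lambda>s. kerB B l e x (y + s *\<^sub>R v)) has_real_derivative f1 v (y + 0 *\<^sub>R v)) (at 0)"
      unfolding kerB_def ker_sym[where x=x]
      by (rule DERIV_cong[OF DERIV_add[OF DERIV_cmult[OF DERIV_cmult[OF ker_line]] DERIV_mult[OF il ker_line]]])
        (use x in \<open>auto simp: f1_def algebra_simps\<close>)
    then show "((\<lambda>s. kerB B l e x (y + s *\<^sub>R v)) has_real_derivative f1 v y) (at 0)" by simp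
  qed
  have d2: "dir_deriv b (dir_deriv b (kerB B l e x)) y = 2 * l * ((x \<bullet> x) * ddker 1 0 e b y x) +
      (2 * (2 * ((y \<bullet> b) * (B x \<bullet> b)) * ker 1 1 e x y + ((x \<bullet> b) * (B x \<bullet> b)) * ker 0 2 e x y) + (B x \<bullet> y) * ddker 0 1 e b y x)"
    if b: "b \<in> Basis" for b
  proof (rule dir_deriv_line[OF smooth_dir_deriv[OF smooth_kerB[OF x] b]])
    have "((\<lambda>s. f1 b (y + s *\<^sub>R b)) has_real_derivative 2 * l * ((x \<bullet> x) * ddker 1 0 e b (y + 0 *\<^sub>R b) x)
        + ((B x \<bullet> b) * dker 0 1 e b (y + 0 *\<^sub>R b) x + ((B x \<bullet> b) * dker 0 1 e b (y + 0 *\<^sub>R b) x + (B x \<bullet> (y + 0 *\<^sub>R b)) * ddker 0 1 e b (y + 0 *\<^sub>R b) x))) (at 0)"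
      unfolding f1_def
      by (rule DERIV_cong[OF DERIV_add[OF DERIV_cmult[OF DERIV_cmult[OF dker_line]]
            DERIV_add[OF DERIV_cmult[OF ker_line] DERIV_mult[OF il dker_line]]]])
        (use x in \<open>auto simp: algebra_simps\<close>)
    moreover have "2 * l * ((x \<bullet> x) * ddker 1 0 e b y x)
        + ((B x \<bullet> b) * dker 0 1 e b y x + ((B x \<bullet> b) * dker 0 1 e b y x + (B x \<bullet> y) * ddker 0 1 e b y x)) =
      2 * l * ((x \<bullet> x) * ddker 1 0 e b y x) +
      (2 * (2 * ((y \<bullet> b) * (B x \<bullet> b)) * ker 1 1 e x y + ((x \<bullet> b) * (B x \<bullet> b)) * ker 0 2 e x y) + (B x \<bullet> y) * ddker 0 1 e b y x)"
      unfolding dker_def inner_commute[of b x] ker_sym[where x=y and y=x] nat_nums by algebra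
    ultimately show "((\<lambda>s. dir_deriv b (kerB B l e x) (y + s *\<^sub>R b)) has_real_derivative 2 * l * ((x \<bullet> x) * ddker 1 0 e b y x) +
      (2 * (2 * ((y \<bullet> b) * (B x \<bullet> b)) * ker 1 1 e x y + ((x \<bullet> b) * (B x \<bullet> b)) * ker 0 2 e x y) + (B x \<bullet> y) * ddker 0 1 e b y x)) (at 0)"
      by (simp add: d1)
  qed
  have "lap (kerB B l e x) y = (\<Sum>b\<in>Basis. 2 * l * ((x \<bullet> x) * ddker 1 0 e b y x) +
      (2 * (2 * ((y \<bullet> b) * (B x \<bullet> b)) * ker 1 1 e x y + ((x \<bullet> b) * (B x \<bullet> b)) * ker 0 2 e x y) + (B x \<bullet> y) * ddker 0 1 e b y x))"
    unfolding lap_def by (rule sum.cong[OF refl d2])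
  also have "\<dots> = 2 * l * ((x \<bullet> x) * (\<Sum>b\<in>Basis. ddker 1 0 e b y x)) +
      (2 * (2 * (\<Sum>b\<in>Basis. (y \<bullet> b) * (B x \<bullet> b)) * ker 1 1 e x y + (\<Sum>b\<in>Basis. (x \<bullet> b) * (B x \<bullet> b)) * ker 0 2 e x y) + (B x \<bullet> y) * (\<Sum>b\<in>Basis. ddker 0 1 e b y x))"
    by (simp only: sum.distrib sum_distrib_left[symmetric] sum_distrib_right[symmetric])
  finally show ?thesis
    by (simp only: ddker_sum euclidean_inner[symmetric] power2_norm_eq_inner inner_commute[of _ "B x"] mult.assoc)
qed

text \<open>In principle this is \<open>ker_laplace_identity\<close> differentiated along B x, as
  that field commutes with |x|^2 \<Delta>_x. It is verified directly, which avoids third derivatives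
  of the kernel as functions of x.\<close>

lemma kerB_laplace_identity:
  fixes x y :: "'a::euclidean_space"
  assumes x: "x \<noteq> 0" and B: "simil B l"
  shows "(norm x)\<^sup>2 * (\<Sum>b\<in>Basis. ddkerB B l e b x y) = (norm y)\<^sup>2 * lap (kerB B l e x) y"
proof -
  define X Y c f N where "X = (norm x)\<^sup>2" "Y = (norm y)\<^sup>2" "c = x \<bullet> y" "f = B x \<bullet> y" "N = real DIM('a)"
  note d = this
  define k where "k i j = ker i j e x y" for i j
  have e1: "4 * ((X + Y) * k 2 0 + c * k 1 1) = - 2 * N * k 1 0"
    using ker_euler[OF disjI1[OF x], where i=1 and j=0 and e=e and y=y]
    unfolding k_def d nat_nums by (simp only:) (simp add: field_simps)
  have e2: "4 * ((X + Y) * k 3 0 + c * k 2 1) = - (2 * N + 4) * k 2 0"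
    using ker_euler[OF disjI1[OF x], where i=2 and j=0 and e=e and y=y]
    unfolding k_def d nat_nums by (simp only:) (simp add: field_simps)
  have e3: "4 * ((X + Y) * k 2 1 + c * k 1 2) = - (2 * N + 4) * k 1 1"
    using ker_euler[OF disjI1[OF x], where i=1 and j=1 and e=e and y=y]
    unfolding k_def d nat_nums by (simp only:) (simp add: field_simps)
  have l: "lapker i j e x y = 2 * N * k (Suc i) j + 4 * X * k (Suc (Suc i)) j + 4 * c * k (Suc i) (Suc j) + Y * k i (Suc (Suc j))"
    "lapker i j e y x = 2 * N * k (Suc i) j + 4 * Y * k (Suc (Suc i)) j + 4 * c * k (Suc i) (Suc j) + X * k i (Suc (Suc j))" for i j
    unfolding lapker_def k_def d ker_sym[where x=y and y=x] inner_commute[of y x] by auto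
  have A: "(norm x)\<^sup>2 * (\<Sum>b\<in>Basis. ddkerB B l e b x y) = X * (2 * l * (2 * N * k 1 0 + 4 * (2 * X * k 2 0 + c * k 1 1)
      + X * (2 * N * k 2 0 + 4 * X * k 3 0 + 4 * c * k 2 1 + Y * k 1 2))
     + (2 * (2 * f * k 1 1 + l * Y * k 0 2) + f * (2 * N * k 1 1 + 4 * X * k 2 1 + 4 * c * k 1 2 + Y * k 0 3)))"
    unfolding ddkerB_sum[OF B] l nat_nums unfolding k_def d by simp
  have A': "(norm y)\<^sup>2 * lap (kerB B l e x) y = Y * (2 * l * X * (2 * N * k 2 0 + 4 * Y * k 3 0 + 4 * c * k 2 1 + X * k 1 2)
     + (2 * (2 * f * k 1 1 + l * X * k 0 2) + f * (2 * N * k 1 1 + 4 * Y * k 2 1 + 4 * c * k 1 2 + X * k 0 3)))"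
    unfolding lap_kerB[OF x] l nat_nums simil_inner[OF B] unfolding k_def d by simp
  \<comment> \<open>A polynomial identity: the difference of the two sides is a combination of the
    three Euler relations \<open>e1\<close>, \<open>e2\<close>, \<open>e3\<close>, each of which
    makes its bracket vanish.\<close>
  have "X * (2 * l * (2 * N * k 1 0 + 4 * (2 * X * k 2 0 + c * k 1 1)
      + X * (2 * N * k 2 0 + 4 * X * k 3 0 + 4 * c * k 2 1 + Y * k 1 2))
     + (2 * (2 * f * k 1 1 + l * Y * k 0 2) + f * (2 * N * k 1 1 + 4 * X * k 2 1 + 4 * c * k 1 2 + Y * k 0 3)))
    - Y * (2 * l * X * (2 * N * k 2 0 + 4 * Y * k 3 0 + 4 * c * k 2 1 + X * k 1 2)
     + (2 * (2 * f * k 1 1 + l * X * k 0 2) + f * (2 * N * k 1 1 + 4 * Y * k 2 1 + 4 * c * k 1 2 + X * k 0 3)))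
   = 2 * l * X * (2 * N * k 1 0 + 4 * ((X + Y) * k 2 0 + c * k 1 1))
     + 2 * l * X * (X - Y) * ((2 * N + 4) * k 2 0 + 4 * ((X + Y) * k 3 0 + c * k 2 1))
     + f * (X - Y) * ((2 * N + 4) * k 1 1 + 4 * ((X + Y) * k 2 1 + c * k 1 2))"
    by algebra
  then have "(norm x)\<^sup>2 * (\<Sum>b\<in>Basis. ddkerB B l e b x y) - (norm y)\<^sup>2 * lap (kerB B l e x) y = 0"
    unfolding A A' e1 e2 e3 by (simp only:) (simp add: algebra_simps)
  then show ?thesis by simp
qed

section \<open>Lebesgue measure under translations, reflections and dilations\<close>

lemma nn_integral_lborel_translate:
  fixes f :: "'a::euclidean_space \<Rightarrow> ennreal"
  assumes "f \<in> borel_measurable borel"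
  shows "(\<integral>\<^sup>+x. f (c + x) \<partial>lborel) = (\<integral>\<^sup>+x. f x \<partial>lborel)"
proof -
  have "(\<integral>\<^sup>+x. f x \<partial>lborel) = (\<integral>\<^sup>+x. f x \<partial>distr lborel borel ((+) c))"
    by (simp add: lborel_distr_plus)
  also have "\<dots> = (\<integral>\<^sup>+x. f (c + x) \<partial>lborel)"
    using assms by (intro nn_integral_distr) auto
  finally show ?thesis by simp
qed

text \<open>Convolve with the indicator of a ball, which \<open>T\<close> preserves, and use Fubini and
  translation invariance: this is the usual proof of uniqueness of Haar measure.\<close>

lemma nn_integral_lborel_reflection:
  fixes f :: "'a::euclidean_space \<Rightarrow> ennreal" and T :: "'a \<Rightarrow> 'a"
  assumes f [measurable]: "f \<in> borel_measurable borel"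
    and T: "linear T" "\<And>x. norm (T x) = norm x" "\<And>x. T (T x) = x"
  shows "(\<integral>\<^sup>+x. f (T x) \<partial>lborel) = (\<integral>\<^sup>+x. f x \<partial>lborel)"
proof -
  define g :: "'a \<Rightarrow> ennreal" where "g = indicator (ball 0 1)"
  define v where "v = (\<integral>\<^sup>+x. g x \<partial>lborel)"
  have g [measurable]: "g \<in> borel_measurable borel" unfolding g_def by (intro borel_measurable_indicator) auto
  have "continuous_on UNIV T" using T(1) by (simp add: linear_continuous_on linear_conv_bounded_linear)
  then have [measurable]: "T \<in> borel_measurable borel" by (rule borel_measurable_continuous_onI)
  have v: "v = ennreal (unit_ball_vol (real DIM('a)))"
    unfolding v_def g_def by (simp add: emeasure_ball)
  then have v0: "v \<noteq> 0" "v \<noteq> top" unfolding v by (simp_all add: ennreal_eq_0_iff not_le)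
  have inner: "(\<integral>\<^sup>+x. g (- T x + y) \<partial>lborel) = v" for y
  proof -
    \<comment> \<open>Applying the isometric involution \<open>T\<close> inside the norm exchanges
      the roles of the variables, and as a function of \<open>x\<close> only a translate of the ball
      remains.\<close>
    have "g (- T x + y) = g (- T y + x)" for x
    proof -
      have "T (T y - x) = - T x + y" by (simp add: linear_diff[OF T(1)] T(3))
      then have "norm (- T x + y) = norm (T y - x)" using T(2)[of "T y - x"] by simp
      also have "\<dots> = norm (- T y + x)" by (simp add: norm_minus_commute)
      finally show ?thesis by (simp add: g_def indicator_def)
    qed
    then show ?thesis by (simp only: nn_integral_lborel_translate[OF g] v_def)
  qed
  have "v * (\<integral>\<^sup>+x. f (T x) \<partial>lborel) = (\<integral>\<^sup>+y. g y * (\<integral>\<^sup>+x. f (T x) \<partial>lborel) \<partial>lborel)"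
    unfolding v_def by (subst nn_integral_multc) auto
  also have "\<dots> = (\<integral>\<^sup>+y. \<integral>\<^sup>+x. g y * f (y + T x) \<partial>lborel \<partial>lborel)"
  proof (rule nn_integral_cong)
    fix y
    have "(\<integral>\<^sup>+x. f (T x) \<partial>lborel) = (\<integral>\<^sup>+x. f (T (T y + x)) \<partial>lborel)"
      by (rule nn_integral_lborel_translate[of "\<lambda>x. f (T x)", symmetric]) measurable
    also have "\<dots> = (\<integral>\<^sup>+x. f (y + T x) \<partial>lborel)"
      by (simp add: linear_add[OF T(1)] T(3))
    finally show "g y * (\<integral>\<^sup>+x. f (T x) \<partial>lborel) = (\<integral>\<^sup>+x. g y * f (y + T x) \<partial>lborel)"
      by (simp add: nn_integral_cmult)
  qed
  also have "\<dots> = (\<integral>\<^sup>+x. \<integral>\<^sup>+y. g y * f (y + T x) \<partial>lborel \<partial>lborel)"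
    by (rule lborel_pair.Fubini') measurable
  also have "\<dots> = (\<integral>\<^sup>+x. \<integral>\<^sup>+y. g (- T x + y) * f y \<partial>lborel \<partial>lborel)"
  proof (rule nn_integral_cong)
    fix x
    have "(\<integral>\<^sup>+y. g y * f (y + T x) \<partial>lborel) = (\<integral>\<^sup>+y. g (- T x + y) * f ((- T x + y) + T x) \<partial>lborel)"
      by (rule nn_integral_lborel_translate[of "\<lambda>y. g y * f (y + T x)", symmetric]) measurable
    then show "(\<integral>\<^sup>+y. g y * f (y + T x) \<partial>lborel) = (\<integral>\<^sup>+y. g (- T x + y) * f y \<partial>lborel)" by simp
  qed
  also have "\<dots> = (\<integral>\<^sup>+y. \<integral>\<^sup>+x. g (- T x + y) * f y \<partial>lborel \<partial>lborel)"
    by (rule lborel_pair.Fubini') measurable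
  also have "\<dots> = (\<integral>\<^sup>+y. v * f y \<partial>lborel)"
  proof (rule nn_integral_cong)
    fix y
    have "(\<integral>\<^sup>+x. g (- T x + y) * f y \<partial>lborel) = (\<integral>\<^sup>+x. g (- T x + y) \<partial>lborel) * f y"
      by (rule nn_integral_multc) measurable
    then show "(\<integral>\<^sup>+x. g (- T x + y) * f y \<partial>lborel) = v * f y" by (simp only: inner)
  qed
  also have "\<dots> = v * (\<integral>\<^sup>+x. f x \<partial>lborel)" by (simp add: nn_integral_cmult)
  finally show ?thesis using v0 by (simp add: ennreal_mult_cancel_left)
qed

lemma nn_integral_lborel_scale:
  fixes f :: "'a::euclidean_space \<Rightarrow> ennreal"
  assumes [measurable]: "f \<in> borel_measurable borel" and r: "r > 0"
  shows "(\<integral>\<^sup>+x. f x \<partial>lborel) = ennreal (r ^ DIM('a)) * (\<integral>\<^sup>+x. f (r *\<^sub>R x) \<partial>lborel)"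
proof -
  have "(\<integral>\<^sup>+x. f x \<partial>lborel) = (\<integral>\<^sup>+x. f x \<partial>density (distr lborel borel (\<lambda>x. 0 + r *\<^sub>R x)) (\<lambda>_. \<bar>r\<bar> ^ DIM('a)))"
    using r by (subst lborel_affine[of r 0]) auto
  also have "\<dots> = (\<integral>\<^sup>+x. ennreal (\<bar>r\<bar> ^ DIM('a)) * f x \<partial>distr lborel borel (\<lambda>x. 0 + r *\<^sub>R x))"
    by (rule nn_integral_density) auto
  also have "\<dots> = (\<integral>\<^sup>+x. ennreal (\<bar>r\<bar> ^ DIM('a)) * f (0 + r *\<^sub>R x) \<partial>lborel)"
    by (rule nn_integral_distr) auto
  also have "\<dots> = ennreal (r ^ DIM('a)) * (\<integral>\<^sup>+x. f (r *\<^sub>R x) \<partial>lborel)"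
    using r by (simp add: nn_integral_cmult)
  finally show ?thesis .
qed

text \<open>The Householder reflection in the hyperplane orthogonal to a - b. Reflections suffice to
  join any two points of a sphere, and being involutions they fit the proof of invariance
  above.\<close>

lemma exists_reflection:
  fixes a b :: "'a::euclidean_space"
  assumes "norm a = norm b"
  obtains T where "linear T" "\<And>x. norm (T x) = norm x" "\<And>x. T (T x) = x" "\<And>x y. T x \<bullet> T y = x \<bullet> y" "T a = b"
proof (cases "a = b")
  case True
  then show thesis by (intro that[of "\<lambda>x. x"]) (auto simp: linear_id[unfolded id_def])
next
  case False
  define v where "v = a - b"
  have v: "v \<bullet> v \<noteq> 0" using False by (simp add: v_def)
  define T where "T x = x - (2 * (x \<bullet> v) / (v \<bullet> v)) *\<^sub>R v" for x
  have inn: "T x \<bullet> T y = x \<bullet> y" for x y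
  proof -
    have "T x \<bullet> T y = x \<bullet> y - (2 * (y \<bullet> v) / (v \<bullet> v)) * (x \<bullet> v) - (2 * (x \<bullet> v) / (v \<bullet> v)) * (y \<bullet> v)
        + (2 * (x \<bullet> v) / (v \<bullet> v)) * (2 * (y \<bullet> v) / (v \<bullet> v)) * (v \<bullet> v)"
      by (simp add: T_def inner_diff_left inner_diff_right inner_commute[of v y])
    also have "\<dots> = x \<bullet> y" using v by simp
    finally show ?thesis .
  qed
  show thesis
  proof (rule that[of T])
    show "linear T" unfolding T_def
      by (intro linearI) (auto simp: inner_add_left add_divide_distrib distrib_left scaleR_left.add scaleR_right_diff_distrib)
    show "norm (T x) = norm x" for x by (simp add: norm_eq_sqrt_inner inn)
    have "T x \<bullet> v = - (x \<bullet> v)" for x using v by (simp add: T_def inner_diff_left)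
    then have "T (T x) = T x + (2 * (x \<bullet> v) / (v \<bullet> v)) *\<^sub>R v" for x
      unfolding T_def[of "T x"] by simp
    moreover have "T x + (2 * (x \<bullet> v) / (v \<bullet> v)) *\<^sub>R v = x" for x by (simp add: T_def)
    ultimately show "T (T x) = x" for x by simp
    show "T x \<bullet> T y = x \<bullet> y" for x y by (rule inn)
    have "a \<bullet> a = b \<bullet> b" using assms by (simp add: norm_eq_sqrt_inner)
    then have "v \<bullet> v = 2 * (a \<bullet> v)"
      by (simp add: v_def inner_diff_left inner_diff_right inner_commute[of b a])
    then have "2 * (a \<bullet> v) / (v \<bullet> v) = (v \<bullet> v) / (v \<bullet> v)" by (simp only:)
    then have "2 * (a \<bullet> v) / (v \<bullet> v) = 1" using v by (metis divide_self)
    then have "T a = a - v" unfolding T_def by (simp only: scaleR_one)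
    then show "T a = b" by (simp add: v_def)
  qed
qed

section \<open>Total mass of the kernel\<close>

lemma ker_measurable [measurable]:
  fixes x :: "'a::euclidean_space"
  assumes "x \<noteq> 0" shows "ker i j e x \<in> borel_measurable borel"
  using smooth_continuous[OF smooth_ker[OF assms]] by (rule borel_measurable_continuous_onI)

lemma ker_00: "ker 0 0 e x y = ((norm x)\<^sup>2 + (norm y)\<^sup>2) powr (- ((real DIM('a) - 2) / 2)) * flat 0 (e - 1 + 2 * (x \<bullet> y) / ((norm x)\<^sup>2 + (norm y)\<^sup>2))"
  for x y :: "'a::euclidean_space"
  by (simp add: ker_def kphi.simps)

lemma ker_nonneg: "0 \<le> ker 0 0 e x y"
  by (simp add: ker_00 flat_0_nonneg)

lemma ker_pos_near:
  fixes x y :: "'a::euclidean_space"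
  assumes "x \<noteq> 0" "2 * (x \<bullet> y) > (1 - e) * ((norm x)\<^sup>2 + (norm y)\<^sup>2)"
  shows "0 < ker 0 0 e x y"
proof -
  have p: "(norm x)\<^sup>2 + (norm y)\<^sup>2 > 0" using sum_norm2_pos assms(1) by blast
  then have "0 < e - 1 + 2 * (x \<bullet> y) / ((norm x)\<^sup>2 + (norm y)\<^sup>2)"
    using assms(2) less_divide_eq[of "1 - e" "2 * (x \<bullet> y)" "(norm x)\<^sup>2 + (norm y)\<^sup>2"] by simp
  from flat_0_pos[OF this] show ?thesis using p unfolding ker_00 by (intro mult_pos_pos) auto
qed

lemma ker_scale:
  fixes x y :: "'a::euclidean_space"
  assumes r: "r > 0"
  shows "ker 0 0 e (r *\<^sub>R x) (r *\<^sub>R y) = r powr (2 - real DIM('a)) * ker 0 0 e x y"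
proof -
  have "(norm (r *\<^sub>R x))\<^sup>2 + (norm (r *\<^sub>R y))\<^sup>2 = r\<^sup>2 * ((norm x)\<^sup>2 + (norm y)\<^sup>2)"
    by (simp add: power_mult_distrib algebra_simps)
  moreover have "(r\<^sup>2 * ((norm x)\<^sup>2 + (norm y)\<^sup>2)) powr a = r powr (2 * a) * ((norm x)\<^sup>2 + (norm y)\<^sup>2) powr a" for a
    using r by (simp add: powr_mult powr_powr[symmetric] powr_numeral)
  moreover have "(r *\<^sub>R x) \<bullet> (r *\<^sub>R y) = r\<^sup>2 * (x \<bullet> y)" by (simp add: power2_eq_square)
  moreover have "2 * (- ((real DIM('a) - 2) / 2)) = 2 - real DIM('a)" by (simp add: field_simps)
  moreover have "2 * (r\<^sup>2 * (x \<bullet> y)) / (r\<^sup>2 * ((norm x)\<^sup>2 + (norm y)\<^sup>2)) = 2 * (x \<bullet> y) / ((norm x)\<^sup>2 + (norm y)\<^sup>2)"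
    using r by simp
  ultimately show ?thesis unfolding ker_00 by (simp only: mult.assoc)
qed

definition kmass_nn :: "real \<Rightarrow> 'a::euclidean_space \<Rightarrow> ennreal" where
  "kmass_nn e x = (\<integral>\<^sup>+y. ennreal (ker 0 0 e x y / (norm y)\<^sup>2) \<partial>lborel)"

text \<open>The degree 2 - N of the kernel cancels the degree N - 2 of the measure |y|^-2 dy. With
  rotation invariance this makes the total mass the same at all points other than the
  origin.\<close>

lemma kmass_nn_scale:
  fixes x :: "'a::euclidean_space"
  assumes x: "x \<noteq> 0" and r: "r > 0"
  shows "kmass_nn e (r *\<^sub>R x) = kmass_nn e x"
proof -
  have rx: "r *\<^sub>R x \<noteq> 0" using x r by simp
  note [measurable] = ker_measurable[OF x] ker_measurable[OF rx]
  have pw: "r ^ DIM('a) * r powr (2 - real DIM('a)) = r\<^sup>2"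
    using r by (simp add: powr_diff powr_realpow)
  have eq: "r ^ DIM('a) * (ker 0 0 e (r *\<^sub>R x) (r *\<^sub>R y) / (norm (r *\<^sub>R y))\<^sup>2) = ker 0 0 e x y / (norm y)\<^sup>2" for y
  proof -
    have "r ^ DIM('a) * (ker 0 0 e (r *\<^sub>R x) (r *\<^sub>R y) / (norm (r *\<^sub>R y))\<^sup>2) =
        (r ^ DIM('a) * r powr (2 - real DIM('a))) * ker 0 0 e x y / (r\<^sup>2 * (norm y)\<^sup>2)"
      by (simp add: ker_scale[OF r] power_mult_distrib)
    then show ?thesis unfolding pw using r by simp
  qed
  have "kmass_nn e (r *\<^sub>R x) = ennreal (r ^ DIM('a)) * (\<integral>\<^sup>+y. ennreal (ker 0 0 e (r *\<^sub>R x) (r *\<^sub>R y) / (norm (r *\<^sub>R y))\<^sup>2) \<partial>lborel)"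
    unfolding kmass_nn_def by (rule nn_integral_lborel_scale[OF _ r]) measurable
  also have "\<dots> = (\<integral>\<^sup>+y. ennreal (r ^ DIM('a)) * ennreal (ker 0 0 e (r *\<^sub>R x) (r *\<^sub>R y) / (norm (r *\<^sub>R y))\<^sup>2) \<partial>lborel)"
    by (rule nn_integral_cmult[symmetric]) measurable
  also have "\<dots> = kmass_nn e x"
    unfolding kmass_nn_def using r by (intro nn_integral_cong) (simp only: eq ennreal_mult'[symmetric] zero_le_power less_imp_le)
  finally show ?thesis .
qed

lemma kmass_nn_rotate:
  fixes x x' :: "'a::euclidean_space"
  assumes x: "x \<noteq> 0" and n: "norm x = norm x'"
  shows "kmass_nn e x' = kmass_nn e x"
proof -
  obtain T where T: "linear T" "\<And>x. norm (T x) = norm x" "\<And>x. T (T x) = x" "\<And>x y. T x \<bullet> T y = x \<bullet> y" "T x = x'"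
    by (rule exists_reflection[OF n]) blast
  have x': "x' \<noteq> 0" using x n by auto
  note [measurable] = ker_measurable[OF x']
  have "kmass_nn e x' = (\<integral>\<^sup>+y. ennreal (ker 0 0 e x' (T y) / (norm (T y))\<^sup>2) \<partial>lborel)"
    unfolding kmass_nn_def by (rule nn_integral_lborel_reflection[OF _ T(1-3), symmetric]) measurable
  also have "\<dots> = kmass_nn e x"
    unfolding kmass_nn_def T(5)[symmetric] by (simp add: ker_00 T(2,4))
  finally show ?thesis .
qed

lemma kmass_nn_const:
  fixes x x' :: "'a::euclidean_space"
  assumes "x \<noteq> 0" "x' \<noteq> 0"
  shows "kmass_nn e x = kmass_nn e x'"
proof -
  have r: "norm x' / norm x > 0" using assms by simp
  have "kmass_nn e x' = kmass_nn e ((norm x' / norm x) *\<^sub>R x)"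
    by (rule kmass_nn_rotate) (use assms in auto)
  also have "\<dots> = kmass_nn e x" by (rule kmass_nn_scale[OF assms(1) r])
  finally show ?thesis by simp
qed

lemma ker_weight_integrable:
  fixes x :: "'a::euclidean_space"
  assumes x: "x \<noteq> 0" and e: "e \<le> 1/2" and N: "DIM('a) \<ge> 2"
  shows "integrable lborel (\<lambda>y. ker 0 0 e x y / (norm y)\<^sup>2)"
proof -
  note [measurable] = ker_measurable[OF x]
  have e1: "e \<le> 1" using e by simp
  obtain C where C: "C > 0" "\<And>p c. p > 0 \<Longrightarrow> \<bar>c\<bar> \<le> p \<Longrightarrow> \<bar>kphi 0 ((real DIM('a) - 2) / 2) e 0 p c\<bar> \<le> C * p powr (- ((real DIM('a) - 2) / 2 + real 0 + real 0))"
    using kphi_bound[of e 0 "(real DIM('a) - 2) / 2" 0] e by (metis e1)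
  define D where "D = C * ((norm x)\<^sup>2) powr (- ((real DIM('a) - 2) / 2)) / ((norm x / 4)\<^sup>2)"
  show ?thesis
  proof (rule Bochner_Integration.integrable_bound)
    show "integrable lborel (\<lambda>y. D * indicator (cball 0 (4 * norm x)) y :: real)"
      by (intro integrable_mult_right integrable_real_indicator) (auto simp: emeasure_lborel_cball_finite[unfolded infinity_ennreal_def])
    show "AE y in lborel. norm (ker 0 0 e x y / (norm y)\<^sup>2) \<le> norm (D * indicator (cball 0 (4 * norm x)) y)"
    proof (rule AE_I2)
      fix y
      show "norm (ker 0 0 e x y / (norm y)\<^sup>2) \<le> norm (D * indicator (cball 0 (4 * norm x)) y)"
      proof (cases "4 * norm x \<le> norm y \<or> 4 * norm y \<le> norm x")
        case True
        then show ?thesis using ker_outside[OF e True] x by simp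
      next
        case False
        then have y: "norm x / 4 \<le> norm y" "norm y \<le> 4 * norm x" by auto
        have "\<bar>ker 0 0 e x y\<bar> \<le> C * ((norm x)\<^sup>2 + (norm y)\<^sup>2) powr (- ((real DIM('a) - 2) / 2 + real 0 + real 0))"
          unfolding ker_def by (rule C(2)[OF sum_norm2_pos abs_inner_le_sum]) (use x in auto)
        also have "\<dots> \<le> C * ((norm x)\<^sup>2) powr (- ((real DIM('a) - 2) / 2))"
          using C(1) x N by (intro mult_left_mono) (auto intro!: powr_mono2')
        finally have k: "\<bar>ker 0 0 e x y\<bar> \<le> C * ((norm x)\<^sup>2) powr (- ((real DIM('a) - 2) / 2))" .
        have y2: "(norm x / 4)\<^sup>2 \<le> (norm y)\<^sup>2" using y by (intro power_mono) auto
        have "\<bar>ker 0 0 e x y\<bar> / (norm y)\<^sup>2 \<le> D"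
          unfolding D_def by (rule frac_le[OF _ k _ y2]) (use x C in auto)
        moreover have "D \<ge> 0" using C by (simp add: D_def)
        ultimately show ?thesis using y by (simp add: abs_divide)
      qed
    qed
  qed measurable
qed

text \<open>The choice of the basis vector is immaterial, by homogeneity and invariance under reflections.\<close>

definition kmass :: "'a::euclidean_space itself \<Rightarrow> real \<Rightarrow> real" where
  "kmass _ e = enn2real (kmass_nn e (SOME b::'a. b \<in> Basis))"

lemma kmass_integral:
  fixes x :: "'a::euclidean_space"
  assumes x: "x \<noteq> 0" and e: "e \<le> 1/2" and N: "DIM('a) \<ge> 2"
  shows "(LINT y|lebesgue. ker 0 0 e x y / (norm y)\<^sup>2) = kmass TYPE('a) e"
    and "integrable lebesgue (\<lambda>y. ker 0 0 e x y / (norm y)\<^sup>2)"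
proof -
  note [measurable] = ker_measurable[OF x]
  show "integrable lebesgue (\<lambda>y. ker 0 0 e x y / (norm y)\<^sup>2)"
    using ker_weight_integrable[OF assms] by (simp add: integrable_completion)
  have "(LINT y|lebesgue. ker 0 0 e x y / (norm y)\<^sup>2) = (LINT y|lborel. ker 0 0 e x y / (norm y)\<^sup>2)"
    by (rule integral_completion) measurable
  also have "\<dots> = enn2real (kmass_nn e x)"
    unfolding kmass_nn_def by (rule integral_eq_nn_integral) (auto simp: ker_nonneg)
  also have "(SOME b::'a. b \<in> Basis) \<noteq> 0"
    using some_in_eq[of "Basis :: 'a set"] nonempty_Basis nonzero_Basis by blast
  then have "kmass_nn e x = kmass_nn e (SOME b::'a. b \<in> Basis)"
    by (rule kmass_nn_const[OF x])
  finally show "(LINT y|lebesgue. ker 0 0 e x y / (norm y)\<^sup>2) = kmass TYPE('a) e"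
    by (simp add: kmass_def)
qed

lemma kmass_pos:
  assumes e: "0 < e" "e \<le> 1/2" and N: "DIM('a::euclidean_space) \<ge> 2"
  shows "kmass TYPE('a) e > 0"
proof -
  obtain x :: 'a where "x \<in> Basis" using nonempty_Basis by blast
  then have x: "x \<noteq> 0" by (simp add: nonzero_Basis)
  define U where "U = {y. 2 * (x \<bullet> y) > (1 - e) * ((norm x)\<^sup>2 + (norm y)\<^sup>2)}"
  have U: "open U" unfolding U_def by (intro open_Collect_less continuous_intros)
  have xU: "x \<in> U" using e x by (simp add: U_def power2_norm_eq_inner[symmetric] algebra_simps)
  have "kmass TYPE('a) e \<ge> 0" by (simp add: kmass_def)
  moreover have "kmass TYPE('a) e \<noteq> 0"
  proof
    assume "kmass TYPE('a) e = 0"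
    then have "(LINT y|lebesgue. ker 0 0 e x y / (norm y)\<^sup>2) = 0"
      using kmass_integral(1)[OF x e(2) N] by simp
    then have "AE y in lebesgue. ker 0 0 e x y / (norm y)\<^sup>2 = 0"
      using kmass_integral(2)[OF x e(2) N] by (subst (asm) integral_nonneg_eq_0_iff_AE) (auto simp: ker_nonneg)
    then have "AE y in lebesgue. y \<notin> U"
    proof eventually_elim
      case (elim y)
      show ?case
      proof
        assume y: "y \<in> U"
        then have "ker 0 0 e x y > 0" unfolding U_def by (intro ker_pos_near[OF x]) auto
        moreover have "y \<noteq> 0" using y e x by (auto simp: U_def mult_less_0_iff not_less)
        ultimately show False using elim by simp
      qed
    qed
    then have "U \<in> null_sets lebesgue" using U by (subst AE_iff_null_sets) (auto intro: open_lebesgue)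
    then have "negligible U" by (simp add: negligible_iff_null_sets)
    then show False using open_not_negligible[OF U] xU by auto
  qed
  ultimately show ?thesis by simp
qed

text \<open>Derivatives of the kernel at scale \<open>e\<close> are of size p^-m with m = (N - 2) /
  2, and on their support the kernel at scale \<open>2 * e\<close> is at least p^-m times
  \<open>flat 0 e\<close>. Doubling the scale thus lets a nonnegative kernel dominate the
  derivative. The constant depends on \<open>e\<close>, which is harmless where it is used.\<close>

lemma kerB_bound:
  assumes e: "0 < e" "e \<le> 1/4" and B: "simil B l"
  obtains C where "C > 0" "\<And>x y. x \<noteq> 0 \<Longrightarrow> \<bar>kerB B l e x y\<bar> \<le> C * ker 0 0 (2 * e) x (y::'a::euclidean_space)"
proof -
  define m where "m = (real DIM('a) - 2) / 2"
  obtain C1 where C1: "C1 > 0" "\<And>p c. p > 0 \<Longrightarrow> \<bar>c\<bar> \<le> p \<Longrightarrow> \<bar>kphi 1 m e 0 p c\<bar> \<le> C1 * p powr (- (m + real 1 + real 0))"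
    using kphi_bound[of e 1 m 0] e by auto
  obtain C2 where C2: "C2 > 0" "\<And>p c. p > 0 \<Longrightarrow> \<bar>c\<bar> \<le> p \<Longrightarrow> \<bar>kphi 0 m e 1 p c\<bar> \<le> C2 * p powr (- (m + real 0 + real 1))"
    using kphi_bound[of e 0 m 1] e by auto
  have f: "flat 0 e > 0" using e flat_0_pos by simp
  define C where "C = (2 * C1 + C2) / flat 0 e"
  have Cpos: "C > 0" using C1 C2 f by (simp add: C_def)
  have "\<bar>kerB B l e x y\<bar> \<le> C * ker 0 0 (2 * e) x y" if x: "x \<noteq> 0" for x y
  proof -
    define p where "p = (norm x)\<^sup>2 + (norm y)\<^sup>2"
    have p: "p > 0" using sum_norm2_pos x unfolding p_def by blast
    show ?thesis
    proof (cases "2 * (x \<bullet> y) / p \<le> 1 - e")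
      case True
      then have "ker 1 0 e x y = 0" "ker 0 1 e x y = 0"
        unfolding ker_def p_def by (auto intro: kphi_outside)
      then show ?thesis using ker_nonneg[of "2 * e" x y] Cpos by (simp add: kerB_def)
    next
      case False
      have pe: "p powr (- (m + 1)) * p = p powr (- m)"
        using p powr_add[of p "- (m + 1)" 1] by simp
      have k: "\<bar>ker 1 0 e x y\<bar> \<le> C1 * p powr (- (m + 1))" "\<bar>ker 0 1 e x y\<bar> \<le> C2 * p powr (- (m + 1))"
        using C1(2)[OF p, of "x \<bullet> y"] C2(2)[OF p, of "x \<bullet> y"] abs_inner_le_sum[of x y]
        unfolding ker_def p_def m_def by auto
      have c1: "\<bar>l * (x \<bullet> x)\<bar> \<le> p"
      proof -
        have "l * (x \<bullet> x) = B x \<bullet> x" using simil_inner[OF B, of x] by (simp add: power2_norm_eq_inner)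
        then have "\<bar>l * (x \<bullet> x)\<bar> \<le> norm (B x) * norm x" using Cauchy_Schwarz_ineq2[of "B x" x] by simp
        also have "\<dots> \<le> norm x * norm x" using simil_norm[OF B, of x] by (intro mult_right_mono) auto
        also have "\<dots> \<le> p" by (simp add: p_def power2_eq_square)
        finally show ?thesis .
      qed
      have c2: "\<bar>B x \<bullet> y\<bar> \<le> p"
      proof -
        have "\<bar>B x \<bullet> y\<bar> \<le> norm (B x) * norm y" by (rule Cauchy_Schwarz_ineq2)
        also have "\<dots> \<le> norm x * norm y" using simil_norm[OF B, of x] by (intro mult_right_mono) auto
        also have "\<dots> \<le> p" using sum_squares_bound[of "norm x" "norm y"] mult_nonneg_nonneg[OF norm_ge_zero[of x] norm_ge_zero[of y]]
          unfolding p_def by linarith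
        finally show ?thesis .
      qed
      have "\<bar>kerB B l e x y\<bar> \<le> 2 * \<bar>l * (x \<bullet> x)\<bar> * \<bar>ker 1 0 e x y\<bar> + \<bar>B x \<bullet> y\<bar> * \<bar>ker 0 1 e x y\<bar>"
        unfolding kerB_def by (rule order.trans[OF abs_triangle_ineq]) (simp add: abs_mult)
      also have "\<dots> \<le> 2 * p * (C1 * p powr (- (m + 1))) + p * (C2 * p powr (- (m + 1)))"
        using c1 c2 k p by (intro add_mono mult_mono) auto
      also have "\<dots> = (2 * C1 + C2) * (p powr (- (m + 1)) * p)" by (simp add: algebra_simps)
      also have "\<dots> = C * (p powr (- m) * flat 0 e)" unfolding pe using f by (simp add: C_def)
      \<comment> \<open>On the support at scale \<open>e\<close> one has 2c/p > 1 - e, so the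
        argument of \<open>flat 0\<close> at scale \<open>2 * e\<close> exceeds
        \<open>e\<close>.\<close>
      also have "\<dots> \<le> C * (p powr (- m) * flat 0 (2 * e - 1 + 2 * (x \<bullet> y) / p))"
        using Cpos False by (intro mult_left_mono flat_0_mono) auto
      also have "\<dots> = C * ker 0 0 (2 * e) x y" by (simp add: ker_00 p_def m_def)
      finally show ?thesis .
    qed
  qed
  with Cpos show thesis by (rule that)
qed

subsection \<open>Maximum principle and gradient estimate\<close>

lemma second_derivative_at_max:
  fixes f f1 :: "real \<Rightarrow> real"
  assumes d: "d > 0" and f: "\<And>s. \<bar>s\<bar> < d \<Longrightarrow> (f has_real_derivative f1 s) (at s)"
    and f1: "(f1 has_real_derivative D) (at 0)" and max: "\<And>s. \<bar>s\<bar> < d \<Longrightarrow> f s \<le> f 0"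
  shows "D \<le> 0"
proof (rule ccontr)
  assume "\<not> D \<le> 0"
  then have "D > 0" by simp
  have z: "f1 0 = 0"
    by (rule DERIV_local_max[OF f[of 0] d]) (use d max in auto)
  obtain r where r: "r > 0" "\<And>h. h > 0 \<Longrightarrow> h < r \<Longrightarrow> f1 0 < f1 (0 + h)"
    using DERIV_pos_inc_right[OF f1 \<open>D > 0\<close>] by blast
  define h where "h = min r d / 2"
  have h: "h > 0" "h < r" "h < d" using r d by (auto simp: h_def min_def)
  have "f 0 < f h"
  proof (rule DERIV_pos_imp_increasing_open[OF h(1)])
    show "\<exists>y. (f has_real_derivative y) (at s) \<and> 0 < y" if "0 < s" "s < h" for s
      using r(2)[of s] that h f[of s] z by auto
    show "continuous_on {0..h} f"
      using h by (intro DERIV_continuous_on[where D=f1] has_field_derivative_at_within[OF f]) auto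
  qed
  then show False using max[of h] h by simp
qed

lemma inv_norm2_line:
  fixes x v :: "'a::euclidean_space"
  assumes "x + s *\<^sub>R v \<noteq> 0"
  shows "((\<lambda>s. 1 / ((x + s *\<^sub>R v) \<bullet> (x + s *\<^sub>R v))) has_real_derivative
    - (2 * ((x + s *\<^sub>R v) \<bullet> v)) / (((x + s *\<^sub>R v) \<bullet> (x + s *\<^sub>R v)) * ((x + s *\<^sub>R v) \<bullet> (x + s *\<^sub>R v)))) (at s)"
  using assms by (intro DERIV_cong[OF DERIV_divide[OF DERIV_const norm2_line]]) auto

lemma inv_norm2_line2:
  fixes x v :: "'a::euclidean_space"
  assumes "x + s *\<^sub>R v \<noteq> 0"
  shows "((\<lambda>s. - (2 * ((x + s *\<^sub>R v) \<bullet> v)) / (((x + s *\<^sub>R v) \<bullet> (x + s *\<^sub>R v)) * ((x + s *\<^sub>R v) \<bullet> (x + s *\<^sub>R v)))) has_real_derivative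
    - 2 * (v \<bullet> v) / ((x + s *\<^sub>R v) \<bullet> (x + s *\<^sub>R v))\<^sup>2 + 8 * ((x + s *\<^sub>R v) \<bullet> v)\<^sup>2 / ((x + s *\<^sub>R v) \<bullet> (x + s *\<^sub>R v)) ^ 3) (at s)"
proof -
  define q where "q = (x + s *\<^sub>R v) \<bullet> (x + s *\<^sub>R v)"
  have q: "q \<noteq> 0" using assms by (simp add: q_def)
  show ?thesis
    by (rule DERIV_cong[OF DERIV_divide[OF DERIV_minus[OF DERIV_cmult[OF inner_line]] DERIV_mult[OF norm2_line norm2_line]]])
      (use q in \<open>simp_all only: q_def[symmetric], simp_all add: field_simps power2_eq_square power3_eq_cube\<close>)
qed

text \<open>The function \<open>|x|\<^sup>2 + |x|\<^sup>-\<^sup>2\<close> serves as a barrier at the origin and at infinity.\<close>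

lemma max_principle:
  fixes F Ft :: "'a::euclidean_space \<Rightarrow> real \<Rightarrow> real" and F1 F2 :: "'a \<Rightarrow> 'a \<Rightarrow> real \<Rightarrow> real"
  assumes cont: "continuous_on ({x. x \<noteq> 0} \<times> {\<tau>..T}) (\<lambda>z. F (fst z) (snd z))"
    and bound: "\<And>x t. x \<noteq> 0 \<Longrightarrow> t \<in> {\<tau>..T} \<Longrightarrow> F x t \<le> M"
    and init: "\<And>x. x \<noteq> 0 \<Longrightarrow> F x \<tau> \<le> 0"
    and dt: "\<And>x t. x \<noteq> 0 \<Longrightarrow> \<tau> < t \<Longrightarrow> t \<le> T \<Longrightarrow> (F x has_real_derivative Ft x t) (at t)"
    and d1: "\<And>x b s t. x + s *\<^sub>R b \<noteq> 0 \<Longrightarrow> \<tau> < t \<Longrightarrow> t \<le> T \<Longrightarrow> ((\<lambda>s. F (x + s *\<^sub>R b) t) has_real_derivative F1 b (x + s *\<^sub>R b) t) (at s)"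
    and d2: "\<And>x b s t. x + s *\<^sub>R b \<noteq> 0 \<Longrightarrow> \<tau> < t \<Longrightarrow> t \<le> T \<Longrightarrow> ((\<lambda>s. F1 b (x + s *\<^sub>R b) t) has_real_derivative F2 b (x + s *\<^sub>R b) t) (at s)"
    and sub: "\<And>x t. x \<noteq> 0 \<Longrightarrow> \<tau> < t \<Longrightarrow> t \<le> T \<Longrightarrow> Ft x t \<le> (norm x)\<^sup>2 * (\<Sum>b\<in>Basis. F2 b x t)"
    and x0: "x0 \<noteq> 0" and t0: "t0 \<in> {\<tau>..T}"
  shows "F x0 t0 \<le> 0"
proof (rule ccontr)
  assume "\<not> F x0 t0 \<le> 0"
  then have Fpos: "F x0 t0 > 0" by simp
  \<comment> \<open>The barrier satisfies |x|^2 \<Delta> (|x|^2 + |x|^-2) = 2 N |x|^2 + (8 - 2 N)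
    |x|^-2. Both coefficients are below 2 N + 9, so exp (K (t - \<tau>)) times the barrier is a
    strict supersolution.\<close>
  define K where "K = 2 * real DIM('a) + 9"
  define h where "h x = x \<bullet> x + 1 / (x \<bullet> x)" for x :: 'a
  have hpos: "h x > 0" if "x \<noteq> 0" for x using that by (simp add: h_def add_pos_pos)
  define \<eta> where "\<eta> = F x0 t0 / (2 * exp (K * (t0 - \<tau>)) * h x0)"
  have \<eta>: "\<eta> > 0" using Fpos hpos[OF x0] by (simp add: \<eta>_def)
  define G where "G x t = F x t - \<eta> * exp (K * (t - \<tau>)) * h x" for x t
  have "\<eta> * exp (K * (t0 - \<tau>)) * h x0 = F x0 t0 / 2" using hpos[OF x0] by (simp add: \<eta>_def)
  then have G0: "G x0 t0 > 0" using Fpos by (simp add: G_def)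
  have Mpos: "M > 0" using bound[OF x0 t0] Fpos by simp
  \<comment> \<open>Where |x| or 1/|x| reaches \<open>R\<close>, the barrier exceeds M / \<eta> and
    forces \<open>G\<close> below 0. A positive maximum over the closed annulus is therefore
    attained at an interior point in space.\<close>
  define R where "R = max (max (norm x0) (1 / norm x0)) (max 1 (M / \<eta>)) + 1"
  have R: "R > 1" "norm x0 < R" "1 / norm x0 < R" "M / \<eta> < R" by (auto simp: R_def)
  define A where "A = cball (0::'a) R - ball 0 (1 / R)"
  have A: "x \<in> A \<longleftrightarrow> 1 / R \<le> norm x \<and> norm x \<le> R" for x by (auto simp: A_def not_less)
  have Anz: "x \<noteq> 0" if "x \<in> A" for x using that R(1) unfolding A by (auto simp: divide_le_0_iff)
  have "1 / R < norm x0" using R(1,3) x0 by (simp add: field_simps)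
  then have x0A: "x0 \<in> A" using R(2) unfolding A by auto
  have cA: "compact (A \<times> {\<tau>..T})"
    unfolding A_def by (intro compact_Times compact_diff) auto
  have "continuous_on (A \<times> {\<tau>..T}) (\<lambda>z. G (fst z) (snd z))"
    unfolding G_def h_def
    by (intro continuous_intros continuous_on_subset[OF cont]) (use Anz in auto)
  then obtain z where z: "z \<in> A \<times> {\<tau>..T}" "\<And>z'. z' \<in> A \<times> {\<tau>..T} \<Longrightarrow> G (fst z') (snd z') \<le> G (fst z) (snd z)"
    using continuous_attains_sup[OF cA, of "\<lambda>z. G (fst z) (snd z)"] x0A t0 by blast
  define x t where "x = fst z" and "t = snd z"
  have xA: "x \<in> A" and tT: "t \<in> {\<tau>..T}" using z(1) by (auto simp: x_def t_def)
  have xt: "G x' t' \<le> G x t" if "x' \<in> A" "t' \<in> {\<tau>..T}" for x' t'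
    using z(2)[of "(x', t')"] that by (simp add: x_def t_def)
  have Gxt: "G x t > 0" using xt[OF x0A t0] G0 by linarith
  have xnz: "x \<noteq> 0" using Anz[OF xA] .
  have tt: "t > \<tau>"
  proof (rule ccontr)
    assume "\<not> t > \<tau>"
    then have "t = \<tau>" using tT by auto
    then have "G x t \<le> - (\<eta> * h x)" using init[OF xnz] by (simp add: G_def)
    then show False using Gxt mult_pos_pos[OF \<eta> hpos[OF xnz]] by linarith
  qed
  have exp1: "exp (K * (t - \<tau>)) \<ge> 1" using tt by (simp add: K_def)
  have hM: "h x < R"
  proof (rule ccontr)
    assume "\<not> h x < R"
    then have "M / \<eta> < h x" using R(4) by linarith
    then have "M < \<eta> * h x" using \<eta> by (simp add: divide_less_eq mult.commute)
    also have "\<dots> \<le> \<eta> * exp (K * (t - \<tau>)) * h x"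
      using exp1 \<eta> hpos[OF xnz] by simp
    finally show False using bound[OF xnz tT] Gxt by (simp add: G_def)
  qed
  have xR: "norm x < R"
  proof (rule ccontr)
    assume "\<not> norm x < R"
    then have "R * 1 \<le> norm x * norm x" using R(1) by (intro mult_mono) auto
    moreover have "norm x * norm x < h x" using xnz by (simp add: h_def power2_norm_eq_inner[symmetric] power2_eq_square)
    ultimately show False using hM by simp
  qed
  have xR': "1 / R < norm x"
  proof (rule ccontr)
    assume "\<not> 1 / R < norm x"
    then have "norm x \<le> 1 / R" by simp
    then have "R \<le> 1 / norm x" using xnz R(1) by (simp add: field_simps)
    then have "R * 1 \<le> (1 / norm x) * (1 / norm x)" using R(1) by (intro mult_mono) auto
    moreover have "(1 / norm x) * (1 / norm x) < h x" using xnz by (simp add: h_def power2_norm_eq_inner[symmetric] power2_eq_square)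
    ultimately show False using hM by simp
  qed
  define d where "d = min (R - norm x) (norm x - 1 / R)"
  have d: "d > 0" using xR xR' by (simp add: d_def)
  have near: "x + s *\<^sub>R b \<in> A" if "b \<in> Basis" "\<bar>s\<bar> < d" for s b
  proof -
    have "norm (s *\<^sub>R b) < d" using that by simp
    moreover have "norm (x + s *\<^sub>R b) \<le> norm x + norm (s *\<^sub>R b)" by (rule norm_triangle_ineq)
    moreover have "norm x - norm (s *\<^sub>R b) \<le> norm (x + s *\<^sub>R b)" by (rule norm_diff_ineq)
    ultimately show ?thesis unfolding A by (auto simp: d_def)
  qed
  define c where "c = \<eta> * exp (K * (t - \<tau>))"
  have c: "c > 0" using \<eta> by (simp add: c_def)
  have spatial: "F2 b x t \<le> c * (2 * (b \<bullet> b) + (- 2 * (b \<bullet> b) / (x \<bullet> x)\<^sup>2 + 8 * (x \<bullet> b)\<^sup>2 / (x \<bullet> x) ^ 3))"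
    if b: "b \<in> Basis" for b
  proof -
    define f1 where "f1 x = F1 b x t - c * (2 * (x \<bullet> b) + - (2 * (x \<bullet> b)) / ((x \<bullet> x) * (x \<bullet> x)))" for x
    have "F2 b (x + 0 *\<^sub>R b) t - c * (2 * (b \<bullet> b) + (- 2 * (b \<bullet> b) / ((x + 0 *\<^sub>R b) \<bullet> (x + 0 *\<^sub>R b))\<^sup>2 + 8 * ((x + 0 *\<^sub>R b) \<bullet> b)\<^sup>2 / ((x + 0 *\<^sub>R b) \<bullet> (x + 0 *\<^sub>R b)) ^ 3)) \<le> 0"
    proof (rule second_derivative_at_max[OF d])
      fix s :: real assume s: "\<bar>s\<bar> < d"
      have nz: "x + s *\<^sub>R b \<noteq> 0" using Anz[OF near[OF b s]] .
      show "((\<lambda>s. G (x + s *\<^sub>R b) t) has_real_derivative f1 (x + s *\<^sub>R b)) (at s)"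
        unfolding G_def h_def f1_def c_def
        by (intro DERIV_diff DERIV_cmult DERIV_add d1 norm2_line inv_norm2_line nz tt) (use tT in auto)
      show "G (x + s *\<^sub>R b) t \<le> G (x + 0 *\<^sub>R b) t" using xt[OF near[OF b s] tT] by simp
    next
      have nz: "x + 0 *\<^sub>R b \<noteq> 0" using xnz by simp
      show "((\<lambda>s. f1 (x + s *\<^sub>R b)) has_real_derivative F2 b (x + 0 *\<^sub>R b) t - c * (2 * (b \<bullet> b) + (- 2 * (b \<bullet> b) / ((x + 0 *\<^sub>R b) \<bullet> (x + 0 *\<^sub>R b))\<^sup>2 + 8 * ((x + 0 *\<^sub>R b) \<bullet> b)\<^sup>2 / ((x + 0 *\<^sub>R b) \<bullet> (x + 0 *\<^sub>R b)) ^ 3))) (at 0)"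
        unfolding f1_def
        by (intro DERIV_diff DERIV_cmult DERIV_add d2 inner_line inv_norm2_line2 nz tt) (use tT in auto)
    qed
    then show ?thesis by simp
  qed
  \<comment> \<open>The maximum may be attained at the final time, so only earlier times are
    compared with it.\<close>
  have time: "Ft x t - \<eta> * (exp (K * (t - \<tau>)) * K) * h x \<ge> 0"
  proof (rule ccontr)
    assume neg: "\<not> Ft x t - \<eta> * (exp (K * (t - \<tau>)) * K) * h x \<ge> 0"
    have "((\<lambda>t. G x t) has_real_derivative Ft x t - \<eta> * (exp (K * (t - \<tau>)) * K) * h x) (at t)"
      unfolding G_def using tT
      by (auto intro!: derivative_eq_intros dt[OF xnz tt])
    from DERIV_neg_dec_left[OF this] obtain r where r: "r > 0" "\<And>k. k > 0 \<Longrightarrow> k < r \<Longrightarrow> G x t < G x (t - k)"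
      using neg by auto
    define k where "k = min r (t - \<tau>) / 2"
    have k: "k > 0" "k < r" "t - k \<in> {\<tau>..T}" using r tt tT by (auto simp: k_def min_def field_simps)
    show False using r(2)[OF k(1,2)] xt[OF xA k(3)] by simp
  qed
  define q where "q = x \<bullet> x"
  have q: "q > 0" using xnz by (simp add: q_def)
  have "(\<Sum>b\<in>Basis. F2 b x t) \<le> (\<Sum>b\<in>(Basis::'a set). c * (2 * (b \<bullet> b) + (- 2 * (b \<bullet> b) / (x \<bullet> x)\<^sup>2 + 8 * (x \<bullet> b)\<^sup>2 / (x \<bullet> x) ^ 3)))"
    by (intro sum_mono spatial)
  also have "\<dots> = c * (2 * (\<Sum>b\<in>(Basis::'a set). b \<bullet> b) + (- 2 * (\<Sum>b\<in>(Basis::'a set). b \<bullet> b) / (x \<bullet> x)\<^sup>2 + 8 * (\<Sum>b\<in>Basis. (x \<bullet> b)\<^sup>2) / (x \<bullet> x) ^ 3))"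
    by (simp only: sum.distrib sum_distrib_left[symmetric] sum_divide_distrib[symmetric])
  also have "(\<Sum>b\<in>Basis. (x \<bullet> b)\<^sup>2) = q"
    unfolding q_def power2_eq_square by (rule euclidean_inner[symmetric])
  also have "(\<Sum>b\<in>(Basis::'a set). b \<bullet> b) = real DIM('a)" by (simp add: inner_Basis)
  finally have S: "(\<Sum>b\<in>Basis. F2 b x t) \<le> c * (2 * real DIM('a) + (- 2 * real DIM('a) / q\<^sup>2 + 8 * q / q ^ 3))"
    by (simp only: q_def)
  have "Ft x t \<le> q * (\<Sum>b\<in>Basis. F2 b x t)"
    using sub[OF xnz tt] tT by (simp add: q_def power2_norm_eq_inner)
  also have "\<dots> \<le> q * (c * (2 * real DIM('a) + (- 2 * real DIM('a) / q\<^sup>2 + 8 * q / q ^ 3)))"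
    using S q by (intro mult_left_mono) auto
  also have "\<dots> = c * (2 * real DIM('a) * q - 2 * real DIM('a) / q + 8 / q)"
    using q by (simp add: field_simps power2_eq_square power3_eq_cube)
  also have "\<dots> < c * (K * h x)"
  proof (rule mult_strict_left_mono[OF _ c])
    have "K * h x = K * q + K / q" by (simp add: h_def q_def distrib_left)
    moreover have "2 * real DIM('a) * q < K * q" using q by (simp add: K_def)
    moreover have "8 / q \<le> K / q" using q by (intro divide_right_mono) (auto simp: K_def)
    moreover have "2 * real DIM('a) / q \<ge> 0" using q by simp
    ultimately show "2 * real DIM('a) * q - 2 * real DIM('a) / q + 8 / q < K * h x" by linarith
  qed
  also have "\<dots> = \<eta> * (exp (K * (t - \<tau>)) * K) * h x" by (simp add: c_def)
  finally show False using time by simp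
qed

text \<open>Hamilton's gradient estimate: \<open>(t - \<tau>) a\<^sup>2/w - w log (M/w)\<close> is a subsolution when
  \<open>w\<close> and its derivative \<open>a\<close> along a symmetry of the equation are solutions.\<close>

lemma hamilton_estimate:
  fixes w wt a at :: "'a::euclidean_space \<Rightarrow> real \<Rightarrow> real" and w1 w2 a1 a2 :: "'a \<Rightarrow> 'a \<Rightarrow> real \<Rightarrow> real"
  assumes \<delta>: "\<delta> > 0"
    and w: "\<And>x t. x \<noteq> 0 \<Longrightarrow> \<tau> \<le> t \<Longrightarrow> \<delta> \<le> w x t" "\<And>x t. x \<noteq> 0 \<Longrightarrow> \<tau> \<le> t \<Longrightarrow> w x t \<le> M"
    and a: "\<And>x t. x \<noteq> 0 \<Longrightarrow> \<tau> \<le> t \<Longrightarrow> \<bar>a x t\<bar> \<le> A"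
    and cont: "continuous_on ({x. x \<noteq> 0} \<times> {\<tau>..}) (\<lambda>z. w (fst z) (snd z))" "continuous_on ({x. x \<noteq> 0} \<times> {\<tau>..}) (\<lambda>z. a (fst z) (snd z))"
    and wt: "\<And>x t. x \<noteq> 0 \<Longrightarrow> \<tau> < t \<Longrightarrow> (w x has_real_derivative (norm x)\<^sup>2 * (\<Sum>b\<in>Basis. w2 b x t)) (at t)"
    and at: "\<And>x t. x \<noteq> 0 \<Longrightarrow> \<tau> < t \<Longrightarrow> (a x has_real_derivative (norm x)\<^sup>2 * (\<Sum>b\<in>Basis. a2 b x t)) (at t)"
    and w1: "\<And>x b s t. x + s *\<^sub>R b \<noteq> 0 \<Longrightarrow> \<tau> < t \<Longrightarrow> ((\<lambda>s. w (x + s *\<^sub>R b) t) has_real_derivative w1 b (x + s *\<^sub>R b) t) (at s)"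
    and w2: "\<And>x b s t. x + s *\<^sub>R b \<noteq> 0 \<Longrightarrow> \<tau> < t \<Longrightarrow> ((\<lambda>s. w1 b (x + s *\<^sub>R b) t) has_real_derivative w2 b (x + s *\<^sub>R b) t) (at s)"
    and a1: "\<And>x b s t. x + s *\<^sub>R b \<noteq> 0 \<Longrightarrow> \<tau> < t \<Longrightarrow> ((\<lambda>s. a (x + s *\<^sub>R b) t) has_real_derivative a1 b (x + s *\<^sub>R b) t) (at s)"
    and a2: "\<And>x b s t. x + s *\<^sub>R b \<noteq> 0 \<Longrightarrow> \<tau> < t \<Longrightarrow> ((\<lambda>s. a1 b (x + s *\<^sub>R b) t) has_real_derivative a2 b (x + s *\<^sub>R b) t) (at s)"
    and grad: "\<And>x t. x \<noteq> 0 \<Longrightarrow> \<tau> < t \<Longrightarrow> (a x t)\<^sup>2 \<le> (norm x)\<^sup>2 * (\<Sum>b\<in>Basis. (w1 b x t)\<^sup>2)"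
    and x: "x \<noteq> 0" and t: "\<tau> \<le> t"
  shows "(t - \<tau>) * (a x t)\<^sup>2 \<le> (w x t)\<^sup>2 * (ln M - ln (w x t))"
proof -
  \<comment> \<open>With L = \<partial>_t - |x|^2 \<Delta> one has L (a^2/w) = -2 |x|^2 |grad a -
    (a/w) grad w|^2 / w and L (w ln (w/M)) = -|x|^2 |grad w|^2 / w. The time factor contributes
    a^2/w, which the second term absorbs through \<open>grad\<close>.\<close>
  define F where "F x t = (t - \<tau>) * ((a x t)\<^sup>2 / w x t) + w x t * (ln (w x t) - ln M)" for x t
  define G1 where "G1 b x t = (t - \<tau>) * (2 * a x t * a1 b x t / w x t - (a x t)\<^sup>2 * w1 b x t / (w x t)\<^sup>2) + w1 b x t * (ln (w x t) + 1 - ln M)" for b x t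
  define G2 where "G2 b x t = (t - \<tau>) * (2 * (a1 b x t - a x t * w1 b x t / w x t)\<^sup>2 / w x t + 2 * a x t / w x t * a2 b x t - (a x t)\<^sup>2 / (w x t)\<^sup>2 * w2 b x t)
      + (ln (w x t) + 1 - ln M) * w2 b x t + (w1 b x t)\<^sup>2 / w x t" for b x t
  define Gt where "Gt x t = (a x t)\<^sup>2 / w x t + (t - \<tau>) * (2 * a x t / w x t * ((norm x)\<^sup>2 * (\<Sum>b\<in>Basis. a2 b x t)) - (a x t)\<^sup>2 / (w x t)\<^sup>2 * ((norm x)\<^sup>2 * (\<Sum>b\<in>Basis. w2 b x t)))
      + (ln (w x t) + 1 - ln M) * ((norm x)\<^sup>2 * (\<Sum>b\<in>Basis. w2 b x t))" for x t
  have wpos: "w x t > 0" if "x \<noteq> 0" "\<tau> \<le> t" for x t using w(1)[OF that] \<delta> by linarith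
  have Mw: "w x t \<le> M" "ln (w x t) \<le> ln M" if "x \<noteq> 0" "\<tau> \<le> t" for x t
    using w(2)[OF that] wpos[OF that] by auto
  have "F x t \<le> 0"
  proof (rule max_principle[of \<tau> t F "(t - \<tau>) * (A\<^sup>2 / \<delta>)" Gt G1 G2])
    show "continuous_on ({x. x \<noteq> 0} \<times> {\<tau>..t}) (\<lambda>z. F (fst z) (snd z))"
      unfolding F_def
      by (intro continuous_intros continuous_on_subset[OF cont(1)] continuous_on_subset[OF cont(2)])
        (use wpos in \<open>force+\<close>)
    \<comment> \<open>The bound \<open>A\<close> enters only here, as the a priori boundedness that
      the maximum principle demands; it does not appear in the conclusion.\<close>
    show "F x' t' \<le> (t - \<tau>) * (A\<^sup>2 / \<delta>)" if "x' \<noteq> 0" "t' \<in> {\<tau>..t}" for x' t'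
    proof -
      have t': "\<tau> \<le> t'" using that by auto
      have "(a x' t')\<^sup>2 \<le> A\<^sup>2" using a[OF that(1) t'] by (metis abs_ge_zero order_trans power2_abs power_mono)
      then have "(a x' t')\<^sup>2 / w x' t' \<le> A\<^sup>2 / \<delta>" using w(1)[OF that(1) t'] \<delta> by (intro frac_le) auto
      then have "(t' - \<tau>) * ((a x' t')\<^sup>2 / w x' t') \<le> (t - \<tau>) * (A\<^sup>2 / \<delta>)"
        using that t' wpos[OF that(1) t'] by (intro mult_mono) auto
      moreover have "w x' t' * (ln (w x' t') - ln M) \<le> 0"
        using wpos[OF that(1) t'] Mw[OF that(1) t'] by (intro mult_nonneg_nonpos) auto
      ultimately show ?thesis by (simp add: F_def)
    qed
    show "F x' \<tau> \<le> 0" if "x' \<noteq> 0" for x'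
      unfolding F_def using wpos[OF that order_refl] Mw[OF that order_refl]
      by (auto intro!: mult_nonneg_nonpos)
    show "(F x' has_real_derivative Gt x' t') (at t')" if "x' \<noteq> 0" "\<tau> < t'" "t' \<le> t" for x' t'
    proof -
      have wp: "w x' t' > 0" using wpos[of x' t'] that by simp
      note D = wt[OF that(1,2)] at[OF that(1,2)]
      show ?thesis unfolding F_def[abs_def]
        by (rule DERIV_cong[OF DERIV_add[OF DERIV_mult[OF DERIV_diff[OF DERIV_ident DERIV_const]
             DERIV_divide[OF DERIV_power[OF D(2), of 2] D(1)]] DERIV_mult[OF D(1) DERIV_diff[OF DERIV_chain2[OF DERIV_ln D(1)] DERIV_const]]]])
          (use wp in \<open>simp_all add: Gt_def\<close>, simp add: field_simps power2_eq_square)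
    qed
    show "((\<lambda>s. F (x' + s *\<^sub>R b) t') has_real_derivative G1 b (x' + s *\<^sub>R b) t') (at s)"
      if nz: "x' + s *\<^sub>R b \<noteq> 0" "\<tau> < t'" "t' \<le> t" for x' b s t'
    proof -
      have wp: "w (x' + s *\<^sub>R b) t' > 0" using wpos[of "x' + s *\<^sub>R b" t'] that by simp
      note D = w1[OF nz(1,2)] a1[OF nz(1,2)]
      show ?thesis unfolding F_def[abs_def]
        by (rule DERIV_cong[OF DERIV_add[OF DERIV_cmult[OF
             DERIV_divide[OF DERIV_power[OF D(2), of 2] D(1)]] DERIV_mult[OF D(1) DERIV_diff[OF DERIV_chain2[OF DERIV_ln D(1)] DERIV_const]]]])
          (use wp in \<open>simp_all add: G1_def\<close>, simp add: field_simps power2_eq_square)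
    qed
    show "((\<lambda>s. G1 b (x' + s *\<^sub>R b) t') has_real_derivative G2 b (x' + s *\<^sub>R b) t') (at s)"
      if nz: "x' + s *\<^sub>R b \<noteq> 0" "\<tau> < t'" "t' \<le> t" for x' b s t'
    proof -
      have wp: "w (x' + s *\<^sub>R b) t' > 0" using wpos[of "x' + s *\<^sub>R b" t'] that by simp
      note D = w1[OF nz(1,2)] a1[OF nz(1,2)] w2[OF nz(1,2)] a2[OF nz(1,2)]
      show ?thesis unfolding G1_def[abs_def]
        by (rule DERIV_cong[OF DERIV_add[OF DERIV_cmult[OF DERIV_diff[OF
             DERIV_divide[OF DERIV_mult[OF DERIV_cmult[OF D(2)] D(4)] D(1)]
             DERIV_divide[OF DERIV_mult[OF DERIV_power[OF D(2), of 2] D(3)] DERIV_power[OF D(1), of 2]]]]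
              DERIV_mult[OF D(3) DERIV_diff[OF DERIV_add[OF DERIV_chain2[OF DERIV_ln D(1)] DERIV_const] DERIV_const]]]])
          (use wp in \<open>simp_all add: G2_def\<close>, simp add: field_simps power2_eq_square power4_eq_xxxx)
    qed
    show "Gt x' t' \<le> (norm x')\<^sup>2 * (\<Sum>b\<in>Basis. G2 b x' t')" if nz: "x' \<noteq> 0" "\<tau> < t'" "t' \<le> t" for x' t'
    proof -
      have wp: "w x' t' > 0" using wpos[of x' t'] that by simp
      have S: "(\<Sum>b\<in>Basis. G2 b x' t') = (t' - \<tau>) * ((\<Sum>b\<in>Basis. 2 * (a1 b x' t' - a x' t' * w1 b x' t' / w x' t')\<^sup>2 / w x' t')
            + 2 * a x' t' / w x' t' * (\<Sum>b\<in>Basis. a2 b x' t') - (a x' t')\<^sup>2 / (w x' t')\<^sup>2 * (\<Sum>b\<in>Basis. w2 b x' t'))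
          + (ln (w x' t') + 1 - ln M) * (\<Sum>b\<in>Basis. w2 b x' t') + (\<Sum>b\<in>Basis. (w1 b x' t')\<^sup>2) / w x' t'"
        unfolding G2_def by (simp only: sum.distrib sum_subtractf sum_distrib_left[symmetric] sum_divide_distrib[symmetric])
      \<comment> \<open>The completed square coming from a^2/w; only its sign matters.\<close>
      define Z where "Z = (\<Sum>b\<in>Basis. 2 * (a1 b x' t' - a x' t' * w1 b x' t' / w x' t')\<^sup>2 / w x' t')"
      have "Z \<ge> 0" unfolding Z_def using wp by (intro sum_nonneg) auto
      then have "(norm x')\<^sup>2 * ((t' - \<tau>) * Z) \<ge> 0" using nz by auto
      moreover have "(a x' t')\<^sup>2 / w x' t' \<le> (norm x')\<^sup>2 * ((\<Sum>b\<in>Basis. (w1 b x' t')\<^sup>2) / w x' t')"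
        using divide_right_mono[OF grad[OF nz(1,2)], of "w x' t'"] wp by simp
      moreover have "(norm x')\<^sup>2 * (\<Sum>b\<in>Basis. G2 b x' t') - Gt x' t' = (norm x')\<^sup>2 * ((t' - \<tau>) * Z)
          + ((norm x')\<^sup>2 * ((\<Sum>b\<in>Basis. (w1 b x' t')\<^sup>2) / w x' t') - (a x' t')\<^sup>2 / w x' t')"
        unfolding S Z_def[symmetric] Gt_def by (simp add: algebra_simps)
      ultimately show ?thesis by linarith
    qed
  qed (use x t in auto)
  then have "(t - \<tau>) * ((a x t)\<^sup>2 / w x t) \<le> w x t * (ln M - ln (w x t))"
    unfolding F_def right_diff_distrib by linarith
  then have "w x t * ((t - \<tau>) * ((a x t)\<^sup>2 / w x t)) \<le> w x t * (w x t * (ln M - ln (w x t)))"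
    using wpos[OF x t] by (intro mult_left_mono) auto
  then show ?thesis using wpos[OF x t] by (simp add: power2_eq_square)
qed

section \<open>Kernels that can be differentiated inside the pairing\<close>

text \<open>Boundedness is uniform for x in an annulus but not up to the origin, where the kernels
  are singular. Together with the support condition this is stable under sums and under products
  with continuous factors, and it suffices for dominated convergence against the finite measure
  \<mu>_t.\<close>

definition tame :: "('a::euclidean_space \<Rightarrow> 'a \<Rightarrow> real) \<Rightarrow> bool" where
  "tame f \<longleftrightarrow> (\<forall>x. x \<noteq> 0 \<longrightarrow> f x \<in> borel_measurable borel) \<and>
     (\<forall>x y. x \<noteq> 0 \<longrightarrow> 4 * norm x < norm y \<longrightarrow> f x y = 0) \<and>
     (\<forall>r>0. \<forall>R. \<exists>C. \<forall>x y. r \<le> norm x \<longrightarrow> norm x \<le> R \<longrightarrow> \<bar>f x y\<bar> \<le> C)"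

lemma tame_measurable: "tame f \<Longrightarrow> x \<noteq> 0 \<Longrightarrow> f x \<in> borel_measurable borel"
  and tame_zero: "tame f \<Longrightarrow> x \<noteq> 0 \<Longrightarrow> 4 * norm x < norm y \<Longrightarrow> f x y = 0"
  and tame_local_bound: "tame f \<Longrightarrow> r > 0 \<Longrightarrow> \<exists>C. \<forall>x y. r \<le> norm x \<longrightarrow> norm x \<le> R \<longrightarrow> \<bar>f x y\<bar> \<le> C"
  unfolding tame_def by blast+

lemma tame_bound:
  assumes "tame f" "x \<noteq> 0"
  obtains C where "\<And>y. \<bar>f x y\<bar> \<le> C"
  using tame_local_bound[OF assms(1), of "norm x" "norm x"] assms(2) by auto

lemma tame_add:
  assumes f: "tame f" and g: "tame g"
  shows "tame (\<lambda>x y. f x y + g x y)"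
  unfolding tame_def
proof (intro conjI allI impI)
  show "(\<lambda>y. f x y + g x y) \<in> borel_measurable borel" if "x \<noteq> 0" for x
    using tame_measurable[OF f that] tame_measurable[OF g that] by (rule borel_measurable_add)
  show "f x y + g x y = 0" if "x \<noteq> 0" "4 * norm x < norm y" for x y
    using tame_zero[OF f that] tame_zero[OF g that] by simp
  fix r R :: real assume r: "r > 0"
  obtain C where C: "\<And>x y. r \<le> norm x \<Longrightarrow> norm x \<le> R \<Longrightarrow> \<bar>f x y\<bar> \<le> C" using tame_local_bound[OF f r, of R] by blast
  obtain D where D: "\<And>x y. r \<le> norm x \<Longrightarrow> norm x \<le> R \<Longrightarrow> \<bar>g x y\<bar> \<le> D" using tame_local_bound[OF g r, of R] by blast
  have "\<bar>f x y + g x y\<bar> \<le> C + D" if "r \<le> norm x" "norm x \<le> R" for x y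
    using C[OF that, of y] D[OF that, of y] by linarith
  then show "\<exists>C. \<forall>x y. r \<le> norm x \<longrightarrow> norm x \<le> R \<longrightarrow> \<bar>f x y + g x y\<bar> \<le> C" by blast
qed

text \<open>The factor \<open>g\<close> may be unbounded, for instance an inner product: only its
  values on the compact set |x| \<le> R, |y| \<le> 4 R count, as the kernel vanishes for larger
  |y|.\<close>

lemma tame_mult:
  assumes g: "continuous_on UNIV (\<lambda>z. g (fst z) (snd z))" and f: "tame f"
  shows "tame (\<lambda>x y. g x y * f x y)"
  unfolding tame_def
proof (intro conjI allI impI)
  show "(\<lambda>y. g x y * f x y) \<in> borel_measurable borel" if "x \<noteq> 0" for x
  proof -
    have "continuous_on UNIV (\<lambda>y. (\<lambda>z. g (fst z) (snd z)) (x, y))"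
      by (rule continuous_on_compose2[OF g]) (auto intro: continuous_intros)
    then have "g x \<in> borel_measurable borel" by (simp add: borel_measurable_continuous_onI)
    then show ?thesis using tame_measurable[OF f that] by (rule borel_measurable_times)
  qed
  show "g x y * f x y = 0" if "x \<noteq> 0" "4 * norm x < norm y" for x y
    using tame_zero[OF f that] by simp
  fix r R :: real assume r: "r > 0"
  obtain C where C: "\<And>x y. r \<le> norm x \<Longrightarrow> norm x \<le> R \<Longrightarrow> \<bar>f x y\<bar> \<le> C" using tame_local_bound[OF f r, of R] by blast
  have "compact ((\<lambda>z. g (fst z) (snd z)) ` (cball 0 R \<times> cball 0 (4 * R)))"
    by (intro compact_continuous_image continuous_on_subset[OF g] compact_Times) auto
  then obtain D where D: "\<And>x. x \<in> (\<lambda>z. g (fst z) (snd z)) ` (cball 0 R \<times> cball 0 (4 * R)) \<Longrightarrow> \<bar>x\<bar> \<le> D"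
    by (metis compact_imp_bounded bounded_iff real_norm_def)
  have "\<bar>g x y * f x y\<bar> \<le> \<bar>D\<bar> * \<bar>C\<bar>" if x: "r \<le> norm x" "norm x \<le> R" for x y
  proof (cases "4 * norm x < norm y")
    case True
    moreover have "x \<noteq> 0" using x r by auto
    ultimately have "f x y = 0" by (intro tame_zero[OF f])
    then show ?thesis by simp
  next
    case False
    then have "(x, y) \<in> cball 0 R \<times> cball 0 (4 * R)" using x by auto
    then have "\<bar>g x y\<bar> \<le> D" using D[of "g x y"] by force
    then show ?thesis using C[OF x, of y] unfolding abs_mult by (intro mult_mono) auto
  qed
  then show "\<exists>C. \<forall>x y. r \<le> norm x \<longrightarrow> norm x \<le> R \<longrightarrow> \<bar>g x y * f x y\<bar> \<le> C" by blast
qed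

lemma tame_ker:
  assumes e: "e \<le> 1/2" and N: "DIM('a::euclidean_space) \<ge> 2"
  shows "tame (ker i j e :: 'a \<Rightarrow> 'a \<Rightarrow> real)"
  unfolding tame_def
proof (intro conjI allI impI)
  show "ker i j e x \<in> borel_measurable borel" if "x \<noteq> 0" for x :: 'a by (rule ker_measurable[OF that])
  show "ker i j e x y = 0" if "x \<noteq> 0" "4 * norm x < norm y" for x y :: 'a
    by (rule ker_outside[OF e]) (use that in auto)
  fix r R :: real assume r: "r > 0"
  define m where "m = (real DIM('a) - 2) / 2"
  have m: "m \<ge> 0" using N by (simp add: m_def)
  have e1: "e \<le> 1" using e by simp
  obtain C where C: "C > 0" "\<And>p c. p > 0 \<Longrightarrow> \<bar>c\<bar> \<le> p \<Longrightarrow> \<bar>kphi i m e j p c\<bar> \<le> C * p powr (- (m + i + j))"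
    by (rule kphi_bound[OF e1, of i m j]) blast
  have "\<bar>ker i j e x y\<bar> \<le> C * (r\<^sup>2) powr (- (m + i + j))" if x: "r \<le> norm x" for x y :: 'a
  proof -
    have x0: "x \<noteq> 0" using x r by auto
    have "r\<^sup>2 \<le> (norm x)\<^sup>2" using x r by (intro power_mono) auto
    then have "r\<^sup>2 \<le> (norm x)\<^sup>2 + (norm y)\<^sup>2" by (simp add: add_increasing2)
    then have "((norm x)\<^sup>2 + (norm y)\<^sup>2) powr (- (m + i + j)) \<le> (r\<^sup>2) powr (- (m + i + j))"
      using r m by (intro powr_mono2') auto
    moreover have "\<bar>ker i j e x y\<bar> \<le> C * ((norm x)\<^sup>2 + (norm y)\<^sup>2) powr (- (m + i + j))"
      unfolding ker_def m_def[symmetric] using x0 by (intro C(2) sum_norm2_pos abs_inner_le_sum) auto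
    ultimately show ?thesis using C(1) by (meson mult_left_mono order_trans less_imp_le)
  qed
  then show "\<exists>C. \<forall>x y::'a. r \<le> norm x \<longrightarrow> norm x \<le> R \<longrightarrow> \<bar>ker i j e x y\<bar> \<le> C" by blast
qed

lemma tame_dker:
  assumes "e \<le> 1/2" "DIM('a::euclidean_space) \<ge> 2"
  shows "tame (dker i j e (v::'a))" "tame (ddker i j e (v::'a))"
proof -
  show 1: "tame (dker i j e v)" for i j and v :: 'a
    unfolding dker_def[abs_def] by (intro tame_add tame_mult tame_ker assms) (auto intro!: continuous_intros)
  show "tame (ddker i j e v)"
    unfolding ddker_def[abs_def] by (intro tame_add tame_mult tame_ker assms 1) (auto intro!: continuous_intros)
qed

lemma tame_kerB:
  assumes e: "e \<le> 1/2" and N: "DIM('a::euclidean_space) \<ge> 2" and B: "simil (B::'a \<Rightarrow> 'a) l"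
  shows "tame (kerB B l e)" "tame (dkerB B l e v)" "tame (ddkerB B l e v)"
proof -
  have bl: "bounded_linear B" using simil_linear[OF B] by (simp add: linear_conv_bounded_linear)
  have c: "continuous_on UNIV (\<lambda>z::'a \<times> 'a. B (fst z) \<bullet> snd z)" "continuous_on UNIV (\<lambda>z::'a \<times> 'a. B v \<bullet> snd z)" for v
    by (intro continuous_intros bounded_linear.continuous_on[OF bl])+
  show "tame (kerB B l e)"
    unfolding kerB_def[abs_def] by (intro tame_add tame_mult tame_ker tame_dker e N) (intro continuous_intros c)+
  show "tame (dkerB B l e v)"
    unfolding dkerB_def[abs_def] by (intro tame_add tame_mult tame_ker tame_dker e N) (intro continuous_intros c)+
  show "tame (ddkerB B l e v)"
    unfolding ddkerB_def[abs_def] by (intro tame_add tame_mult tame_ker tame_dker e N) (intro continuous_intros c)+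
qed

section \<open>Infinitesimal similarities with a prescribed value\<close>

text \<open>Nonnegativity of the Gram determinant of \<open>x\<close>, \<open>v\<close>,
  \<open>y\<close>. Removing the components along \<open>x\<close> from \<open>v\<close> and
  \<open>y\<close> reduces it to the Cauchy-Schwarz inequality.\<close>

lemma gram3_nonneg:
  fixes x y v :: "'a::euclidean_space"
  assumes "x \<noteq> 0"
  shows "(x \<bullet> v)\<^sup>2 * (y \<bullet> y) + (x \<bullet> y)\<^sup>2 * (v \<bullet> v) + (v \<bullet> y)\<^sup>2 * (x \<bullet> x) - 2 * (x \<bullet> y) * (v \<bullet> y) * (x \<bullet> v)
    \<le> (x \<bullet> x) * (v \<bullet> v) * (y \<bullet> y)"
proof -
  define X where "X = x \<bullet> x"
  have X: "X > 0" using assms by (simp add: X_def)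
  define p where "p = X *\<^sub>R v - (x \<bullet> v) *\<^sub>R x"
  define q where "q = X *\<^sub>R y - (x \<bullet> y) *\<^sub>R x"
  have pq: "p \<bullet> q = X * (X * (v \<bullet> y) - (x \<bullet> v) * (x \<bullet> y))"
    by (simp add: p_def q_def inner_diff_left inner_diff_right X_def[symmetric] inner_commute[of v x] algebra_simps)
  have pp: "p \<bullet> p = X * (X * (v \<bullet> v) - (x \<bullet> v)\<^sup>2)"
    by (simp add: p_def inner_diff_left inner_diff_right X_def[symmetric] inner_commute[of v x] algebra_simps power2_eq_square)
  have qq: "q \<bullet> q = X * (X * (y \<bullet> y) - (x \<bullet> y)\<^sup>2)"
    by (simp add: q_def inner_diff_left inner_diff_right X_def[symmetric] inner_commute[of y x] algebra_simps power2_eq_square)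
  define a b c A Y where "a = x \<bullet> v" "b = x \<bullet> y" "c = v \<bullet> y" "A = v \<bullet> v" "Y = y \<bullet> y"
  note d = this
  have "(X * (X * c - a * b))\<^sup>2 \<le> (X * (X * A - a\<^sup>2)) * (X * (X * Y - b\<^sup>2))"
    using Cauchy_Schwarz_ineq[of p q] unfolding pq pp qq d .
  then have "X\<^sup>2 * (X * c - a * b)\<^sup>2 \<le> X\<^sup>2 * ((X * A - a\<^sup>2) * (X * Y - b\<^sup>2))"
    by (simp add: power_mult_distrib power2_eq_square mult_ac)
  then have "(X * c - a * b)\<^sup>2 \<le> (X * A - a\<^sup>2) * (X * Y - b\<^sup>2)" using X by simp
  moreover have "(X * A - a\<^sup>2) * (X * Y - b\<^sup>2) - (X * c - a * b)\<^sup>2 = X * (X * A * Y - (a\<^sup>2 * Y + b\<^sup>2 * A + c\<^sup>2 * X - 2 * b * c * a))"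
    by (simp add: power2_eq_square algebra_simps)
  ultimately have "0 \<le> X * (X * A * Y - (a\<^sup>2 * Y + b\<^sup>2 * A + c\<^sup>2 * X - 2 * b * c * a))" by simp
  then have "a\<^sup>2 * Y + b\<^sup>2 * A + c\<^sup>2 * X - 2 * b * c * a \<le> X * A * Y" using X by (simp add: zero_le_mult_iff)
  then show ?thesis unfolding d X_def .
qed

text \<open>Any direction at a point x \<noteq> 0 is tangent to the flow of a similarity, so an
  estimate along all similarities is a full gradient estimate. The map is the multiple (x . v) /
  |x|^2 of the identity plus the skew map y \<mapsto> ((x . y) v - (v . y) x) / |x|^2; its norm is
  controlled by the Gram determinant.\<close>

lemma simil_exists:
  fixes x v :: "'a::euclidean_space"
  assumes x: "x \<noteq> 0" and v: "norm v \<le> norm x"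
  obtains B l where "simil B l" "B x = v"
proof -
  define X where "X = x \<bullet> x"
  have X: "X > 0" using x by (simp add: X_def)
  define A where "A y = (x \<bullet> v) *\<^sub>R y + (x \<bullet> y) *\<^sub>R v - (v \<bullet> y) *\<^sub>R x" for y
  define B where "B y = (1 / X) *\<^sub>R A y" for y
  have lin: "linear B"
  proof (rule linearI)
    show "B (a + b) = B a + B b" for a b
      unfolding B_def A_def inner_add_right scaleR_add_left scaleR_add_right scaleR_diff_right by simp
    show "B (r *\<^sub>R b) = r *\<^sub>R B b" for r b
      unfolding B_def A_def inner_scaleR_right by (simp only: scaleR_add_right scaleR_diff_right scaleR_scaleR mult_ac)
  qed
  have inn: "B y \<bullet> y = (x \<bullet> v) / X * (norm y)\<^sup>2" for y
    unfolding B_def A_def inner_scaleR_left inner_diff_left inner_add_left power2_norm_eq_inner by simp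
  have nrm: "norm (B y) \<le> norm y" for y
  proof -
    define a b c where "a = x \<bullet> v" "b = x \<bullet> y" "c = v \<bullet> y"
    note d = this
    have d': "v \<bullet> x = a" "y \<bullet> x = b" "y \<bullet> v = c" unfolding d by (rule inner_commute)+
    have "A y \<bullet> A y = (a * (a * (y \<bullet> y) + b * c - c * b) + b * (a * c + b * (v \<bullet> v) - c * a)) - c * (a * b + b * a - c * (x \<bullet> x))"
      unfolding A_def inner_diff_left inner_add_left inner_scaleR_left inner_diff_right inner_add_right inner_scaleR_right
        d[symmetric] d' ..
    also have "\<dots> = a\<^sup>2 * (y \<bullet> y) + b\<^sup>2 * (v \<bullet> v) + c\<^sup>2 * (x \<bullet> x) - 2 * b * c * a"
      by (simp add: power2_eq_square algebra_simps)
    also have "\<dots> \<le> X * (v \<bullet> v) * (y \<bullet> y)" unfolding X_def d by (rule gram3_nonneg[OF x])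
    also have "\<dots> \<le> X * X * (y \<bullet> y)"
    proof (intro mult_right_mono mult_left_mono)
      show "v \<bullet> v \<le> X" using power_mono[OF v, of 2] by (simp add: X_def power2_norm_eq_inner)
    qed (use X in auto)
    also have "\<dots> = (X * norm y)\<^sup>2" unfolding power_mult_distrib power2_norm_eq_inner power2_eq_square[of X] ..
    finally have "(norm (A y))\<^sup>2 \<le> (X * norm y)\<^sup>2" unfolding power2_norm_eq_inner[of "A y"] .
    then have "norm (A y) \<le> X * norm y" by (rule power2_le_imp_le) (use X in auto)
    then show ?thesis using X by (simp add: B_def divide_le_eq mult.commute)
  qed
  have "simil B ((x \<bullet> v) / X)" unfolding simil_def using lin inn nrm by blast
  moreover have "B x = v"
  proof -
    have "A x = X *\<^sub>R v" unfolding A_def X_def inner_commute[of v x] by simp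
    then show ?thesis using X by (simp add: B_def)
  qed
  ultimately show thesis by (rule that)
qed

lemma dker_inner_sum: "dker i j e v x y = (\<Sum>b\<in>Basis. (v \<bullet> b) * dker i j e b x y)"
proof -
  have "(\<Sum>b\<in>Basis. (v \<bullet> b) * dker i j e b x y) =
    2 * (\<Sum>b\<in>Basis. (x \<bullet> b) * (v \<bullet> b)) * ker (Suc i) j e x y + (\<Sum>b\<in>Basis. (v \<bullet> b) * (y \<bullet> b)) * ker i (Suc j) e x y"
    unfolding sum_distrib_left sum_distrib_right sum.distrib[symmetric] dker_def
    by (intro sum.cong) (auto simp: algebra_simps inner_commute[of _ y])
  then show ?thesis by (simp add: dker_def euclidean_inner[symmetric])
qed

section \<open>Averages of a solution and their gradients\<close>

context global_solution
begin

lemma tame_pairing_integrable: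
  assumes "tame f" "x \<noteq> 0" "t \<in> I"
  shows "integrable lebesgue (\<lambda>y. f x y * dens u t y)"
proof -
  obtain C where "\<And>y. \<bar>f x y\<bar> \<le> C" using tame_bound[OF assms(1,2)] by blast
  then show ?thesis using pairing_integrable[OF assms(3) tame_measurable[OF assms(1,2)]] by blast
qed

lemma pairing_sum:
  assumes "\<And>b. b \<in> A \<Longrightarrow> integrable lebesgue (\<lambda>y. g b y * dens u t y)"
  shows "P (\<lambda>y. \<Sum>b\<in>A. c b * g b y) t = (\<Sum>b\<in>A. c b * P (g b) t)"
proof -
  have "P (\<lambda>y. \<Sum>b\<in>A. c b * g b y) t = (LINT y|lebesgue. (\<Sum>b\<in>A. c b * (g b y * dens u t y)))"
    unfolding pairing_def by (simp add: sum_distrib_right mult.assoc)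
  also have "\<dots> = (\<Sum>b\<in>A. LINT y|lebesgue. c b * (g b y * dens u t y))"
    using assms by (intro Bochner_Integration.integral_sum integrable_mult_right)
  finally show ?thesis by (simp add: pairing_def)
qed

lemma tame_line_deriv:
  assumes f: "tame f" and f': "tame f'" and t: "t \<in> I" and x: "x + s *\<^sub>R v \<noteq> 0"
    and d: "\<And>s y. x + s *\<^sub>R v \<noteq> 0 \<Longrightarrow> ((\<lambda>s. f (x + s *\<^sub>R v) y) has_real_derivative f' (x + s *\<^sub>R v) y) (at s)"
  shows "((\<lambda>s. P (f (x + s *\<^sub>R v)) t) has_real_derivative P (f' (x + s *\<^sub>R v)) t) (at s)"
proof -
  define z where "z = x + s *\<^sub>R v"
  \<comment> \<open>A step small enough that the line stays in the annulus between |z|/2 and 2 |z|,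
    where tame kernels are bounded uniformly. The 1 in the denominator covers
    \<open>v = 0\<close>.\<close>
  define e where "e = norm z / 2 / (norm v + 1)"
  have nv: "norm v + 1 > 0" by (simp add: add_nonneg_pos)
  have ev: "e * (norm v + 1) = norm z / 2" by (rule iffD1[OF nonzero_eq_divide_eq e_def]) (use nv in linarith)
  have e: "e > 0" using x nv by (simp add: e_def z_def)
  have near: "norm z / 2 \<le> norm (x + r *\<^sub>R v)" "norm (x + r *\<^sub>R v) \<le> 2 * norm z" if "\<bar>r - s\<bar> < e" for r
  proof -
    have eq: "x + r *\<^sub>R v = z + (r - s) *\<^sub>R v" by (simp add: z_def algebra_simps)
    have "\<bar>r - s\<bar> * norm v \<le> e * (norm v + 1)" using that by (intro mult_mono) auto
    also have "\<dots> = norm z / 2" by (rule ev)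
    finally have "norm ((r - s) *\<^sub>R v) \<le> norm z / 2" by simp
    then show "norm z / 2 \<le> norm (x + r *\<^sub>R v)" "norm (x + r *\<^sub>R v) \<le> 2 * norm z"
      using norm_diff_ineq[of z "(r - s) *\<^sub>R v"] norm_triangle_ineq[of z "(r - s) *\<^sub>R v"] unfolding eq by auto
  qed
  have z2: "norm z / 2 > 0" using x by (simp add: z_def)
  obtain C where C: "\<And>x y. norm z / 2 \<le> norm x \<Longrightarrow> norm x \<le> 2 * norm z \<Longrightarrow> \<bar>f x y\<bar> \<le> C"
    using tame_local_bound[OF f z2, of "2 * norm z"] by blast
  obtain D where D: "\<And>x y. norm z / 2 \<le> norm x \<Longrightarrow> norm x \<le> 2 * norm z \<Longrightarrow> \<bar>f' x y\<bar> \<le> D"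
    using tame_local_bound[OF f' z2, of "2 * norm z"] by blast
  have nz: "x + r *\<^sub>R v \<noteq> 0" if "\<bar>r - s\<bar> < e" for r using near(1)[OF that] z2 by auto
  show ?thesis
    unfolding pairing_def
  proof (rule has_real_derivative_integral[OF slice_integrable[OF t] e])
    show "f (x + r *\<^sub>R v) \<in> borel_measurable lebesgue" if "\<bar>r - s\<bar> < e" for r
      by (rule borel_measurable_lebesgueI[OF tame_measurable[OF f nz[OF that]]])
    show "((\<lambda>s. f (x + s *\<^sub>R v) y) has_real_derivative f' (x + r *\<^sub>R v) y) (at r)" if "\<bar>r - s\<bar> < e" for r y
      by (rule d[OF nz[OF that]])
    show "\<bar>f' (x + r *\<^sub>R v) y\<bar> \<le> D" if "\<bar>r - s\<bar> < e" for r y by (rule D[OF near[OF that]])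
    show "\<bar>f (x + r *\<^sub>R v) y\<bar> \<le> C" if "\<bar>r - s\<bar> < e" for r y by (rule C[OF near[OF that]])
  qed
qed

text \<open>Moving the time costs a multiple of the weighted distance, uniformly over the bounded
  kernels f (X n); moving the point at the fixed time is dominated convergence.\<close>

lemma tame_joint_continuous:
  assumes f: "tame f" and c: "\<And>x y. x \<noteq> 0 \<Longrightarrow> isCont (\<lambda>x. f x y) x"
  shows "continuous_on ({x. x \<noteq> 0} \<times> I) (\<lambda>z. P (f (fst z)) (snd z))"
  unfolding continuous_on_sequentially
proof (intro allI ballI impI)
  fix z :: "nat \<Rightarrow> 'a \<times> real" and z0 assume z0: "z0 \<in> {x. x \<noteq> 0} \<times> I"
    and z: "(\<forall>n. z n \<in> {x. x \<noteq> 0} \<times> I) \<and> z \<longlonglongrightarrow> z0"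
  obtain x0 t0 where zt: "z0 = (x0, t0)" by (cases z0)
  have x0: "x0 \<noteq> 0" and t0: "t0 \<in> I" using z0 zt by auto
  have zI: "fst (z n) \<noteq> 0" "snd (z n) \<in> I" for n using z by (auto simp: mem_Times_iff)
  have lim: "(\<lambda>n. fst (z n)) \<longlonglongrightarrow> x0" "(\<lambda>n. snd (z n)) \<longlonglongrightarrow> t0"
    using z zt tendsto_fst[of z z0 sequentially] tendsto_snd[of z z0 sequentially] by auto
  have n2: "norm x0 / 2 > 0" using x0 by simp
  obtain C where C: "\<And>x y. norm x0 / 2 \<le> norm x \<Longrightarrow> norm x \<le> 2 * norm x0 \<Longrightarrow> \<bar>f x y\<bar> \<le> C"
    using tame_local_bound[OF f n2, of "2 * norm x0"] by blast
  have "\<forall>\<^sub>F n in sequentially. dist (norm (fst (z n))) (norm x0) < norm x0 / 2"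
    by (rule tendstoD[OF tendsto_norm[OF lim(1)] n2])
  then obtain k where k: "\<And>n. n \<ge> k \<Longrightarrow> \<bar>norm (fst (z n)) - norm x0\<bar> < norm x0 / 2"
    by (auto simp: eventually_sequentially dist_real_def)
  have near: "norm x0 / 2 \<le> norm (fst (z (n + k)))" "norm (fst (z (n + k))) \<le> 2 * norm x0" for n
  proof -
    have "\<bar>norm (fst (z (n + k))) - norm x0\<bar> < norm x0 / 2" by (rule k) simp
    then show "norm x0 / 2 \<le> norm (fst (z (n + k)))" "norm (fst (z (n + k))) \<le> 2 * norm x0"
      using norm_ge_zero[of x0] by linarith+
  qed
  define X T where "X n = fst (z (n + k))" and "T n = snd (z (n + k))" for n
  have X: "X n \<noteq> 0" "T n \<in> I" "\<bar>f (X n) y\<bar> \<le> C" for n y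
    using zI C[OF near] by (auto simp: X_def T_def)
  have lX: "X \<longlonglongrightarrow> x0" "T \<longlonglongrightarrow> t0"
    unfolding X_def T_def using lim by (auto intro: LIMSEQ_ignore_initial_segment)
  have 1: "(\<lambda>n. P (f (X n)) t0) \<longlonglongrightarrow> P (f x0) t0"
  proof (rule pairing_tendsto[OF t0 tame_measurable[OF f X(1)] X(3) _ tame_measurable[OF f x0]])
    show "(\<lambda>n. f (X n) y) \<longlonglongrightarrow> f x0 y" for y
      using isCont_tendsto_compose[OF c[OF x0] lX(1)] .
  qed
  define D where "D s = L12_dist (\<lambda>x. u (x, s)) (\<lambda>x. u (x, t0))" for s
  have D0: "D t0 = 0" by (simp add: D_def L12_dist_dens)
  have "(D \<longlongrightarrow> D t0) (at t0 within I)" using slice_cont[OF t0, folded D_def] by (simp only: D0)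
  then have "(\<lambda>n. D (T n)) \<longlonglongrightarrow> D t0"
    using lX(2) X(2) by (intro continuous_within_tendsto_compose'[of t0 I D]) (auto simp: continuous_within)
  then have "(\<lambda>n. C * D (T n)) \<longlonglongrightarrow> 0"
    unfolding D0 by (rule tendsto_mult_right_zero)
  then have 2: "(\<lambda>n. P (f (X n)) (T n) - P (f (X n)) t0) \<longlonglongrightarrow> 0"
    by (rule Lim_null_comparison[rotated])
      (auto intro!: always_eventually pairing_diff_bound X t0 tame_measurable[OF f] simp: D_def)
  have "(\<lambda>n. P (f (X n)) (T n)) \<longlonglongrightarrow> P (f x0) t0"
    using tendsto_add[OF 1 2] by simp
  then have "(\<lambda>n. P (f (fst (z n))) (snd (z n))) \<longlonglongrightarrow> P (f x0) t0"
    unfolding X_def T_def by (rule LIMSEQ_offset[where k=k and f="\<lambda>n. P (f (fst (z n))) (snd (z n))"])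
  then show "((\<lambda>z. P (f (fst z)) (snd z)) \<circ> z) \<longlonglongrightarrow> P (f (fst z0)) (snd z0)"
    by (simp add: o_def zt)
qed

text \<open>The kernel identity moves |y|^2 \<Delta>_y to |x|^2 \<Delta>_x, which can be taken out
  of the pairing. So the weak equation tested with the kernel becomes the classical equation in
  \<open>x\<close>.\<close>

lemma ker_time_deriv:
  assumes e: "e \<le> 1/2" and N: "DIM('a) \<ge> 2" and x: "x \<noteq> 0" and t: "t > 0"
  shows "(P (ker 0 0 e x) has_real_derivative (norm x)\<^sup>2 * (\<Sum>b\<in>Basis. P (ddker 0 0 e b x) t)) (at t)"
proof -
  have "(P (ker 0 0 e x) has_real_derivative P (\<lambda>y. (norm y)\<^sup>2 * lap (ker 0 0 e x) y) t) (at t)"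
  proof (rule pairing_deriv[OF smooth_ker[OF x] _ t])
    show "ker 0 0 e x y = 0" if "norm y > 4 * norm x" for y
      using that x by (intro ker_outside[OF e]) auto
  qed
  also have "(\<lambda>y. (norm y)\<^sup>2 * lap (ker 0 0 e x) y) = (\<lambda>y. \<Sum>b\<in>Basis. (norm x)\<^sup>2 * ddker 0 0 e b x y)"
    by (simp only: lap_ker[OF x] ker_laplace_identity[OF x, symmetric] ddker_sum sum_distrib_left[symmetric])
  also have "P \<dots> t = (\<Sum>b\<in>Basis. (norm x)\<^sup>2 * P (ddker 0 0 e b x) t)"
    by (rule pairing_sum) (intro tame_pairing_integrable tame_dker e N x pos_I t)
  finally show ?thesis by (simp only: sum_distrib_left)
qed

lemma kerB_time_deriv:
  assumes e: "e \<le> 1/2" and N: "DIM('a) \<ge> 2" and x: "x \<noteq> 0" and t: "t > 0" and B: "simil B l"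
  shows "(P (kerB B l e x) has_real_derivative (norm x)\<^sup>2 * (\<Sum>b\<in>Basis. P (ddkerB B l e b x) t)) (at t)"
proof -
  have "(P (kerB B l e x) has_real_derivative P (\<lambda>y. (norm y)\<^sup>2 * lap (kerB B l e x) y) t) (at t)"
    by (rule pairing_deriv[OF smooth_kerB[OF x] _ t]) (rule tame_zero[OF tame_kerB(1)[OF e N B] x])
  also have "(\<lambda>y. (norm y)\<^sup>2 * lap (kerB B l e x) y) = (\<lambda>y. \<Sum>b\<in>Basis. (norm x)\<^sup>2 * ddkerB B l e b x y)"
    by (simp only: kerB_laplace_identity[OF x B, symmetric] sum_distrib_left[symmetric])
  also have "P \<dots> t = (\<Sum>b\<in>Basis. (norm x)\<^sup>2 * P (ddkerB B l e b x) t)"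
    by (rule pairing_sum) (intro tame_pairing_integrable tame_kerB e N x pos_I t B)
  finally show ?thesis by (simp only: sum_distrib_left)
qed

text \<open>Division by the total mass of the kernel makes the average of a constant solution that
  constant. \<open>davg\<close> is the derivative of the average along \<open>v\<close>.\<close>

definition avg :: "real \<Rightarrow> 'a \<Rightarrow> real \<Rightarrow> real" where
  "avg e x t = P (ker 0 0 e x) t / kmass TYPE('a) e"

definition davg :: "real \<Rightarrow> 'a \<Rightarrow> 'a \<Rightarrow> real \<Rightarrow> real" where
  "davg e v x t = P (dker 0 0 e v x) t / kmass TYPE('a) e"

text \<open>The normalisation cancels the total mass in \<open>pairing_upper\<close>, so the bound
  is that of the solution itself, whatever the scale.\<close>

lemma avg_bounds:
  assumes N: "DIM('a) \<ge> 2" and \<tau>: "\<tau> > 0"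
  obtains C where "C > 0" "\<And>e x t. 0 < e \<Longrightarrow> e \<le> 1/2 \<Longrightarrow> x \<noteq> 0 \<Longrightarrow> \<tau> \<le> t \<Longrightarrow> 0 \<le> avg e x t"
    "\<And>e x t. 0 < e \<Longrightarrow> e \<le> 1/2 \<Longrightarrow> x \<noteq> 0 \<Longrightarrow> \<tau> \<le> t \<Longrightarrow> avg e x t \<le> C"
proof -
  obtain C where C: "C > 0" "\<And>f t B. f \<in> borel_measurable borel \<Longrightarrow> (\<And>y. \<bar>f y\<bar> \<le> B) \<Longrightarrow> (\<And>y. 0 \<le> f y)
     \<Longrightarrow> integrable lebesgue (\<lambda>y. f y / (norm y)\<^sup>2) \<Longrightarrow> t \<ge> \<tau>
     \<Longrightarrow> P f t \<le> C * (LINT y|lebesgue. f y / (norm y)\<^sup>2)"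
    by (rule pairing_upper[OF \<tau>]) blast
  have b: "0 \<le> avg e x t \<and> avg e x t \<le> C" if e: "0 < e" "e \<le> 1/2" and x: "x \<noteq> 0" and t: "\<tau> \<le> t" for e x t
  proof -
    obtain B where B: "\<And>y. \<bar>ker 0 0 e x y\<bar> \<le> B" using tame_bound[OF tame_ker[OF e(2) N] x] by blast
    have "P (ker 0 0 e x) t \<le> C * kmass TYPE('a) e"
      using C(2)[OF ker_measurable[OF x] B ker_nonneg kmass_integral(2)[OF x e(2) N] t]
      by (simp only: kmass_integral(1)[OF x e(2) N])
    moreover have "0 \<le> P (ker 0 0 e x) t"
      using t \<tau> by (intro pairing_nonneg[OF pos_I ker_measurable[OF x] B ker_nonneg]) auto
    ultimately show ?thesis using kmass_pos[OF e N] by (simp add: avg_def divide_le_eq)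
  qed
  show thesis by (rule that[OF C(1)]) (use b in auto)
qed

text \<open>Hamilton's estimate for the average plus \<delta> and for its derivative along a
  similarity \<open>B\<close> with \<open>B x = v\<close>. Both solve the equation, and the
  resulting inequality carries no constant that depends on \<open>e\<close>.\<close>

lemma avg_gradient:
  assumes N: "DIM('a) \<ge> 2" and \<tau>: "\<tau> > 0"
    and C: "C > 0" "\<And>e x t. 0 < e \<Longrightarrow> e \<le> 1/2 \<Longrightarrow> x \<noteq> 0 \<Longrightarrow> \<tau> \<le> t \<Longrightarrow> 0 \<le> avg e x t"
    "\<And>e x t. 0 < e \<Longrightarrow> e \<le> 1/2 \<Longrightarrow> x \<noteq> 0 \<Longrightarrow> \<tau> \<le> t \<Longrightarrow> avg e x t \<le> C"
    and e: "0 < e" "e \<le> 1/4" and \<delta>: "\<delta> > 0" and x: "x \<noteq> 0" and v: "norm v \<le> norm x" and t: "\<tau> \<le> t"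
  shows "(t - \<tau>) * (davg e v x t)\<^sup>2 \<le> (avg e x t + \<delta>)\<^sup>2 * (ln (C + \<delta>) - ln (avg e x t + \<delta>))"
proof -
  obtain B l where B: "simil B l" "B x = v" by (rule simil_exists[OF x v])
  define K where "K = kmass TYPE('a) e"
  have e2: "e \<le> 1/2" using e by simp
  have K: "K > 0" unfolding K_def by (rule kmass_pos[OF e(1) e2 N])
  define a where "a x t = P (kerB B l e x) t / K" for x t
  obtain C1 where C1: "C1 > 0" "\<And>x y. x \<noteq> 0 \<Longrightarrow> \<bar>kerB B l e x y\<bar> \<le> C1 * ker 0 0 (2 * e) x y"
    by (rule kerB_bound[OF e B(1)]) blast
  \<comment> \<open>The derivative is dominated by the average at scale \<open>2 * e\<close>, hence
    the restriction e \<le> 1/4. This bound may explode as \<open>e\<close> tends to 0.\<close>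
  define A where "A = C1 * (C * kmass TYPE('a) (2 * e)) / K"
  have tI: "t \<in> I" if "\<tau> \<le> t" for t using that \<tau> pos_I by simp
  have "(t - \<tau>) * (a x t)\<^sup>2 \<le> (avg e x t + \<delta>)\<^sup>2 * (ln (C + \<delta>) - ln (avg e x t + \<delta>))"
  proof (rule hamilton_estimate[of \<delta> \<tau> "\<lambda>x t. avg e x t + \<delta>" "C + \<delta>" a A
       "\<lambda>b x t. P (ddker 0 0 e b x) t / K" "\<lambda>b x t. P (ddkerB B l e b x) t / K"
       "\<lambda>b x t. P (dker 0 0 e b x) t / K" "\<lambda>b x t. P (dkerB B l e b x) t / K"])
    show "\<delta> \<le> avg e x t + \<delta>" "avg e x t + \<delta> \<le> C + \<delta>" if "x \<noteq> 0" "\<tau> \<le> t" for x t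
      using C(2,3)[OF e(1) e2 that] by auto
    show "\<bar>a x t\<bar> \<le> A" if x: "x \<noteq> 0" and t: "\<tau> \<le> t" for x t
    proof -
      have e2': "0 < 2 * e" "2 * e \<le> 1/2" using e by auto
      obtain D where D: "\<And>y. \<bar>ker 0 0 (2 * e) x y\<bar> \<le> D" using tame_bound[OF tame_ker[OF e2'(2) N] x] by blast
      obtain E where E: "\<And>y. \<bar>kerB B l e x y\<bar> \<le> E" using tame_bound[OF tame_kerB(1)[OF e2 N B(1)] x] by blast
      note m = tame_measurable[OF tame_kerB(1)[OF e2 N B(1)] x] ker_measurable[OF x, of 0 0 "2 * e"]
      have lin: "P (\<lambda>y. c * ker 0 0 (2 * e) x y + 0 * ker 0 0 (2 * e) x y) t = c * P (ker 0 0 (2 * e) x) t" for c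
        by (subst pairing_linear[OF tI[OF t] m(2) D m(2) D]) simp
      have bd: "\<bar>c * ker 0 0 (2 * e) x y + 0 * ker 0 0 (2 * e) x y\<bar> \<le> \<bar>c\<bar> * D" for c y
        using D[of y] by (simp add: abs_mult mult_left_mono)
      have mm: "(\<lambda>y. c * ker 0 0 (2 * e) x y + 0 * ker 0 0 (2 * e) x y) \<in> borel_measurable borel" for c
        using m(2) by simp
      have "P (kerB B l e x) t \<le> C1 * P (ker 0 0 (2 * e) x) t"
        unfolding lin[symmetric] using C1(2)[OF x]
        by (intro pairing_mono[OF tI[OF t] m(1) E mm bd]) (auto dest: abs_le_D1)
      moreover have "(- C1) * P (ker 0 0 (2 * e) x) t \<le> P (kerB B l e x) t"
        unfolding lin[symmetric]
      proof (rule pairing_mono[OF tI[OF t] mm bd m(1) E])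
        show "- C1 * ker 0 0 (2 * e) x y + 0 * ker 0 0 (2 * e) x y \<le> kerB B l e x y" for y
          using C1(2)[OF x, of y] by (simp add: abs_le_iff)
      qed
      ultimately have "\<bar>P (kerB B l e x) t\<bar> \<le> C1 * P (ker 0 0 (2 * e) x) t" by simp
      also have "\<dots> \<le> C1 * (C * kmass TYPE('a) (2 * e))"
        using C(3)[OF e2' x t] kmass_pos[OF e2' N] C1(1) by (intro mult_left_mono) (auto simp: avg_def divide_le_eq)
      finally show ?thesis using K by (simp add: a_def A_def abs_divide divide_right_mono)
    qed
    have sub: "{x. x \<noteq> 0} \<times> {\<tau>..} \<subseteq> {x. x \<noteq> (0::'a)} \<times> I" using tI by auto
    show "continuous_on ({x. x \<noteq> 0} \<times> {\<tau>..}) (\<lambda>z. avg e (fst z) (snd z) + \<delta>)"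
      unfolding avg_def K_def[symmetric] using K
      by (intro continuous_intros continuous_on_subset[OF tame_joint_continuous[OF tame_ker[OF e2 N]] sub])
        (auto intro: has_derivative_continuous[OF ker_has_derivative])
    show "continuous_on ({x. x \<noteq> 0} \<times> {\<tau>..}) (\<lambda>z. a (fst z) (snd z))"
      unfolding a_def using K
    proof (intro continuous_intros continuous_on_subset[OF tame_joint_continuous[OF tame_kerB(1)[OF e2 N B(1)]] sub])
      fix x y :: 'a assume x: "x \<noteq> 0"
      have bl: "bounded_linear B" using simil_linear[OF B(1)] by (simp add: linear_conv_bounded_linear)
      have k: "isCont (\<lambda>x. ker i j e x y) x" for i j
        using x by (intro has_derivative_continuous[OF ker_has_derivative]) auto
      show "isCont (\<lambda>x. kerB B l e x y) x" unfolding kerB_def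
        by (intro continuous_intros k bounded_linear.isCont[OF bl])
    qed auto
    show "((\<lambda>t. avg e x t + \<delta>) has_real_derivative (norm x)\<^sup>2 * (\<Sum>b\<in>Basis. P (ddker 0 0 e b x) t / K)) (at t)"
      if "x \<noteq> 0" "\<tau> < t" for x t
      unfolding avg_def K_def[symmetric] sum_divide_distrib[symmetric]
      by (rule DERIV_cong[OF DERIV_add[OF DERIV_cdivide[OF ker_time_deriv[OF e2 N that(1)]] DERIV_const]]) (use that \<tau> in auto)
    show "(a x has_real_derivative (norm x)\<^sup>2 * (\<Sum>b\<in>Basis. P (ddkerB B l e b x) t / K)) (at t)"
      if "x \<noteq> 0" "\<tau> < t" for x t
      unfolding a_def[abs_def] sum_divide_distrib[symmetric]
      by (rule DERIV_cong[OF DERIV_cdivide[OF kerB_time_deriv[OF e2 N that(1) _ B(1)]]]) (use that \<tau> in auto)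
    fix x b :: 'a and s t :: real assume nz: "x + s *\<^sub>R b \<noteq> 0" and "\<tau> < t"
    then have t: "t \<in> I" using tI by simp
    show "((\<lambda>s. avg e (x + s *\<^sub>R b) t + \<delta>) has_real_derivative P (dker 0 0 e b (x + s *\<^sub>R b)) t / K) (at s)"
      unfolding avg_def K_def[symmetric]
      by (rule DERIV_cong[OF DERIV_add[OF DERIV_cdivide[OF tame_line_deriv[OF tame_ker[OF e2 N] tame_dker(1)[OF e2 N] t nz ker_line]] DERIV_const]]) auto
    show "((\<lambda>s. P (dker 0 0 e b (x + s *\<^sub>R b)) t / K) has_real_derivative P (ddker 0 0 e b (x + s *\<^sub>R b)) t / K) (at s)"
      by (rule DERIV_cdivide[OF tame_line_deriv[OF tame_dker(1)[OF e2 N] tame_dker(2)[OF e2 N] t nz dker_line]]) auto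
    show "((\<lambda>s. a (x + s *\<^sub>R b) t) has_real_derivative P (dkerB B l e b (x + s *\<^sub>R b)) t / K) (at s)"
      unfolding a_def
      by (rule DERIV_cdivide[OF tame_line_deriv[OF tame_kerB(1)[OF e2 N B(1)] tame_kerB(2)[OF e2 N B(1)] t nz kerB_line[OF _ B(1)]]]) auto
    show "((\<lambda>s. P (dkerB B l e b (x + s *\<^sub>R b)) t / K) has_real_derivative P (ddkerB B l e b (x + s *\<^sub>R b)) t / K) (at s)"
      by (rule DERIV_cdivide[OF tame_line_deriv[OF tame_kerB(2)[OF e2 N B(1)] tame_kerB(3)[OF e2 N B(1)] t nz dkerB_line[OF _ B(1)]]]) auto
  next
    \<comment> \<open>The derivative along B x is the inner product of B x with the gradient, and |B
      x| \<le> |x|.\<close>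
    show "(a x t)\<^sup>2 \<le> (norm x)\<^sup>2 * (\<Sum>b\<in>Basis. (P (dker 0 0 e b x) t / K)\<^sup>2)" if x: "x \<noteq> 0" and "\<tau> < t" for x t
    proof -
      have t: "t \<in> I" using tI \<open>\<tau> < t\<close> by simp
      have "kerB B l e x = (\<lambda>y. \<Sum>b\<in>Basis. (B x \<bullet> b) * dker 0 0 e b x y)"
        unfolding kerB_eq_dker[OF B(1), abs_def] by (rule ext) (rule dker_inner_sum)
      then have "P (kerB B l e x) t = (\<Sum>b\<in>Basis. (B x \<bullet> b) * P (dker 0 0 e b x) t)"
        by (simp only:) (intro pairing_sum tame_pairing_integrable tame_dker e2 N x t)
      then have "a x t = (\<Sum>b\<in>Basis. (B x \<bullet> b) * (P (dker 0 0 e b x) t / K))"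
        by (simp add: a_def sum_divide_distrib)
      then have "(a x t)\<^sup>2 \<le> (\<Sum>b\<in>Basis. (B x \<bullet> b)\<^sup>2) * (\<Sum>b\<in>Basis. (P (dker 0 0 e b x) t / K)\<^sup>2)"
        by (simp only:) (rule Cauchy_Schwarz_ineq_sum)
      also have "(\<Sum>b\<in>Basis. (B x \<bullet> b)\<^sup>2) = (norm (B x))\<^sup>2"
        unfolding power2_eq_square[of "_ \<bullet> _"] power2_norm_eq_inner by (rule euclidean_inner[symmetric])
      also have "(norm (B x))\<^sup>2 * (\<Sum>b\<in>Basis. (P (dker 0 0 e b x) t / K)\<^sup>2) \<le> (norm x)\<^sup>2 * (\<Sum>b\<in>Basis. (P (dker 0 0 e b x) t / K)\<^sup>2)"
        using simil_norm[OF B(1), of x] by (intro mult_right_mono power_mono sum_nonneg) auto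
      finally show ?thesis .
    qed
  qed (use \<delta> x t in auto)
  then show ?thesis by (simp add: a_def davg_def K_def kerB_eq_dker[OF B(1), abs_def] B(2))
qed

lemma avg_line:
  assumes N: "DIM('a) \<ge> 2" and e: "e \<le> 1/2" and t: "t \<in> I" and nz: "x + s *\<^sub>R v \<noteq> 0"
  shows "((\<lambda>s. avg e (x + s *\<^sub>R v) t) has_real_derivative davg e v (x + s *\<^sub>R v) t) (at s)"
  unfolding avg_def davg_def
  by (rule DERIV_cdivide[OF tame_line_deriv[OF tame_ker[OF e N] tame_dker(1)[OF e N] t nz ker_line]]) auto

lemma davg_scale: "davg e (c *\<^sub>R v) x t = c * davg e v x t"
proof -
  have "dker 0 0 e (c *\<^sub>R v) x = (\<lambda>y. c * dker 0 0 e v x y)" for x :: 'a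
    by (rule ext) (simp add: dker_def algebra_simps)
  then show ?thesis by (simp add: davg_def pairing_def mult.assoc)
qed

text \<open>Both sides of the square root of \<open>avg_gradient\<close> are linear in the length of
  the direction, so scaling \<open>v\<close> to the length of \<open>x\<close> removes the
  restriction on \<open>v\<close>.\<close>

lemma avg_gradient':
  assumes N: "DIM('a) \<ge> 2" and \<tau>: "\<tau> > 0"
    and C: "C > 0" "\<And>e x t. 0 < e \<Longrightarrow> e \<le> 1/2 \<Longrightarrow> x \<noteq> 0 \<Longrightarrow> \<tau> \<le> t \<Longrightarrow> 0 \<le> avg e x t"
    "\<And>e x t. 0 < e \<Longrightarrow> e \<le> 1/2 \<Longrightarrow> x \<noteq> 0 \<Longrightarrow> \<tau> \<le> t \<Longrightarrow> avg e x t \<le> C"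
    and e: "0 < e" "e \<le> 1/4" and \<delta>: "\<delta> > 0" and x: "x \<noteq> 0" and t: "\<tau> < t"
  shows "\<bar>davg e v x t\<bar> * norm x * sqrt (t - \<tau>) \<le> norm v * ((avg e x t + \<delta>) * sqrt (ln (C + \<delta>) - ln (avg e x t + \<delta>)))"
proof (cases "v = 0")
  case True
  then show ?thesis using davg_scale[of e 0 v x t] by simp
next
  case False
  define c where "c = norm x / norm v"
  have nv: "norm v > 0" using False by simp
  have c: "c > 0" unfolding c_def using nv x by (intro divide_pos_pos) auto
  have cv: "c * norm v = norm x" unfolding c_def using nv by simp
  define W L d s where "W = avg e x t + \<delta>" "L = ln (C + \<delta>) - ln (avg e x t + \<delta>)" "d = \<bar>davg e v x t\<bar>" "s = sqrt (t - \<tau>)"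
  note defs = this
  have b: "0 \<le> avg e x t" "avg e x t \<le> C" using C(2,3)[OF e(1) _ x] e t by auto
  have W: "W > 0" and L: "L \<ge> 0" using b \<delta> by (auto simp: defs)
  have "norm (c *\<^sub>R v) \<le> norm x" using c cv by simp
  from avg_gradient[OF N \<tau> C e \<delta> x this less_imp_le[OF t]]
  have g: "(t - \<tau>) * (davg e (c *\<^sub>R v) x t)\<^sup>2 \<le> W\<^sup>2 * L" unfolding defs .
  have s2: "s\<^sup>2 = t - \<tau>" using t by (simp add: defs)
  have "(s * (c * d))\<^sup>2 = (t - \<tau>) * (davg e (c *\<^sub>R v) x t)\<^sup>2"
    unfolding davg_scale power_mult_distrib s2 by (simp add: defs)
  also have "\<dots> \<le> (W * sqrt L)\<^sup>2" unfolding power_mult_distrib real_sqrt_pow2[OF L] by (rule g)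
  finally have "s * (c * d) \<le> W * sqrt L" by (rule power2_le_imp_le) (use W L in auto)
  then have "norm v * (s * (c * d)) \<le> norm v * (W * sqrt L)" by (rule mult_left_mono) simp
  moreover have "norm v * (s * (c * d)) = d * norm x * s" unfolding cv[symmetric] by (simp only: mult_ac)
  ultimately show ?thesis unfolding defs by (simp only:)
qed

text \<open>Taking \<delta> = 1 in the gradient estimate gives a Lipschitz bound, relative to |x|,
  that is the same at all scales. This equicontinuity is what makes the averages converge.\<close>

lemma avg_lipschitz:
  assumes N: "DIM('a) \<ge> 2" and \<tau>: "\<tau> > 0"
    and C: "C > 0" "\<And>e x t. 0 < e \<Longrightarrow> e \<le> 1/2 \<Longrightarrow> x \<noteq> 0 \<Longrightarrow> \<tau> \<le> t \<Longrightarrow> 0 \<le> avg e x t"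
    "\<And>e x t. 0 < e \<Longrightarrow> e \<le> 1/2 \<Longrightarrow> x \<noteq> 0 \<Longrightarrow> \<tau> \<le> t \<Longrightarrow> avg e x t \<le> C"
    and e: "0 < e" "e \<le> 1/4" and x: "x \<noteq> 0" and t: "\<tau> < t" and z: "norm (z - x) \<le> norm x / 2"
  shows "\<bar>avg e z t - avg e x t\<bar> \<le> 2 * (C + 1) / sqrt (t - \<tau>) * (norm (z - x) / norm x)"
proof -
  define v where "v = z - x"
  have seg: "norm x / 2 \<le> norm (x + s *\<^sub>R v)" if "s \<in> {0..1}" for s
  proof -
    have "norm (s *\<^sub>R v) \<le> norm v" using that by (simp add: mult_left_le_one_le)
    then show ?thesis using norm_diff_ineq[of x "s *\<^sub>R v"] z by (simp add: v_def)
  qed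
  have nz: "x + s *\<^sub>R v \<noteq> 0" if "s \<in> {0..1}" for s using seg[OF that] x by auto
  have tI: "t \<in> I" using \<tau> t pos_I by simp
  define D where "D = 2 * (C + 1) / sqrt (t - \<tau>) * (norm v / norm x)"
  have st: "sqrt (t - \<tau>) > 0" using t by simp
  have "norm (avg e (x + 1 *\<^sub>R v) t - avg e (x + 0 *\<^sub>R v) t) \<le> D * norm (1 - 0 :: real)"
  proof (rule field_differentiable_bound[of "{0..1}" _ "\<lambda>s. davg e v (x + s *\<^sub>R v) t"])
    fix s :: real assume s: "s \<in> {0..1}"
    show "((\<lambda>s. avg e (x + s *\<^sub>R v) t) has_field_derivative davg e v (x + s *\<^sub>R v) t) (at s within {0..1})"
      using e by (intro has_field_derivative_at_within[OF avg_line[OF N _ tI nz[OF s]]]) auto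
    define p where "p = x + s *\<^sub>R v"
    define W where "W = avg e p t + 1"
    have p: "p \<noteq> 0" using nz[OF s] by (simp add: p_def)
    have W: "1 \<le> W" "W \<le> C + 1" using C(2,3)[OF e(1) _ p, of t] e t by (auto simp: W_def)
    have L: "ln (C + 1) - ln W \<ge> 0" using W by simp
    \<comment> \<open>Since ln s \<le> s, the square of the left side is at most W^2 (C + 1) / W = W
      (C + 1) \<le> (C + 1)^2.\<close>
    have WC: "W * sqrt (ln (C + 1) - ln W) \<le> C + 1"
    proof (rule power2_le_imp_le)
      have "ln (C + 1) - ln W = ln ((C + 1) / W)" using W C(1) by (simp add: ln_div)
      also have "\<dots> \<le> (C + 1) / W" using W C(1) ln_le_minus_one[of "(C + 1) / W"] by simp
      finally have "W\<^sup>2 * (ln (C + 1) - ln W) \<le> W\<^sup>2 * ((C + 1) / W)" by (rule mult_left_mono) simp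
      also have "\<dots> = W * (C + 1)" using W by (simp add: power2_eq_square)
      also have "\<dots> \<le> (C + 1) * (C + 1)" using W C(1) by (intro mult_right_mono) auto
      finally have "W\<^sup>2 * (ln (C + 1) - ln W) \<le> (C + 1)\<^sup>2" by (simp only: power2_eq_square[of "C + 1"])
      then show "(W * sqrt (ln (C + 1) - ln W))\<^sup>2 \<le> (C + 1)\<^sup>2"
        unfolding power_mult_distrib real_sqrt_pow2[OF L] .
    qed (use C(1) in simp)
    have "\<bar>davg e v p t\<bar> * norm p * sqrt (t - \<tau>) \<le> norm v * (W * sqrt (ln (C + 1) - ln W))"
      unfolding W_def by (rule avg_gradient'[OF N \<tau> C e zero_less_one p t])
    also have "\<dots> \<le> norm v * (C + 1)" by (rule mult_left_mono[OF WC]) simp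
    finally have g: "\<bar>davg e v p t\<bar> * norm p * sqrt (t - \<tau>) \<le> norm v * (C + 1)" .
    have "\<bar>davg e v p t\<bar> * (norm x / 2) * sqrt (t - \<tau>) \<le> \<bar>davg e v p t\<bar> * norm p * sqrt (t - \<tau>)"
      by (rule mult_right_mono[OF mult_left_mono]) (use seg[OF s] st in \<open>auto simp: p_def\<close>)
    with g have "\<bar>davg e v p t\<bar> * (norm x / 2) * sqrt (t - \<tau>) \<le> norm v * (C + 1)" by (rule order_trans[rotated])
    then have "\<bar>davg e v p t\<bar> * (norm x * sqrt (t - \<tau>)) \<le> 2 * (norm v * (C + 1))" by simp
    moreover have "norm x * sqrt (t - \<tau>) > 0" using x st by simp
    ultimately have "\<bar>davg e v p t\<bar> \<le> 2 * (norm v * (C + 1)) / (norm x * sqrt (t - \<tau>))"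
      by (simp only: pos_le_divide_eq)
    also have "\<dots> = D" by (simp add: D_def mult_ac)
    finally show "norm (davg e v (x + s *\<^sub>R v) t) \<le> D" by (simp add: p_def)
  qed auto
  then show ?thesis by (simp add: D_def v_def)
qed

end

subsection \<open>The continuous representative\<close>

lemma ker_near_support:
  fixes x z :: "'a::euclidean_space"
  assumes x: "x \<noteq> 0" and e: "0 < e" "e \<le> 1/2" and k: "ker 0 0 e x z \<noteq> 0"
  shows "norm (z - x) \<le> 5 * sqrt e * norm x"
proof -
  define p where "p = (norm x)\<^sup>2 + (norm z)\<^sup>2"
  have p: "p > 0" using sum_norm2_pos x unfolding p_def by blast
  have "\<not> 2 * (x \<bullet> z) / p \<le> 1 - e" using k kphi_outside unfolding ker_def p_def by blast
  then have "(1 - e) * p < 2 * (x \<bullet> z)" using p by (simp add: divide_le_eq not_le)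
  moreover have "(norm (z - x))\<^sup>2 = p - 2 * (x \<bullet> z)"
    unfolding p_def power2_norm_eq_inner by (simp add: inner_diff_left inner_diff_right inner_commute[of z x])
  ultimately have 1: "(norm (z - x))\<^sup>2 \<le> e * p" by (simp add: left_diff_distrib)
  have "norm z \<le> 4 * norm x" using ker_outside[OF e(2), of x z 0 0] k x by force
  then have "(norm z)\<^sup>2 \<le> (4 * norm x)\<^sup>2" by (rule power_mono) simp
  then have "(norm z)\<^sup>2 \<le> 16 * (norm x)\<^sup>2" by (simp add: power_mult_distrib)
  \<comment> \<open>The sum 1 + 16 is rounded up to a square, which yields the factor 5.\<close>
  then have "p \<le> 25 * (norm x)\<^sup>2" unfolding p_def using zero_le_power2[of "norm x"] by linarith
  then have "e * p \<le> e * (25 * (norm x)\<^sup>2)" using e by (intro mult_left_mono) auto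
  also have "\<dots> = (5 * sqrt e * norm x)\<^sup>2" using e by (simp add: power_mult_distrib)
  finally have "(norm (z - x))\<^sup>2 \<le> (5 * sqrt e * norm x)\<^sup>2" using 1 by simp
  then show ?thesis by (rule power2_le_imp_le) (use e in simp)
qed

lemma Int_stable_open: "Int_stable {S :: 'a::topological_space set. open S}"
  by (auto simp: Int_stable_def)

text \<open>Open sets form an intersection-stable generator of the Borel sets, so the vanishing of
  the integrals spreads to all Borel sets by Dynkin's argument.\<close>

lemma AE_zero_of_open_integrals:
  fixes f :: "'a::euclidean_space \<Rightarrow> real"
  assumes f: "integrable lborel f" and z: "\<And>U. open U \<Longrightarrow> (LINT x:U|lborel. f x) = 0"
  shows "AE x in lborel. f x = 0"
proof -
  have si: "set_integrable lborel A f" if "A \<in> sets borel" for A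
    unfolding set_integrable_def using f that by (intro integrable_mult_indicator) auto
  have "(LINT x:A|lborel. f x) = 0" if "A \<in> sets borel" for A
  proof -
    have "A \<in> sigma_sets UNIV {S. open S}" using that by (simp add: borel_def sets_measure_of)
    then show ?thesis
    proof (induction rule: sigma_sets_induct_disjoint[OF Int_stable_open, where \<Omega>=UNIV, simplified, consumes 1, case_names basic empty compl union])
      case (basic A)
      then show ?case using z by simp
    next
      case empty
      show ?case by (simp add: set_lebesgue_integral_def)
    next
      case (compl A)
      then have A: "A \<in> sets borel" by (simp add: borel_def sets_measure_of)
      have "(LINT x:UNIV - A|lborel. f x) = (LINT x:UNIV|lborel. f x) - (LINT x:A|lborel. f x)"
        using set_integral_Un[of A "UNIV - A" lborel f] si[OF A] si[of "UNIV - A"] A by (auto simp: Un_absorb1)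
      then show ?case using compl z[of UNIV] by simp
    next
      case (union A)
      then have A: "range A \<subseteq> sets borel" by (auto simp: borel_def sets_measure_of)
      have "(LINT x:(\<Union>i. A i)|lborel. f x) = (\<Sum>i. (LINT x:A i|lborel. f x))"
        by (rule lebesgue_integral_countable_add) (use A union(1) si in \<open>auto simp: disjoint_family_on_def\<close>)
      then show ?case using union by simp
    qed
  qed
  then have "AE x in lborel. f x = (\<lambda>_. 0) x"
    using f by (intro density_unique_real) (auto simp: set_lebesgue_integral_def)
  then show ?thesis by simp
qed

lemma flat_measurable [measurable]: "flat n \<in> borel_measurable borel"
  by (rule borel_measurable_continuous_onI[OF flat_continuous])

lemma ker_joint_measurable [measurable]:
  "(\<lambda>(y, z). ker 0 0 e y (z::'a::euclidean_space)) \<in> borel_measurable (lborel \<Otimes>\<^sub>M lborel)"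
  unfolding ker_00 case_prod_beta by measurable

lemma ker_zero_left: "e \<le> 1 \<Longrightarrow> ker 0 0 e 0 z = 0"
  by (simp add: ker_00)

text \<open>The averaging operator acting on test functions, with respect to the measure |z|^-2 dz.
  By symmetry of the kernel it is the adjoint of \<open>avg\<close>.\<close>

definition smear :: "real \<Rightarrow> ('a::euclidean_space \<Rightarrow> real) \<Rightarrow> 'a \<Rightarrow> real" where
  "smear e \<psi> y = (LINT z|lborel. ker 0 0 e y z * (\<psi> z / (norm z)\<^sup>2)) / kmass TYPE('a) e"

lemma ker_weight_bound:
  fixes y :: "'a::euclidean_space"
  assumes e: "0 < e" "e \<le> 1/2" and N: "DIM('a) \<ge> 2" and \<psi>: "\<psi> \<in> borel_measurable borel" "\<And>z. ker 0 0 e y z \<noteq> 0 \<Longrightarrow> \<bar>\<psi> z\<bar> \<le> D" and D: "D \<ge> 0"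
  shows "integrable lborel (\<lambda>z. ker 0 0 e y z * (\<psi> z / (norm z)\<^sup>2))"
    and "(LINT z|lborel. \<bar>ker 0 0 e y z * (\<psi> z / (norm z)\<^sup>2)\<bar>) \<le> D * kmass TYPE('a) e"
proof -
  have K: "kmass TYPE('a) e > 0" by (rule kmass_pos[OF e N])
  have both: "integrable lborel (\<lambda>z. ker 0 0 e y z * (\<psi> z / (norm z)\<^sup>2)) \<and>
     (LINT z|lborel. \<bar>ker 0 0 e y z * (\<psi> z / (norm z)\<^sup>2)\<bar>) \<le> D * kmass TYPE('a) e"
  proof (cases "y = 0")
    case True
    then show ?thesis using e D K by (simp add: True ker_zero_left[where 'a='a])
  next
    case False
    note km = ker_measurable[OF False, of 0 0 e]
    have i: "integrable lborel (\<lambda>z. D * (ker 0 0 e y z / (norm z)\<^sup>2))"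
      using ker_weight_integrable[OF False e(2) N] by (rule integrable_mult_right)
    have b: "\<bar>ker 0 0 e y z * (\<psi> z / (norm z)\<^sup>2)\<bar> \<le> D * (ker 0 0 e y z / (norm z)\<^sup>2)" for z
    proof (cases "ker 0 0 e y z = 0")
      case False
      have "ker 0 0 e y z * \<bar>\<psi> z\<bar> / (norm z)\<^sup>2 \<le> ker 0 0 e y z * D / (norm z)\<^sup>2"
        using \<psi>(2)[OF False] ker_nonneg[of e y z] by (intro divide_right_mono mult_left_mono) auto
      then show ?thesis using ker_nonneg[of e y z] by (simp add: abs_mult mult.commute)
    qed simp
    have m: "(\<lambda>z. ker 0 0 e y z * (\<psi> z / (norm z)\<^sup>2)) \<in> borel_measurable lborel"
      using km \<psi>(1) by measurable
    have i2: "integrable lborel (\<lambda>z. ker 0 0 e y z * (\<psi> z / (norm z)\<^sup>2))"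
    proof (rule Bochner_Integration.integrable_bound[OF i m], rule AE_I2)
      fix z show "norm (ker 0 0 e y z * (\<psi> z / (norm z)\<^sup>2)) \<le> norm (D * (ker 0 0 e y z / (norm z)\<^sup>2))"
        using b[of z] unfolding real_norm_def by linarith
    qed
    have "(LINT z|lborel. \<bar>ker 0 0 e y z * (\<psi> z / (norm z)\<^sup>2)\<bar>) \<le> (LINT z|lborel. D * (ker 0 0 e y z / (norm z)\<^sup>2))"
      using i2 i b by (intro integral_mono integrable_abs) auto
    also have "\<dots> = D * (LINT z|lborel. ker 0 0 e y z / (norm z)\<^sup>2)" by (rule integral_mult_right_zero)
    also have "(LINT z|lborel. ker 0 0 e y z / (norm z)\<^sup>2) = (LINT z|lebesgue. ker 0 0 e y z / (norm z)\<^sup>2)"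
      by (rule integral_completion[symmetric]) (use km in measurable)
    also have "\<dots> = kmass TYPE('a) e" by (rule kmass_integral(1)[OF False e(2) N])
    finally show ?thesis using i2 by simp
  qed
  then show "integrable lborel (\<lambda>z. ker 0 0 e y z * (\<psi> z / (norm z)\<^sup>2))"
    "(LINT z|lborel. \<bar>ker 0 0 e y z * (\<psi> z / (norm z)\<^sup>2)\<bar>) \<le> D * kmass TYPE('a) e" by auto
qed

lemma smear_bound:
  fixes y :: "'a::euclidean_space"
  assumes e: "0 < e" "e \<le> 1/2" and N: "DIM('a) \<ge> 2" and \<psi>: "\<psi> \<in> borel_measurable borel" "\<And>z. ker 0 0 e y z \<noteq> 0 \<Longrightarrow> \<bar>\<psi> z\<bar> \<le> D" and D: "D \<ge> 0"
  shows "\<bar>smear e \<psi> y\<bar> \<le> D"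
proof -
  have "\<bar>LINT z|lborel. ker 0 0 e y z * (\<psi> z / (norm z)\<^sup>2)\<bar> \<le> D * kmass TYPE('a) e"
    by (rule order_trans[OF integral_abs_bound ker_weight_bound(2)[OF assms]])
  then show ?thesis using kmass_pos[OF e N] by (simp add: smear_def abs_divide divide_le_eq)
qed

lemma smear_measurable:
  assumes \<psi>: "\<psi> \<in> borel_measurable borel"
  shows "smear e \<psi> \<in> borel_measurable borel"
proof -
  have "(\<lambda>(y, z). ker 0 0 e y z * (\<psi> z / (norm z)\<^sup>2)) \<in> borel_measurable (lborel \<Otimes>\<^sub>M lborel)"
  proof -
    have [measurable]: "\<psi> \<in> borel_measurable lborel" using \<psi> by simp
    show ?thesis using ker_joint_measurable[of e] by (simp add: case_prod_beta)
  qed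
  then have "(\<lambda>y. LINT z|lborel. ker 0 0 e y z * (\<psi> z / (norm z)\<^sup>2)) \<in> borel_measurable lborel"
    by (rule lborel.borel_measurable_lebesgue_integral)
  then show ?thesis unfolding smear_def[abs_def] by simp
qed

lemma smear_const:
  fixes y :: "'a::euclidean_space"
  assumes e: "0 < e" "e \<le> 1/2" and N: "DIM('a) \<ge> 2" and y: "y \<noteq> 0"
  shows "smear e (\<lambda>_. c) y = c"
proof -
  have "(LINT z|lborel. ker 0 0 e y z * (c / (norm z)\<^sup>2)) = (LINT z|lborel. c * (ker 0 0 e y z / (norm z)\<^sup>2))"
    by (simp add: mult.commute)
  also have "\<dots> = c * (LINT z|lborel. ker 0 0 e y z / (norm z)\<^sup>2)" by (rule integral_mult_right_zero)
  also have "(LINT z|lborel. ker 0 0 e y z / (norm z)\<^sup>2) = (LINT z|lebesgue. ker 0 0 e y z / (norm z)\<^sup>2)"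
    by (rule integral_completion[symmetric]) (use ker_measurable[OF y, of 0 0 e] in measurable)
  also have "\<dots> = kmass TYPE('a) e" by (rule kmass_integral(1)[OF y e(2) N])
  finally show ?thesis using kmass_pos[OF e N] by (simp add: smear_def)
qed

lemma smear_diff:
  fixes y :: "'a::euclidean_space"
  assumes e: "0 < e" "e \<le> 1/2" and N: "DIM('a) \<ge> 2" and y: "y \<noteq> 0"
    and \<psi>: "\<psi> \<in> borel_measurable borel" "\<And>z. ker 0 0 e y z \<noteq> 0 \<Longrightarrow> \<bar>\<psi> z - c\<bar> \<le> r" and r: "r \<ge> 0"
  shows "\<bar>smear e \<psi> y - c\<bar> \<le> r"
proof -
  have m: "(\<lambda>z. \<psi> z - c) \<in> borel_measurable borel" using \<psi>(1) by simp
  have c: "(\<lambda>z::'a. c) \<in> borel_measurable borel" by simp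
  have i1: "integrable lborel (\<lambda>z. ker 0 0 e y z * ((\<psi> z - c) / (norm z)\<^sup>2))"
    by (rule ker_weight_bound(1)[OF e N m \<psi>(2) r])
  have i2: "integrable lborel (\<lambda>z. ker 0 0 e y z * (c / (norm z)\<^sup>2))"
    by (rule ker_weight_bound(1)[OF e N c, of y "\<bar>c\<bar>"]) auto
  have "smear e \<psi> y = smear e (\<lambda>z. \<psi> z - c) y + smear e (\<lambda>_. c) y"
    unfolding smear_def add_divide_distrib[symmetric] Bochner_Integration.integral_add[OF i1 i2, symmetric]
    by (simp add: distrib_left[symmetric] add_divide_distrib[symmetric])
  then show ?thesis using smear_bound[OF e N m \<psi>(2) r] smear_const[OF e N y, of c] by simp
qed

text \<open>The factor 100 gives 5 * sqrt (scale n) \<le> 1/2, so that by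
  \<open>ker_near_support\<close> every point of the support lies within |x|/2 of \<open>x\<close>,
  as \<open>avg_lipschitz\<close> demands.\<close>

definition scale :: "nat \<Rightarrow> real" where
  "scale n = 1 / (100 * (real n + 1))"

lemma scale_bounds: "0 < scale n" "scale n \<le> 1/100" "scale n \<le> 1/2" "scale n \<le> 1/4"
proof -
  show "0 < scale n" by (simp add: scale_def)
  have "1 / (100 * (real n + 1)) \<le> 1 / 100" by (intro divide_left_mono) auto
  then show "scale n \<le> 1/100" "scale n \<le> 1/2" "scale n \<le> 1/4" by (auto simp: scale_def)
qed

lemma sqrt_scale_tendsto: "(\<lambda>n. sqrt (scale n)) \<longlonglongrightarrow> 0"
proof -
  have "(\<lambda>n. (1/100) * inverse (real (Suc n))) \<longlonglongrightarrow> (1/100) * 0"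
    by (intro tendsto_mult tendsto_const LIMSEQ_inverse_real_of_nat)
  moreover have "(\<lambda>n. (1/100) * inverse (real (Suc n))) = scale"
    by (rule ext) (simp add: scale_def field_simps)
  ultimately have "scale \<longlonglongrightarrow> 0" by (simp only: mult_zero_right)
  from tendsto_real_sqrt[OF this] show ?thesis by simp
qed

lemma smear_tendsto:
  fixes y :: "'a::euclidean_space"
  assumes N: "DIM('a) \<ge> 2" and y: "y \<noteq> 0" and \<psi>: "\<psi> \<in> borel_measurable borel" and c: "isCont \<psi> y"
  shows "(\<lambda>n. smear (scale n) \<psi> y) \<longlonglongrightarrow> \<psi> y"
proof (rule LIMSEQ_I)
  fix r :: real assume r: "r > 0"
  have r2: "r / 2 > 0" using r by simp
  from c[unfolded continuous_at_eps_delta, rule_format, OF r2]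
  obtain d where d: "d > 0" "\<And>z. norm (z - y) < d \<Longrightarrow> \<bar>\<psi> z - \<psi> y\<bar> < r / 2"
    unfolding dist_norm real_norm_def by blast
  have "(\<lambda>n. 5 * sqrt (scale n) * norm y) \<longlonglongrightarrow> 5 * 0 * norm y"
    by (intro tendsto_intros sqrt_scale_tendsto)
  then have "\<forall>\<^sub>F n in sequentially. 5 * sqrt (scale n) * norm y < d"
    using d(1) by (intro order_tendstoD(2)) auto
  then obtain n0 where n0: "\<And>n. n \<ge> n0 \<Longrightarrow> 5 * sqrt (scale n) * norm y < d"
    by (auto simp: eventually_sequentially)
  \<comment> \<open>For large \<open>n\<close> the support of the kernel lies in the ball where
    \<psi> varies by less than r/2.\<close>
  have "norm (smear (scale n) \<psi> y - \<psi> y) < r" if "n \<ge> n0" for n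
  proof -
    have "\<bar>smear (scale n) \<psi> y - \<psi> y\<bar> \<le> r / 2"
    proof (rule smear_diff[OF scale_bounds(1,3) N y \<psi>])
      fix z assume "ker 0 0 (scale n) y z \<noteq> 0"
      then have "norm (z - y) < d"
        using ker_near_support[OF y scale_bounds(1,3)] n0[OF that] by (meson le_less_trans)
      then show "\<bar>\<psi> z - \<psi> y\<bar> \<le> r / 2" using d(2) by (simp add: less_imp_le)
    qed (use r in simp)
    then show ?thesis unfolding real_norm_def using r by linarith
  qed
  then show "\<exists>n0. \<forall>n\<ge>n0. norm (smear (scale n) \<psi> y - \<psi> y) < r" by blast
qed

section \<open>Convergence of the averages\<close>

context global_solution
begin

text \<open>A Borel version of the density at a fixed time, so that Fubini can be applied on the
  product of Borel measures.\<close>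

lemma pairing_borel:
  assumes t: "t \<in> I"
  obtains g where "g \<in> borel_measurable borel" "integrable lborel g" "AE y in lborel. dens u t y = g y"
    "\<And>f. f \<in> borel_measurable borel \<Longrightarrow> P f t = (LINT y|lborel. f y * g y)"
proof -
  obtain g where g: "g \<in> borel_measurable lborel" and gd: "AE y in lborel. dens u t y = g y"
    using completion_ex_borel_measurable_real[OF dens_measurable[OF t]] by auto
  have gl: "g \<in> borel_measurable lebesgue" using g by (rule measurable_completion)
  have gi: "integrable lborel g"
  proof -
    have "integrable lebesgue g"
      by (rule integrable_cong_AE_imp[OF slice_integrable[OF t] gl]) (use gd in \<open>simp add: AE_completion_iff eq_commute\<close>)
    then show ?thesis by (rule integrable_completion[OF g, THEN iffD1])
  qed
  have Pg: "P f t = (LINT y|lborel. f y * g y)" if f: "f \<in> borel_measurable borel" for f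
  proof -
    have fl: "f \<in> borel_measurable lebesgue" using f by (rule borel_measurable_lebesgueI)
    have "P f t = (LINT y|lebesgue. f y * g y)"
      unfolding pairing_def
    proof (rule integral_cong_AE)
      show "AE y in lebesgue. f y * dens u t y = f y * g y" using gd by (auto simp: AE_completion_iff)
    qed (use fl gl dens_measurable[OF t] in auto)
    also have "\<dots> = (LINT y|lborel. f y * g y)"
      by (rule integral_completion) (use f g in simp)
    finally show ?thesis .
  qed
  have gb: "g \<in> borel_measurable borel" using g by simp
  show thesis by (rule that[OF gb gi gd Pg])
qed

text \<open>Fubini together with the symmetry of the kernel: averaging the solution against \<psi>
  is the same as averaging \<psi> against the solution.\<close>

lemma avg_dual:
  assumes N: "DIM('a) \<ge> 2" and e: "0 < e" "e \<le> 1/2" and t: "t \<in> I"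
    and \<psi>: "\<psi> \<in> borel_measurable borel" "\<And>z. \<bar>\<psi> z\<bar> \<le> D"
  shows "integrable lborel (\<lambda>z. avg e z t * (\<psi> z / (norm z)\<^sup>2))"
    and "(LINT z|lborel. avg e z t * (\<psi> z / (norm z)\<^sup>2)) = P (smear e \<psi>) t"
proof -
  define K where "K = kmass TYPE('a) e"
  have K: "K > 0" unfolding K_def by (rule kmass_pos[OF e N])
  have D: "D \<ge> 0" using \<psi>(2)[of 0] by linarith
  obtain g where g: "g \<in> borel_measurable borel" and gi: "integrable lborel g"
    and Pg: "\<And>f. f \<in> borel_measurable borel \<Longrightarrow> P f t = (LINT y|lborel. f y * g y)"
    by (rule pairing_borel[OF t]) blast
  have [measurable]: "g \<in> borel_measurable lborel" using g by simp
  define f where "f y z = (ker 0 0 e y z * (\<psi> z / (norm z)\<^sup>2)) * g y" for y z :: 'a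
  have [measurable]: "\<psi> \<in> borel_measurable lborel" using \<psi>(1) by simp
  have fm: "(\<lambda>(y, z). f y z) \<in> borel_measurable (lborel \<Otimes>\<^sub>M lborel)"
    using ker_joint_measurable[of e] unfolding f_def by (simp add: case_prod_beta)
  have kb: "integrable lborel (\<lambda>z. ker 0 0 e y z * (\<psi> z / (norm z)\<^sup>2))"
    "(LINT z|lborel. \<bar>ker 0 0 e y z * (\<psi> z / (norm z)\<^sup>2)\<bar>) \<le> D * K" for y :: 'a
    unfolding K_def by (rule ker_weight_bound[OF e N \<psi>(1) \<psi>(2) D])+
  have fi: "integrable (lborel \<Otimes>\<^sub>M lborel) (\<lambda>(y, z). f y z)"
  proof (rule lborel_pair.Fubini_integrable[OF fm])
    have m1: "(\<lambda>y. LINT z|lborel. norm (case (y, z) of (y, z) \<Rightarrow> f y z)) \<in> borel_measurable lborel"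
      using fm by (intro lborel.borel_measurable_lebesgue_integral) (simp add: case_prod_beta)
    show "integrable lborel (\<lambda>y. LINT z|lborel. norm (case (y, z) of (y, z) \<Rightarrow> f y z))"
    proof (rule Bochner_Integration.integrable_bound[OF _ m1], rule_tac [2] AE_I2)
      show "integrable lborel (\<lambda>y. (D * K) * g y)" using gi by (rule integrable_mult_right)
      fix y
      have "(LINT z|lborel. norm (case (y, z) of (y, z) \<Rightarrow> f y z)) = (LINT z|lborel. \<bar>ker 0 0 e y z * (\<psi> z / (norm z)\<^sup>2)\<bar> * \<bar>g y\<bar>)"
        by (simp add: f_def abs_mult)
      also have "\<dots> = (LINT z|lborel. \<bar>ker 0 0 e y z * (\<psi> z / (norm z)\<^sup>2)\<bar>) * \<bar>g y\<bar>"
        by (rule integral_mult_left_zero)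
      finally have eq: "(LINT z|lborel. norm (case (y, z) of (y, z) \<Rightarrow> f y z)) = (LINT z|lborel. \<bar>ker 0 0 e y z * (\<psi> z / (norm z)\<^sup>2)\<bar>) * \<bar>g y\<bar>" .
      have "(LINT z|lborel. \<bar>ker 0 0 e y z * (\<psi> z / (norm z)\<^sup>2)\<bar>) * \<bar>g y\<bar> \<le> (D * K) * \<bar>g y\<bar>"
        by (rule mult_right_mono[OF kb(2)]) simp
      moreover have "0 \<le> (LINT z|lborel. \<bar>ker 0 0 e y z * (\<psi> z / (norm z)\<^sup>2)\<bar>) * \<bar>g y\<bar>"
        by (intro mult_nonneg_nonneg integral_nonneg_AE) auto
      ultimately show "norm (LINT z|lborel. norm (case (y, z) of (y, z) \<Rightarrow> f y z)) \<le> norm ((D * K) * g y)"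
        unfolding eq using D K by (simp add: abs_mult)
    qed
    show "AE y in lborel. integrable lborel (\<lambda>z. case (y, z) of (y, z) \<Rightarrow> f y z)"
      unfolding f_def prod.case by (intro AE_I2 integrable_mult_left kb(1))
  qed
  have inner: "(LINT y|lborel. f y z) = K * (avg e z t * (\<psi> z / (norm z)\<^sup>2))" for z
  proof (cases "z = 0")
    case True
    then show ?thesis by (simp add: f_def)
  next
    case False
    have "(LINT y|lborel. f y z) = (LINT y|lborel. (\<psi> z / (norm z)\<^sup>2) * (ker 0 0 e z y * g y))"
      unfolding f_def ker_sym[where x=z] by (simp add: mult_ac)
    also have "\<dots> = (\<psi> z / (norm z)\<^sup>2) * P (ker 0 0 e z) t"
      by (simp only: integral_mult_right_zero Pg[OF ker_measurable[OF False]])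
    finally show ?thesis using K by (simp add: avg_def K_def)
  qed
  have "integrable lborel (\<lambda>z. LINT y|lborel. f y z)" by (rule lborel_pair.integrable_snd[OF fi])
  then have "integrable lborel (\<lambda>z. (1 / K) * (LINT y|lborel. f y z))" by (rule integrable_mult_right)
  then show "integrable lborel (\<lambda>z. avg e z t * (\<psi> z / (norm z)\<^sup>2))"
    unfolding inner using K by simp
  have "(LINT z|lborel. LINT y|lborel. f y z) = (LINT y|lborel. LINT z|lborel. f y z)"
    by (rule lborel_pair.Fubini_integral[OF fi])
  moreover have "(LINT z|lborel. LINT y|lborel. f y z) = K * (LINT z|lborel. avg e z t * (\<psi> z / (norm z)\<^sup>2))"
    unfolding inner by (rule integral_mult_right_zero)
  moreover have "(LINT y|lborel. LINT z|lborel. f y z) = (LINT y|lborel. K * (smear e \<psi> y * g y))"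
    unfolding f_def integral_mult_left_zero smear_def K_def[symmetric] using K by simp
  moreover have "\<dots> = K * P (smear e \<psi>) t"
    by (simp only: integral_mult_right_zero Pg[OF smear_measurable[OF \<psi>(1)]])
  ultimately show "(LINT z|lborel. avg e z t * (\<psi> z / (norm z)\<^sup>2)) = P (smear e \<psi>) t"
    using K by simp
qed

text \<open>By duality the convergence can be checked on the test function, which is continuous off
  the origin, so that its averages converge boundedly at every point that matters.\<close>

lemma avg_weak_limit:
  assumes N: "DIM('a) \<ge> 2" and t: "t \<in> I"
    and \<psi>: "\<psi> \<in> borel_measurable borel" "\<And>z. \<bar>\<psi> z\<bar> \<le> D" "\<And>y. y \<noteq> 0 \<Longrightarrow> isCont \<psi> y"
  shows "(\<lambda>n. LINT z|lborel. avg (scale n) z t * (\<psi> z / (norm z)\<^sup>2)) \<longlonglongrightarrow> P \<psi> t"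
proof -
  have D: "D \<ge> 0" using \<psi>(2)[of 0] by linarith
  have "(\<lambda>n. P (smear (scale n) \<psi>) t) \<longlonglongrightarrow> P \<psi> t"
  proof (rule pairing_tendsto[OF t smear_measurable[OF \<psi>(1)] _ _ \<psi>(1)])
    show "\<bar>smear (scale n) \<psi> y\<bar> \<le> D" for n y
      by (rule smear_bound[OF scale_bounds(1,3) N \<psi>(1) \<psi>(2) D])
    show "(\<lambda>n. smear (scale n) \<psi> y) \<longlonglongrightarrow> \<psi> y" if "y \<noteq> 0" for y
      by (rule smear_tendsto[OF N that \<psi>(1) \<psi>(3)[OF that]])
  qed
  then show ?thesis by (simp only: avg_dual(2)[OF N scale_bounds(1,3) t \<psi>(1,2)])
qed

lemma avg_continuous:
  assumes N: "DIM('a) \<ge> 2" and e: "0 < e" "e \<le> 1/2"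
  shows "continuous_on ({x. x \<noteq> 0} \<times> I) (\<lambda>z. avg e (fst z) (snd z))"
  unfolding avg_def using kmass_pos[OF e N]
  by (intro continuous_on_divide continuous_on_const tame_joint_continuous[OF tame_ker[OF e(2) N]])
    (auto intro: has_derivative_continuous[OF ker_has_derivative])

lemma avg_zero: "e \<le> 1 \<Longrightarrow> avg e 0 t = 0"
proof -
  assume "e \<le> 1"
  then have "ker 0 0 e (0::'a) = (\<lambda>y. 0)" by (intro ext ker_zero_left)
  then show ?thesis by (simp add: avg_def pairing_def)
qed

lemma avg_measurable:
  assumes N: "DIM('a) \<ge> 2" and e: "0 < e" "e \<le> 1/2" and t: "t \<in> I"
  shows "(\<lambda>x. avg e x t) \<in> borel_measurable borel"
proof -
  have "continuous_on {x. x \<noteq> 0} (\<lambda>x. (\<lambda>z. avg e (fst z) (snd z)) (x, t))"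
    by (rule continuous_on_compose2[OF avg_continuous[OF N e]]) (use t in \<open>auto intro: continuous_intros\<close>)
  then have c: "continuous_on {x. x \<noteq> 0} (\<lambda>x. avg e x t)" by simp
  have "{x::'a. x \<noteq> 0} \<in> sets borel" by simp
  from borel_measurable_continuous_on_indicator[OF this c]
  have "(\<lambda>x. indicator {x. x \<noteq> 0} x *\<^sub>R avg e x t) \<in> borel_measurable borel" .
  moreover have "(\<lambda>x. indicator {x. x \<noteq> 0} x *\<^sub>R avg e x t) = (\<lambda>x. avg e x t)"
    using avg_zero[of e t] e by (auto simp: fun_eq_iff indicator_def)
  ultimately show ?thesis by simp
qed

definition rep :: "'a \<Rightarrow> real \<Rightarrow> real" where
  "rep x t = lim (\<lambda>n. avg (scale n) x t)"

text \<open>Averages of the equi-Lipschitz functions \<open>avg (scale n)\<close> with the kernel at a fixed scale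
  stay close to them, and converge by weak convergence; hence \<open>avg (scale n)\<close> is Cauchy.\<close>

lemma rep_approx:
  assumes N: "DIM('a) \<ge> 2" and \<tau>: "\<tau> > 0"
  obtains L where "L > 0" "\<And>x t k. x \<noteq> 0 \<Longrightarrow> 2 * \<tau> \<le> t \<Longrightarrow> \<bar>rep x t - avg (scale k) x t\<bar> \<le> L * sqrt (scale k)"
    "\<And>x t. x \<noteq> 0 \<Longrightarrow> 2 * \<tau> \<le> t \<Longrightarrow> (\<lambda>n. avg (scale n) x t) \<longlonglongrightarrow> rep x t"
proof -
  obtain C where C: "C > 0" "\<And>e x t. 0 < e \<Longrightarrow> e \<le> 1/2 \<Longrightarrow> x \<noteq> 0 \<Longrightarrow> \<tau> \<le> t \<Longrightarrow> 0 \<le> avg e x t"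
    "\<And>e x t. 0 < e \<Longrightarrow> e \<le> 1/2 \<Longrightarrow> x \<noteq> 0 \<Longrightarrow> \<tau> \<le> t \<Longrightarrow> avg e x t \<le> C"
    by (rule avg_bounds[OF N \<tau>]) blast
  \<comment> \<open>The product of the constant 2 (C + 1) / sqrt \<tau> from
    \<open>avg_lipschitz\<close> and the radius 5 of the kernel's support; t \<ge> 2 \<tau> ensures
    t - \<tau> \<ge> \<tau>.\<close>
  define L where "L = 10 * (C + 1) / sqrt \<tau>"
  have L: "L > 0" using C(1) \<tau> by (simp add: L_def)
  have main: "\<bar>rep x t - avg (scale k) x t\<bar> \<le> L * sqrt (scale k) \<and> (\<lambda>n. avg (scale n) x t) \<longlonglongrightarrow> rep x t"
    if x: "x \<noteq> 0" and t: "2 * \<tau> \<le> t" for x t k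
  proof -
    have tt: "\<tau> < t" using t \<tau> by linarith
    have tI: "t \<in> I" using t \<tau> pos_I by simp
    define a where "a n = avg (scale n) x t" for n
    have sq: "sqrt \<tau> \<le> sqrt (t - \<tau>)" using t by simp
    have near: "\<bar>smear (scale k) (\<lambda>z. avg (scale n) z t) x - a n\<bar> \<le> L * sqrt (scale k)" for n k
    proof (rule smear_diff[OF scale_bounds(1,3) N x avg_measurable[OF N scale_bounds(1,3) tI]])
      fix z assume z: "ker 0 0 (scale k) x z \<noteq> 0"
      have z1: "norm (z - x) \<le> 5 * sqrt (scale k) * norm x"
        by (rule ker_near_support[OF x scale_bounds(1,3) z])
      have "sqrt (scale k) \<le> sqrt ((1/10)\<^sup>2)"
        using scale_bounds(2)[of k] by (intro real_sqrt_le_mono) (simp add: power2_eq_square)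
      then have s10: "sqrt (scale k) \<le> 1/10" by simp
      have "5 * sqrt (scale k) * norm x \<le> (1/2) * norm x" using s10 by (intro mult_right_mono) auto
      then have z2: "norm (z - x) \<le> norm x / 2" using z1 by simp
      have "\<bar>avg (scale n) z t - a n\<bar> \<le> 2 * (C + 1) / sqrt (t - \<tau>) * (norm (z - x) / norm x)"
        unfolding a_def by (rule avg_lipschitz[OF N \<tau> C scale_bounds(1,4) x tt z2])
      also have "\<dots> \<le> 2 * (C + 1) / sqrt \<tau> * (5 * sqrt (scale k))"
      proof (rule mult_mono)
        show "2 * (C + 1) / sqrt (t - \<tau>) \<le> 2 * (C + 1) / sqrt \<tau>"
          using C(1) \<tau> sq by (intro divide_left_mono) (auto intro!: mult_pos_pos simp: tt)
        show "norm (z - x) / norm x \<le> 5 * sqrt (scale k)" using z1 x by (simp add: divide_le_eq)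
      qed (use C(1) \<tau> scale_bounds(1)[of k] in auto)
      also have "\<dots> = L * sqrt (scale k)" by (simp add: L_def)
      finally show "\<bar>avg (scale n) z t - a n\<bar> \<le> L * sqrt (scale k)" .
    qed (use L scale_bounds(1)[of k] in auto)
    \<comment> \<open>The kernel at the fixed scale k is a bounded continuous test function, and its
      pairing with the solution is by definition a multiple of the average at that scale.\<close>
    have lim: "(\<lambda>n. smear (scale k) (\<lambda>z. avg (scale n) z t) x) \<longlonglongrightarrow> a k" for k
    proof -
      obtain D where D: "\<And>y. \<bar>ker 0 0 (scale k) x y\<bar> \<le> D" using tame_bound[OF tame_ker[OF scale_bounds(3) N] x] by blast
      have "(\<lambda>n. LINT z|lborel. avg (scale n) z t * (ker 0 0 (scale k) x z / (norm z)\<^sup>2)) \<longlonglongrightarrow> P (ker 0 0 (scale k) x) t"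
        by (rule avg_weak_limit[OF N tI ker_measurable[OF x] D])
          (use x in \<open>auto intro: has_derivative_continuous[OF ker_has_derivative2]\<close>)
      from tendsto_divide[OF this tendsto_const[of "kmass TYPE('a) (scale k)"]]
      show ?thesis using kmass_pos[OF scale_bounds(1,3) N, of k] by (simp add: smear_def a_def avg_def mult.commute)
    qed
    have close: "\<forall>\<^sub>F n in sequentially. \<bar>a n - a k\<bar> \<le> L * sqrt (scale k) + r" if r: "r > 0" for k r
    proof -
      have "\<forall>\<^sub>F n in sequentially. dist (smear (scale k) (\<lambda>z. avg (scale n) z t) x) (a k) < r"
        by (rule tendstoD[OF lim r])
      then show ?thesis
      proof eventually_elim
        case (elim n)
        then show ?case using near[of k n] unfolding dist_real_def by linarith
      qed
    qed
    have "Cauchy a"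
    proof (rule metric_CauchyI)
      fix r :: real assume r: "r > 0"
      have "(\<lambda>n. L * sqrt (scale n)) \<longlonglongrightarrow> L * 0" by (intro tendsto_intros sqrt_scale_tendsto)
      then have "\<forall>\<^sub>F n in sequentially. L * sqrt (scale n) < r / 8" using r by (intro order_tendstoD(2)) auto
      then obtain k where k: "L * sqrt (scale k) < r / 8" by (auto simp: eventually_sequentially)
      have "\<forall>\<^sub>F n in sequentially. \<bar>a n - a k\<bar> \<le> L * sqrt (scale k) + r / 8" using r by (intro close) simp
      then obtain n0 where n0: "\<And>n. n \<ge> n0 \<Longrightarrow> \<bar>a n - a k\<bar> \<le> L * sqrt (scale k) + r / 8"
        by (auto simp: eventually_sequentially)
      have "dist (a m) (a n) < r" if "m \<ge> n0" "n \<ge> n0" for m n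
        using n0[OF that(1)] n0[OF that(2)] k r unfolding dist_real_def by linarith
      then show "\<exists>n0. \<forall>m\<ge>n0. \<forall>n\<ge>n0. dist (a m) (a n) < r" by blast
    qed
    then have conv: "a \<longlonglongrightarrow> rep x t"
      unfolding rep_def a_def[symmetric] by (simp add: Cauchy_convergent_iff convergent_LIMSEQ_iff)
    have "\<bar>rep x t - a k\<bar> \<le> L * sqrt (scale k)"
    proof (rule field_le_epsilon)
      fix r :: real assume r: "r > 0"
      show "\<bar>rep x t - a k\<bar> \<le> L * sqrt (scale k) + r"
        by (rule tendsto_upperbound[OF tendsto_rabs[OF tendsto_diff[OF conv tendsto_const]] close[OF r]]) simp
    qed
    with conv show ?thesis by (simp add: a_def[abs_def])
  qed
  show thesis by (rule that[OF L]) (use main in auto)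
qed

text \<open>The rate in \<open>rep_approx\<close> is uniform over all points other than the origin
  and over times away from 0, so the limit of the continuous averages is locally uniform.\<close>

lemma rep_continuous:
  assumes N: "DIM('a) \<ge> 2"
  shows "continuous_on ({x. x \<noteq> 0} \<times> {0<..}) (\<lambda>z. rep (fst z) (snd z))"
proof -
  have "isCont (\<lambda>z. rep (fst z) (snd z)) (x, t)" if x: "x \<noteq> 0" and t: "t > 0" for x t
  proof -
    define \<tau> where "\<tau> = t / 4"
    have \<tau>: "\<tau> > 0" using t by (simp add: \<tau>_def)
    obtain L where L: "L > 0" "\<And>x t k. x \<noteq> 0 \<Longrightarrow> 2 * \<tau> \<le> t \<Longrightarrow> \<bar>rep x t - avg (scale k) x t\<bar> \<le> L * sqrt (scale k)"
      by (rule rep_approx[OF N \<tau>]) blast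
    define S where "S = {x::'a. x \<noteq> 0} \<times> {2 * \<tau><..}"
    have "continuous_on S (\<lambda>z. rep (fst z) (snd z))"
    proof (rule uniform_limit_theorem)
      show "\<forall>\<^sub>F n in sequentially. continuous_on S (\<lambda>z. avg (scale n) (fst z) (snd z))"
        using \<tau> pos_I by (intro always_eventually allI continuous_on_subset[OF avg_continuous[OF N scale_bounds(1,3)]]) (auto simp: S_def)
      show "uniform_limit S (\<lambda>n z. avg (scale n) (fst z) (snd z)) (\<lambda>z. rep (fst z) (snd z)) sequentially"
      proof (rule uniform_limitI)
        fix r :: real assume r: "r > 0"
        have "(\<lambda>n. L * sqrt (scale n)) \<longlonglongrightarrow> L * 0" by (intro tendsto_intros sqrt_scale_tendsto)
        then have "\<forall>\<^sub>F n in sequentially. L * sqrt (scale n) < r" using r by (intro order_tendstoD(2)) auto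
        then show "\<forall>\<^sub>F n in sequentially. \<forall>z\<in>S. dist (avg (scale n) (fst z) (snd z)) (rep (fst z) (snd z)) < r"
        proof eventually_elim
          case (elim n)
          show ?case
          proof
            fix z assume "z \<in> S"
            then have "\<bar>rep (fst z) (snd z) - avg (scale n) (fst z) (snd z)\<bar> \<le> L * sqrt (scale n)"
              by (intro L(2)) (auto simp: S_def)
            then show "dist (avg (scale n) (fst z) (snd z)) (rep (fst z) (snd z)) < r"
              using elim unfolding dist_real_def by linarith
          qed
        qed
      qed
    qed simp
    moreover have "open S" unfolding S_def by (intro open_Times open_Collect_neq continuous_intros open_greaterThan)
    moreover have "(x, t) \<in> S" using x t by (auto simp: S_def \<tau>_def)
    ultimately show ?thesis by (simp add: continuous_on_eq_continuous_at)
  qed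
  then show ?thesis by (auto intro!: continuous_at_imp_continuous_on)
qed

end

context global_solution
begin

lemma avg_tendsto_rep:
  assumes N: "DIM('a) \<ge> 2" and t: "t > 0"
  shows "(\<lambda>n. avg (scale n) x t) \<longlonglongrightarrow> rep x t"
proof (cases "x = 0")
  case True
  have "avg (scale n) 0 t = 0" for n by (rule avg_zero) (use scale_bounds(2)[of n] in linarith)
  then show ?thesis unfolding True rep_def by (simp add: limI[OF tendsto_const])
next
  case False
  have t2: "t / 2 > 0" using t by simp
  obtain L where "\<And>x s. x \<noteq> 0 \<Longrightarrow> 2 * (t / 2) \<le> s \<Longrightarrow> (\<lambda>n. avg (scale n) x s) \<longlonglongrightarrow> rep x s"
    by (rule rep_approx[OF N t2]) blast
  from this[OF False] show ?thesis by simp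
qed

lemma rep_measurable:
  assumes N: "DIM('a) \<ge> 2" and t: "t > 0"
  shows "(\<lambda>x. rep x t) \<in> borel_measurable borel"
  by (rule borel_measurable_LIMSEQ_real[OF avg_tendsto_rep[OF N t] avg_measurable[OF N scale_bounds(1,3) pos_I[OF t]]])

lemma avg_scale_bounds:
  assumes N: "DIM('a) \<ge> 2" and t: "t > 0"
  obtains C where "C > 0" "\<And>x n. 0 \<le> avg (scale n) x t" "\<And>x n. avg (scale n) x t \<le> C"
    "\<And>x. 0 \<le> rep x t" "\<And>x. rep x t \<le> C"
proof -
  obtain C where C: "C > 0" "\<And>e x s. 0 < e \<Longrightarrow> e \<le> 1/2 \<Longrightarrow> x \<noteq> 0 \<Longrightarrow> t \<le> s \<Longrightarrow> 0 \<le> avg e x s"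
    "\<And>e x s. 0 < e \<Longrightarrow> e \<le> 1/2 \<Longrightarrow> x \<noteq> 0 \<Longrightarrow> t \<le> s \<Longrightarrow> avg e x s \<le> C"
    by (rule avg_bounds[OF N t]) blast
  have z: "avg (scale n) 0 t = 0" for n by (rule avg_zero) (use scale_bounds(2)[of n] in linarith)
  have a: "0 \<le> avg (scale n) x t" "avg (scale n) x t \<le> C" for x n
    using C(2)[OF scale_bounds(1,3), of x t n] C(3)[OF scale_bounds(1,3), of x t n] z[of n] C(1)
    by (cases "x = 0"; simp)+
  have "0 \<le> rep x t" "rep x t \<le> C" for x
    using LIMSEQ_le_const[OF avg_tendsto_rep[OF N t], of 0 x] LIMSEQ_le_const2[OF avg_tendsto_rep[OF N t], of x C] a by blast+
  then show thesis using that[of C] C(1) a by blast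
qed

text \<open>On an annulus the averages converge boundedly to \<open>rep\<close> and weakly to the
  solution, so the two have equal integrals against continuous functions supported there, and then
  over open sets. Away from the origin |x|^-2 is bounded, which provides the domination.\<close>

lemma rep_eq_on_annulus:
  assumes N: "DIM('a) \<ge> 2" and t: "t > 0" and a: "a > 0"
    and g: "g \<in> borel_measurable borel" "integrable lborel g"
      "\<And>f. f \<in> borel_measurable borel \<Longrightarrow> P f t = (LINT y|lborel. f y * g y)"
  shows "AE x in lborel. a < norm x \<longrightarrow> norm x < b \<longrightarrow> rep x t / (norm x)\<^sup>2 = g x"
proof -
  obtain C where C: "C > 0" "\<And>x n. 0 \<le> avg (scale n) x t" "\<And>x n. avg (scale n) x t \<le> C"
    "\<And>x. 0 \<le> rep x t" "\<And>x. rep x t \<le> C"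
    by (rule avg_scale_bounds[OF N t]) blast
  define A where "A = {x::'a. a < norm x \<and> norm x < b}"
  have A: "open A" unfolding A_def by (intro open_Collect_conj open_Collect_less continuous_intros)
  then have Am: "A \<in> sets lborel" by simp
  define h where "h x = indicator A x * (rep x t / (norm x)\<^sup>2 - g x)" for x
  have rm: "(\<lambda>x. rep x t) \<in> borel_measurable lborel" using rep_measurable[OF N t] by simp
  have nm: "(\<lambda>x::'a. (norm x)\<^sup>2) \<in> borel_measurable lborel" by simp
  have gm: "g \<in> borel_measurable lborel" using g(1) by simp
  have dom: "integrable lborel (\<lambda>x. C / a\<^sup>2 * indicator A x)"
  proof (intro integrable_mult_right integrable_real_indicator Am emeasure_bounded_finite)
    show "bounded A" unfolding bounded_iff A_def by (intro exI[of _ b]) auto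
  qed
  have bd: "norm (r * (s / (norm x)\<^sup>2)) \<le> C / a\<^sup>2 * indicator A x" if r: "0 \<le> r" "r \<le> C" and s: "\<bar>s\<bar> \<le> indicator A x" for r s x
  proof (cases "x \<in> A")
    case True
    then have "a\<^sup>2 \<le> (norm x)\<^sup>2" using a by (intro power_mono) (auto simp: A_def)
    moreover have "r * \<bar>s\<bar> \<le> C * 1" using r s True C(1) by (intro mult_mono) auto
    ultimately have "r * \<bar>s\<bar> / (norm x)\<^sup>2 \<le> C * 1 / a\<^sup>2" using a C(1) by (intro frac_le) auto
    then show ?thesis using True r by (simp add: abs_mult)
  next
    case False
    then have "s = 0" using s by simp
    then show ?thesis using False by simp
  qed
  have ri: "integrable lborel (\<lambda>x. rep x t * (indicator A x / (norm x)\<^sup>2))"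
  proof (rule Bochner_Integration.integrable_bound[OF dom])
    show "(\<lambda>x. rep x t * (indicator A x / (norm x)\<^sup>2)) \<in> borel_measurable lborel"
      by (intro borel_measurable_times borel_measurable_divide borel_measurable_indicator rm nm Am)
    show "AE x in lborel. norm (rep x t * (indicator A x / (norm x)\<^sup>2)) \<le> norm (C / a\<^sup>2 * indicator A x)"
    proof (rule AE_I2)
      fix x
      have "norm (rep x t * (indicator A x / (norm x)\<^sup>2)) \<le> C / a\<^sup>2 * indicator A x" by (rule bd[OF C(4,5)]) simp
      also have "\<dots> \<le> norm (C / a\<^sup>2 * indicator A x)" unfolding real_norm_def by (rule abs_ge_self)
      finally show "norm (rep x t * (indicator A x / (norm x)\<^sup>2)) \<le> norm (C / a\<^sup>2 * indicator A x)" .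
    qed
  qed
  have "integrable lborel (\<lambda>x. rep x t * (indicator A x / (norm x)\<^sup>2) - g x * indicator A x)"
    by (rule Bochner_Integration.integrable_diff[OF ri integrable_real_mult_indicator[OF Am g(2)]])
  moreover have "(\<lambda>x. rep x t * (indicator A x / (norm x)\<^sup>2) - g x * indicator A x) = h"
    unfolding h_def by (rule ext) (simp add: right_diff_distrib mult.commute)
  ultimately have hi: "integrable lborel h" by (simp only:)
  have z: "(LINT x:U|lborel. h x) = 0" if U: "open U" for U
  proof -
    define W where "W = U \<inter> A"
    have W: "open W" "W \<subseteq> A" unfolding W_def using U A by auto
    \<comment> \<open>The distance to the empty set is 0 by convention, so the complement must be
      nonempty for the functions below to become positive on W.\<close>
    have ne: "- W \<noteq> {}"
    proof -
      have "0 \<notin> A" using a by (simp add: A_def)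
      then show ?thesis using W(2) by blast
    qed
    \<comment> \<open>Continuous functions that vanish off W and tend to its indicator.\<close>
    define \<psi> where "\<psi> k x = min 1 (real k * infdist x (- W))" for k x
    have c: "continuous_on UNIV (\<psi> k)" for k unfolding \<psi>_def by (intro continuous_intros)
    have \<psi>m: "\<psi> k \<in> borel_measurable borel" for k by (rule borel_measurable_continuous_onI[OF c])
    have \<psi>ml: "\<psi> k \<in> borel_measurable lborel" for k using \<psi>m by simp
    have \<psi>0: "0 \<le> \<psi> k x" "\<psi> k x \<le> 1" for k x by (auto simp: \<psi>_def infdist_nonneg)
    have \<psi>out: "\<psi> k x = 0" if "x \<notin> W" for k x using that by (simp add: \<psi>_def infdist_zero)
    have \<psi>A: "\<bar>\<psi> k x\<bar> \<le> indicator A x" for k x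
      using \<psi>0[of k x] \<psi>out[of x k] W(2) by (cases "x \<in> A") auto
    have \<psi>1: "\<bar>\<psi> k x\<bar> \<le> 1" for k x using \<psi>0[of k x] by simp
    have \<psi>lim: "(\<lambda>k. \<psi> k x) \<longlonglongrightarrow> indicator W x" for x
    proof (cases "x \<in> W")
      case True
      have d: "infdist x (- W) > 0" by (rule infdist_pos_not_in_closed) (use W ne True in auto)
      from ex_less_of_nat_mult[OF this, of 1] obtain k0 where k0: "1 < real k0 * infdist x (- W)" by blast
      have "\<psi> k x = 1" if "k \<ge> k0" for k
      proof -
        have "real k0 * infdist x (- W) \<le> real k * infdist x (- W)" using d that by (intro mult_right_mono) auto
        then show ?thesis using k0 by (simp add: \<psi>_def)
      qed
      then have "\<forall>\<^sub>F k in sequentially. \<psi> k x = indicator W x" using True by (auto simp: eventually_sequentially)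
      then show ?thesis by (rule tendsto_eventually)
    qed (simp add: \<psi>out)
    have eq: "(LINT x|lborel. \<psi> k x * h x) = 0" for k
    proof -
      have l1: "(\<lambda>n. LINT z|lborel. avg (scale n) z t * (\<psi> k z / (norm z)\<^sup>2)) \<longlonglongrightarrow> P (\<psi> k) t"
        by (rule avg_weak_limit[OF N pos_I[OF t] \<psi>m \<psi>1])
          (use c[of k] in \<open>simp add: continuous_on_eq_continuous_at\<close>)
      have l2: "(\<lambda>n. LINT z|lborel. avg (scale n) z t * (\<psi> k z / (norm z)\<^sup>2)) \<longlonglongrightarrow> (LINT z|lborel. rep z t * (\<psi> k z / (norm z)\<^sup>2))"
      proof (rule integral_dominated_convergence[OF _ _ dom])
        show "(\<lambda>z. rep z t * (\<psi> k z / (norm z)\<^sup>2)) \<in> borel_measurable lborel"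
          by (intro borel_measurable_times borel_measurable_divide rm nm \<psi>ml)
        show "(\<lambda>z. avg (scale n) z t * (\<psi> k z / (norm z)\<^sup>2)) \<in> borel_measurable lborel" for n
          using avg_measurable[OF N scale_bounds(1,3) pos_I[OF t], of n]
          by (intro borel_measurable_times borel_measurable_divide nm \<psi>ml) simp
        show "AE z in lborel. (\<lambda>n. avg (scale n) z t * (\<psi> k z / (norm z)\<^sup>2)) \<longlonglongrightarrow> rep z t * (\<psi> k z / (norm z)\<^sup>2)"
          by (intro AE_I2 tendsto_mult tendsto_const avg_tendsto_rep[OF N t])
        show "AE z in lborel. norm (avg (scale n) z t * (\<psi> k z / (norm z)\<^sup>2)) \<le> C / a\<^sup>2 * indicator A z" for n
          by (intro AE_I2 bd C \<psi>A)
      qed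
      have e1: "(LINT z|lborel. rep z t * (\<psi> k z / (norm z)\<^sup>2)) = (LINT y|lborel. \<psi> k y * g y)"
        using LIMSEQ_unique[OF l2 l1] g(3)[OF \<psi>m, of k] by simp
      have i1: "integrable lborel (\<lambda>z. rep z t * (\<psi> k z / (norm z)\<^sup>2))"
      proof (rule Bochner_Integration.integrable_bound[OF dom])
        show "(\<lambda>z. rep z t * (\<psi> k z / (norm z)\<^sup>2)) \<in> borel_measurable lborel"
          by (intro borel_measurable_times borel_measurable_divide rm nm \<psi>ml)
        show "AE x in lborel. norm (rep x t * (\<psi> k x / (norm x)\<^sup>2)) \<le> norm (C / a\<^sup>2 * indicator A x)"
          using order_trans[OF bd[OF C(4,5) \<psi>A] abs_ge_self] by (intro AE_I2) simp
      qed
      have i2: "integrable lborel (\<lambda>y. \<psi> k y * g y)"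
      proof (rule Bochner_Integration.integrable_bound[OF g(2)])
        show "(\<lambda>y. \<psi> k y * g y) \<in> borel_measurable lborel" by (intro borel_measurable_times \<psi>ml gm)
        show "AE x in lborel. norm (\<psi> k x * g x) \<le> norm (g x)"
          using \<psi>1 by (intro AE_I2) (simp add: abs_mult mult_left_le_one_le)
      qed
      have "\<psi> k x * h x = rep x t * (\<psi> k x / (norm x)\<^sup>2) - \<psi> k x * g x" for x
        using \<psi>out[of x k] W(2) by (cases "x \<in> W") (auto simp: h_def right_diff_distrib)
      then show ?thesis using Bochner_Integration.integral_diff[OF i1 i2] e1 by simp
    qed
    have "(\<lambda>k. LINT x|lborel. \<psi> k x * h x) \<longlonglongrightarrow> (LINT x|lborel. indicator W x * h x)"
    proof (rule integral_dominated_convergence[where w="\<lambda>x. \<bar>h x\<bar>"])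
      have hm: "h \<in> borel_measurable lborel" using hi by (rule borel_measurable_integrable)
      show "(\<lambda>x. indicator W x * h x) \<in> borel_measurable lborel"
        using W(1) by (intro borel_measurable_times borel_measurable_indicator hm) simp
      show "(\<lambda>x. \<psi> k x * h x) \<in> borel_measurable lborel" for k by (intro borel_measurable_times \<psi>ml hm)
      show "integrable lborel (\<lambda>x. \<bar>h x\<bar>)" using hi by (rule integrable_abs)
      show "AE x in lborel. (\<lambda>k. \<psi> k x * h x) \<longlonglongrightarrow> indicator W x * h x"
        by (intro AE_I2 tendsto_mult tendsto_const \<psi>lim)
      show "AE x in lborel. norm (\<psi> k x * h x) \<le> \<bar>h x\<bar>" for k
        using \<psi>1 by (intro AE_I2) (simp add: abs_mult mult_left_le_one_le)
    qed
    then have "(LINT x|lborel. indicator W x * h x) = 0" unfolding eq by (simp add: LIMSEQ_const_iff)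
    moreover have "indicator W x * h x = indicator U x *\<^sub>R h x" for x
      by (auto simp: W_def h_def indicator_def)
    ultimately show ?thesis by (simp add: set_lebesgue_integral_def)
  qed
  have "AE x in lborel. h x = 0" by (rule AE_zero_of_open_integrals[OF hi]) (rule z)
  then show ?thesis
    by eventually_elim (auto simp: h_def A_def)
qed

lemma rep_slice_eq:
  assumes N: "DIM('a) \<ge> 2" and t: "t > 0"
  shows "AE x in lebesgue. rep x t / (norm x)\<^sup>2 = dens u t x"
proof -
  obtain g where g: "g \<in> borel_measurable borel" "integrable lborel g"
      "\<And>f. f \<in> borel_measurable borel \<Longrightarrow> P f t = (LINT y|lborel. f y * g y)"
      and gd: "AE y in lborel. dens u t y = g y"
    by (rule pairing_borel[OF pos_I[OF t]]) blast
  have "AE x in lborel. \<forall>n. inverse (real (Suc n)) < norm x \<longrightarrow> norm x < real n \<longrightarrow> rep x t / (norm x)\<^sup>2 = g x"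
    unfolding AE_all_countable by (intro allI rep_eq_on_annulus[OF N t _ g]) auto
  with gd have "AE x in lborel. rep x t / (norm x)\<^sup>2 = dens u t x"
  proof eventually_elim
    case (elim x)
    show ?case
    proof (cases "x = 0")
      case False
      obtain n1 where n1: "inverse (real (Suc n1)) < norm x" using reals_Archimedean[of "norm x"] False by auto
      obtain n2 where n2: "norm x < real n2" using reals_Archimedean2 by blast
      have "inverse (real (Suc (max n1 n2))) \<le> inverse (real (Suc n1))" by (intro le_imp_inverse_le) auto
      then have "inverse (real (Suc (max n1 n2))) < norm x" using n1 by linarith
      moreover have "norm x < real (max n1 n2)" using n2 by simp
      ultimately show ?thesis using elim by metis
    qed (simp add: dens_def)
  qed
  then show ?thesis by (simp add: AE_completion_iff)
qed

text \<open>Equality holds on almost all of each slice. Applying Fubini to the absolute difference,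
  whose slice integrals all vanish, gives equality almost everywhere in space-time.\<close>

lemma rep_AE_eq:
  assumes N: "DIM('a) \<ge> 2"
  shows "AE z in lebesgue_on Q_star. rep (fst z) (snd z) = u z"
proof -
  have Qs: "Q_star = {x::'a. x \<noteq> 0} \<times> {0<..}" by (auto simp: Q_star_def Q_def)
  have oQ: "open (Q_star :: ('a \<times> real) set)"
    unfolding Qs by (intro open_Times open_Collect_neq continuous_intros open_greaterThan)
  define F where "F z = \<bar>indicator Q_star z * rep (fst z) (snd z) - indicator Q_star z * u z\<bar>" for z
  have "(\<lambda>z. indicator Q_star z *\<^sub>R rep (fst z) (snd z)) \<in> borel_measurable borel"
    using rep_continuous[OF N] oQ unfolding Qs by (intro borel_measurable_continuous_on_indicator) auto
  then have m1: "(\<lambda>z. indicator Q_star z * rep (fst z) (snd z)) \<in> borel_measurable lebesgue"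
    unfolding real_scaleR_def by (rule borel_measurable_lebesgueI)
  have "(\<lambda>z. indicator Q_star z * (indicator Q z * u z)) \<in> borel_measurable lebesgue"
    by (intro borel_measurable_times borel_measurable_indicator open_lebesgue oQ u_measurable)
  moreover have "(\<lambda>z. indicator Q_star z * (indicator Q z * u z)) = (\<lambda>z. indicator Q_star z * u z)"
    by (rule ext) (simp add: indicator_def Q_star_def)
  ultimately have m2: "(\<lambda>z. indicator Q_star z * u z) \<in> borel_measurable lebesgue" by (simp only:)
  have Fm: "F \<in> borel_measurable lebesgue"
    unfolding F_def[abs_def] by (intro borel_measurable_abs borel_measurable_diff m1 m2)
  have sl: "integrable lebesgue (\<lambda>y. F (y, r)) \<and> (LINT y|lebesgue. F (y, r)) = 0" for r
  proof (cases "r > 0")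
    case False
    then have "F (y, r) = 0" for y by (simp add: F_def Qs)
    then show ?thesis by simp
  next
    case True
    have Fy: "F (y, r) = \<bar>indicator {x. x \<noteq> 0} y * rep y r - indicator {x. x \<noteq> 0} y * u (y, r)\<bar>" for y
      using True by (simp add: F_def Qs indicator_def)
    have im: "(indicator {x. x \<noteq> 0} :: 'a \<Rightarrow> real) \<in> borel_measurable lebesgue"
      by (rule borel_measurable_lebesgueI) simp
    have Fym: "(\<lambda>y. F (y, r)) \<in> borel_measurable lebesgue"
      unfolding Fy by (intro borel_measurable_abs borel_measurable_diff borel_measurable_times im
        slice_measurable[OF pos_I[OF True]] borel_measurable_lebesgueI[OF rep_measurable[OF N True]])
    have ae: "AE y in lebesgue. F (y, r) = 0"
      using rep_slice_eq[OF N True]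
    proof eventually_elim
      case (elim y)
      then show ?case unfolding Fy dens_def by (cases "y = 0") auto
    qed
    have "integrable lebesgue (\<lambda>y. F (y, r))"
      by (rule integrable_cong_AE_imp[OF integrable_zero Fym]) (use ae in auto)
    then show ?thesis using integral_eq_zero_AE[OF ae] by simp
  qed
  have Fn: "\<bar>F z\<bar> = F z" "0 \<le> F z" for z by (simp_all add: F_def)
  have h: "AE r in lebesgue. integrable lebesgue (\<lambda>y. F (y, r)) \<and> (LINT y|lebesgue. \<bar>F (y, r)\<bar>) \<le> (0::real)"
    by (intro AE_I2) (simp add: sl Fn)
  have Fi: "integrable lebesgue F" by (rule lebesgue_Fubini_snd(1)[OF Fm h integrable_zero])
  have "(LINT z|lebesgue. F z) = 0"
    using lebesgue_Fubini_snd(2)[OF Fm h integrable_zero] by (simp add: sl)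
  then have "AE z in lebesgue. F z = 0" using integral_nonneg_eq_0_iff_AE[OF Fi] Fn by simp
  then show ?thesis using open_lebesgue[OF oQ]
    by (auto simp: AE_restrict_space_iff F_def)
qed

end

subsection \<open>Positivity and the behaviour at the origin\<close>

lemma segment_avoids_zero:
  fixes x y :: "'a::real_vector"
  assumes "x \<noteq> 0" "y \<notin> span {x}"
  shows "0 \<notin> closed_segment x y"
proof
  assume "0 \<in> closed_segment x y"
  then obtain s where s: "0 = (1 - s) *\<^sub>R x + s *\<^sub>R y" by (auto simp: in_segment)
  have "s \<noteq> 0" using s assms(1) by auto
  have "s *\<^sub>R y = (s - 1) *\<^sub>R x" using s by (simp add: algebra_simps add_eq_0_iff)
  then have "y = ((s - 1) / s) *\<^sub>R x" using \<open>s \<noteq> 0\<close> by (metis eq_vector_fraction_iff)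
  then show False using assms(2) by (metis span_base span_scale singletonI)
qed

context global_solution
begin

text \<open>Along a segment avoiding the origin, the gradient estimate bounds the derivative of
  \<open>ln (1 + ln ((C + \<delta>) / (avg + \<delta>)))\<close> independently of \<open>\<delta>\<close> and of the scale of the average.\<close>

lemma avg_harnack:
  assumes N: "DIM('a) \<ge> 2" and \<tau>: "\<tau> > 0"
    and C: "C > 0" "\<And>e x t. 0 < e \<Longrightarrow> e \<le> 1/2 \<Longrightarrow> x \<noteq> 0 \<Longrightarrow> \<tau> \<le> t \<Longrightarrow> 0 \<le> avg e x t"
    "\<And>e x t. 0 < e \<Longrightarrow> e \<le> 1/2 \<Longrightarrow> x \<noteq> 0 \<Longrightarrow> \<tau> \<le> t \<Longrightarrow> avg e x t \<le> C"
    and e: "0 < e" "e \<le> 1/4" and \<delta>: "\<delta> > 0" and t: "\<tau> < t"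
    and \<rho>: "\<rho> > 0" "\<And>s. s \<in> {0..1} \<Longrightarrow> \<rho> \<le> norm (x + s *\<^sub>R v)"
  shows "1 + ln (C + \<delta>) - ln (avg e (x + v) t + \<delta>)
    \<le> (1 + ln (C + \<delta>) - ln (avg e x t + \<delta>)) * exp (norm v / (\<rho> * sqrt (t - \<tau>)))"
proof -
  define L where "L s = ln (C + \<delta>) - ln (avg e (x + s *\<^sub>R v) t + \<delta>)" for s
  define L' where "L' s = - (davg e v (x + s *\<^sub>R v) t / (avg e (x + s *\<^sub>R v) t + \<delta>))" for s
  define \<Lambda> where "\<Lambda> = norm v / (\<rho> * sqrt (t - \<tau>))"
  have e2: "e \<le> 1/2" using e by simp
  have tI: "t \<in> I" using \<tau> t pos_I by simp
  have nz: "x + s *\<^sub>R v \<noteq> 0" if "s \<in> {0..1}" for s using \<rho>(2)[OF that] \<rho>(1) by auto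
  have a: "0 < avg e (x + s *\<^sub>R v) t + \<delta>" "avg e (x + s *\<^sub>R v) t + \<delta> \<le> C + \<delta>" if "s \<in> {0..1}" for s
    using C(2)[OF e(1) e2 nz[OF that], of t] C(3)[OF e(1) e2 nz[OF that], of t] t \<delta> by auto
  have L0: "0 \<le> L s" if "s \<in> {0..1}" for s
    using a[OF that] by (simp add: L_def)
  have dL: "(L has_real_derivative L' s) (at s)" if s: "s \<in> {0..1}" for s
  proof -
    have "((\<lambda>s. avg e (x + s *\<^sub>R v) t + \<delta>) has_real_derivative davg e v (x + s *\<^sub>R v) t + 0) (at s)"
      by (rule DERIV_add[OF avg_line[OF N e2 tI nz[OF s]] DERIV_const])
    from DERIV_diff[OF DERIV_const DERIV_chain2[OF DERIV_ln_divide[OF a(1)[OF s]] this], of "ln (C + \<delta>)"]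
    show ?thesis by (simp add: L_def[abs_def] L'_def)
  qed
  have dZ: "((\<lambda>s. ln (1 + L s)) has_real_derivative 1 / (1 + L s) * L' s) (at s)" if s: "s \<in> {0..1}" for s
  proof (rule DERIV_chain2[OF DERIV_ln_divide])
    show "0 < 1 + L s" using L0[OF s] by simp
    show "((\<lambda>s. 1 + L s) has_real_derivative L' s) (at s)" using DERIV_add[OF DERIV_const dL[OF s], of 1] by simp
  qed
  have bd: "\<bar>1 / (1 + L s) * L' s\<bar> \<le> \<Lambda>" if s: "s \<in> {0..1}" for s
  proof -
    define A where "A = avg e (x + s *\<^sub>R v) t + \<delta>"
    define d where "d = \<bar>davg e v (x + s *\<^sub>R v) t\<bar>"
    have A: "A > 0" using a(1)[OF s] by (simp add: A_def)
    have d: "d \<ge> 0" by (simp add: d_def)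
    have st: "sqrt (t - \<tau>) > 0" using t by simp
    have "d * norm (x + s *\<^sub>R v) * sqrt (t - \<tau>) \<le> norm v * (A * sqrt (L s))"
      unfolding d_def A_def L_def by (rule avg_gradient'[OF N \<tau> C e \<delta> nz[OF s] t])
    moreover have "d * \<rho> * sqrt (t - \<tau>) \<le> d * norm (x + s *\<^sub>R v) * sqrt (t - \<tau>)"
      using d st \<rho>(2)[OF s] by (intro mult_right_mono mult_left_mono) auto
    \<comment> \<open>The estimate bounds |L'| by a multiple of sqrt L. Passing to 1 + L avoids
      dividing by L, which vanishes where the average reaches its upper bound
      \<open>C\<close>.\<close>
    moreover have "norm v * (A * sqrt (L s)) \<le> norm v * (A * (1 + L s))"
    proof (intro mult_left_mono)
      have "0 \<le> (sqrt (L s) - 1)\<^sup>2" by simp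
      then have "2 * sqrt (L s) \<le> 1 + L s" using L0[OF s] by (simp add: power2_diff)
      then show "sqrt (L s) \<le> 1 + L s" using real_sqrt_ge_zero[OF L0[OF s]] by linarith
    qed (use A in auto)
    ultimately have "d * (\<rho> * sqrt (t - \<tau>)) \<le> norm v * (A * (1 + L s))" by (simp add: mult.assoc)
    then have "d / (A * (1 + L s)) \<le> norm v / (\<rho> * sqrt (t - \<tau>))"
      using A L0[OF s] \<rho>(1) st by (simp add: divide_le_eq le_divide_eq mult_ac)
    moreover have "\<bar>1 / (1 + L s) * L' s\<bar> = d / (A * (1 + L s))"
      using A L0[OF s] by (simp add: L'_def d_def A_def abs_mult mult.commute)
    ultimately show ?thesis by (simp add: \<Lambda>_def)
  qed
  obtain z where z: "0 < z" "z < 1" "ln (1 + L 1) - ln (1 + L 0) = (1 - 0) * (1 / (1 + L z) * L' z)"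
    using MVT2[of 0 1 "\<lambda>s. ln (1 + L s)" "\<lambda>s. 1 / (1 + L s) * L' s"] dZ by auto
  have "ln (1 + L 1) - ln (1 + L 0) \<le> \<Lambda>"
    unfolding z(3) using abs_le_D1[OF bd[of z]] z(1,2) by simp
  then have "ln (1 + L 1) \<le> ln (1 + L 0) + \<Lambda>" by linarith
  then have "exp (ln (1 + L 1)) \<le> exp (ln (1 + L 0) + \<Lambda>)" by simp
  then have "1 + L 1 \<le> (1 + L 0) * exp \<Lambda>" using L0[of 0] L0[of 1] by (simp add: exp_add)
  then show ?thesis by (simp add: L_def \<Lambda>_def add_diff_eq)
qed

text \<open>If \<open>rep\<close> vanished at \<open>y\<close>, then ln ((C + \<delta>) / \<delta>)
  would stay below a constant multiple of 1 + ln ((C + \<delta>) / (rep x t + \<delta>)). The former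
  tends to infinity with \<delta> \<rightarrow> 0, while the latter stays bounded because
  \<open>rep x t\<close> is positive.\<close>

lemma rep_pos_along_segment:
  assumes N: "DIM('a) \<ge> 2" and t: "t > 0" and pos: "rep x t > 0" and seg: "0 \<notin> closed_segment x y"
  shows "rep y t > 0"
proof (rule ccontr)
  assume "\<not> rep y t > 0"
  moreover have "0 \<le> rep y t" by (rule avg_scale_bounds[OF N t]) blast
  ultimately have y0: "rep y t = 0" by simp
  define \<tau> where "\<tau> = t / 2"
  have \<tau>: "\<tau> > 0" "\<tau> < t" using t by (auto simp: \<tau>_def)
  obtain C where C: "C > 0" "\<And>e x t. 0 < e \<Longrightarrow> e \<le> 1/2 \<Longrightarrow> x \<noteq> 0 \<Longrightarrow> \<tau> \<le> t \<Longrightarrow> 0 \<le> avg e x t"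
    "\<And>e x t. 0 < e \<Longrightarrow> e \<le> 1/2 \<Longrightarrow> x \<noteq> 0 \<Longrightarrow> \<tau> \<le> t \<Longrightarrow> avg e x t \<le> C"
    by (rule avg_bounds[OF N \<tau>(1)]) blast
  obtain p where p: "p \<in> closed_segment x y" "\<And>q. q \<in> closed_segment x y \<Longrightarrow> norm p \<le> norm q"
    using continuous_attains_inf[of "closed_segment x y" norm] by (auto intro: continuous_intros)
  have \<rho>: "norm p > 0" using p(1) seg by auto
  have seg': "norm p \<le> norm (x + s *\<^sub>R (y - x))" if "s \<in> {0..1}" for s
    using that by (intro p(2)) (auto simp: in_segment algebra_simps intro!: exI[of _ s])
  define E where "E = exp (norm (y - x) / (norm p * sqrt (t - \<tau>)))"
  have E: "E > 0" by (simp add: E_def)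
  have lim: "1 + ln (C + \<delta>) - ln \<delta> \<le> (1 + ln (C + \<delta>) - ln (rep x t + \<delta>)) * E" if \<delta>: "\<delta> > 0" for \<delta>
  proof (rule LIMSEQ_le)
    have "(\<lambda>n. 1 + ln (C + \<delta>) - ln (avg (scale n) y t + \<delta>)) \<longlonglongrightarrow> 1 + ln (C + \<delta>) - ln (rep y t + \<delta>)"
      using \<delta> y0 by (intro tendsto_intros avg_tendsto_rep[OF N t]) auto
    then show "(\<lambda>n. 1 + ln (C + \<delta>) - ln (avg (scale n) y t + \<delta>)) \<longlonglongrightarrow> 1 + ln (C + \<delta>) - ln \<delta>"
      by (simp add: y0)
    show "(\<lambda>n. (1 + ln (C + \<delta>) - ln (avg (scale n) x t + \<delta>)) * E) \<longlonglongrightarrow> (1 + ln (C + \<delta>) - ln (rep x t + \<delta>)) * E"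
      using \<delta> pos by (intro tendsto_intros avg_tendsto_rep[OF N t]) auto
    show "\<exists>N. \<forall>n\<ge>N. 1 + ln (C + \<delta>) - ln (avg (scale n) y t + \<delta>) \<le> (1 + ln (C + \<delta>) - ln (avg (scale n) x t + \<delta>)) * E"
      using avg_harnack[OF N \<tau>(1) C scale_bounds(1,4) \<delta> \<tau>(2) \<rho> seg'] by (simp add: E_def)
  qed
  define B where "B = (1 + ln (C + 1) - ln (rep x t)) * E"
  \<comment> \<open>With this choice 1 + ln C - ln \<delta> = 1 + ln C + \<bar>ln C\<bar> +
    \<bar>B\<bar>, which exceeds \<open>B\<close>.\<close>
  define \<delta> where "\<delta> = exp (- (\<bar>B\<bar> + \<bar>ln C\<bar>))"
  have \<delta>: "\<delta> > 0" "\<delta> \<le> 1" by (auto simp: \<delta>_def)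
  have "ln C \<le> ln (C + \<delta>)" "ln (C + \<delta>) \<le> ln (C + 1)" "ln (rep x t) \<le> ln (rep x t + \<delta>)"
    using C(1) \<delta> pos by auto
  moreover from this have "(1 + ln (C + \<delta>) - ln (rep x t + \<delta>)) * E \<le> B"
    unfolding B_def using E by (intro mult_right_mono) auto
  moreover have "ln \<delta> = - (\<bar>B\<bar> + \<bar>ln C\<bar>)" by (simp add: \<delta>_def)
  ultimately show False using lim[OF \<delta>(1)] by linarith
qed

text \<open>A segment from \<open>x\<close> may meet the origin only if its end point is on the line
  through \<open>x\<close> and the origin. In that case the path makes a detour through a point
  \<open>w\<close> off this line, which exists as the dimension is at least 2.\<close>

lemma rep_pos_spreads:
  assumes N: "DIM('a) \<ge> 2" and t: "t > 0" and pos: "rep x t > 0" and x: "x \<noteq> 0" and y: "y \<noteq> 0"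
  shows "rep y t > 0"
proof -
  have direct: "rep z t > 0" if "z \<notin> span {x}" for z
    by (rule rep_pos_along_segment[OF N t pos segment_avoids_zero[OF x that]])
  show ?thesis
  proof (cases "y \<in> span {x}")
    case True
    have "span {x} \<noteq> UNIV"
    proof
      assume "span {x} = UNIV"
      then have "DIM('a) = dim (span {x})" by (metis dim_UNIV)
      also have "\<dots> \<le> card {x}" unfolding dim_span by (rule dim_le_card') simp
      finally show False using N by simp
    qed
    then obtain w where w: "w \<notin> span {x}" by blast
    have "span {y} \<subseteq> span {x}" using True by (intro span_minimal subspace_span) simp
    then have "0 \<notin> closed_segment y w" using w by (intro segment_avoids_zero[OF y]) auto
    then show ?thesis
      using rep_pos_along_segment[OF N t direct[OF w], of y] by (simp add: closed_segment_commute)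
  qed (rule direct)
qed

text \<open>A single zero would make \<open>rep\<close> vanish everywhere at that time. Then the
  mass is 0 at time \<open>t\<close> and, by conservation, at time 0, against the nontriviality of
  the datum.\<close>

lemma rep_pos:
  assumes N: "DIM('a) \<ge> 2" and t: "t > 0" and I0: "0 \<in> I" and nontriv: "\<not> (AE x in lebesgue. u (x, 0) = 0)" and y: "y \<noteq> 0"
  shows "rep y t > 0"
proof (rule ccontr)
  assume neg: "\<not> rep y t > 0"
  have nn: "0 \<le> rep x t" for x by (rule avg_scale_bounds[OF N t]) blast
  have zero: "rep x t = 0" if "x \<noteq> 0" for x
    using rep_pos_spreads[OF N t _ that y] neg nn[of x] by force
  from rep_slice_eq[OF N t] have "AE x in lebesgue. \<bar>dens u t x\<bar> = 0"
  proof eventually_elim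
    case (elim x)
    then show ?case using zero[of x] by (cases "x = 0") (auto simp: dens_def)
  qed
  then have "mass t = 0" unfolding mass_def by (rule integral_eq_zero_AE)
  then have m0: "mass 0 = 0" using mass_constant[OF I0 pos_I[OF t]] by simp
  have "AE x in lebesgue. \<bar>dens u 0 x\<bar> = 0"
    using m0 integral_nonneg_eq_0_iff_AE[OF integrable_abs[OF slice_integrable[OF I0]]] by (simp add: mass_def)
  moreover have "AE x in lebesgue. x \<noteq> (0::'a)" by (simp add: AE_completion_iff AE_lborel_singleton)
  ultimately have "AE x in lebesgue. u (x, 0) = 0"
    by eventually_elim (simp add: dens_def)
  with nontriv show False by simp
qed

text \<open>A fixed average at \<open>x\<close> sees only the ball of radius 5 |x|, where the mass
  decays faster than the kernel grows. The scale is fixed first, so that \<open>rep\<close> is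
  within r/2 of the average; the constant, which depends on the scale, is then compensated by |x|
  \<rightarrow> 0.\<close>

lemma rep_tendsto_zero:
  assumes N: "DIM('a) \<ge> 2" and t: "t > 0" and I0: "0 \<in> I" and r0: "r0 > 0"
    and vanish: "AE x in lebesgue. x \<in> ball 0 r0 \<longrightarrow> u (x, 0) = 0"
  shows "((\<lambda>x. rep x t) \<longlongrightarrow> 0) (at 0)"
proof -
  define n where "n = DIM('a)"
  \<comment> \<open>For |x| \<le> 1 the kernel is at most |x|^(-2n), as (N - 2) / 2 \<le> n. The
    exponent 2 (n + 1) therefore leaves a factor |x|^2.\<close>
  obtain C where C: "C > 0" "\<And>\<rho>. \<rho> > 0 \<Longrightarrow> P (indicator {y. norm y < \<rho>}) t \<le> C * \<rho> ^ (2 * (n + 1))"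
    by (rule mass_near_origin[OF I0 r0 vanish t, of "n + 1"]) blast
  have avgb: "avg e x t \<le> C * 25 ^ (n + 1) / kmass TYPE('a) e * (norm x)\<^sup>2"
    if e: "0 < e" "e \<le> 1/2" and x: "x \<noteq> 0" "norm x \<le> 1" for e x
  proof -
    define q where "q = (norm x)\<^sup>2"
    define f :: "'a \<Rightarrow> real" where "f = indicator {y. norm y < 5 * norm x}"
    have q: "0 < q" "q \<le> 1" using x by (auto simp: q_def power_le_one)
    have K: "kmass TYPE('a) e > 0" by (rule kmass_pos[OF e N])
    have fm: "f \<in> borel_measurable borel" unfolding f_def by (rule indicator_ball_measurable)
    have kb: "ker 0 0 e x y \<le> inverse (q ^ n) * f y" for y
    proof (cases "norm y < 5 * norm x")
      case True
      define m where "m = (real DIM('a) - 2) / 2"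
      have m: "0 \<le> m" "m \<le> real n" using N by (auto simp: m_def n_def)
      have "(q + (norm y)\<^sup>2) powr (- m) \<le> q powr (- m)" using q m by (intro powr_mono2') auto
      also have "\<dots> \<le> q powr (- real n)" using q m by (intro powr_mono') auto
      also have "\<dots> = inverse (q ^ n)" using q by (simp add: powr_minus powr_realpow)
      finally have "(q + (norm y)\<^sup>2) powr (- m) * flat 0 (e - 1 + 2 * (x \<bullet> y) / (q + (norm y)\<^sup>2)) \<le> inverse (q ^ n) * 1"
        using q flat_0_le_1 flat_0_nonneg by (intro mult_mono) auto
      then show ?thesis using True unfolding ker_00 f_def q_def m_def by simp
    next
      case False
      then have "ker 0 0 e x y = 0" using x by (intro ker_outside e) auto
      then show ?thesis using q by (simp add: f_def)
    qed
    obtain D where D: "\<And>y. \<bar>ker 0 0 e x y\<bar> \<le> D" using tame_bound[OF tame_ker[OF e(2) N] x(1)] by blast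
    have fb: "\<bar>inverse (q ^ n) * f y\<bar> \<le> inverse (q ^ n)" for y using q by (simp add: f_def indicator_def)
    have "P (ker 0 0 e x) t \<le> P (\<lambda>y. inverse (q ^ n) * f y) t"
      by (rule pairing_mono[OF pos_I[OF t] ker_measurable[OF x(1)] D _ fb kb])
        (intro borel_measurable_times borel_measurable_const fm)
    also have "\<dots> = inverse (q ^ n) * P f t"
      unfolding pairing_def by (simp add: mult.assoc)
    also have "\<dots> \<le> inverse (q ^ n) * (C * (5 * norm x) ^ (2 * (n + 1)))"
      using q x unfolding f_def by (intro mult_left_mono C(2)) auto
    also have "(5 * norm x) ^ (2 * (n + 1)) = (25 * q) ^ (n + 1)"
      unfolding power_mult by (simp add: power_mult_distrib q_def)
    also have "inverse (q ^ n) * (C * (25 * q) ^ (n + 1)) = C * 25 ^ (n + 1) * q"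
      using q by (simp add: power_mult_distrib field_simps)
    finally have "P (ker 0 0 e x) t / kmass TYPE('a) e \<le> C * 25 ^ (n + 1) * q / kmass TYPE('a) e"
      using K by (intro divide_right_mono) auto
    then show ?thesis unfolding avg_def q_def by simp
  qed
  have t2: "t / 2 > 0" using t by simp
  obtain L where L: "L > 0" "\<And>x s k. x \<noteq> 0 \<Longrightarrow> 2 * (t / 2) \<le> s \<Longrightarrow> \<bar>rep x s - avg (scale k) x s\<bar> \<le> L * sqrt (scale k)"
    by (rule rep_approx[OF N t2]) blast
  have nn: "0 \<le> rep x t" for x by (rule avg_scale_bounds[OF N t]) blast
  show ?thesis
    unfolding LIM_def
  proof (intro allI impI)
    fix r :: real assume r: "r > 0"
    have "(\<lambda>n. L * sqrt (scale n)) \<longlonglongrightarrow> L * 0" by (intro tendsto_intros sqrt_scale_tendsto)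
    then have "\<forall>\<^sub>F n in sequentially. L * sqrt (scale n) < r / 2" using r by (intro order_tendstoD(2)) auto
    then obtain k where k: "L * sqrt (scale k) < r / 2" by (auto simp: eventually_sequentially)
    define B where "B = C * 25 ^ (n + 1) / kmass TYPE('a) (scale k)"
    have B: "B > 0" using C(1) kmass_pos[OF scale_bounds(1,3) N, of k] by (simp add: B_def)
    have "dist (rep x t) 0 < r" if x: "x \<noteq> 0" "dist x 0 < min 1 (r / (2 * B))" for x
    proof -
      have x1: "norm x \<le> 1" "norm x < r / (2 * B)" using x by auto
      have "B * (norm x)\<^sup>2 \<le> B * norm x"
        using B x1(1) mult_right_mono[of "norm x" 1 "norm x"] by (simp add: power2_eq_square)
      also have "\<dots> < r / 2" using x1(2) B by (simp add: less_divide_eq mult_ac)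
      finally have "avg (scale k) x t < r / 2"
        using avgb[OF scale_bounds(1,3) x(1) x1(1), of k] unfolding B_def by linarith
      then show ?thesis using L(2)[OF x(1), of t k] k nn[of x] by (simp add: dist_real_def)
    qed
    moreover have "min 1 (r / (2 * B)) > 0" using r B by simp
    ultimately show "\<exists>s>0. \<forall>x. x \<noteq> 0 \<and> dist x 0 < s \<longrightarrow> dist (rep x t) 0 < r" by blast
  qed
qed

text \<open>A bump at the origin of radius \<open>r\<close> has integral at most \<open>r\<^sup>2\<close> times the mass,
  which is finite and constant in time.\<close>

lemma dirac_mass_nonpos:
  assumes lim: "\<And>\<psi>. \<psi> \<in> test_functions UNIV \<Longrightarrow> ((\<lambda>t. LINT x|lebesgue. u (x, t) * \<psi> x) \<longlongrightarrow> M * \<psi> 0) (at_right 0)"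
  shows "M \<le> 0"
proof -
  have "M * flat 0 1 \<le> 0"
  proof (rule field_le_epsilon)
    fix r :: real assume r: "r > 0"
    \<comment> \<open>The radius for which R^2 times the mass is at most \<open>r\<close>; the 1
      covers a vanishing mass.\<close>
    define R where "R = sqrt (r / (mass 1 + 1))"
    have m1: "mass 1 + 1 > 0" using mass_nonneg[of 1] by linarith
    have R: "R > 0" "R\<^sup>2 = r / (mass 1 + 1)" using r m1 by (auto simp: R_def)
    define \<psi> :: "'a \<Rightarrow> real" where "\<psi> y = flat 0 (1 + (- (1 / R\<^sup>2)) * (norm y)\<^sup>2)" for y
    have sm: "smooth \<psi>"
      unfolding \<psi>_def[abs_def] by (intro smooth_flat smooth_add smooth_mult smooth_const smooth_norm2)
    have out: "\<psi> y = 0" if "R \<le> norm y" for y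
    proof -
      have "R\<^sup>2 \<le> (norm y)\<^sup>2" using that R(1) by (intro power_mono) auto
      then show ?thesis using R(1) unfolding \<psi>_def by (intro flat_nonpos) (simp add: divide_simps)
    qed
    have supp: "{y. \<psi> y \<noteq> 0} \<subseteq> cball 0 R" using out by (force simp: not_le)
    have "bounded {y. \<psi> y \<noteq> 0}" by (rule bounded_subset[OF bounded_cball supp])
    then have tf: "\<psi> \<in> test_functions UNIV" using sm by (simp add: test_functions_def smooth_def compact_closure)
    have \<psi>m: "\<psi> \<in> borel_measurable borel"
      by (rule borel_measurable_continuous_onI[OF smooth_continuous[OF sm]])
    have \<psi>0: "0 \<le> \<psi> y" "\<psi> y \<le> 1" for y unfolding \<psi>_def by (rule flat_0_nonneg flat_0_le_1)+
    have b: "\<bar>(norm y)\<^sup>2 * \<psi> y\<bar> \<le> R\<^sup>2" for y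
    proof (cases "R \<le> norm y")
      case False
      then have "(norm y)\<^sup>2 * \<psi> y \<le> R\<^sup>2 * 1" using \<psi>0 by (intro mult_mono power_mono) auto
      then show ?thesis using \<psi>0[of y] by (simp add: abs_mult)
    qed (simp add: out)
    have le: "(LINT x|lebesgue. u (x, t) * \<psi> x) \<le> r" if t: "t > 0" for t
    proof -
      have tI: "t \<in> I" by (rule pos_I[OF t])
      have fm: "(\<lambda>y. (norm y)\<^sup>2 * \<psi> y) \<in> borel_measurable borel" using \<psi>m by simp
      \<comment> \<open>The integral of u \<psi> is \<mu>_t(|y|^2 \<psi>), and |y|^2 \<psi> is at
        most R^2. The weight |x|^-2 in the conserved mass is what excludes concentration at the
        origin.\<close>
      have "(LINT x|lebesgue. u (x, t) * \<psi> x) = P (\<lambda>y. (norm y)\<^sup>2 * \<psi> y) t"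
        unfolding pairing_def
      proof (rule integral_cong_AE)
        have "AE x in lebesgue. x \<noteq> (0::'a)" by (simp add: AE_completion_iff AE_lborel_singleton)
        then show "AE x in lebesgue. u (x, t) * \<psi> x = (norm x)\<^sup>2 * \<psi> x * dens u t x"
          by eventually_elim (simp add: dens_def)
        show "(\<lambda>x. u (x, t) * \<psi> x) \<in> borel_measurable lebesgue"
          by (intro borel_measurable_times slice_measurable[OF tI] borel_measurable_lebesgueI[OF \<psi>m])
        show "(\<lambda>x. (norm x)\<^sup>2 * \<psi> x * dens u t x) \<in> borel_measurable lebesgue"
          by (intro borel_measurable_times[OF borel_measurable_lebesgueI[OF fm] dens_measurable[OF tI]])
      qed
      also have "\<dots> \<le> R\<^sup>2 * mass t" using pairing_abs_le[OF tI fm b] by linarith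
      also have "\<dots> = r * (mass 1 / (mass 1 + 1))"
        using mass_constant[OF tI pos_I[of 1]] by (simp add: R(2))
      also have "\<dots> \<le> r * 1" using r m1 by (intro mult_left_mono) (auto simp: divide_le_eq)
      finally show ?thesis by simp
    qed
    have "M * \<psi> 0 \<le> r"
    proof (rule tendsto_upperbound[OF lim[OF tf]])
      show "\<forall>\<^sub>F t in at_right 0. (LINT x|lebesgue. u (x, t) * \<psi> x) \<le> r"
        using le by (auto simp: eventually_at_right_field intro!: exI[of _ 1])
    qed simp
    then show "M * flat 0 1 \<le> 0 + r" by (simp add: \<psi>_def)
  qed
  then show ?thesis using flat_0_pos[of 1] by (simp add: mult_le_0_iff)
qed

end

section \<open>Non-existence, positivity and the value at the origin\<close>

theorem proposition1p4:
  assumes "CARD('n::finite) \<ge> 3"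
  shows "(\<forall>M>0. \<not> (\<exists>u :: (real ^ 'n) \<times> real \<Rightarrow> real. is_dirac_solution M u)) \<and>
    (\<forall>(u\<^sub>0 :: real ^ 'n \<Rightarrow> real) (u :: (real ^ 'n) \<times> real \<Rightarrow> real) r\<^sub>0.
       u\<^sub>0 \<in> L12 \<longrightarrow> (AE x in lebesgue. 0 \<le> u\<^sub>0 x) \<longrightarrow> \<not> (AE x in lebesgue. u\<^sub>0 x = 0) \<longrightarrow>
       r\<^sub>0 > 0 \<longrightarrow> (AE x in lebesgue. x \<in> ball 0 r\<^sub>0 \<longrightarrow> u\<^sub>0 x = 0) \<longrightarrow>
       is_solution u\<^sub>0 u \<longrightarrow>
       (\<exists>v. continuous_representative u v \<and>
          (\<forall>x t. x \<noteq> 0 \<longrightarrow> t > 0 \<longrightarrow> v (x, t) > 0) \<and>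
          (\<forall>t>0. ((\<lambda>x. v (x, t)) \<longlongrightarrow> 0) (at 0))))"
proof (intro conjI allI impI notI)
  fix M :: real assume M: "M > 0" and "\<exists>u :: (real ^ 'n) \<times> real \<Rightarrow> real. is_dirac_solution M u"
  then obtain u :: "(real ^ 'n) \<times> real \<Rightarrow> real" where u: "is_dirac_solution M u" by blast
  interpret global_solution "{0<..}" u
    by unfold_locales (use u in \<open>auto simp: is_dirac_solution_def\<close>)
  have "M \<le> 0" by (rule dirac_mass_nonpos) (use u in \<open>auto simp: is_dirac_solution_def\<close>)
  then show False using M by simp
next
  fix u\<^sub>0 :: "real ^ 'n \<Rightarrow> real" and u :: "(real ^ 'n) \<times> real \<Rightarrow> real" and r\<^sub>0 :: real
  assume nontriv: "\<not> (AE x in lebesgue. u\<^sub>0 x = 0)" and r0: "r\<^sub>0 > 0"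
    and vanish: "AE x in lebesgue. x \<in> ball 0 r\<^sub>0 \<longrightarrow> u\<^sub>0 x = 0" and u: "is_solution u\<^sub>0 u"
  interpret global_solution "{0..}" u
    by unfold_locales (use u in \<open>auto simp: is_solution_def\<close>)
  have N: "DIM(real ^ 'n) \<ge> 2" using assms by simp
  have init: "AE x in lebesgue. u (x, 0) = u\<^sub>0 x" using u by (simp add: is_solution_def)
  have vanish': "AE x in lebesgue. x \<in> ball 0 r\<^sub>0 \<longrightarrow> u (x, 0) = 0"
    using init vanish by eventually_elim simp
  have nontriv': "\<not> (AE x in lebesgue. u (x, 0) = 0)"
  proof
    assume "AE x in lebesgue. u (x, 0) = 0"
    then have "AE x in lebesgue. u\<^sub>0 x = 0" using init by eventually_elim simp
    with nontriv show False by simp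
  qed
  have "(Q_star :: ((real ^ 'n) \<times> real) set) = {x. x \<noteq> 0} \<times> {0<..}" by (auto simp: Q_star_def Q_def)
  then have "continuous_representative u (\<lambda>z. rep (fst z) (snd z))"
    unfolding continuous_representative_def using rep_continuous[OF N] rep_AE_eq[OF N] by simp
  then show "\<exists>v. continuous_representative u v \<and> (\<forall>x t. x \<noteq> 0 \<longrightarrow> t > 0 \<longrightarrow> v (x, t) > 0) \<and>
      (\<forall>t>0. ((\<lambda>x. v (x, t)) \<longlongrightarrow> 0) (at 0))"
    using rep_pos[OF N _ _ nontriv'] rep_tendsto_zero[OF N _ _ r0 vanish']
    by (intro exI[of _ "\<lambda>z. rep (fst z) (snd z)"]) auto
qed

end
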